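(* There exist gentle algebras (over a field $k$) that have the same AG-invariant but are not derived equivalent.
   Context: Let $k$ be a field. Two finite-dimensional $k$-algebras are derived equivalent if their bounded derived categories of finitely generated modules are equivalent as triangulated categories. Gentle algebras. A gentle algebra is a finite-dimensional algebra $A=kQ/I$ with $Q$ a finite connected quiver and $I$ an ideal generated by paths of length $2$, such that: every vertex is the source of at most two arrows and the target of at most two arrows; for each arrow $\beta$ there is at most one arrow $\gamma$ with $s(\gamma)=t(\beta)$ and $\gamma\beta\notin I$, and at most one arrow $\gamma$ with $s(\gamma)=t(\beta)$ and $\gamma\beta\in I$; and for each arrow $\gamma$ there is at most one arrow $\beta$ with $t(\beta)=s(\gamma)$ and $\gamma\beta\notin I$, and at most one with $t(\beta)=s(\gamma)$ and $\gamma\beta\in I$. Here $\gamma\beta$ means first $\beta$ then $\gamma$. AG-invariant (Avella-Alaminos and Geiss). Assume $Q$ has at least one arrow. A nontrivial permitted thread is a maximal path $\alpha_n\cdots\alpha_1$ ($n\ge1$) with no $\alpha_{i+1}\alpha_i\in I$. A nontrivial forbidden thread is a maximal path $\alpha_n\cdots\alpha_1$ ($n\geq 1$) of pairwise distinct arrows with all $\alpha_{i+1}\alpha_i\in I$ (oriented cycles with all consecutive compositions, including the closing one, in $I$ are treated separately). For a vertex $v$ with at most one incoming arrow and at most one outgoing arrow: if whenever $\beta$ ends and $\gamma$ starts at $v$ one has $\gamma\beta\notin I$, there is a trivial permitted thread $h_v$; if whenever $\beta$ ends and $\gamma$ starts at $v$ one has $\gamma\beta\in I$, there is a trivial forbidden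 thread $p_v$. Trivial threads at $v$ have length $0$ and start and end at $v$. Choose $\sigma,\varepsilon:Q_1\to\{1,-1\}$ such that: distinct arrows with the same source have opposite $\sigma$; distinct arrows with the same target have opposite $\varepsilon$; if $s(\gamma)=t(\beta)$ then $\sigma(\gamma)=-\varepsilon(\beta)$ when $\gamma\beta\notin I$ and $\sigma(\gamma)=\varepsilon(\beta)$ when $\gamma\beta\in I$. For a nontrivial thread $H=\alpha_n\cdots\alpha_1$ put $\sigma(H)=\sigma(\alpha_1)$, $\varepsilon(H)=\varepsilon(\alpha_n)$. For a trivial permitted thread $h_v$ put $\sigma(h_v)=-\varepsilon(h_v)=-\sigma(\gamma)$ if $\gamma$ starts at $v$, and $\sigma(h_v)=-\varepsilon(h_v)=\varepsilon(\beta)$ if $\beta$ ends at $v$. For a trivial forbidden thread $p_v$ put $\sigma(p_v)=\varepsilon(p_v)=-\sigma(\gamma)$ if $\gamma$ starts at $v$, and $\sigma(p_v)=\varepsilon(p_v)=-\varepsilon(\beta)$ if $\beta$ ends at $v$ (these agree when both exist). Starting from a permitted thread $H_0$, define inductively $\Pi_i$ as the forbidden thread ending at the end of $H_i$ with $\varepsilon(\Pi_i)=-\varepsilon(H_i)$, and $H_{i+1}$ as the permitted thread starting at the start of $\Pi_i$ with $\sigma(H_{i+1})=-\sigma(\Pi_i)$. Stop at the first $n\ge1$ with $H_n=H_0$ and record the pair $(n,m)$ where $m$ is the sum of the lengths of $\Pi_0,\dots,\Pi_{n-1}$. Repeat with unused permitted threads until every permitted thread has been used. In addition, for each oriented cycle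 all of whose consecutive compositions (cyclically) lie in $I$, record $(0,m)$ with $m$ its length. The AG-invariant of $A$ is the function $\Phi_A:\mathbb N^2\to\mathbb N$ counting how many times each pair is recorded (it does not depend on the choices). *)

theory Defs
  imports
    "HOL-Algebra.QuotRing"
    "HOL-Algebra.Module"
    "Graph_Theory.Arc_Walk"
    "Graph_Theory.Digraph_Component"
begin

section \<open>Path algebras and gentle algebras\<close>

text \<open>
  A quiver is a \<^typ>\<open>('v, 'e) pre_digraph\<close>; finiteness is \<^const>\<open>fin_digraph\<close>. A path is encoded as a
  pair \<open>(u, [\<alpha>\<^sub>1, \<dots>, \<alpha>\<^sub>n])\<close> consisting of its start vertex and its arrows in the order in which they
  are travelled, i.e. it stands for \<open>\<alpha>\<^sub>n \<cdots> \<alpha>\<^sub>1\<close>; the trivial path at \<open>u\<close> is \<open>(u, [])\<close>.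
\<close>

definition paths :: "('v, 'e) pre_digraph \<Rightarrow> ('v \<times> 'e list) set" where
  "paths Q = {(u, p). \<exists>v. pre_digraph.awalk Q u p v}"

definition path_elem :: "'v \<times> 'e list \<Rightarrow> 'v \<times> 'e list \<Rightarrow> 'k::field" where
  "path_elem x = (\<lambda>y. if y = x then 1 else 0)"

text \<open>
  Elements are finitely supported functions on the set of paths, multiplied by convolution; in a
  product \<open>f g\<close> the path contributed by \<open>g\<close> is travelled first.
\<close>

definition path_algebra :: "('v, 'e) pre_digraph \<Rightarrow> ('v \<times> 'e list \<Rightarrow> 'k::field) ring" where
  "path_algebra Q =
    \<lparr>carrier = {f. finite {x. f x \<noteq> 0} \<and> (\<forall>x. x \<notin> paths Q \<longrightarrow> f x = 0)},
     monoid.mult = (\<lambda>f g (u, p).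
       \<Sum>i\<le>length p. f (pre_digraph.awlast Q u (take i p), drop i p) * g (u, take i p)),
     one = (\<lambda>(u, p). if u \<in> verts Q \<and> p = [] then 1 else 0),
     zero = (\<lambda>x. 0),
     add = (\<lambda>f g x. f x + g x)\<rparr>"

definition composable :: "('v, 'e) pre_digraph \<Rightarrow> 'e \<Rightarrow> 'e \<Rightarrow> bool" where
  "composable Q \<beta> \<gamma> \<longleftrightarrow> \<beta> \<in> arcs Q \<and> \<gamma> \<in> arcs Q \<and> head Q \<beta> = tail Q \<gamma>"

definition two_path :: "('v, 'e) pre_digraph \<Rightarrow> 'e \<Rightarrow> 'e \<Rightarrow> 'v \<times> 'e list \<Rightarrow> 'k::field" where
  "two_path Q \<beta> \<gamma> = path_elem (tail Q \<beta>, [\<beta>, \<gamma>])"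

definition gentle :: "('v, 'e) pre_digraph \<Rightarrow> ('v \<times> 'e list \<Rightarrow> 'k::field) set \<Rightarrow> bool" where
  "gentle Q I \<longleftrightarrow>
    fin_digraph Q \<and> connected Q \<and>
    (\<exists>\<rho>. \<rho> \<subseteq> {(\<beta>, \<gamma>). composable Q \<beta> \<gamma>} \<and>
         I = Idl\<^bsub>path_algebra Q\<^esub> ((\<lambda>(\<beta>, \<gamma>). two_path Q \<beta> \<gamma>) ` \<rho>)) \<and>
    (\<exists>B. finite B \<and> B \<subseteq> carrier (path_algebra Q) \<and>
         (\<forall>a \<in> carrier (path_algebra Q Quot I).
            \<exists>c. a = I +>\<^bsub>path_algebra Q\<^esub> (\<lambda>x. \<Sum>b\<in>B. c b * b x))) \<and>
    (\<forall>v\<in>verts Q. card {\<alpha> \<in> arcs Q. tail Q \<alpha> = v} \<le> 2 \<and> card {\<alpha> \<in> arcs Q. head Q \<alpha> = v} \<le> 2) \<and>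
    (\<forall>\<beta>\<in>arcs Q. card {\<gamma>. composable Q \<beta> \<gamma> \<and> two_path Q \<beta> \<gamma> \<notin> I} \<le> 1 \<and>
                card {\<gamma>. composable Q \<beta> \<gamma> \<and> two_path Q \<beta> \<gamma> \<in> I} \<le> 1) \<and>
    (\<forall>\<gamma>\<in>arcs Q. card {\<beta>. composable Q \<beta> \<gamma> \<and> two_path Q \<beta> \<gamma> \<notin> I} \<le> 1 \<and>
                card {\<beta>. composable Q \<beta> \<gamma> \<and> two_path Q \<beta> \<gamma> \<in> I} \<le> 1)"


section \<open>The AG-invariant\<close>

text \<open>
  \<open>Nontriv [\<alpha>\<^sub>1, \<dots>, \<alpha>\<^sub>n]\<close> stands for \<open>\<alpha>\<^sub>n \<cdots> \<alpha>\<^sub>1\<close>. \<open>Triv v\<close> is \<open>h\<^sub>v\<close> when regarded as a permitted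
  thread and \<open>p\<^sub>v\<close> when regarded as a forbidden thread.
\<close>

datatype ('v, 'e) thread = Triv 'v | Nontriv "'e list"

fun thread_start :: "('v, 'e) pre_digraph \<Rightarrow> ('v, 'e) thread \<Rightarrow> 'v" where
  "thread_start Q (Triv v) = v"
| "thread_start Q (Nontriv p) = tail Q (hd p)"

fun thread_end :: "('v, 'e) pre_digraph \<Rightarrow> ('v, 'e) thread \<Rightarrow> 'v" where
  "thread_end Q (Triv v) = v"
| "thread_end Q (Nontriv p) = head Q (last p)"

fun thread_length :: "('v, 'e) thread \<Rightarrow> nat" where
  "thread_length (Triv v) = 0"
| "thread_length (Nontriv p) = length p"

definition arrow_path :: "('v, 'e) pre_digraph \<Rightarrow> 'e list \<Rightarrow> bool" where
  "arrow_path Q p \<longleftrightarrow> p \<noteq> [] \<and> set p \<subseteq> arcs Q \<and>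
     (\<forall>i. Suc i < length p \<longrightarrow> composable Q (p ! i) (p ! Suc i))"

definition maximal_path :: "('e list \<Rightarrow> bool) \<Rightarrow> 'e list \<Rightarrow> bool" where
  "maximal_path P p \<longleftrightarrow> P p \<and> (\<forall>q r. P (q @ p @ r) \<longrightarrow> q = [] \<and> r = [])"

definition permitted_path ::
  "('v, 'e) pre_digraph \<Rightarrow> ('v \<times> 'e list \<Rightarrow> 'k::field) set \<Rightarrow> 'e list \<Rightarrow> bool" where
  "permitted_path Q I p \<longleftrightarrow> arrow_path Q p \<and>
     (\<forall>i. Suc i < length p \<longrightarrow> two_path Q (p ! i) (p ! Suc i) \<notin> I)"

definition forbidden_path ::
  "('v, 'e) pre_digraph \<Rightarrow> ('v \<times> 'e list \<Rightarrow> 'k::field) set \<Rightarrow> 'e list \<Rightarrow> bool" where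
  "forbidden_path Q I p \<longleftrightarrow> arrow_path Q p \<and> distinct p \<and>
     (\<forall>i. Suc i < length p \<longrightarrow> two_path Q (p ! i) (p ! Suc i) \<in> I)"

definition forbidden_cycle ::
  "('v, 'e) pre_digraph \<Rightarrow> ('v \<times> 'e list \<Rightarrow> 'k::field) set \<Rightarrow> 'e list \<Rightarrow> bool" where
  "forbidden_cycle Q I p \<longleftrightarrow> forbidden_path Q I p \<and>
     composable Q (last p) (hd p) \<and> two_path Q (last p) (hd p) \<in> I"

definition thin_vertex :: "('v, 'e) pre_digraph \<Rightarrow> 'v \<Rightarrow> bool" where
  "thin_vertex Q v \<longleftrightarrow> v \<in> verts Q \<and>
     card {\<alpha> \<in> arcs Q. tail Q \<alpha> = v} \<le> 1 \<and> card {\<alpha> \<in> arcs Q. head Q \<alpha> = v} \<le> 1"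

definition permitted_threads ::
  "('v, 'e) pre_digraph \<Rightarrow> ('v \<times> 'e list \<Rightarrow> 'k::field) set \<Rightarrow> ('v, 'e) thread set" where
  "permitted_threads Q I =
     Nontriv ` {p. maximal_path (permitted_path Q I) p} \<union>
     Triv ` {v. thin_vertex Q v \<and>
       (\<forall>\<beta> \<gamma>. composable Q \<beta> \<gamma> \<and> head Q \<beta> = v \<longrightarrow> two_path Q \<beta> \<gamma> \<notin> I)}"

text \<open>
  A cycle with full relations, cut open at any of its vertices, is maximal among the forbidden
  paths but is not a forbidden thread.
\<close>

definition forbidden_threads ::
  "('v, 'e) pre_digraph \<Rightarrow> ('v \<times> 'e list \<Rightarrow> 'k::field) set \<Rightarrow> ('v, 'e) thread set" where
  "forbidden_threads Q I =
     Nontriv ` {p. maximal_path (forbidden_path Q I) p \<and> \<not> forbidden_cycle Q I p} \<union>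
     Triv ` {v. thin_vertex Q v \<and>
       (\<forall>\<beta> \<gamma>. composable Q \<beta> \<gamma> \<and> head Q \<beta> = v \<longrightarrow> two_path Q \<beta> \<gamma> \<in> I)}"

definition sign_functions ::
  "('v, 'e) pre_digraph \<Rightarrow> ('v \<times> 'e list \<Rightarrow> 'k::field) set \<Rightarrow> ('e \<Rightarrow> int) \<Rightarrow> ('e \<Rightarrow> int) \<Rightarrow> bool" where
  "sign_functions Q I \<sigma> \<epsilon> \<longleftrightarrow>
     (\<forall>\<alpha>\<in>arcs Q. \<sigma> \<alpha> \<in> {1, -1} \<and> \<epsilon> \<alpha> \<in> {1, -1}) \<and>
     (\<forall>\<alpha>\<in>arcs Q. \<forall>\<beta>\<in>arcs Q. \<alpha> \<noteq> \<beta> \<and> tail Q \<alpha> = tail Q \<beta> \<longrightarrow> \<sigma> \<alpha> = - \<sigma> \<beta>) \<and>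
     (\<forall>\<alpha>\<in>arcs Q. \<forall>\<beta>\<in>arcs Q. \<alpha> \<noteq> \<beta> \<and> head Q \<alpha> = head Q \<beta> \<longrightarrow> \<epsilon> \<alpha> = - \<epsilon> \<beta>) \<and>
     (\<forall>\<beta> \<gamma>. composable Q \<beta> \<gamma> \<longrightarrow>
        (if two_path Q \<beta> \<gamma> \<notin> I then \<sigma> \<gamma> = - \<epsilon> \<beta> else \<sigma> \<gamma> = \<epsilon> \<beta>))"

text \<open>
  In the trivial cases below the vertex has at most one outgoing and at most one incoming arrow,
  and at least one of the two; if both exist, the two prescriptions agree.
\<close>

definition out_arrow :: "('v, 'e) pre_digraph \<Rightarrow> 'v \<Rightarrow> 'e" where
  "out_arrow Q v = (THE \<gamma>. \<gamma> \<in> arcs Q \<and> tail Q \<gamma> = v)"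

definition in_arrow :: "('v, 'e) pre_digraph \<Rightarrow> 'v \<Rightarrow> 'e" where
  "in_arrow Q v = (THE \<beta>. \<beta> \<in> arcs Q \<and> head Q \<beta> = v)"

context
  fixes Q :: "('v, 'e) pre_digraph" and \<sigma> \<epsilon> :: "'e \<Rightarrow> int"
begin

fun permitted_sigma :: "('v, 'e) thread \<Rightarrow> int" where
  "permitted_sigma (Nontriv p) = \<sigma> (hd p)"
| "permitted_sigma (Triv v) =
     (if \<exists>\<gamma>\<in>arcs Q. tail Q \<gamma> = v then - \<sigma> (out_arrow Q v) else \<epsilon> (in_arrow Q v))"

fun permitted_epsilon :: "('v, 'e) thread \<Rightarrow> int" where
  "permitted_epsilon (Nontriv p) = \<epsilon> (last p)"
| "permitted_epsilon (Triv v) = - permitted_sigma (Triv v)"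

fun forbidden_sigma :: "('v, 'e) thread \<Rightarrow> int" where
  "forbidden_sigma (Nontriv p) = \<sigma> (hd p)"
| "forbidden_sigma (Triv v) =
     (if \<exists>\<gamma>\<in>arcs Q. tail Q \<gamma> = v then - \<sigma> (out_arrow Q v) else - \<epsilon> (in_arrow Q v))"

fun forbidden_epsilon :: "('v, 'e) thread \<Rightarrow> int" where
  "forbidden_epsilon (Nontriv p) = \<epsilon> (last p)"
| "forbidden_epsilon (Triv v) = forbidden_sigma (Triv v)"

context
  fixes I :: "('v \<times> 'e list \<Rightarrow> 'k::field) set"
begin

definition AG_forbidden :: "('v, 'e) thread \<Rightarrow> ('v, 'e) thread" where
  "AG_forbidden H = (THE P. P \<in> forbidden_threads Q I \<and> thread_end Q P = thread_end Q H \<and>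
     forbidden_epsilon P = - permitted_epsilon H)"

definition AG_next :: "('v, 'e) thread \<Rightarrow> ('v, 'e) thread" where
  "AG_next H = (THE H'. H' \<in> permitted_threads Q I \<and>
     thread_start Q H' = thread_start Q (AG_forbidden H) \<and>
     permitted_sigma H' = - forbidden_sigma (AG_forbidden H))"

definition AG_steps :: "('v, 'e) thread \<Rightarrow> nat" where
  "AG_steps H = (LEAST n. n \<ge> 1 \<and> (AG_next ^^ n) H = H)"

definition AG_orbit :: "('v, 'e) thread \<Rightarrow> ('v, 'e) thread set" where
  "AG_orbit H = (\<lambda>i. (AG_next ^^ i) H) ` {..<AG_steps H}"

definition AG_pair :: "('v, 'e) thread \<Rightarrow> nat \<times> nat" where
  "AG_pair H =
     (AG_steps H, \<Sum>i<AG_steps H. thread_length (AG_forbidden ((AG_next ^^ i) H)))"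

text \<open>
  One pair is recorded per orbit of permitted threads, and one per cycle with full relations, where
  cycles are considered up to rotation.
\<close>

definition AG_count :: "nat \<times> nat \<Rightarrow> nat" where
  "AG_count = (\<lambda>(n, m).
     card {AG_orbit H | H. H \<in> permitted_threads Q I \<and> AG_pair H = (n, m)} +
     (if n = 0
      then card {{rotate i p | i. True} | p. forbidden_cycle Q I p \<and> length p = m}
      else 0))"

end

end

definition AG_invariant ::
  "('v, 'e) pre_digraph \<Rightarrow> ('v \<times> 'e list \<Rightarrow> 'k::field) set \<Rightarrow> nat \<times> nat \<Rightarrow> nat" where
  "AG_invariant Q I =
     (let (\<sigma>, \<epsilon>) = (SOME (\<sigma>, \<epsilon>). sign_functions Q I \<sigma> \<epsilon>) in AG_count Q \<sigma> \<epsilon> I)"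


section \<open>Categories, localisation, triangulated equivalence\<close>

text \<open>
  Hom-sets need not be disjoint, so composition and the action of functors on morphisms take the
  objects as arguments: \<open>Comp C X Y Z g f\<close> is \<open>X \<rightarrow>\<^sub>f Y \<rightarrow>\<^sub>g Z\<close>.
\<close>

record ('o, 'm) cat =
  Obj :: "'o set"
  Mor :: "'o \<Rightarrow> 'o \<Rightarrow> 'm set"
  Ident :: "'o \<Rightarrow> 'm"
  Comp :: "'o \<Rightarrow> 'o \<Rightarrow> 'o \<Rightarrow> 'm \<Rightarrow> 'm \<Rightarrow> 'm"

definition is_functor ::
  "('o, 'm, 'x) cat_scheme \<Rightarrow> ('p, 'n, 'y) cat_scheme \<Rightarrow> ('o \<Rightarrow> 'p) \<Rightarrow> ('o \<Rightarrow> 'o \<Rightarrow> 'm \<Rightarrow> 'n) \<Rightarrow> bool"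
where
  "is_functor C D Fo Fm \<longleftrightarrow>
     (\<forall>X\<in>Obj C. Fo X \<in> Obj D \<and> Fm X X (Ident C X) = Ident D (Fo X)) \<and>
     (\<forall>X\<in>Obj C. \<forall>Y\<in>Obj C. \<forall>f\<in>Mor C X Y. Fm X Y f \<in> Mor D (Fo X) (Fo Y)) \<and>
     (\<forall>X\<in>Obj C. \<forall>Y\<in>Obj C. \<forall>Z\<in>Obj C. \<forall>f\<in>Mor C X Y. \<forall>g\<in>Mor C Y Z.
        Fm X Z (Comp C X Y Z g f) = Comp D (Fo X) (Fo Y) (Fo Z) (Fm Y Z g) (Fm X Y f))"

definition is_iso :: "('o, 'm, 'x) cat_scheme \<Rightarrow> 'o \<Rightarrow> 'o \<Rightarrow> 'm \<Rightarrow> bool" where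
  "is_iso C X Y f \<longleftrightarrow> f \<in> Mor C X Y \<and>
     (\<exists>g\<in>Mor C Y X. Comp C X Y X g f = Ident C X \<and> Comp C Y X Y f g = Ident C Y)"

definition natural_iso ::
  "('o, 'm, 'x) cat_scheme \<Rightarrow> ('p, 'n, 'y) cat_scheme \<Rightarrow>
   ('o \<Rightarrow> 'p) \<Rightarrow> ('o \<Rightarrow> 'o \<Rightarrow> 'm \<Rightarrow> 'n) \<Rightarrow> ('o \<Rightarrow> 'p) \<Rightarrow> ('o \<Rightarrow> 'o \<Rightarrow> 'm \<Rightarrow> 'n) \<Rightarrow> ('o \<Rightarrow> 'n) \<Rightarrow> bool" where
  "natural_iso C D Fo Fm Go Gm \<theta> \<longleftrightarrow>
     (\<forall>X\<in>Obj C. is_iso D (Fo X) (Go X) (\<theta> X)) \<and>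
     (\<forall>X\<in>Obj C. \<forall>Y\<in>Obj C. \<forall>f\<in>Mor C X Y.
        Comp D (Fo X) (Fo Y) (Go Y) (\<theta> Y) (Fm X Y f) =
        Comp D (Fo X) (Go X) (Go Y) (Gm X Y f) (\<theta> X))"

text \<open>
  Gabriel--Zisman localisation of \<open>C\<close> at a class \<open>W\<close> of morphisms. A morphism is a class of zigzags;
  a step \<open>Fwd X Y f\<close> goes from \<open>X\<close> to \<open>Y\<close> along \<open>f : X \<rightarrow> Y\<close>, and \<open>Bwd X Y s\<close> goes from \<open>Y\<close> to \<open>X\<close>
  along the formal inverse of \<open>s : X \<rightarrow> Y\<close> in \<open>W\<close>. Steps are listed in the order in which they are
  travelled.
\<close>

datatype ('o, 'm) zstep = Fwd 'o 'o 'm | Bwd 'o 'o 'm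

inductive zigzag ::
  "('o, 'm, 'x) cat_scheme \<Rightarrow> ('o \<Rightarrow> 'o \<Rightarrow> 'm set) \<Rightarrow> 'o \<Rightarrow> ('o, 'm) zstep list \<Rightarrow> 'o \<Rightarrow> bool"
  for C W where
  zz_nil: "X \<in> Obj C \<Longrightarrow> zigzag C W X [] X"
| zz_fwd: "X \<in> Obj C \<Longrightarrow> f \<in> Mor C X Y \<Longrightarrow> zigzag C W Y p Z \<Longrightarrow> zigzag C W X (Fwd X Y f # p) Z"
| zz_bwd: "Y \<in> Obj C \<Longrightarrow> s \<in> W X Y \<Longrightarrow> zigzag C W X p Z \<Longrightarrow> zigzag C W Y (Bwd X Y s # p) Z"

inductive zigzag_eq ::
  "('o, 'm, 'x) cat_scheme \<Rightarrow> ('o \<Rightarrow> 'o \<Rightarrow> 'm set) \<Rightarrow> 'o \<Rightarrow> 'o \<Rightarrow>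
   ('o, 'm) zstep list \<Rightarrow> ('o, 'm) zstep list \<Rightarrow> bool"
  for C W where
  ze_refl: "zigzag C W A p B \<Longrightarrow> zigzag_eq C W A B p p"
| ze_sym: "zigzag_eq C W A B p q \<Longrightarrow> zigzag_eq C W A B q p"
| ze_trans: "zigzag_eq C W A B p q \<Longrightarrow> zigzag_eq C W A B q r \<Longrightarrow> zigzag_eq C W A B p r"
| ze_ident: "zigzag C W A p X \<Longrightarrow> zigzag C W X q B \<Longrightarrow>
    zigzag_eq C W A B (p @ [Fwd X X (Ident C X)] @ q) (p @ q)"
| ze_comp: "zigzag C W A p X \<Longrightarrow> Y \<in> Obj C \<Longrightarrow> zigzag C W Z q B \<Longrightarrow>
    f \<in> Mor C X Y \<Longrightarrow> g \<in> Mor C Y Z \<Longrightarrow>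
    zigzag_eq C W A B (p @ [Fwd X Y f, Fwd Y Z g] @ q) (p @ [Fwd X Z (Comp C X Y Z g f)] @ q)"
| ze_inv1: "zigzag C W A p X \<Longrightarrow> zigzag C W X q B \<Longrightarrow> Y \<in> Obj C \<Longrightarrow> s \<in> W X Y \<Longrightarrow>
    zigzag_eq C W A B (p @ [Fwd X Y s, Bwd X Y s] @ q) (p @ q)"
| ze_inv2: "zigzag C W A p Y \<Longrightarrow> zigzag C W Y q B \<Longrightarrow> X \<in> Obj C \<Longrightarrow> s \<in> W X Y \<Longrightarrow>
    zigzag_eq C W A B (p @ [Bwd X Y s, Fwd X Y s] @ q) (p @ q)"

definition zigzag_rel ::
  "('o, 'm, 'x) cat_scheme \<Rightarrow> ('o \<Rightarrow> 'o \<Rightarrow> 'm set) \<Rightarrow> 'o \<Rightarrow> 'o \<Rightarrow>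
   (('o, 'm) zstep list \<times> ('o, 'm) zstep list) set" where
  "zigzag_rel C W X Y = {(p, q). zigzag_eq C W X Y p q}"

definition localisation ::
  "('o, 'm, 'x) cat_scheme \<Rightarrow> ('o \<Rightarrow> 'o \<Rightarrow> 'm set) \<Rightarrow> ('o, ('o, 'm) zstep list set) cat" where
  "localisation C W =
    \<lparr>Obj = Obj C,
     Mor = (\<lambda>X Y. {p. zigzag C W X p Y} // zigzag_rel C W X Y),
     Ident = (\<lambda>X. zigzag_rel C W X X `` {[]}),
     Comp = (\<lambda>X Y Z g f. zigzag_rel C W X Z `` {p @ q | p q. p \<in> f \<and> q \<in> g})\<rparr>"

definition loc_functor ::
  "('o, 'm, 'x) cat_scheme \<Rightarrow> ('o \<Rightarrow> 'o \<Rightarrow> 'm set) \<Rightarrow> 'o \<Rightarrow> 'o \<Rightarrow> 'm \<Rightarrow> ('o, 'm) zstep list set" where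
  "loc_functor C W X Y f = zigzag_rel C W X Y `` {[Fwd X Y f]}"

record ('o, 'm) tri_cat = "('o, 'm) cat" +
  shift_obj :: "'o \<Rightarrow> 'o"
  shift_mor :: "'o \<Rightarrow> 'o \<Rightarrow> 'm \<Rightarrow> 'm"
  triangles :: "('o \<times> 'o \<times> 'o \<times> 'm \<times> 'm \<times> 'm) set"

text \<open>
  Additivity is not listed separately: a functor between triangulated categories that preserves
  distinguished triangles preserves finite biproducts, hence sums of morphisms.
\<close>

definition triangle_functor ::
  "('o, 'm) tri_cat \<Rightarrow> ('p, 'n) tri_cat \<Rightarrow> ('o \<Rightarrow> 'p) \<Rightarrow> ('o \<Rightarrow> 'o \<Rightarrow> 'm \<Rightarrow> 'n) \<Rightarrow> ('o \<Rightarrow> 'n) \<Rightarrow> bool"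
where
  "triangle_functor C D Fo Fm \<theta> \<longleftrightarrow>
     is_functor C D Fo Fm \<and>
     natural_iso C D
       (\<lambda>X. Fo (shift_obj C X)) (\<lambda>X Y f. Fm (shift_obj C X) (shift_obj C Y) (shift_mor C X Y f))
       (\<lambda>X. shift_obj D (Fo X)) (\<lambda>X Y f. shift_mor D (Fo X) (Fo Y) (Fm X Y f)) \<theta> \<and>
     (\<forall>X Y Z u v w. (X, Y, Z, u, v, w) \<in> triangles C \<longrightarrow>
        (Fo X, Fo Y, Fo Z, Fm X Y u, Fm Y Z v,
         Comp D (Fo Z) (Fo (shift_obj C X)) (shift_obj D (Fo X)) (\<theta> X) (Fm Z (shift_obj C X) w))
        \<in> triangles D)"

definition triangle_equivalent :: "('o, 'm) tri_cat \<Rightarrow> ('p, 'n) tri_cat \<Rightarrow> bool" where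
  "triangle_equivalent C D \<longleftrightarrow>
     (\<exists>Fo Fm \<theta> Go Gm \<eta> \<kappa>.
        triangle_functor C D Fo Fm \<theta> \<and> is_functor D C Go Gm \<and>
        natural_iso C C (\<lambda>X. X) (\<lambda>X Y f. f)
          (\<lambda>X. Go (Fo X)) (\<lambda>X Y f. Gm (Fo X) (Fo Y) (Fm X Y f)) \<eta> \<and>
        natural_iso D D (\<lambda>X. Fo (Go X)) (\<lambda>X Y f. Fm (Go X) (Go Y) (Gm X Y f))
          (\<lambda>X. X) (\<lambda>X Y f. f) \<kappa>)"


section \<open>Bounded derived categories of module categories\<close>

text \<open>
  The library locale \<^locale>\<open>module\<close> requires a commutative ring; its record type is reused here for
  left modules over arbitrary rings.
\<close>

locale left_module = R?: ring R + M?: abelian_group M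
  for R :: "'a ring" (structure) and M :: "('a, 'm) module" (structure) +
  assumes smult_closed: "a \<in> carrier R \<Longrightarrow> x \<in> carrier M \<Longrightarrow> a \<odot>\<^bsub>M\<^esub> x \<in> carrier M"
    and smult_l_distr: "a \<in> carrier R \<Longrightarrow> b \<in> carrier R \<Longrightarrow> x \<in> carrier M \<Longrightarrow>
      (a \<oplus> b) \<odot>\<^bsub>M\<^esub> x = a \<odot>\<^bsub>M\<^esub> x \<oplus>\<^bsub>M\<^esub> b \<odot>\<^bsub>M\<^esub> x"
    and smult_r_distr: "a \<in> carrier R \<Longrightarrow> x \<in> carrier M \<Longrightarrow> y \<in> carrier M \<Longrightarrow>
      a \<odot>\<^bsub>M\<^esub> (x \<oplus>\<^bsub>M\<^esub> y) = a \<odot>\<^bsub>M\<^esub> x \<oplus>\<^bsub>M\<^esub> a \<odot>\<^bsub>M\<^esub> y"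
    and smult_assoc: "a \<in> carrier R \<Longrightarrow> b \<in> carrier R \<Longrightarrow> x \<in> carrier M \<Longrightarrow>
      (a \<otimes> b) \<odot>\<^bsub>M\<^esub> x = a \<odot>\<^bsub>M\<^esub> (b \<odot>\<^bsub>M\<^esub> x)"
    and smult_one: "x \<in> carrier M \<Longrightarrow> \<one> \<odot>\<^bsub>M\<^esub> x = x"

definition fin_gen :: "'a ring \<Rightarrow> ('a, 'm) module \<Rightarrow> bool" where
  "fin_gen R M \<longleftrightarrow> (\<exists>S. finite S \<and> S \<subseteq> carrier M \<and>
     (\<forall>x\<in>carrier M. \<exists>c \<in> S \<rightarrow> carrier R. x = (\<Oplus>\<^bsub>M\<^esub>s\<in>S. c s \<odot>\<^bsub>M\<^esub> s)))"

definition module_hom ::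
  "'a ring \<Rightarrow> ('a, 'm) module \<Rightarrow> ('a, 'n) module \<Rightarrow> ('m \<Rightarrow> 'n) set" where
  "module_hom R M N = {f \<in> carrier M \<rightarrow>\<^sub>E carrier N.
     (\<forall>x\<in>carrier M. \<forall>y\<in>carrier M. f (x \<oplus>\<^bsub>M\<^esub> y) = f x \<oplus>\<^bsub>N\<^esub> f y) \<and>
     (\<forall>a\<in>carrier R. \<forall>x\<in>carrier M. f (a \<odot>\<^bsub>M\<^esub> x) = a \<odot>\<^bsub>N\<^esub> f x)}"

definition module_sum :: "('a, 'm) module \<Rightarrow> ('a, 'n) module \<Rightarrow> ('a, 'm \<times> 'n) module" where
  "module_sum M N =
    \<lparr>carrier = carrier M \<times> carrier N,
     monoid.mult = (\<lambda>x y. undefined), one = undefined,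
     zero = (\<zero>\<^bsub>M\<^esub>, \<zero>\<^bsub>N\<^esub>),
     add = (\<lambda>(x, y) (x', y'). (x \<oplus>\<^bsub>M\<^esub> x', y \<oplus>\<^bsub>N\<^esub> y')),
     smult = (\<lambda>a (x, y). (a \<odot>\<^bsub>M\<^esub> x, a \<odot>\<^bsub>N\<^esub> y))\<rparr>"

text \<open>Cochain complexes: \<open>cdiff X n\<close> goes from degree \<open>n\<close> to degree \<open>n + 1\<close>.\<close>

record ('a, 'm) cochain =
  cterm :: "int \<Rightarrow> ('a, 'm) module"
  cdiff :: "int \<Rightarrow> 'm \<Rightarrow> 'm"

definition bounded_complex :: "'a ring \<Rightarrow> ('a, 'm) cochain \<Rightarrow> bool" where
  "bounded_complex R X \<longleftrightarrow>
     (\<forall>n. left_module R (cterm X n) \<and> fin_gen R (cterm X n) \<and>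
          cdiff X n \<in> module_hom R (cterm X n) (cterm X (n + 1)) \<and>
          (\<forall>x\<in>carrier (cterm X n). cdiff X (n + 1) (cdiff X n x) = \<zero>\<^bsub>cterm X (n + 1 + 1)\<^esub>)) \<and>
     (\<exists>N. \<forall>n. \<bar>n\<bar> > N \<longrightarrow> carrier (cterm X n) = {\<zero>\<^bsub>cterm X n\<^esub>})"

definition chain_maps ::
  "'a ring \<Rightarrow> ('a, 'm) cochain \<Rightarrow> ('a, 'n) cochain \<Rightarrow> (int \<Rightarrow> 'm \<Rightarrow> 'n) set" where
  "chain_maps R X Y = {f. \<forall>n. f n \<in> module_hom R (cterm X n) (cterm Y n) \<and>
     (\<forall>x\<in>carrier (cterm X n). f (n + 1) (cdiff X n x) = cdiff Y n (f n x))}"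

definition complexes :: "'a ring \<Rightarrow> (('a, 'm) cochain, int \<Rightarrow> 'm \<Rightarrow> 'm) cat" where
  "complexes R =
    \<lparr>Obj = {X. bounded_complex R X},
     Mor = chain_maps R,
     Ident = (\<lambda>X n. \<lambda>x\<in>carrier (cterm X n). x),
     Comp = (\<lambda>X Y Z g f n. compose (carrier (cterm X n)) (g n) (f n))\<rparr>"

definition cocycles :: "('a, 'm) cochain \<Rightarrow> int \<Rightarrow> 'm set" where
  "cocycles X n = {x \<in> carrier (cterm X n). cdiff X n x = \<zero>\<^bsub>cterm X (n + 1)\<^esub>}"

definition coboundaries :: "('a, 'm) cochain \<Rightarrow> int \<Rightarrow> 'm set" where
  "coboundaries X n = cdiff X (n - 1) ` carrier (cterm X (n - 1))"

definition cohomology :: "('a, 'm) cochain \<Rightarrow> int \<Rightarrow> 'm set set" where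
  "cohomology X n = (\<lambda>z. coboundaries X n +>\<^bsub>cterm X n\<^esub> z) ` cocycles X n"

text \<open>A cohomology class, being a coset \<open>B\<^sup>n(X) + z\<close>, is sent to \<open>B\<^sup>n(Y) + f\<^sup>n(z)\<close>.\<close>

definition cohomology_map ::
  "('a, 'm) cochain \<Rightarrow> (int \<Rightarrow> 'm \<Rightarrow> 'm) \<Rightarrow> int \<Rightarrow> 'm set \<Rightarrow> 'm set" where
  "cohomology_map Y f n c = coboundaries Y n <+>\<^bsub>cterm Y n\<^esub> f n ` c"

definition quasi_isos ::
  "'a ring \<Rightarrow> ('a, 'm) cochain \<Rightarrow> ('a, 'm) cochain \<Rightarrow> (int \<Rightarrow> 'm \<Rightarrow> 'm) set" where
  "quasi_isos R X Y = {f \<in> chain_maps R X Y.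
     \<forall>n. bij_betw (cohomology_map Y f n) (cohomology X n) (cohomology Y n)}"

definition shift :: "('a, 'm) cochain \<Rightarrow> ('a, 'm) cochain" where
  "shift X =
    \<lparr>cterm = (\<lambda>n. cterm X (n + 1)),
     cdiff = (\<lambda>n. \<lambda>x\<in>carrier (cterm X (n + 1)). \<ominus>\<^bsub>cterm X (n + 1 + 1)\<^esub> cdiff X (n + 1) x)\<rparr>"

fun shift_zstep ::
  "(('a, 'm) cochain, int \<Rightarrow> 'm \<Rightarrow> 'm) zstep \<Rightarrow> (('a, 'm) cochain, int \<Rightarrow> 'm \<Rightarrow> 'm) zstep" where
  "shift_zstep (Fwd X Y f) = Fwd (shift X) (shift Y) (\<lambda>n. f (n + 1))"
| "shift_zstep (Bwd X Y s) = Bwd (shift X) (shift Y) (\<lambda>n. s (n + 1))"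

definition cone ::
  "('a, 'm) cochain \<Rightarrow> ('a, 'm) cochain \<Rightarrow> (int \<Rightarrow> 'm \<Rightarrow> 'm) \<Rightarrow> ('a, 'm \<times> 'm) cochain" where
  "cone X Y f =
    \<lparr>cterm = (\<lambda>n. module_sum (cterm X (n + 1)) (cterm Y n)),
     cdiff = (\<lambda>n. \<lambda>(x, y)\<in>carrier (module_sum (cterm X (n + 1)) (cterm Y n)).
       (\<ominus>\<^bsub>cterm X (n + 1 + 1)\<^esub> cdiff X (n + 1) x, f (n + 1) x \<oplus>\<^bsub>cterm Y (n + 1)\<^esub> cdiff Y n y))\<rparr>"

text \<open>
  The cone lives on pairs, so it has to be transported to the carrier type of the category: \<open>\<phi>\<close> is an
  isomorphism from \<open>cone X Y f\<close> to a complex \<open>Z\<close>, and \<open>i : Y \<rightarrow> Z\<close>, \<open>p : Z \<rightarrow> X[1]\<close> are the transported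
  inclusion and projection.
\<close>

definition mapping_cone ::
  "'a ring \<Rightarrow> ('a, 'm) cochain \<Rightarrow> ('a, 'm) cochain \<Rightarrow> (int \<Rightarrow> 'm \<Rightarrow> 'm) \<Rightarrow>
   ('a, 'm) cochain \<Rightarrow> (int \<Rightarrow> 'm \<Rightarrow> 'm) \<Rightarrow> (int \<Rightarrow> 'm \<Rightarrow> 'm) \<Rightarrow> bool" where
  "mapping_cone R X Y f Z i p \<longleftrightarrow>
     (\<exists>\<phi> \<in> chain_maps R (cone X Y f) Z.
        (\<forall>n. bij_betw (\<phi> n) (carrier (cterm (cone X Y f) n)) (carrier (cterm Z n))) \<and>
        i = (\<lambda>n. \<lambda>y\<in>carrier (cterm Y n). \<phi> n (\<zero>\<^bsub>cterm X (n + 1)\<^esub>, y)) \<and>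
        p = (\<lambda>n. \<lambda>z\<in>carrier (cterm Z n).
               fst (inv_into (carrier (cterm (cone X Y f) n)) (\<phi> n) z)))"

definition derived_cat ::
  "'a ring \<Rightarrow> (('a, 'm) cochain, (('a, 'm) cochain, int \<Rightarrow> 'm \<Rightarrow> 'm) zstep list set) cat" where
  "derived_cat R = localisation (complexes R) (quasi_isos R)"

text \<open>
  The bounded derived category, with as distinguished triangles those isomorphic to
  \<open>X' \<rightarrow> Y' \<rightarrow> cone f \<rightarrow> X'[1]\<close> for a chain map \<open>f : X' \<rightarrow> Y'\<close>.
\<close>

definition derived_tri_cat ::
  "'a ring \<Rightarrow> (('a, 'm) cochain, (('a, 'm) cochain, int \<Rightarrow> 'm \<Rightarrow> 'm) zstep list set) tri_cat" where
  "derived_tri_cat R = (let D = derived_cat R; q = loc_functor (complexes R) (quasi_isos R);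
      sh = (\<lambda>X Y c. zigzag_rel (complexes R) (quasi_isos R) (shift X) (shift Y) `` (map shift_zstep ` c))
    in
    \<lparr>Obj = Obj D, Mor = Mor D, Ident = Ident D, Comp = Comp D,
     shift_obj = shift,
     shift_mor = sh,
     triangles = {(X, Y, Z, u, v, w).
       X \<in> Obj D \<and> Y \<in> Obj D \<and> Z \<in> Obj D \<and>
       u \<in> Mor D X Y \<and> v \<in> Mor D Y Z \<and> w \<in> Mor D Z (shift X) \<and>
       (\<exists>X' \<in> Obj D. \<exists>Y' \<in> Obj D. \<exists>Z' \<in> Obj D. \<exists>f \<in> chain_maps R X' Y'. \<exists>i p a b c.
          mapping_cone R X' Y' f Z' i p \<and>
          is_iso D X X' a \<and> is_iso D Y Y' b \<and> is_iso D Z Z' c \<and>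
          Comp D X Y Y' b u = Comp D X X' Y' (q X' Y' f) a \<and>
          Comp D Y Z Z' c v = Comp D Y Y' Z' (q Y' Z' i) b \<and>
          Comp D Z (shift X) (shift X') (sh X X' a) w = Comp D Z Z' (shift X') (q Z' (shift X') p) c)}\<rparr>)"

text \<open>
  The carriers of the modules range over subsets of the type \<^typ>\<open>'a list set\<close>. This loses nothing:
  a module generated by \<open>n\<close> elements is isomorphic to a quotient of \<open>R\<^sup>n\<close>, whose elements are cosets
  of lists of length \<open>n\<close>.
\<close>

definition derived_equivalent :: "'a ring \<Rightarrow> 'b ring \<Rightarrow> bool" where
  "derived_equivalent R S \<longleftrightarrow>
     triangle_equivalent
       (derived_tri_cat R ::
         (('a, 'a list set) cochain,
          (('a, 'a list set) cochain, int \<Rightarrow> 'a list set \<Rightarrow> 'a list set) zstep list set) tri_cat)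
       (derived_tri_cat S ::
         (('b, 'b list set) cochain,
          (('b, 'b list set) cochain, int \<Rightarrow> 'b list set \<Rightarrow> 'b list set) zstep list set) tri_cat)"

end

theory Submission
 imports Defs "HOL-Library.Function_Algebras"
begin

text \<open>
 Two bound quivers with four vertices and six arrows are compared; both have AG-invariant counting
 \<open>(1, 3)\<close> twice. In the first algebra there are nonzero orthogonal idempotents \<open>x\<close>, \<open>y\<close> with
 \<open>x A y = y A x = 0\<close>, so the projectives \<open>P\<^sub>x\<close>, \<open>P\<^sub>y\<close> have no morphisms between them in any degree, and
 no self-extensions. The second algebra is triangular and its Euler form satisfies
 \<open>\<chi>(S, T) + \<chi>(T, S) = 2 \<rho>(S) \<rho>(T)\<close> for a linear form \<open>\<rho>\<close>, because
 \<open>dim (e\<^sub>i B e\<^sub>j) + dim (e\<^sub>j B e\<^sub>i) = 2\<close> for all \<open>i\<close>, \<open>j\<close>. The images of \<open>P\<^sub>x\<close> and \<open>P\<^sub>y\<close> under a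
 derived equivalence would satisfy \<open>\<rho>(S)\<^sup>2 = \<chi>(S, S) > 0\<close>, \<open>\<rho>(T)\<^sup>2 = \<chi>(T, T) > 0\<close> and
 \<open>2 \<rho>(S) \<rho>(T) = 0\<close>, a contradiction.

 Since morphism sets of the localised category are classes of zigzags, vanishing of \<open>Hom(X, Y)\<close> is
 expressed by saying that all morphisms \<open>X \<rightarrow> Y\<close> are equal (\<open>thin\<close>). Objects are replaced by bounded
 semi-free complexes, for which \<open>thin\<close> amounts to exactness of the Hom complex.
\<close>

text \<open>Two obstacles shape the proof. A morphism of the localisation is a class of zigzags with
  formal inverses, so unequal morphisms must be told apart by an invariant. Semi-free complexes
  supply it: homotopy classes of cocycles with values in \<open>Z\<close> form a set-valued functor
  of \<open>Z\<close> that turns quasi-isomorphisms into bijections, hence lets zigzags act. In this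
  way \<open>thin\<close> yields an exact Hom complex. Conversely, thinness is derived for
  one-generator complexes, where a cylinder makes homotopic maps equal, and for complexes whose
  identity is contractible. The second obstacle is that the images of the two projectives under an
  equivalence are arbitrary bounded complexes. They must be resolved by finitely many projectives,
  which is where triangularity of the second algebra enters; the first algebra has oriented cycles,
  but only its projectives occur. The Euler form is not taken from a Grothendieck group: it is the
  Euler characteristic of a Hom complex, counted over pairs of generators, so the linear form is the
  signed number of generators.\<close>

locale category =
 fixes C :: "('o, 'm, 'x) cat_scheme"
 assumes ident_in: "X \<in> Obj C \<Longrightarrow> Ident C X \<in> Mor C X X"
  and comp_in: "X \<in> Obj C \<Longrightarrow> Y \<in> Obj C \<Longrightarrow> Z \<in> Obj C \<Longrightarrow> f \<in> Mor C X Y \<Longrightarrow> g \<in> Mor C Y Z \<Longrightarrow>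
   Comp C X Y Z g f \<in> Mor C X Z"
  and comp_ident: "X \<in> Obj C \<Longrightarrow> Y \<in> Obj C \<Longrightarrow> f \<in> Mor C X Y \<Longrightarrow> Comp C X X Y f (Ident C X) = f"
  and ident_comp: "X \<in> Obj C \<Longrightarrow> Y \<in> Obj C \<Longrightarrow> f \<in> Mor C X Y \<Longrightarrow> Comp C X Y Y (Ident C Y) f = f"
  and comp_assoc: "X \<in> Obj C \<Longrightarrow> Y \<in> Obj C \<Longrightarrow> Z \<in> Obj C \<Longrightarrow> V \<in> Obj C \<Longrightarrow>
   f \<in> Mor C X Y \<Longrightarrow> g \<in> Mor C Y Z \<Longrightarrow> h \<in> Mor C Z V \<Longrightarrow>
   Comp C X Z V h (Comp C X Y Z g f) = Comp C X Y V (Comp C Y Z V h g) f"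

definition thin :: "('o, 'm, 'x) cat_scheme \<Rightarrow> 'o \<Rightarrow> 'o \<Rightarrow> bool" where
 "thin C X Y \<longleftrightarrow> (\<forall>f\<in>Mor C X Y. \<forall>g\<in>Mor C X Y. f = g)"

definition isomorphic :: "('o, 'm, 'x) cat_scheme \<Rightarrow> 'o \<Rightarrow> 'o \<Rightarrow> bool" where
 "isomorphic C X Y \<longleftrightarrow> (\<exists>f. is_iso C X Y f)"

context category
begin

lemma isomorphic_sym: "isomorphic C X Y \<Longrightarrow> isomorphic C Y X"
 unfolding isomorphic_def is_iso_def by blast

lemma isomorphic_trans:
 assumes XYZ: "X \<in> Obj C" "Y \<in> Obj C" "Z \<in> Obj C" and "isomorphic C X Y" "isomorphic C Y Z"
 shows "isomorphic C X Z"
proof -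
 obtain f f' where f: "f \<in> Mor C X Y" "f' \<in> Mor C Y X"
  "Comp C X Y X f' f = Ident C X" "Comp C Y X Y f f' = Ident C Y"
  using assms(4) unfolding isomorphic_def is_iso_def by blast
 obtain g g' where g: "g \<in> Mor C Y Z" "g' \<in> Mor C Z Y"
  "Comp C Y Z Y g' g = Ident C Y" "Comp C Z Y Z g g' = Ident C Z"
  using assms(5) unfolding isomorphic_def is_iso_def by blast
 let ?h = "Comp C X Y Z g f" and ?k = "Comp C Z Y X f' g'"
 have "Comp C X Z X ?k ?h = Comp C X Y X (Comp C Y Z X ?k g) f"
  using XYZ f g by (intro comp_assoc comp_in) auto
 also have "Comp C Y Z X ?k g = Comp C Y Y X f' (Comp C Y Z Y g' g)"
  using XYZ f g by (intro comp_assoc[symmetric]) auto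
 finally have 1: "Comp C X Z X ?k ?h = Ident C X" using XYZ f g by (simp add: comp_ident)
 have "Comp C Z X Z ?h ?k = Comp C Z Y Z (Comp C Y X Z ?h f') g'"
  using XYZ f g by (intro comp_assoc comp_in) auto
 also have "Comp C Y X Z ?h f' = Comp C Y Y Z g (Comp C Y X Y f f')"
  using XYZ f g by (intro comp_assoc[symmetric]) auto
 finally have 2: "Comp C Z X Z ?h ?k = Ident C Z" using XYZ f g by (simp add: comp_ident)
 show ?thesis unfolding isomorphic_def is_iso_def using 1 2 XYZ f g comp_in by blast
qed

lemma thin_isomorphic:
 assumes Obj: "X \<in> Obj C" "Y \<in> Obj C" "X' \<in> Obj C" "Y' \<in> Obj C"
  and "isomorphic C X X'" "isomorphic C Y Y'" and thin: "thin C X Y"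
 shows "thin C X' Y'"
 unfolding thin_def
proof (intro ballI)
 fix f g assume fg: "f \<in> Mor C X' Y'" "g \<in> Mor C X' Y'"
 obtain u u' where u: "u \<in> Mor C X X'" "u' \<in> Mor C X' X" "Comp C X' X X' u u' = Ident C X'"
  using assms(5) unfolding isomorphic_def is_iso_def by blast
 obtain v v' where v: "v \<in> Mor C Y Y'" "v' \<in> Mor C Y' Y" "Comp C Y' Y Y' v v' = Ident C Y'"
  using assms(6) unfolding isomorphic_def is_iso_def by blast
 \<comment> \<open>\<open>h\<close> is recovered from its conjugate \<open>v' h u\<close>, which
   lives in the thin hom-set from \<open>X\<close> to \<open>Y\<close>.\<close>
 have rec: "h = Comp C X' X Y' (Comp C X Y Y' v (Comp C X Y' Y v' (Comp C X X' Y' h u))) u'"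
  if h: "h \<in> Mor C X' Y'" for h
 proof -
  let ?hu = "Comp C X X' Y' h u"
  have hu: "?hu \<in> Mor C X Y'" using Obj h u comp_in by blast
  have "Comp C X Y Y' v (Comp C X Y' Y v' ?hu) = Comp C X Y' Y' (Comp C Y' Y Y' v v') ?hu"
   using Obj hu v by (intro comp_assoc) auto
  then have "Comp C X Y Y' v (Comp C X Y' Y v' ?hu) = ?hu" using Obj hu v by (simp add: ident_comp)
  moreover have "Comp C X' X Y' ?hu u' = Comp C X' X' Y' h (Comp C X' X X' u u')"
   using Obj h u by (intro comp_assoc[symmetric]) auto
  ultimately show ?thesis using Obj h u by (simp add: comp_ident)
 qed
 have "Comp C X Y' Y v' (Comp C X X' Y' f u) = Comp C X Y' Y v' (Comp C X X' Y' g u)"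
  using thin Obj fg u v comp_in unfolding thin_def by metis
 then show "f = g" using rec[OF fg(1)] rec[OF fg(2)] by simp
qed

text \<open>Naturality expresses \<open>\<eta> Y\<close> after \<open>f\<close> through the image of
  \<open>f\<close>, and \<open>\<eta> Y\<close> cancels on the left. Applied to the composite of an
  equivalence with its quasi-inverse, this shows that the equivalence is injective on
  hom-sets.\<close>

lemma faithful_if_natural_iso:
 assumes nat: "natural_iso C C (\<lambda>X. X) (\<lambda>X Y f. f) Fo Fm \<eta>"
  and Fo: "\<And>X. X \<in> Obj C \<Longrightarrow> Fo X \<in> Obj C"
  and XY: "X \<in> Obj C" "Y \<in> Obj C" and fg: "f \<in> Mor C X Y" "g \<in> Mor C X Y"
  and eq: "Fm X Y f = Fm X Y g"
 shows "f = g"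
proof -
 obtain v where v: "\<eta> Y \<in> Mor C Y (Fo Y)" "v \<in> Mor C (Fo Y) Y" "Comp C Y (Fo Y) Y v (\<eta> Y) = Ident C Y"
  using nat XY unfolding natural_iso_def is_iso_def by blast
 have n: "Comp C X Y (Fo Y) (\<eta> Y) h = Comp C X (Fo X) (Fo Y) (Fm X Y h) (\<eta> X)" if "h \<in> Mor C X Y" for h
  using nat XY that unfolding natural_iso_def by blast
 have r: "h = Comp C X (Fo Y) Y v (Comp C X Y (Fo Y) (\<eta> Y) h)" if h: "h \<in> Mor C X Y" for h
  using comp_assoc[OF XY(1,2) Fo[OF XY(2)] XY(2) h v(1,2)] v XY h by (simp add: ident_comp)
 show ?thesis by (rule trans[OF r[OF fg(1)] trans[OF _ r[OF fg(2), symmetric]]]) (simp add: n fg eq)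
qed

end

text \<open>The same cancellation for a transformation into the identity, where
  \<open>\<kappa> X\<close> cancels on the right. The two directions are those of
  \<open>\<eta>\<close> and \<open>\<kappa>\<close> in \<open>triangle_equivalent\<close>.\<close>

lemma faithful_if_natural_iso':
 assumes "category D" and nat: "natural_iso D D Fo Fm (\<lambda>X. X) (\<lambda>X Y f. f) \<kappa>"
  and Fo: "\<And>X. X \<in> Obj D \<Longrightarrow> Fo X \<in> Obj D"
  and Fm: "\<And>X Y f. X \<in> Obj D \<Longrightarrow> Y \<in> Obj D \<Longrightarrow> f \<in> Mor D X Y \<Longrightarrow> Fm X Y f \<in> Mor D (Fo X) (Fo Y)"
  and XY: "X \<in> Obj D" "Y \<in> Obj D" and fg: "f \<in> Mor D X Y" "g \<in> Mor D X Y"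
  and eq: "Fm X Y f = Fm X Y g"
 shows "f = g"
proof -
 interpret category D by fact
 obtain v where v: "\<kappa> X \<in> Mor D (Fo X) X" "v \<in> Mor D X (Fo X)" "Comp D X (Fo X) X (\<kappa> X) v = Ident D X"
  using nat XY unfolding natural_iso_def is_iso_def by blast
 have n: "Comp D (Fo X) (Fo Y) Y (\<kappa> Y) (Fm X Y h) = Comp D (Fo X) X Y h (\<kappa> X)" if "h \<in> Mor D X Y" for h
  using nat XY that unfolding natural_iso_def by blast
 have r: "h = Comp D X (Fo X) Y (Comp D (Fo X) X Y h (\<kappa> X)) v" if h: "h \<in> Mor D X Y" for h
  using comp_assoc[OF XY(1) Fo[OF XY(1)] XY(1,2) v(2,1) h] v XY h by (simp add: comp_ident)
 show ?thesis by (rule trans[OF r[OF fg(1)] trans[OF _ r[OF fg(2), symmetric]]]) (simp add: n[symmetric] fg eq)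
qed

abbreviation ct :: "('a, 'm) cochain \<Rightarrow> int \<Rightarrow> ('a, 'm) module" where "ct \<equiv> cterm"
abbreviation cd :: "('a, 'm) cochain \<Rightarrow> int \<Rightarrow> 'm \<Rightarrow> 'm" where "cd \<equiv> cdiff"
abbreviation car :: "('a, 'm) cochain \<Rightarrow> int \<Rightarrow> 'm set" where "car X n \<equiv> carrier (ct X n)"
abbreviation zc :: "('a, 'm) cochain \<Rightarrow> int \<Rightarrow> 'm" where "zc X n \<equiv> \<zero>\<^bsub>ct X n\<^esub>"

section \<open>Localisation\<close>

locale localising =
 fixes C :: "('o, 'm, 'x) cat_scheme" and W :: "'o => 'o => 'm set"
 assumes Ident_Mor: "X \<in> Obj C ==> Ident C X \<in> Mor C X X"
  and Comp_Mor: "X \<in> Obj C ==> Y \<in> Obj C ==> Z \<in> Obj C ==> f \<in> Mor C X Y ==> g \<in> Mor C Y Z ==>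
   Comp C X Y Z g f \<in> Mor C X Z"
  and W_Mor: "W X Y \<subseteq> Mor C X Y"
begin

abbreviation "zz \<equiv> zigzag C W"
abbreviation "ze \<equiv> zigzag_eq C W"

lemma zz_Obj: "zz A p B ==> A \<in> Obj C & B \<in> Obj C"
 by (induction rule: zigzag.induct) auto

lemma zz_append: "zz A p B ==> zz B q E ==> zz A (p @ q) E"
 by (induction rule: zigzag.induct) (auto intro: zigzag.intros)

lemma zz_Fwd: "X \<in> Obj C ==> Y \<in> Obj C ==> f \<in> Mor C X Y ==> zz X [Fwd X Y f] Y"
 by (intro zz_fwd zz_nil)

lemma zz_Bwd: "X \<in> Obj C ==> Y \<in> Obj C ==> s \<in> W X Y ==> zz Y [Bwd X Y s] X"
 by (intro zz_bwd zz_nil)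

text \<open>Each generating relation replaces a segment between fixed endpoints, and
  \<open>W_Mor\<close> makes the forward step along a member of \<open>W\<close> legitimate.
  Representatives may therefore be exchanged without rechecking well-formedness.\<close>

lemma ze_zz: "ze A B p q ==> zz A p B & zz A q B"
proof (induction rule: zigzag_eq.induct)
 case (ze_ident A p X q B)
 then have "zz X (Fwd X X (Ident C X) # q) B" using zz_Obj Ident_Mor by (blast intro: zz_fwd)
 then show ?case using ze_ident zz_append by fastforce
next
 case (ze_comp A p X Y Z q B f g)
 then have *: "X \<in> Obj C" "Z \<in> Obj C" using zz_Obj by blast+
 then have "zz X ([Fwd X Y f, Fwd Y Z g] @ q) B" "zz X ([Fwd X Z (Comp C X Y Z g f)] @ q) B"
  using ze_comp Comp_Mor by (auto intro!: zz_fwd)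
 then show ?case using ze_comp zz_append by blast
next
 case (ze_inv1 A p X q B Y s)
 then have "zz X ([Fwd X Y s, Bwd X Y s] @ q) B"
  using zz_Obj subsetD[OF W_Mor] by (auto intro!: zz_fwd zz_bwd)
 then show ?case using ze_inv1 zz_append by blast
next
 case (ze_inv2 A p Y q B X s)
 then have "zz Y ([Bwd X Y s, Fwd X Y s] @ q) B"
  using zz_Obj subsetD[OF W_Mor] by (auto intro!: zz_fwd zz_bwd)
 then show ?case using ze_inv2 zz_append by blast
qed auto

lemma ze_append_left: "ze A B p q ==> zz A' r A ==> ze A' B (r @ p) (r @ q)"
proof (induction rule: zigzag_eq.induct)
 case (ze_refl A p B) then show ?case using zz_append zigzag_eq.ze_refl by metis
next
 case (ze_sym A B p q) then show ?case using zigzag_eq.ze_sym by metis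
next
 case (ze_trans A B p q r) then show ?case using zigzag_eq.ze_trans by metis
next
 case (ze_ident A p X q B) then show ?case using zigzag_eq.ze_ident[of C W A' "r @ p"] zz_append by fastforce
next
 case (ze_comp A p X Y Z q B f g) then show ?case using zigzag_eq.ze_comp[of C W A' "r @ p"] zz_append by fastforce
next
 case (ze_inv1 A p X q B Y s) then show ?case using zigzag_eq.ze_inv1[of C W A' "r @ p"] zz_append by fastforce
next
 case (ze_inv2 A p Y q B X s) then show ?case using zigzag_eq.ze_inv2[of C W A' "r @ p"] zz_append by fastforce
qed

lemma ze_append_right: "ze A B p q ==> zz B r B' ==> ze A B' (p @ r) (q @ r)"
proof (induction rule: zigzag_eq.induct)
 case (ze_refl A p B) then show ?case using zz_append zigzag_eq.ze_refl by metis
next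
 case (ze_sym A B p q) then show ?case using zigzag_eq.ze_sym by metis
next
 case (ze_trans A B p q r) then show ?case using zigzag_eq.ze_trans by metis
next
 case (ze_ident A p X q B)
 then have "zz X (q @ r) B'" using zz_append by metis
 from zigzag_eq.ze_ident[OF ze_ident(1) this] show ?case by simp
next
 case (ze_comp A p X Y Z q B f g)
 then have "zz Z (q @ r) B'" using zz_append by metis
 from zigzag_eq.ze_comp[OF ze_comp(1,2) this ze_comp(4,5)] show ?case by simp
next
 case (ze_inv1 A p X q B Y s)
 then have "zz X (q @ r) B'" using zz_append by metis
 from zigzag_eq.ze_inv1[OF ze_inv1(1) this ze_inv1(3,4)] show ?case by simp
next
 case (ze_inv2 A p Y q B X s)
 then have "zz Y (q @ r) B'" using zz_append by metis
 from zigzag_eq.ze_inv2[OF ze_inv2(1) this ze_inv2(3,4)] show ?case by simp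
qed

lemma ze_append: "ze A B p p' ==> ze B E q q' ==> ze A E (p @ q) (p' @ q')"
 by (meson ze_append_left ze_append_right ze_trans ze_zz)

abbreviation "L \<equiv> localisation C W"

definition cls :: "'o => 'o => ('o, 'm) zstep list => ('o, 'm) zstep list set" where
 "cls A B p = {q. ze A B p q}"

lemma cls_eq_iff: "zz A p B ==> zz A q B ==> cls A B p = cls A B q \<longleftrightarrow> ze A B p q"
 unfolding cls_def using ze_refl ze_sym ze_trans by (metis Collect_cong mem_Collect_eq)

lemma zigzag_rel_Image: "zigzag_rel C W A B `` {p} = cls A B p"
 unfolding zigzag_rel_def cls_def by auto

lemma Obj_L [simp]: "Obj L = Obj C"
 unfolding localisation_def by simp

lemma Mor_L: "Mor L A B = {cls A B p | p. zz A p B}"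
 unfolding localisation_def quotient_def by (auto simp: zigzag_rel_Image)

lemma Ident_L: "Ident L A = cls A A []"
 unfolding localisation_def by (simp add: zigzag_rel_Image)

text \<open>\<open>localisation\<close> composes whole classes through an image of sets; since
  \<open>ze\<close> is a congruence for concatenation, all choices of representatives end in the
  same class.\<close>

lemma Comp_L:
 assumes "zz A p B" "zz B q E"
 shows "Comp L A B E (cls B E q) (cls A B p) = cls A E (p @ q)"
proof -
 have "zigzag_rel C W A E `` {p' @ q' | p' q'. p' \<in> cls A B p & q' \<in> cls B E q} = cls A E (p @ q)"
  (is "?l = ?r")
 proof
  show "?l \<subseteq> ?r"
  proof
   fix z assume "z \<in> ?l"
   then obtain p' q' where "ze A B p p'" "ze B E q q'" "ze A E (p' @ q') z"
    unfolding zigzag_rel_def cls_def by blast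
   then show "z \<in> ?r" unfolding cls_def mem_Collect_eq using ze_append ze_trans by metis
  qed
  show "?r \<subseteq> ?l"
  proof
   fix z assume "z \<in> ?r"
   moreover have "p \<in> cls A B p" "q \<in> cls B E q" unfolding cls_def using assms by (auto intro: ze_refl)
   ultimately show "z \<in> ?l" unfolding zigzag_rel_def cls_def by blast
  qed
 qed
 then show ?thesis unfolding localisation_def by simp
qed

text \<open>Composition is concatenation of representatives, and lists form a monoid.\<close>

lemma category_L: "category L"
proof
 fix X assume "X \<in> Obj L" then show "Ident L X \<in> Mor L X X"
  by (auto simp: Mor_L Ident_L intro!: exI[of _ "[]"] zz_nil)
next
 fix X Y Z f g assume "f \<in> Mor L X Y" "g \<in> Mor L Y Z"
 then show "Comp L X Y Z g f \<in> Mor L X Z" using zz_append by (auto simp: Mor_L Comp_L)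
next
 fix X Y f assume "X \<in> Obj L" "f \<in> Mor L X Y"
 then show "Comp L X X Y f (Ident L X) = f" by (auto simp: Mor_L Ident_L Comp_L zz_nil)
next
 fix X Y f assume "Y \<in> Obj L" "f \<in> Mor L X Y"
 then show "Comp L X Y Y (Ident L Y) f = f" by (auto simp: Mor_L Ident_L Comp_L zz_nil)
next
 fix X Y Z V f g h
 assume "f \<in> Mor L X Y" "g \<in> Mor L Y Z" "h \<in> Mor L Z V"
 then show "Comp L X Z V h (Comp L X Y Z g f) = Comp L X Y V (Comp L Y Z V h g) f"
  using zz_append by (auto simp: Mor_L Comp_L)
qed

lemma thin_L: "thin L A B \<longleftrightarrow> (\<forall>p q. zz A p B --> zz A q B --> ze A B p q)"
proof -
 have "thin L A B \<longleftrightarrow> (\<forall>p q. zz A p B --> zz A q B --> cls A B p = cls A B q)"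
  unfolding thin_def Mor_L by blast
 then show ?thesis using cls_eq_iff by metis
qed

lemma isomorphic_L_W:
 assumes "X \<in> Obj C" "Y \<in> Obj C" "s \<in> W X Y"
 shows "isomorphic L X Y"
proof -
 have f: "zz X [Fwd X Y s] Y" and b: "zz Y [Bwd X Y s] X" using assms zz_Fwd zz_Bwd W_Mor by blast+
 have n: "zz X [] X" "zz Y [] Y" using assms by (auto intro: zz_nil)
 have "ze X X ([Fwd X Y s] @ [Bwd X Y s]) []" "ze Y Y ([Bwd X Y s] @ [Fwd X Y s]) []"
  using ze_inv1[OF n(1) n(1) assms(2,3)] ze_inv2[OF n(2) n(2) assms(1,3)] by simp_all
 then have "Comp L X Y X (cls Y X [Bwd X Y s]) (cls X Y [Fwd X Y s]) = Ident L X"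
  "Comp L Y X Y (cls X Y [Fwd X Y s]) (cls Y X [Bwd X Y s]) = Ident L Y"
  unfolding Comp_L[OF f b] Comp_L[OF b f] Ident_L
  using cls_eq_iff n zz_append f b by metis+
 then show ?thesis unfolding isomorphic_def is_iso_def Mor_L using f b by blast
qed

text \<open>The map from \<open>T A\<close> to \<open>T B\<close> induced by a zigzag when
  \<open>(T, Tm)\<close> is a set-valued functor that makes the members of \<open>W\<close>
  bijective: a backward step acts by the inverse function.\<close>

fun act :: "('o => 't set) => ('o => 'o => 'm => 't => 't) => ('o, 'm) zstep list => 't => 't" where
 "act T Tm [] t = t"
| "act T Tm (Fwd X Y f # p) t = act T Tm p (Tm X Y f t)"
| "act T Tm (Bwd X Y s # p) t = act T Tm p (inv_into (T X) (Tm X Y s) t)"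

lemma act_append: "act T Tm (p @ q) t = act T Tm q (act T Tm p t)"
proof (induction p arbitrary: t)
 case (Cons a p) then show ?case by (cases a) auto
qed simp

text \<open>The universal property of the localisation, for functors to sets.\<close>

lemma act_ze:
 assumes T: "!!X Y f t. X \<in> Obj C ==> Y \<in> Obj C ==> f \<in> Mor C X Y ==> t \<in> T X ==> Tm X Y f t \<in> T Y"
  and Id: "!!X t. X \<in> Obj C ==> t \<in> T X ==> Tm X X (Ident C X) t = t"
  and Co: "!!X Y Z f g t. X \<in> Obj C ==> Y \<in> Obj C ==> Z \<in> Obj C ==> f \<in> Mor C X Y ==> g \<in> Mor C Y Z ==>
   t \<in> T X ==> Tm X Z (Comp C X Y Z g f) t = Tm Y Z g (Tm X Y f t)"
  and bij: "!!X Y s. X \<in> Obj C ==> Y \<in> Obj C ==> s \<in> W X Y ==> bij_betw (Tm X Y s) (T X) (T Y)"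
  and "ze A B p q" "t \<in> T A"
 shows "act T Tm p t = act T Tm q t"
proof -
 \<comment> \<open>Staying inside the sets \<open>T\<close> is what allows the inverse functions to
   be cancelled below.\<close>
 have zz: "zz A p B ==> t \<in> T A ==> act T Tm p t \<in> T B" for A p B t
 proof (induction arbitrary: t rule: zigzag.induct)
  case (zz_fwd X f Y p Z) then show ?case using T zz_Obj by auto
 next
  case (zz_bwd Y s X p Z)
  then have "inv_into (T X) (Tm X Y s) t \<in> T X"
   using bij[of X Y s] zz_Obj by (metis bij_betw_def inv_into_into)
  then show ?case using zz_bwd by simp
 qed simp
 show ?thesis using assms(5,6)
 proof (induction arbitrary: t rule: zigzag_eq.induct)
  case (ze_ident A p X q B) then show ?case using zz zz_Obj Id by (simp add: act_append)
 next
  case (ze_comp A p X Y Z q B f g)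
  then show ?case using zz[OF ze_comp(1)] zz_Obj Co by (simp add: act_append)
 next
  case (ze_inv1 A p X q B Y s)
  then have "inv_into (T X) (Tm X Y s) (Tm X Y s (act T Tm p t)) = act T Tm p t"
   using zz[OF ze_inv1(1)] zz_Obj bij[of X Y s] by (meson bij_betw_inv_into_left)
  then show ?case by (simp add: act_append)
 next
  case (ze_inv2 A p Y q B X s)
  then have "Tm X Y s (inv_into (T X) (Tm X Y s) (act T Tm p t)) = act T Tm p t"
   using zz[OF ze_inv2(1)] zz_Obj bij[of X Y s] by (meson bij_betw_inv_into_right)
  then show ?case by (simp add: act_append)
 qed auto
qed

end

section \<open>Modules and complexes\<close>

context left_module
begin

lemma minus_zero [simp]: "\<ominus>\<^bsub>M\<^esub> \<zero>\<^bsub>M\<^esub> = \<zero>\<^bsub>M\<^esub>"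
 by (rule M.minus_equality) simp_all

lemma smult_zero_right [simp]:
 assumes a: "a \<in> carrier R" shows "a \<odot>\<^bsub>M\<^esub> \<zero>\<^bsub>M\<^esub> = \<zero>\<^bsub>M\<^esub>"
proof -
 have "a \<odot>\<^bsub>M\<^esub> \<zero>\<^bsub>M\<^esub> = a \<odot>\<^bsub>M\<^esub> \<zero>\<^bsub>M\<^esub> \<oplus>\<^bsub>M\<^esub> a \<odot>\<^bsub>M\<^esub> \<zero>\<^bsub>M\<^esub>"
  using smult_r_distr[OF a, of "\<zero>\<^bsub>M\<^esub>" "\<zero>\<^bsub>M\<^esub>"] by simp
 then show ?thesis using M.add.l_cancel_one' smult_closed[OF a M.zero_closed] by metis
qed

lemma smult_zero_left [simp]:
 assumes x: "x \<in> carrier M" shows "\<zero> \<odot>\<^bsub>M\<^esub> x = \<zero>\<^bsub>M\<^esub>"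
proof -
 have "\<zero> \<odot>\<^bsub>M\<^esub> x = \<zero> \<odot>\<^bsub>M\<^esub> x \<oplus>\<^bsub>M\<^esub> \<zero> \<odot>\<^bsub>M\<^esub> x"
  using smult_l_distr[OF R.zero_closed R.zero_closed x] by simp
 then show ?thesis using M.add.l_cancel_one' smult_closed[OF R.zero_closed x] by metis
qed

lemma smult_minus_right:
 assumes "a \<in> carrier R" "x \<in> carrier M" shows "a \<odot>\<^bsub>M\<^esub> (\<ominus>\<^bsub>M\<^esub> x) = \<ominus>\<^bsub>M\<^esub> (a \<odot>\<^bsub>M\<^esub> x)"
proof -
 have "a \<odot>\<^bsub>M\<^esub> (\<ominus>\<^bsub>M\<^esub> x) \<oplus>\<^bsub>M\<^esub> a \<odot>\<^bsub>M\<^esub> x = \<zero>\<^bsub>M\<^esub>"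
  using smult_r_distr[of a "\<ominus>\<^bsub>M\<^esub> x" x] assms by (simp add: M.l_neg)
 then show ?thesis using M.minus_equality[of "a \<odot>\<^bsub>M\<^esub> (\<ominus>\<^bsub>M\<^esub> x)" "a \<odot>\<^bsub>M\<^esub> x"] assms smult_closed by simp
qed

lemma smult_minus_left:
 assumes "a \<in> carrier R" "x \<in> carrier M" shows "(\<ominus> a) \<odot>\<^bsub>M\<^esub> x = \<ominus>\<^bsub>M\<^esub> (a \<odot>\<^bsub>M\<^esub> x)"
proof -
 have "(\<ominus> a) \<odot>\<^bsub>M\<^esub> x \<oplus>\<^bsub>M\<^esub> a \<odot>\<^bsub>M\<^esub> x = \<zero>\<^bsub>M\<^esub>"
  using smult_l_distr[of "\<ominus> a" a x] assms by (simp add: R.l_neg)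
 then show ?thesis using M.minus_equality[of "(\<ominus> a) \<odot>\<^bsub>M\<^esub> x" "a \<odot>\<^bsub>M\<^esub> x"] assms smult_closed by simp
qed

end

lemma left_moduleI:
 assumes "ring R" "abelian_group M"
  "!!a x. a \<in> carrier R ==> x \<in> carrier M ==> a \<odot>\<^bsub>M\<^esub> x \<in> carrier M"
  "!!a b x. a \<in> carrier R ==> b \<in> carrier R ==> x \<in> carrier M ==>
   (a \<oplus>\<^bsub>R\<^esub> b) \<odot>\<^bsub>M\<^esub> x = a \<odot>\<^bsub>M\<^esub> x \<oplus>\<^bsub>M\<^esub> b \<odot>\<^bsub>M\<^esub> x"
  "!!a x y. a \<in> carrier R ==> x \<in> carrier M ==> y \<in> carrier M ==>
   a \<odot>\<^bsub>M\<^esub> (x \<oplus>\<^bsub>M\<^esub> y) = a \<odot>\<^bsub>M\<^esub> x \<oplus>\<^bsub>M\<^esub> a \<odot>\<^bsub>M\<^esub> y"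
  "!!a b x. a \<in> carrier R ==> b \<in> carrier R ==> x \<in> carrier M ==>
   (a \<otimes>\<^bsub>R\<^esub> b) \<odot>\<^bsub>M\<^esub> x = a \<odot>\<^bsub>M\<^esub> (b \<odot>\<^bsub>M\<^esub> x)"
  "!!x. x \<in> carrier M ==> \<one>\<^bsub>R\<^esub> \<odot>\<^bsub>M\<^esub> x = x"
 shows "left_module R M"
 using assms unfolding left_module_def left_module_axioms_def by blast

lemma module_homD:
 assumes "f \<in> module_hom R M N"
 shows "x \<in> carrier M ==> f x \<in> carrier N"
  and "x \<in> carrier M ==> y \<in> carrier M ==> f (x \<oplus>\<^bsub>M\<^esub> y) = f x \<oplus>\<^bsub>N\<^esub> f y"
  and "a \<in> carrier R ==> x \<in> carrier M ==> f (a \<odot>\<^bsub>M\<^esub> x) = a \<odot>\<^bsub>N\<^esub> f x"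
  and "f \<in> extensional (carrier M)"
 using assms unfolding module_hom_def by (auto simp: PiE_def)

lemma module_homI:
 assumes "f \<in> extensional (carrier M)"
  and "!!x. x \<in> carrier M ==> f x \<in> carrier N"
  and "!!x y. x \<in> carrier M ==> y \<in> carrier M ==> f (x \<oplus>\<^bsub>M\<^esub> y) = f x \<oplus>\<^bsub>N\<^esub> f y"
  and "!!a x. a \<in> carrier R ==> x \<in> carrier M ==> f (a \<odot>\<^bsub>M\<^esub> x) = a \<odot>\<^bsub>N\<^esub> f x"
 shows "f \<in> module_hom R M N"
 using assms unfolding module_hom_def by (auto simp: PiE_def)

lemma module_hom_zero:
 assumes f: "f \<in> module_hom R M N" and M: "left_module R M" and N: "left_module R N"
 shows "f \<zero>\<^bsub>M\<^esub> = \<zero>\<^bsub>N\<^esub>"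
proof -
 interpret M: left_module R M by fact
 interpret N: left_module R N by fact
 have "f (\<zero>\<^bsub>R\<^esub> \<odot>\<^bsub>M\<^esub> \<zero>\<^bsub>M\<^esub>) = \<zero>\<^bsub>R\<^esub> \<odot>\<^bsub>N\<^esub> f \<zero>\<^bsub>M\<^esub>"
  by (rule module_homD(3)[OF f]) simp_all
 then show ?thesis using module_homD(1)[OF f] by simp
qed

lemma module_hom_minus:
 assumes f: "f \<in> module_hom R M N" and M: "left_module R M" and N: "left_module R N" and x: "x \<in> carrier M"
 shows "f (\<ominus>\<^bsub>M\<^esub> x) = \<ominus>\<^bsub>N\<^esub> f x"
proof -
 interpret M: left_module R M by fact
 interpret N: left_module R N by fact
 have "f ((\<ominus>\<^bsub>R\<^esub> \<one>\<^bsub>R\<^esub>) \<odot>\<^bsub>M\<^esub> x) = (\<ominus>\<^bsub>R\<^esub> \<one>\<^bsub>R\<^esub>) \<odot>\<^bsub>N\<^esub> f x" using module_homD(3)[OF f] x by simp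
 then show ?thesis
  using module_homD(1)[OF f x] x by (simp add: M.smult_minus_left N.smult_minus_left M.smult_one N.smult_one)
qed

lemma module_hom_compose:
 assumes "left_module R M" and f: "f \<in> module_hom R M N" and g: "g \<in> module_hom R N P"
 shows "compose (carrier M) g f \<in> module_hom R M P"
proof -
 interpret M: left_module R M by fact
 show ?thesis
  by (intro module_homI) (auto simp: compose_def module_homD[OF f] module_homD[OF g] M.smult_closed)
qed

lemma left_module_module_sum:
 assumes "left_module R M" "left_module R N"
 shows "left_module R (module_sum M N)"
proof -
 interpret M: left_module R M by fact
 interpret N: left_module R N by fact
 have "abelian_group (module_sum M N)"
  by (rule abelian_groupI) (auto simp: module_sum_def M.a_ac N.a_ac
   intro!: bexI[of _ "\<ominus>\<^bsub>M\<^esub> _"] bexI[of _ "\<ominus>\<^bsub>N\<^esub> _"] M.l_neg N.l_neg)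
 then show ?thesis
  by (intro left_moduleI) (auto simp: module_sum_def M.smult_closed N.smult_closed M.smult_l_distr
   N.smult_l_distr M.smult_r_distr N.smult_r_distr M.smult_assoc N.smult_assoc M.smult_one N.smult_one
   intro: M.R.ring_axioms)
qed

section \<open>Complexes, cohomology and mapping cones\<close>

definition pre_complex :: "'a ring => ('a, 'm) cochain => bool" where
 "pre_complex R X \<longleftrightarrow> (\<forall>n. left_module R (ct X n) &
   cd X n \<in> module_hom R (ct X n) (ct X (n + 1)) &
   (\<forall>x\<in>car X n. cd X (n + 1) (cd X n x) = (zc X (n + 1 + 1))))"

definition acyclic_complex :: "('a, 'm) cochain => bool" where
 "acyclic_complex X \<longleftrightarrow> (\<forall>n. cocycles X n \<subseteq> coboundaries X n)"

text \<open>Homological arguments run on \<open>pre_complex\<close>, which also covers cones, whose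
  elements are pairs; the finiteness conditions return for the objects of the category.\<close>

lemma bounded_complex_iff:
 "bounded_complex R X \<longleftrightarrow> pre_complex R X & (\<forall>n. fin_gen R (ct X n)) &
   (\<exists>N. \<forall>n. \<bar>n\<bar> > N --> car X n = {(zc X n)})"
 unfolding bounded_complex_def pre_complex_def by blast

locale complex =
 fixes R :: "'a ring" and X :: "('a, 'm) cochain"
 assumes pre_complex: "pre_complex R X"
begin

lemma lm: "left_module R (ct X n)" using pre_complex unfolding pre_complex_def by blast

lemma abg: "abelian_group (ct X n)" using lm[of n] unfolding left_module_def by blast

lemma hom: "cd X n \<in> module_hom R (ct X n) (ct X (n + 1))"
 using pre_complex unfolding pre_complex_def by blast

text \<open>Degrees are linked by equations such as \<open>m = n + 1\<close> in the premises, so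
  that indices written \<open>n - 1 + 1\<close> and \<open>n\<close> can be matched alike.\<close>

lemma d_closed: "x \<in> car X n ==> m = n + 1 ==> cd X n x \<in> car X m"
 using module_homD(1)[OF hom] by blast

lemma d_closed': "x \<in> car X (n - 1) ==> cd X (n - 1) x \<in> car X n"
 using d_closed[of x "n - 1" n] by simp

lemma d_add: "x \<in> car X n ==> y \<in> car X n ==> m = n + 1 ==>
  cd X n (x \<oplus>\<^bsub>ct X n\<^esub> y) = cd X n x \<oplus>\<^bsub>ct X m\<^esub> cd X n y"
 using module_homD(2)[OF hom] by blast

lemma d_smult: "a \<in> carrier R ==> x \<in> car X n ==> m = n + 1 ==>
  cd X n (a \<odot>\<^bsub>ct X n\<^esub> x) = a \<odot>\<^bsub>ct X m\<^esub> cd X n x"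
 using module_homD(3)[OF hom] by blast

lemma d_zero: "m = n + 1 ==> cd X n (zc X n) = (zc X m)"
 using module_hom_zero[OF hom lm lm] by blast

lemma d_minus: "x \<in> car X n ==> m = n + 1 ==>
  cd X n (\<ominus>\<^bsub>ct X n\<^esub> x) = \<ominus>\<^bsub>ct X m\<^esub> cd X n x"
 using module_hom_minus[OF hom lm lm] by blast

lemma d_d: "x \<in> car X n ==> m = n + 1 ==> k = m + 1 ==> cd X m (cd X n x) = (zc X k)"
 using pre_complex unfolding pre_complex_def by blast

lemma d_d': "x \<in> car X (n - 1) ==> cd X n (cd X (n - 1) x) = (zc X (n + 1))"
 using d_d[of x "n - 1" n] by simp

lemma coboundaries_subset: "coboundaries X n \<subseteq> cocycles X n"
 unfolding coboundaries_def cocycles_def using d_closed' d_d' by auto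

end

lemma chain_mapsD:
 assumes "f \<in> chain_maps R X Y"
 shows "f n \<in> module_hom R (ct X n) (ct Y n)"
  and "x \<in> car X n ==> m = n + 1 ==> f m (cd X n x) = cd Y n (f n x)"
 using assms unfolding chain_maps_def by auto

locale chain_map = X: complex R X + Y: complex R Y
 for R :: "'a ring" and X Y :: "('a, 'm) cochain" +
 fixes f :: "int => 'm => 'm"
 assumes f: "f \<in> chain_maps R X Y"
begin

lemma closed: "x \<in> car X n ==> f n x \<in> car Y n"
 using module_homD(1)[OF chain_mapsD(1)[OF f]] by blast
lemma add: "x \<in> car X n ==> y \<in> car X n ==>
  f n (x \<oplus>\<^bsub>ct X n\<^esub> y) = f n x \<oplus>\<^bsub>ct Y n\<^esub> f n y"
 using module_homD(2)[OF chain_mapsD(1)[OF f]] by blast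
lemma smult: "a \<in> carrier R ==> x \<in> car X n ==> f n (a \<odot>\<^bsub>ct X n\<^esub> x) = a \<odot>\<^bsub>ct Y n\<^esub> f n x"
 using module_homD(3)[OF chain_mapsD(1)[OF f]] by blast
lemma zero: "f n (zc X n) = (zc Y n)"
 using module_hom_zero[OF chain_mapsD(1)[OF f] X.lm Y.lm] by blast
lemma minus: "x \<in> car X n ==> f n (\<ominus>\<^bsub>ct X n\<^esub> x) = \<ominus>\<^bsub>ct Y n\<^esub> f n x"
 using module_hom_minus[OF chain_mapsD(1)[OF f] X.lm Y.lm] by blast
lemma comm: "x \<in> car X n ==> m = n + 1 ==> f m (cd X n x) = cd Y n (f n x)"
 using chain_mapsD(2)[OF f] by blast
lemma comm': "x \<in> car X (n - 1) ==> f n (cd X (n - 1) x) = cd Y (n - 1) (f (n - 1) x)"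
 using comm[of x "n - 1" n] by simp

lemma cocycle: "x \<in> cocycles X n ==> f n x \<in> cocycles Y n"
 unfolding cocycles_def using comm[of x n "n + 1", symmetric] closed zero by auto

end

lemma coset_eq_iff:
 assumes M: "abelian_group M" and B: "B \<subseteq> carrier M" "\<zero>\<^bsub>M\<^esub> \<in> B"
  "!!x y. x \<in> B ==> y \<in> B ==> x \<oplus>\<^bsub>M\<^esub> y \<in> B" "!!x. x \<in> B ==> \<ominus>\<^bsub>M\<^esub> x \<in> B"
  and x: "x \<in> carrier M" and y: "y \<in> carrier M"
 shows "B +>\<^bsub>M\<^esub> x = B +>\<^bsub>M\<^esub> y \<longleftrightarrow> (\<exists>b\<in>B. x = b \<oplus>\<^bsub>M\<^esub> y)"
proof -
 interpret M: abelian_group M by fact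
 have c: "B +>\<^bsub>M\<^esub> z = {b \<oplus>\<^bsub>M\<^esub> z | b. b \<in> B}" for z by (auto simp: a_r_coset_def')
 show ?thesis
 proof
  assume "B +>\<^bsub>M\<^esub> x = B +>\<^bsub>M\<^esub> y"
  moreover have "x \<in> B +>\<^bsub>M\<^esub> x" unfolding c using B x by force
  ultimately show "\<exists>b\<in>B. x = b \<oplus>\<^bsub>M\<^esub> y" unfolding c by blast
 next
  assume "\<exists>b\<in>B. x = b \<oplus>\<^bsub>M\<^esub> y"
  then obtain b where b: "b \<in> B" "x = b \<oplus>\<^bsub>M\<^esub> y" by blast
  have bc: "b \<in> carrier M" using b B by blast
  have "y = \<ominus>\<^bsub>M\<^esub> b \<oplus>\<^bsub>M\<^esub> x" using b bc y M.r_neg2 M.r_neg1 by simp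
  then have "z \<oplus>\<^bsub>M\<^esub> y = (z \<oplus>\<^bsub>M\<^esub> \<ominus>\<^bsub>M\<^esub> b) \<oplus>\<^bsub>M\<^esub> x" if "z \<in> B" for z
   using that B bc x by (metis M.a_assoc M.a_inv_closed subsetD)
  moreover have "z \<oplus>\<^bsub>M\<^esub> x = (z \<oplus>\<^bsub>M\<^esub> b) \<oplus>\<^bsub>M\<^esub> y" if "z \<in> B" for z
   using that B bc y b(2) by (metis M.a_assoc subsetD)
  moreover have "\<ominus>\<^bsub>M\<^esub> b \<in> B" using B b by blast
  ultimately show "B +>\<^bsub>M\<^esub> x = B +>\<^bsub>M\<^esub> y" unfolding c using B(3) b(1) by blast
 qed
qed

lemma (in complex) coboundaries_subgroup:
 "coboundaries X n \<subseteq> car X n" "(zc X n) \<in> coboundaries X n"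
 "x \<in> coboundaries X n ==> y \<in> coboundaries X n ==> x \<oplus>\<^bsub>ct X n\<^esub> y \<in> coboundaries X n"
 "x \<in> coboundaries X n ==> \<ominus>\<^bsub>ct X n\<^esub> x \<in> coboundaries X n"
proof -
 interpret A: abelian_group "ct X (n - 1)" by (rule abg)
 show "coboundaries X n \<subseteq> car X n" unfolding coboundaries_def using d_closed' by auto
 show "(zc X n) \<in> coboundaries X n"
  unfolding coboundaries_def using d_zero[of n "n - 1"] A.zero_closed by (metis diff_add_cancel imageI)
 show "x \<in> coboundaries X n ==> y \<in> coboundaries X n ==> x \<oplus>\<^bsub>ct X n\<^esub> y \<in> coboundaries X n"
  unfolding coboundaries_def using d_add[of _ "n - 1" _ n] A.a_closed by (smt (verit) diff_add_cancel imageE imageI)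
 show "x \<in> coboundaries X n ==> \<ominus>\<^bsub>ct X n\<^esub> x \<in> coboundaries X n"
  unfolding coboundaries_def using d_minus[of _ "n - 1" n] A.a_inv_closed by (smt (verit) diff_add_cancel imageE imageI)
qed

lemma (in complex) cohomology_class_eq_iff:
 assumes "x \<in> car X n" "y \<in> car X n"
 shows "coboundaries X n +>\<^bsub>ct X n\<^esub> x = coboundaries X n +>\<^bsub>ct X n\<^esub> y \<longleftrightarrow>
  (\<exists>b\<in>coboundaries X n. x = b \<oplus>\<^bsub>ct X n\<^esub> y)"
 by (intro coset_eq_iff abg coboundaries_subgroup assms)

text \<open>\<open>f n\<close> carries coboundaries to coboundaries, so adding
  \<open>coboundaries Y n\<close> to the image of a coset fills up exactly one coset.\<close>

lemma (in chain_map) cohomology_map_class: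
 assumes z: "z \<in> cocycles X n"
 shows "cohomology_map Y f n (coboundaries X n +>\<^bsub>ct X n\<^esub> z) = coboundaries Y n +>\<^bsub>ct Y n\<^esub> f n z"
  (is "?l = ?r")
proof -
 interpret A: abelian_group "ct Y n" by (rule Y.abg)
 interpret B: abelian_group "ct X n" by (rule X.abg)
 have zc: "z \<in> car X n" using z unfolding cocycles_def by blast
 have l: "?l = {b \<oplus>\<^bsub>ct Y n\<^esub> f n (c \<oplus>\<^bsub>ct X n\<^esub> z) | b c. b \<in> coboundaries Y n & c \<in> coboundaries X n}"
  unfolding cohomology_map_def by (auto simp: a_r_coset_def' set_add_def')
 have r: "?r = {b \<oplus>\<^bsub>ct Y n\<^esub> f n z | b. b \<in> coboundaries Y n}" by (auto simp: a_r_coset_def')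
 have fc: "f n c \<in> coboundaries Y n" if "c \<in> coboundaries X n" for c
  using that comm' closed unfolding coboundaries_def by auto
 show ?thesis
 proof
  show "?l \<subseteq> ?r"
  proof
   fix y assume "y \<in> ?l"
   then obtain b c where bc: "b \<in> coboundaries Y n" "c \<in> coboundaries X n"
    "y = b \<oplus>\<^bsub>ct Y n\<^esub> f n (c \<oplus>\<^bsub>ct X n\<^esub> z)" unfolding l by blast
   have cc: "c \<in> car X n" "b \<in> car Y n"
    using bc X.coboundaries_subgroup(1) Y.coboundaries_subgroup(1) by blast+
   then have "y = (b \<oplus>\<^bsub>ct Y n\<^esub> f n c) \<oplus>\<^bsub>ct Y n\<^esub> f n z"
    using bc zc by (simp add: add closed A.a_assoc)
   then show "y \<in> ?r" unfolding r using Y.coboundaries_subgroup(3)[OF bc(1) fc[OF bc(2)]] by blast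
  qed
  show "?r \<subseteq> ?l"
  proof
   fix y assume "y \<in> ?r"
   then obtain b where "b \<in> coboundaries Y n" "y = b \<oplus>\<^bsub>ct Y n\<^esub> f n ((zc X n) \<oplus>\<^bsub>ct X n\<^esub> z)"
    unfolding r using zc by auto
   then show "y \<in> ?l" unfolding l using X.coboundaries_subgroup(2)[of n] by blast
  qed
 qed
qed

text \<open>On cosets, surjectivity means that every cocycle is hit up to a coboundary; injectivity
  may be tested at the zero class because cocycles can be subtracted. Later proofs work with this
  elementwise form.\<close>

lemma (in chain_map) quasi_isos_iff:
 "f \<in> quasi_isos R X Y \<longleftrightarrow> (\<forall>n.
   (\<forall>z\<in>cocycles Y n. \<exists>x\<in>cocycles X n. \<exists>b\<in>coboundaries Y n. z = b \<oplus>\<^bsub>ct Y n\<^esub> f n x) &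
   (\<forall>x\<in>cocycles X n. f n x \<in> coboundaries Y n --> x \<in> coboundaries X n))"
  (is "_ \<longleftrightarrow> (\<forall>n. ?s n & ?i n)")
proof -
 have "bij_betw (cohomology_map Y f n) (cohomology X n) (cohomology Y n) \<longleftrightarrow> ?s n & ?i n" for n
 proof -
  interpret A: abelian_group "ct Y n" by (rule Y.abg)
  interpret B: abelian_group "ct X n" by (rule X.abg)
  let ?c = "%x. coboundaries X n +>\<^bsub>ct X n\<^esub> x" and ?d = "%y. coboundaries Y n +>\<^bsub>ct Y n\<^esub> y"
  have cX: "x \<in> car X n" if "x \<in> cocycles X n" for x using that unfolding cocycles_def by blast
  have cY: "x \<in> car Y n" if "x \<in> cocycles Y n" for x using that unfolding cocycles_def by blast
  have im: "cohomology_map Y f n ` cohomology X n = (%x. ?d (f n x)) ` cocycles X n"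
   unfolding cohomology_def image_image using cohomology_map_class by auto
  have "cohomology_map Y f n ` cohomology X n \<subseteq> cohomology Y n"
   unfolding im unfolding cohomology_def using cocycle by blast
  then have "cohomology_map Y f n ` cohomology X n = cohomology Y n \<longleftrightarrow>
   (\<forall>z\<in>cocycles Y n. \<exists>x\<in>cocycles X n. ?d z = ?d (f n x))"
   unfolding im unfolding cohomology_def image_iff[symmetric] by blast
  also have "\<dots> \<longleftrightarrow> ?s n"
   using Y.cohomology_class_eq_iff[OF cY closed[OF cX]] by meson
  finally have s: "cohomology_map Y f n ` cohomology X n = cohomology Y n \<longleftrightarrow> ?s n" .
  have "inj_on (cohomology_map Y f n) (cohomology X n) \<longleftrightarrow>
   (\<forall>x\<in>cocycles X n. \<forall>y\<in>cocycles X n. ?d (f n x) = ?d (f n y) --> ?c x = ?c y)"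
   unfolding inj_on_def cohomology_def using cohomology_map_class by auto
  also have "\<dots> \<longleftrightarrow> (\<forall>x\<in>cocycles X n. \<forall>y\<in>cocycles X n.
   (\<exists>b\<in>coboundaries Y n. f n x = b \<oplus>\<^bsub>ct Y n\<^esub> f n y) --> (\<exists>b\<in>coboundaries X n. x = b \<oplus>\<^bsub>ct X n\<^esub> y))"
   using Y.cohomology_class_eq_iff[OF closed[OF cX] closed[OF cX]] X.cohomology_class_eq_iff[OF cX cX] by simp
  also have "\<dots> \<longleftrightarrow> ?i n"
  proof
   assume *: "\<forall>x\<in>cocycles X n. \<forall>y\<in>cocycles X n.
    (\<exists>b\<in>coboundaries Y n. f n x = b \<oplus>\<^bsub>ct Y n\<^esub> f n y) --> (\<exists>b\<in>coboundaries X n. x = b \<oplus>\<^bsub>ct X n\<^esub> y)"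
   show "?i n"
   proof (intro ballI impI)
    fix x assume x: "x \<in> cocycles X n" "f n x \<in> coboundaries Y n"
    have "(zc X n) \<in> cocycles X n" using X.coboundaries_subgroup(2) X.coboundaries_subset by blast
    moreover have "f n x = f n x \<oplus>\<^bsub>ct Y n\<^esub> f n (zc X n)"
     using x cX closed by (simp add: zero)
    ultimately obtain b where "b \<in> coboundaries X n" "x = b \<oplus>\<^bsub>ct X n\<^esub> (zc X n)" using * x by blast
    then show "x \<in> coboundaries X n" using X.coboundaries_subgroup(1) B.r_zero by (metis subsetD)
   qed
  next
   assume *: "?i n"
   show "\<forall>x\<in>cocycles X n. \<forall>y\<in>cocycles X n.
    (\<exists>b\<in>coboundaries Y n. f n x = b \<oplus>\<^bsub>ct Y n\<^esub> f n y) --> (\<exists>b\<in>coboundaries X n. x = b \<oplus>\<^bsub>ct X n\<^esub> y)"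
   proof (intro ballI impI)
    fix x y assume x: "x \<in> cocycles X n" and y: "y \<in> cocycles X n"
     and "\<exists>b\<in>coboundaries Y n. f n x = b \<oplus>\<^bsub>ct Y n\<^esub> f n y"
    then obtain b where b: "b \<in> coboundaries Y n" "f n x = b \<oplus>\<^bsub>ct Y n\<^esub> f n y" by blast
    let ?w = "x \<oplus>\<^bsub>ct X n\<^esub> (\<ominus>\<^bsub>ct X n\<^esub> y)"
    interpret A1: abelian_group "ct X (n + 1)" by (rule X.abg)
    have w: "?w \<in> cocycles X n"
     using x y unfolding cocycles_def by (simp add: X.d_add[of _ n _ "n + 1"] X.d_minus[of _ n "n + 1"])
    have bc: "b \<in> car Y n" using b(1) Y.coboundaries_subgroup(1) by blast
    have "f n ?w = b" using b bc cX[OF x] cX[OF y]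
     by (simp add: add minus closed A.a_assoc A.r_neg)
    then have "?w \<in> coboundaries X n" using * w b by blast
    moreover have "x = ?w \<oplus>\<^bsub>ct X n\<^esub> y" using cX[OF x] cX[OF y] by (simp add: B.a_assoc B.l_neg)
    ultimately show "\<exists>b\<in>coboundaries X n. x = b \<oplus>\<^bsub>ct X n\<^esub> y" by blast
   qed
  qed
  finally show ?thesis unfolding bij_betw_def using s by blast
 qed
 then show ?thesis unfolding quasi_isos_def using f by auto
qed

lemma cone_term:
 "m = n + 1 ==> ct (cone X Y f) n = module_sum (ct X m) (ct Y n)"
 unfolding cone_def by simp

lemma cone_diff:
 assumes "m = n + 1" "k = m + 1" "x \<in> car X m" "y \<in> car Y n"
 shows "cd (cone X Y f) n (x, y) =
  (\<ominus>\<^bsub>ct X k\<^esub> cd X m x, f m x \<oplus>\<^bsub>ct Y m\<^esub> cd Y n y)"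
 using assms unfolding cone_def by (simp add: module_sum_def)

lemma module_sum_simps:
 "(x, y) \<in> carrier (module_sum M N) \<longleftrightarrow> x \<in> carrier M & y \<in> carrier N"
 "\<zero>\<^bsub>module_sum M N\<^esub> = (\<zero>\<^bsub>M\<^esub>, \<zero>\<^bsub>N\<^esub>)"
 "(x, y) \<oplus>\<^bsub>module_sum M N\<^esub> (x', y') = (x \<oplus>\<^bsub>M\<^esub> x', y \<oplus>\<^bsub>N\<^esub> y')"
 "a \<odot>\<^bsub>module_sum M N\<^esub> (x, y) = (a \<odot>\<^bsub>M\<^esub> x, a \<odot>\<^bsub>N\<^esub> y)"
 by (simp_all add: module_sum_def)

lemma (in chain_map) pre_complex_cone: "pre_complex R (cone X Y f)"
proof -
 let ?C = "cone X Y f"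
 have lm: "left_module R (ct ?C n)" for n
  unfolding cone_def by (simp add: left_module_module_sum X.lm Y.lm)
 have hom: "cd ?C n \<in> module_hom R (ct ?C n) (ct ?C m)" if m: "m = n + 1" for n m
 proof -
  obtain k where k: "k = m + 1" by simp
  interpret A: left_module R "ct X k" by (rule X.lm)
  interpret B: left_module R "ct Y m" by (rule Y.lm)
  interpret A': left_module R "ct X m" by (rule X.lm)
  interpret B': left_module R "ct Y n" by (rule Y.lm)
  note t = cone_term[OF m, of X Y f] cone_term[OF k, of X Y f] and d = cone_diff[OF m k, of _ X _ Y f]
  show ?thesis
  proof (rule module_homI, goal_cases)
   case 1 show ?case unfolding cone_def by (auto simp: extensional_def)
  next
   case (2 x) then show ?case
    by (cases x) (simp add: t d module_sum_simps X.d_closed[OF _ k] closed Y.d_closed[OF _ m])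
  next
   case (3 x y) then show ?case
    by (cases x; cases y) (simp add: t d module_sum_simps X.d_add[OF _ _ k] add Y.d_add[OF _ _ m]
     X.d_closed[OF _ k] closed Y.d_closed[OF _ m] A.minus_add B.a_ac)
  next
   case (4 a x) then show ?case
    by (cases x) (simp add: t d module_sum_simps X.d_smult[OF _ _ k] smult Y.d_smult[OF _ _ m]
     X.d_closed[OF _ k] closed Y.d_closed[OF _ m] A.smult_minus_right B.smult_r_distr
     A'.smult_closed B'.smult_closed)
  qed
 qed
 have "cd ?C m (cd ?C n x) = (zc ?C k)"
  if m: "m = n + 1" and k: "k = m + 1" and x: "x \<in> car ?C n" for n m k x
 proof -
  obtain l where l: "l = k + 1" by simp
  interpret A: left_module R "ct X k" by (rule X.lm)
  interpret A': left_module R "ct X l" by (rule X.lm)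
  interpret B: left_module R "ct Y k" by (rule Y.lm)
  interpret B': left_module R "ct Y m" by (rule Y.lm)
  obtain a b where "x = (a, b)" "a \<in> car X m" "b \<in> car Y n"
   using x by (cases x) (simp add: cone_term[OF m] module_sum_simps)
  then show ?thesis
   by (simp add: cone_diff[OF m k] cone_diff[OF k l] cone_term[OF l] module_sum_simps
    X.d_closed[OF _ k] closed Y.d_closed[OF _ m] Y.d_closed[OF _ k] X.d_minus[OF _ l]
    X.d_d[OF _ k l] Y.d_d[OF _ m k] Y.d_add[OF _ _ k] minus comm[OF _ k] B.l_neg)
 qed
 then show ?thesis unfolding pre_complex_def using lm hom by blast
qed

text \<open>For a cocycle \<open>(x, y)\<close> the element \<open>f x = - d y\<close> is a
  coboundary, so injectivity gives \<open>x = d a\<close>. Then \<open>y + f a\<close> is a cocycle,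
  and surjectivity writes it as \<open>d w + f c\<close> with \<open>c\<close> a cocycle. The pair
  \<open>(c - a, w)\<close> bounds \<open>(x, y)\<close>.\<close>

lemma (in chain_map) acyclic_cone:
 assumes q: "f \<in> quasi_isos R X Y"
 shows "acyclic_complex (cone X Y f)"
 unfolding acyclic_complex_def
proof (intro allI subsetI)
 fix n p assume "p \<in> cocycles (cone X Y f) n"
 interpret A: left_module R "ct X (n + 1)" by (rule X.lm)
 interpret A': left_module R "ct X (n + 1 + 1)" by (rule X.lm)
 interpret A0: left_module R "ct X n" by (rule X.lm)
 interpret B: left_module R "ct Y n" by (rule Y.lm)
 interpret B': left_module R "ct Y (n + 1)" by (rule Y.lm)
 interpret B0: left_module R "ct Y (n - 1)" by (rule Y.lm)
 obtain x y where p: "p = (x, y)" and x: "x \<in> car X (n + 1)" and y: "y \<in> car Y n"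
  and dx: "\<ominus>\<^bsub>ct X (n + 1 + 1)\<^esub> cd X (n + 1) x = (zc X (n + 1 + 1))"
  and dy: "f (n + 1) x \<oplus>\<^bsub>ct Y (n + 1)\<^esub> cd Y n y = (zc Y (n + 1))"
  using \<open>p \<in> _\<close> unfolding cocycles_def cone_def module_sum_def by auto
 have dyc: "cd Y n y \<in> car Y (n + 1)" using Y.d_closed y by blast
 have xc: "x \<in> cocycles X (n + 1)"
  unfolding cocycles_def using x dx X.d_closed[OF x refl]
  by (metis (mono_tags, lifting) A'.M.add.inv_eq_1_iff mem_Collect_eq)
 have "f (n + 1) x = cd Y n (\<ominus>\<^bsub>ct Y n\<^esub> y)"
  using dy dyc closed[OF x] y Y.d_minus[OF y refl] B'.minus_equality by metis
 then have "f (n + 1) x \<in> coboundaries Y (n + 1)" unfolding coboundaries_def using y by auto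
 then have "x \<in> coboundaries X (n + 1)" using q xc unfolding quasi_isos_iff by blast
 then obtain a where a: "a \<in> car X n" "x = cd X n a" unfolding coboundaries_def by auto
 have fa: "f (n + 1) x = cd Y n (f n a)" using a comm by simp
 have "y \<oplus>\<^bsub>ct Y n\<^esub> f n a \<in> cocycles Y n"
  unfolding cocycles_def using y a dy fa closed[OF a(1)] dyc
  by (simp add: Y.d_add[of _ _ _ "n + 1"] Y.d_closed B'.a_comm)
 then obtain c b where c: "c \<in> cocycles X n" and "b \<in> coboundaries Y n"
  and b: "y \<oplus>\<^bsub>ct Y n\<^esub> f n a = b \<oplus>\<^bsub>ct Y n\<^esub> f n c"
  using q unfolding quasi_isos_iff by blast
 then obtain w where w: "w \<in> car Y (n - 1)" "b = cd Y (n - 1) w" unfolding coboundaries_def by auto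
 have cc: "c \<in> car X n" "cd X n c = (zc X (n + 1))" using c unfolding cocycles_def by auto
 have bc: "b \<in> car Y n" using w Y.d_closed' by blast
 let ?u = "c \<oplus>\<^bsub>ct X n\<^esub> (\<ominus>\<^bsub>ct X n\<^esub> a)"
 have u: "?u \<in> car X n" using cc a by simp
 have "cd X n ?u = \<ominus>\<^bsub>ct X (n + 1)\<^esub> x"
  using cc a x by (simp add: X.d_add[of _ _ _ "n + 1"] X.d_minus[of _ _ "n + 1"])
 then have 1: "x = \<ominus>\<^bsub>ct X (n + 1)\<^esub> cd X n ?u" using x by simp
 have "y = (b \<oplus>\<^bsub>ct Y n\<^esub> f n c) \<oplus>\<^bsub>ct Y n\<^esub> (\<ominus>\<^bsub>ct Y n\<^esub> f n a)"
  unfolding b[symmetric] using y closed[OF a(1)] by (simp add: B.a_assoc B.r_neg)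
 also have "\<dots> = f n ?u \<oplus>\<^bsub>ct Y n\<^esub> b"
  using cc a bc by (simp add: add minus closed B.a_assoc B.a_comm[of b])
 finally have 2: "y = f n ?u \<oplus>\<^bsub>ct Y n\<^esub> cd Y (n - 1) w" using w by simp
 have "p = cd (cone X Y f) (n - 1) (?u, w)"
  using cone_diff[of n "n - 1" "n + 1" ?u X w Y f] u w 1 2 unfolding p by simp
 moreover have "(?u, w) \<in> car (cone X Y f) (n - 1)"
  using u w by (simp add: cone_def module_sum_def)
 ultimately show "p \<in> coboundaries (cone X Y f) n" unfolding coboundaries_def by blast
qed

section \<open>Semi-free complexes\<close>

text \<open>Linear combination with coefficients on the left, by recursion on the number of terms,
  so that attaching a generator is one unfolding. The vectors precede the coefficients:
  \<open>lin M x n\<close> is the linear map sending the i-th basis vector to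
  \<open>x i\<close>.\<close>

primrec lin :: "('a, 'm) module => (nat => 'm) => nat => (nat => 'a) => 'm" where
 "lin M x 0 r = \<zero>\<^bsub>M\<^esub>"
| "lin M x (Suc n) r = lin M x n r \<oplus>\<^bsub>M\<^esub> r n \<odot>\<^bsub>M\<^esub> x n"

context left_module
begin

lemma lin_closed [intro]:
 "(!!i. i < n ==> r i \<in> carrier R) ==> (!!i. i < n ==> x i \<in> carrier M) ==> lin M x n r \<in> carrier M"
 by (induction n) (auto intro: smult_closed)

lemma lin_cong:
 "(!!i. i < n ==> r i \<odot>\<^bsub>M\<^esub> x i = r' i \<odot>\<^bsub>M\<^esub> x' i) ==> lin M x n r = lin M x' n r'"
 by (induction n) auto

lemma lin_zero: "(!!i. i < n ==> r i \<odot>\<^bsub>M\<^esub> x i = \<zero>\<^bsub>M\<^esub>) ==> lin M x n r = \<zero>\<^bsub>M\<^esub>"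
 by (induction n) auto

lemma lin_add_left:
 "(!!i. i < n ==> r i \<in> carrier R) ==> (!!i. i < n ==> q i \<in> carrier R) ==> (!!i. i < n ==> x i \<in> carrier M) ==>
  lin M x n (%i. r i \<oplus> q i) = lin M x n r \<oplus>\<^bsub>M\<^esub> lin M x n q"
proof (induction n)
 case (Suc n)
 have "lin M x n r \<in> carrier M" "lin M x n q \<in> carrier M" using Suc by auto
 then show ?case using Suc by (simp add: smult_l_distr smult_closed M.a_ac)
qed simp

lemma lin_smult_left:
 "a \<in> carrier R ==> (!!i. i < n ==> r i \<in> carrier R) ==> (!!i. i < n ==> x i \<in> carrier M) ==>
  lin M x n (%i. a \<otimes> r i) = a \<odot>\<^bsub>M\<^esub> lin M x n r"
proof (induction n)
 case (Suc n)
 have "lin M x n r \<in> carrier M" using Suc by auto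
 then show ?case using Suc by (simp add: smult_assoc smult_closed smult_r_distr)
qed simp

lemma lin_add_right:
 "(!!i. i < n ==> r i \<in> carrier R) ==> (!!i. i < n ==> y i \<in> carrier M) ==> (!!i. i < n ==> x i \<in> carrier M) ==>
  lin M (%i. x i \<oplus>\<^bsub>M\<^esub> y i) n r = lin M x n r \<oplus>\<^bsub>M\<^esub> lin M y n r"
proof (induction n)
 case (Suc n)
 have "lin M x n r \<in> carrier M" "lin M y n r \<in> carrier M" using Suc by auto
 then show ?case using Suc by (simp add: smult_r_distr smult_closed M.a_ac)
qed simp

lemma lin_minus_right:
 "(!!i. i < n ==> r i \<in> carrier R) ==> (!!i. i < n ==> x i \<in> carrier M) ==>
  lin M (%i. \<ominus>\<^bsub>M\<^esub> x i) n r = \<ominus>\<^bsub>M\<^esub> lin M x n r"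
proof (induction n)
 case (Suc n)
 have "lin M x n r \<in> carrier M" using Suc by auto
 then show ?case using Suc by (simp add: smult_minus_right smult_closed M.minus_add)
qed (simp add: M.minus_equality[of "\<zero>\<^bsub>M\<^esub>" "\<zero>\<^bsub>M\<^esub>"])

text \<open>A scalar passes the coefficients if it commutes with them. This serves for signs and for
  scalars from the ground field.\<close>

lemma lin_central_right:
 "s \<in> carrier R ==> (!!r. r \<in> carrier R ==> r \<otimes> s = s \<otimes> r) ==>
  (!!i. i < n ==> r i \<in> carrier R) ==> (!!i. i < n ==> x i \<in> carrier M) ==>
  lin M (%i. s \<odot>\<^bsub>M\<^esub> x i) n r = s \<odot>\<^bsub>M\<^esub> lin M x n r"
proof (induction n)
 case (Suc n)
 have "lin M x n r \<in> carrier M" using Suc by auto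
 moreover have "r n \<odot>\<^bsub>M\<^esub> (s \<odot>\<^bsub>M\<^esub> x n) = s \<odot>\<^bsub>M\<^esub> (r n \<odot>\<^bsub>M\<^esub> x n)"
  using Suc(2-) by (simp add: smult_assoc[symmetric])
 ultimately show ?case using Suc by (simp add: smult_closed smult_r_distr)
qed simp

lemma lin_hom:
 assumes "\<phi> \<zero>\<^bsub>M\<^esub> = \<zero>\<^bsub>N\<^esub>"
  "!!x y. x \<in> carrier M ==> y \<in> carrier M ==> \<phi> (x \<oplus>\<^bsub>M\<^esub> y) = \<phi> x \<oplus>\<^bsub>N\<^esub> \<phi> y"
  "!!a x. a \<in> carrier R ==> x \<in> carrier M ==> \<phi> (a \<odot>\<^bsub>M\<^esub> x) = a \<odot>\<^bsub>N\<^esub> \<phi> x"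
 shows "(!!i. i < n ==> r i \<in> carrier R) ==> (!!i. i < n ==> x i \<in> carrier M) ==>
  \<phi> (lin M x n r) = lin N (%i. \<phi> (x i)) n r"
proof (induction n)
 case (Suc n)
 have "lin M x n r \<in> carrier M" using Suc by auto
 then show ?case using Suc assms by (simp add: smult_closed)
qed (simp add: assms)

lemma lin_trunc:
 assumes "n \<le> n'" "!!i. n \<le> i ==> i < n' ==> r i \<odot>\<^bsub>M\<^esub> x i = \<zero>\<^bsub>M\<^esub>"
  "!!i. i < n ==> r i \<in> carrier R" "!!i. i < n ==> x i \<in> carrier M"
 shows "lin M x n' r = lin M x n r"
 using assms(1,2)
proof (induction n')
 case (Suc m)
 show ?case
 proof (cases "n = Suc m")
  case False
  then have "lin M x m r = lin M x n r" using Suc by auto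
  moreover have "lin M x n r \<in> carrier M" using assms(3,4) by auto
  ultimately show ?thesis using Suc False by simp
 qed simp
qed simp

lemma lin_single:
 assumes "g < n" "a \<in> carrier R" "!!i. i < n ==> x i \<in> carrier M"
 shows "lin M x n (%i. if i = g then a else \<zero>) = a \<odot>\<^bsub>M\<^esub> x g"
 using assms(1,3)
proof (induction n)
 case (Suc n)
 show ?case
 proof (cases "g = n")
  case True
  have "lin M x n (%i. if i = g then a else \<zero>) = \<zero>\<^bsub>M\<^esub>" using True Suc by (intro lin_zero) auto
  then show ?thesis using True Suc assms(2) by (simp add: smult_closed)
 next
  case False
  then show ?thesis using Suc assms(2) by (simp add: smult_closed)
 qed
qed simp

lemma left_module_submodule:
 assumes C: "C \<subseteq> carrier M" "\<zero>\<^bsub>M\<^esub> \<in> C" "!!x y. x \<in> C ==> y \<in> C ==> x \<oplus>\<^bsub>M\<^esub> y \<in> C"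
  "!!a x. a \<in> carrier R ==> x \<in> C ==> a \<odot>\<^bsub>M\<^esub> x \<in> C"
 shows "left_module R (M\<lparr>carrier := C\<rparr>)"
proof -
 have m: "(\<ominus> \<one>) \<odot>\<^bsub>M\<^esub> x \<oplus>\<^bsub>M\<^esub> x = \<zero>\<^bsub>M\<^esub>" if "x \<in> C" for x
  using that C(1) by (auto simp: smult_minus_left smult_one M.l_neg)
 have "abelian_group (M\<lparr>carrier := C\<rparr>)"
 proof (intro abelian_groupI)
  fix x assume "x \<in> carrier (M\<lparr>carrier := C\<rparr>)"
  then show "\<exists>y\<in>carrier (M\<lparr>carrier := C\<rparr>). y \<oplus>\<^bsub>M\<lparr>carrier := C\<rparr>\<^esub> x = \<zero>\<^bsub>M\<lparr>carrier := C\<rparr>\<^esub>"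
   using C m by (intro bexI[of _ "(\<ominus> \<one>) \<odot>\<^bsub>M\<^esub> x"]) auto
 qed (use C in \<open>auto simp: M.a_ac subset_eq\<close>)
 then show ?thesis
  using C by (intro left_moduleI) (auto simp: smult_l_distr smult_r_distr smult_assoc smult_one subset_eq
    intro: R.ring_axioms)
qed

end

text \<open>All sequences in \<open>R\<close>, as one ambient module for semi-free complexes with
  any number of generators; the modules in use are cut out by \<open>sf_carrier\<close>.\<close>

definition fmod :: "'a ring => ('a, nat => 'a) module" where
 "fmod R = \<lparr>carrier = {r. \<forall>i. r i \<in> carrier R}, monoid.mult = (%x y. undefined), one = undefined,
   zero = (%i. \<zero>\<^bsub>R\<^esub>), add = (%r q i. r i \<oplus>\<^bsub>R\<^esub> q i), smult = (%a r i. a \<otimes>\<^bsub>R\<^esub> r i)\<rparr>"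

lemma fmod_simps [simp]:
 fixes R :: "'a ring"
 shows
 "r \<in> carrier (fmod R) \<longleftrightarrow> (\<forall>i. r i \<in> carrier R)"
 "\<zero>\<^bsub>fmod R\<^esub> = (%i. \<zero>\<^bsub>R\<^esub>)"
 "r \<oplus>\<^bsub>fmod R\<^esub> q = (%i. r i \<oplus>\<^bsub>R\<^esub> q i)"
 "a \<odot>\<^bsub>fmod R\<^esub> r = (%i. a \<otimes>\<^bsub>R\<^esub> r i)"
 unfolding fmod_def by auto

lemma left_module_fmod:
 fixes R :: "'a ring" (structure)
 assumes "ring R" shows "left_module R (fmod R)"
proof -
 interpret ring R by fact
 have "abelian_group (fmod R)"
 proof (rule abelian_groupI)
  fix x assume "x \<in> carrier (fmod R)"
  then show "\<exists>y\<in>carrier (fmod R). y \<oplus>\<^bsub>fmod R\<^esub> x = \<zero>\<^bsub>fmod R\<^esub>"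
   by (intro bexI[of _ "%i. \<ominus> x i"]) (auto simp: l_neg)
 qed (auto simp: a_ac)
 then show ?thesis by (intro left_moduleI) (auto simp: l_distr r_distr m_assoc ring_axioms)
qed

record 'a semifree =
 gens :: nat
 vtx :: "nat => 'a"
 degr :: "nat => int"
 att :: "nat => nat => 'a"

text \<open>\<open>r i \<otimes> vtx S i = r i\<close> says that \<open>r i\<close> lies in the left
  ideal generated by the idempotent, so the module is a sum of projectives \<open>R e\<close>. The
  bound \<open>n\<close> is separate from \<open>gens S\<close>, which lets
  \<open>is_semifree\<close> ask that a differential involve earlier generators only.\<close>

definition sf_carrier :: "'a ring => 'a semifree => nat => int => (nat => 'a) set" where
 "sf_carrier R S n k = {r. \<forall>i. if i < n & degr S i = k then r i \<in> carrier R & r i \<otimes>\<^bsub>R\<^esub> vtx S i = r i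
   else r i = \<zero>\<^bsub>R\<^esub>}"

text \<open>
 The complex of left modules freely generated by elements \<open>x\<^sub>0, x\<^sub>1, \<dots>\<close> with \<open>x\<^sub>g\<close> in degree \<open>degr g\<close>,
 subject to \<open>vtx g x\<^sub>g = x\<^sub>g\<close>, with differential \<open>d x\<^sub>g = \<Sum>\<^sub>i att g i x\<^sub>i\<close>; \<open>r\<close> stands for \<open>\<Sum>\<^sub>i r i x\<^sub>i\<close>.
\<close>

definition sf_complex :: "'a ring => 'a semifree => ('a, nat => 'a) cochain" where
 "sf_complex R S =
  \<lparr>cterm = (%k. (fmod R)\<lparr>carrier := sf_carrier R S (gens S) k\<rparr>),
   cdiff = (%k. \<lambda>r\<in>sf_carrier R S (gens S) k. lin (fmod R) (att S) (gens S) r)\<rparr>"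

text \<open>The bound \<open>g\<close> in \<open>sf_carrier R S g\<close> is the cell filtration
  behind all inductions over generators. The condition on \<open>vtx S g \<otimes> att S g i\<close>
  expresses that the differential respects the relation
  \<open>vtx g x\<^sub>g = x\<^sub>g\<close>.\<close>

definition is_semifree :: "'a ring => 'a semifree => bool" where
 "is_semifree R S \<longleftrightarrow> (\<forall>g<gens S. vtx S g \<in> carrier R & vtx S g \<otimes>\<^bsub>R\<^esub> vtx S g = vtx S g &
   att S g \<in> sf_carrier R S g (degr S g + 1) & (\<forall>i. vtx S g \<otimes>\<^bsub>R\<^esub> att S g i = att S g i) &
   lin (fmod R) (att S) (gens S) (att S g) = (%i. \<zero>\<^bsub>R\<^esub>))"

locale semifree = ring R for R :: "'a ring" (structure) +
 fixes S :: "'a semifree"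
 assumes is_semifree: "is_semifree R S"
begin

abbreviation "N \<equiv> gens S"
abbreviation "F \<equiv> fmod R"
abbreviation "dif \<equiv> lin F (att S) N"
abbreviation "P k \<equiv> sf_carrier R S N k"

sublocale F: left_module R F by (intro left_module_fmod ring_axioms)

lemma vtx: "g < N ==> vtx S g \<in> carrier R" "g < N ==> vtx S g \<otimes> vtx S g = vtx S g"
 using is_semifree unfolding is_semifree_def by auto

lemma att_sf: "g < N ==> att S g \<in> sf_carrier R S g (degr S g + 1)"
 using is_semifree unfolding is_semifree_def by auto

lemma vtx_att: "g < N ==> vtx S g \<otimes> att S g i = att S g i"
 using is_semifree unfolding is_semifree_def by auto

lemma sf_closed: "r \<in> sf_carrier R S n k ==> r i \<in> carrier R"
 unfolding sf_carrier_def by (auto split: if_splits dest: spec[of _ i])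

lemma sf_zero: "r \<in> sf_carrier R S n k ==> \<not> (i < n & degr S i = k) ==> r i = \<zero>"
 unfolding sf_carrier_def by (auto split: if_splits dest: spec[of _ i])

lemma att_closed [simp]: "g < N ==> att S g i \<in> carrier R"
 using att_sf sf_closed by blast

lemma att_zero: "g < N ==> \<not> (i < g & degr S i = degr S g + 1) ==> att S g i = \<zero>"
 using att_sf sf_zero by blast

lemma sf_mono: "r \<in> sf_carrier R S n k ==> n \<le> m ==> m \<le> N ==> r \<in> sf_carrier R S m k"
proof -
 assume a: "r \<in> sf_carrier R S n k" "n \<le> m" "m \<le> N"
 show "r \<in> sf_carrier R S m k"
  unfolding sf_carrier_def mem_Collect_eq
 proof
  fix i
  show "if i < m & degr S i = k then r i \<in> carrier R & r i \<otimes> vtx S i = r i else r i = \<zero>"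
  proof (cases "i < n & degr S i = k")
   case True then show ?thesis using a unfolding sf_carrier_def by auto
  next
   case False then have "r i = \<zero>" using sf_zero a by blast
   then show ?thesis using a(3) vtx(1)[of i] by auto
  qed
 qed
qed

lemma sf_0: "(%i. \<zero>) \<in> sf_carrier R S n k" if "n \<le> N"
 using that vtx unfolding sf_carrier_def by auto

lemma sf_add:
 assumes "n \<le> N" "r \<in> sf_carrier R S n k" "q \<in> sf_carrier R S n k"
 shows "(%i. r i \<oplus> q i) \<in> sf_carrier R S n k"
 unfolding sf_carrier_def mem_Collect_eq
proof
 fix i
 have "if i < n & degr S i = k then r i \<in> carrier R & r i \<otimes> vtx S i = r i else r i = \<zero>"
  "if i < n & degr S i = k then q i \<in> carrier R & q i \<otimes> vtx S i = q i else q i = \<zero>"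
  using assms(2,3) unfolding sf_carrier_def by blast+
 then show "if i < n & degr S i = k then r i \<oplus> q i \<in> carrier R & (r i \<oplus> q i) \<otimes> vtx S i = r i \<oplus> q i
  else r i \<oplus> q i = \<zero>" using vtx(1)[of i] assms(1) by (auto simp: l_distr)
qed

lemma sf_smult:
 assumes "n \<le> N" "r \<in> sf_carrier R S n k" "a \<in> carrier R"
 shows "(%i. a \<otimes> r i) \<in> sf_carrier R S n k"
 unfolding sf_carrier_def mem_Collect_eq
proof
 fix i
 have "if i < n & degr S i = k then r i \<in> carrier R & r i \<otimes> vtx S i = r i else r i = \<zero>"
  using assms(2) unfolding sf_carrier_def by blast+
 then show "if i < n & degr S i = k then a \<otimes> r i \<in> carrier R & (a \<otimes> r i) \<otimes> vtx S i = a \<otimes> r i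
  else a \<otimes> r i = \<zero>" using vtx(1)[of i] assms(1,3) by (auto simp: m_assoc)
qed

lemma lin_att_sf:
 assumes r: "r \<in> P k"
 shows "dif r \<in> P (k + 1)"
proof -
 have "lin F (att S) n r \<in> P (k + 1)" if "n \<le> N" for n
  using that
 proof (induction n)
  case 0 then show ?case using sf_0 by simp
 next
  case (Suc n)
  have "(%i. r n \<otimes> att S n i) \<in> P (k + 1)"
  proof (cases "degr S n = k")
   case True
   have "att S n \<in> P (k + 1)" using sf_mono[OF att_sf[of n]] Suc True by simp
   then show ?thesis using sf_smult sf_closed[OF r] by blast
  next
   case False
   then have "r n = \<zero>" using sf_zero[OF r] by blast
   then have "(%i. r n \<otimes> att S n i) = (%i. \<zero>)" using att_closed[of n] Suc by auto
   then show ?thesis using sf_0 by simp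
  qed
  then show ?case using Suc sf_add by simp
 qed
 then show ?thesis by simp
qed

lemma att_F [simp]: "g < N ==> att S g \<in> carrier F" by simp

text \<open>Both sides are linear in \<open>r\<close> and agree on basis vectors: evaluating a map
  on a differential is combining its values on the differentials of the generators. Together with
  \<open>att_att\<close> this makes iterated evaluations vanish.\<close>

lemma lin_lin:
 assumes M: "left_module R M" and x: "!!i. i < N ==> x i \<in> carrier M" and n: "n \<le> N"
  and r: "!!i. r i \<in> carrier R"
 shows "lin M x N (lin F (att S) n r) = lin M (%g. lin M x N (att S g)) n r"
proof -
 interpret M: left_module R M by fact
 show ?thesis
 proof (rule F.lin_hom)
  show "lin M x N \<zero>\<^bsub>F\<^esub> = \<zero>\<^bsub>M\<^esub>" using x by (intro M.lin_zero) simp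
  show "lin M x N (r \<oplus>\<^bsub>F\<^esub> q) = lin M x N r \<oplus>\<^bsub>M\<^esub> lin M x N q" if "r \<in> carrier F" "q \<in> carrier F" for r q
   using that x by (simp add: M.lin_add_left)
  show "lin M x N (a \<odot>\<^bsub>F\<^esub> r) = a \<odot>\<^bsub>M\<^esub> lin M x N r" if "a \<in> carrier R" "r \<in> carrier F" for a r
   using that x by (simp add: M.lin_smult_left)
 qed (use n r in auto)
qed

lemma att_att: "g < N ==> dif (att S g) = \<zero>\<^bsub>F\<^esub>"
 using is_semifree unfolding is_semifree_def by simp

lemma d_d_zero:
 assumes r: "!!i. r i \<in> carrier R"
 shows "dif (dif r) = \<zero>\<^bsub>F\<^esub>"
proof -
 have "dif (dif r) = lin F (%g. dif (att S g)) N r"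
  using r by (intro lin_lin F.left_module_axioms) auto
 also have "\<dots> = \<zero>\<^bsub>F\<^esub>" using r by (intro F.lin_zero) (simp add: att_att)
 finally show ?thesis .
qed

lemma sf_subset: "sf_carrier R S n k \<subseteq> carrier F"
 using sf_closed by auto

lemma sf_cterm: "ct (sf_complex R S) k = F\<lparr>carrier := P k\<rparr>"
 unfolding sf_complex_def by simp

lemma sf_cdiff: "r \<in> P k ==> cd (sf_complex R S) k r = dif r"
 unfolding sf_complex_def by simp

lemma pre_complex_sf: "pre_complex R (sf_complex R S)"
 unfolding pre_complex_def
proof (intro allI conjI ballI)
 fix k
 show "left_module R (ct (sf_complex R S) k)"
  unfolding sf_cterm using sf_subset sf_0 sf_add sf_smult
  by (intro F.left_module_submodule) auto
 show "cd (sf_complex R S) k \<in> module_hom R (ct (sf_complex R S) k) (ct (sf_complex R S) (k + 1))"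
  unfolding sf_cterm
 proof (rule module_homI, goal_cases)
  case 1 show ?case unfolding sf_complex_def by simp
 next
  case (2 r) then show ?case using lin_att_sf by (simp add: sf_cdiff)
 next
  case (3 r q)
  then have "r \<in> P k" "q \<in> P k" "(%i. r i \<oplus> q i) \<in> P k" using sf_add by auto
  then show ?case using F.lin_add_left[of N r q "att S"] sf_closed by (simp add: sf_cdiff)
 next
  case (4 a r)
  then have "r \<in> P k" "(%i. a \<otimes> r i) \<in> P k" using sf_smult by auto
  then show ?case using F.lin_smult_left[of a N r "att S"] sf_closed 4 by (simp add: sf_cdiff)
 qed
 fix r assume "r \<in> car (sf_complex R S) k"
 then have "r \<in> P k" by (simp add: sf_cterm)
 then show "cd (sf_complex R S) (k + 1) (cd (sf_complex R S) k r) = (zc (sf_complex R S) (k + 1 + 1))"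
  using d_d_zero sf_closed lin_att_sf by (simp add: sf_cdiff sf_cterm)
qed

end

text \<open>The value at \<open>r\<close> of the graded linear map with images \<open>u\<close> of
  the generators. These images lie in different modules of \<open>Z\<close>, so those of generators
  outside degree \<open>k\<close> are replaced by zero and the sum makes sense in degree
  \<open>j\<close>.\<close>

definition ev ::
 "('a, 'm) cochain => 'a semifree => (nat => 'm) => nat => int => int => (nat => 'a) => 'm" where
 "ev Z S u n k j r = lin (ct Z j) (%i. if degr S i = k then u i else (zc Z j)) n r"

context semifree
begin

lemma ev_att_trunc:
 assumes Z: "pre_complex R Z" and g: "g < N" "g \<le> n" "n \<le> N"
  and u: "!!i. i < n ==> degr S i = degr S g + 1 ==> u i \<in> car Z j"
 shows "ev Z S u n (degr S g + 1) j (att S g) = ev Z S u g (degr S g + 1) j (att S g)"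
proof -
 interpret Z: complex R Z by (rule complex.intro[OF Z])
 interpret M: left_module R "ct Z j" by (rule Z.lm)
 show ?thesis unfolding ev_def
  using g u by (intro M.lin_trunc) (auto simp: att_zero)
qed

text \<open>\<open>v\<close> is a cocycle of degree \<open>m\<close> in the Hom complex and
  \<open>s\<close> is the central sign in its differential. A primitive \<open>u\<close> is built
  generator by generator: given its values below \<open>n\<close>, the element
  \<open>v n - s u(d x_n)\<close> is a cocycle of \<open>Z\<close> and so has a preimage. Only
  earlier generators occur in \<open>d x_n\<close>, hence later choices do not disturb earlier
  ones.\<close>

lemma Hom_acyclic:
 assumes Z: "pre_complex R Z" and acyc: "acyclic_complex Z"
  and s: "s \<in> carrier R" "!!r. r \<in> carrier R ==> r \<otimes> s = s \<otimes> r" "s \<otimes> s = \<one>"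
  and v: "!!g. g < N ==> v g \<in> car Z (degr S g + m)"
   "!!g. g < N ==> vtx S g \<odot>\<^bsub>ct Z (degr S g + m)\<^esub> v g = v g"
   "!!g. g < N ==> cd Z (degr S g + m) (v g) =
    s \<odot>\<^bsub>ct Z (degr S g + m + 1)\<^esub> ev Z S v N (degr S g + 1) (degr S g + m + 1) (att S g)"
 shows "\<exists>u. \<forall>g<N. u g \<in> car Z (degr S g + m - 1) &
  vtx S g \<odot>\<^bsub>ct Z (degr S g + m - 1)\<^esub> u g = u g &
  v g = cd Z (degr S g + m - 1) (u g) \<oplus>\<^bsub>ct Z (degr S g + m)\<^esub>
   s \<odot>\<^bsub>ct Z (degr S g + m)\<^esub> ev Z S u N (degr S g + 1) (degr S g + m) (att S g)"
proof -
 interpret Z: complex R Z by (rule complex.intro[OF Z])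
 let ?ok = "%u g. u g \<in> car Z (degr S g + m - 1) &
  vtx S g \<odot>\<^bsub>ct Z (degr S g + m - 1)\<^esub> u g = u g &
  v g = cd Z (degr S g + m - 1) (u g) \<oplus>\<^bsub>ct Z (degr S g + m)\<^esub>
   s \<odot>\<^bsub>ct Z (degr S g + m)\<^esub> ev Z S u g (degr S g + 1) (degr S g + m) (att S g)"
 have "\<exists>u. \<forall>g<n. ?ok u g" if "n \<le> N" for n
  using that
 proof (induction n)
  case (Suc n)
  then obtain u0 where u0: "\<forall>g<n. ?ok u0 g" by auto
  have n: "n < N" using Suc by simp
  obtain T where T_def: "T = degr S n + m" by simp
  interpret M0: left_module R "ct Z (T - 1)" by (rule Z.lm)
  interpret M: left_module R "ct Z T" by (rule Z.lm)
  interpret M1: left_module R "ct Z (T + 1)" by (rule Z.lm)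
  define E where "E = ev Z S u0 n (degr S n + 1) T (att S n)"
  define V where "V = ev Z S v n (degr S n + 1) (T + 1) (att S n)"
  \<comment> \<open>The values of \<open>u0\<close> on generators two degrees above generator
    \<open>n\<close>, those that occur when the differential is applied to it twice. Extended by
    zero they define a linear map to which \<open>att_att\<close> applies.\<close>
  define x where "x j = (if j < n & degr S j = degr S n + 2 then u0 j else (zc Z (T + 1)))" for j
  have u0c: "u0 i \<in> car Z j" if "i < n" "j = degr S i + m - 1" for i j
   using u0 that by blast
  have u0T: "u0 i \<in> car Z T" if "i < n" "degr S i = degr S n + 1" for i
   using u0c[OF that(1), of T] that(2) T_def by simp
  have xc: "x j \<in> car Z (T + 1)" for j
   using u0c[of j "T + 1"] M1.M.zero_closed unfolding x_def by (simp add: T_def)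
  have vc: "v i \<in> car Z (T + 1)" if "i < N" "degr S i = degr S n + 1" for i
   using v(1)[OF that(1)] that(2) unfolding T_def by (simp add: algebra_simps)
  have E: "E \<in> car Z T"
   unfolding E_def ev_def using n u0T by (intro M.lin_closed) auto
  have V: "V \<in> car Z (T + 1)"
   unfolding V_def ev_def using n vc by (intro M1.lin_closed) auto
  have "lin (ct Z (T + 1)) (%g. lin (ct Z (T + 1)) x N (att S g)) n (att S n) =
   lin (ct Z (T + 1)) x N (lin F (att S) n (att S n))"
   using n xc by (intro lin_lin[symmetric] M1.left_module_axioms) auto
  also have "lin F (att S) n (att S n) = dif (att S n)"
   using n by (intro F.lin_trunc[symmetric]) (auto simp: att_zero)
  also have "lin (ct Z (T + 1)) x N (dif (att S n)) = (zc Z (T + 1))"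
   unfolding att_att[OF n] using xc by (intro M1.lin_zero) simp
  finally have zero: "lin (ct Z (T + 1)) (%g. lin (ct Z (T + 1)) x N (att S g)) n (att S n) =
   (zc Z (T + 1))" .
  have lc: "lin (ct Z (T + 1)) x N (att S i) \<in> car Z (T + 1)" if "i < n" for i
   using that n xc by (intro M1.lin_closed) auto
  have Du0: "cd Z T (u0 i) = v i \<oplus>\<^bsub>ct Z (T + 1)\<^esub>
   (\<ominus>\<^bsub>ct Z (T + 1)\<^esub> (s \<odot>\<^bsub>ct Z (T + 1)\<^esub> lin (ct Z (T + 1)) x N (att S i)))"
   if i: "i < n" "degr S i = degr S n + 1" for i
  proof -
   have T: "degr S i + m - 1 = T" "degr S i + m = T + 1" "degr S i + 1 = degr S n + 2" using i T_def by auto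
   have "lin (ct Z (T + 1)) x N (att S i) = lin (ct Z (T + 1)) x i (att S i)"
    using i n xc by (intro M1.lin_trunc) (auto simp: att_zero)
   also have "\<dots> = ev Z S u0 i (degr S i + 1) (T + 1) (att S i)"
    unfolding ev_def T x_def using i by (intro M1.lin_cong) auto
   finally have "v i = cd Z T (u0 i) \<oplus>\<^bsub>ct Z (T + 1)\<^esub>
    s \<odot>\<^bsub>ct Z (T + 1)\<^esub> lin (ct Z (T + 1)) x N (att S i)"
    using u0 i(1) T by (metis (no_types, lifting))
   moreover have "cd Z T (u0 i) \<in> car Z (T + 1)"
    using Z.d_closed[OF u0c[OF i(1)], of T "T + 1"] T by simp
   ultimately show ?thesis
    using lc[OF i(1)] s(1) by (simp add: M1.smult_closed M1.M.a_assoc M1.M.r_neg)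
  qed
  have "cd Z T E = lin (ct Z (T + 1))
    (%i. cd Z T (if degr S i = degr S n + 1 then u0 i else (zc Z T))) n (att S n)"
   unfolding E_def ev_def using n u0T
   by (intro M.lin_hom Z.d_zero Z.d_add Z.d_smult) auto
  also have "\<dots> = lin (ct Z (T + 1)) (%i. (if degr S i = degr S n + 1 then v i else (zc Z (T + 1)))
   \<oplus>\<^bsub>ct Z (T + 1)\<^esub> (\<ominus>\<^bsub>ct Z (T + 1)\<^esub> (s \<odot>\<^bsub>ct Z (T + 1)\<^esub> lin (ct Z (T + 1)) x N (att S i)))) n (att S n)"
  proof (rule M1.lin_cong, goal_cases)
   case (1 i)
   show ?case
   proof (cases "degr S i = degr S n + 1")
    case True then show ?thesis using Du0[OF 1] by simp
   next
    case False
    then have "att S n i = \<zero>" using att_zero[OF n] by blast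
    then show ?thesis using False lc[OF 1] s(1) by (simp add: Z.d_zero M1.smult_closed)
   qed
  qed
  also have "\<dots> = V \<oplus>\<^bsub>ct Z (T + 1)\<^esub> lin (ct Z (T + 1))
    (%i. \<ominus>\<^bsub>ct Z (T + 1)\<^esub> (s \<odot>\<^bsub>ct Z (T + 1)\<^esub> lin (ct Z (T + 1)) x N (att S i))) n (att S n)"
   unfolding V_def ev_def using n vc lc s(1) by (intro M1.lin_add_right) (auto intro: M1.smult_closed)
  also have "\<dots> = V"
  proof -
   have "lin (ct Z (T + 1)) (%i. \<ominus>\<^bsub>ct Z (T + 1)\<^esub> (s \<odot>\<^bsub>ct Z (T + 1)\<^esub>
     lin (ct Z (T + 1)) x N (att S i))) n (att S n) =
    \<ominus>\<^bsub>ct Z (T + 1)\<^esub> lin (ct Z (T + 1)) (%i. s \<odot>\<^bsub>ct Z (T + 1)\<^esub>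
     lin (ct Z (T + 1)) x N (att S i)) n (att S n)"
    using n lc s(1) by (intro M1.lin_minus_right M1.smult_closed) auto
   also have "lin (ct Z (T + 1)) (%i. s \<odot>\<^bsub>ct Z (T + 1)\<^esub>
     lin (ct Z (T + 1)) x N (att S i)) n (att S n) = s \<odot>\<^bsub>ct Z (T + 1)\<^esub> (zc Z (T + 1))"
    unfolding zero[symmetric] using n lc s(1,2) by (intro M1.lin_central_right) auto
   finally show ?thesis using s(1) V by simp
  qed
  finally have DE: "cd Z T E = V" .
  have Dv: "cd Z T (v n) = s \<odot>\<^bsub>ct Z (T + 1)\<^esub> V"
   using v(3)[OF n] ev_att_trunc[OF Z n, of N v "T + 1"] n vc unfolding V_def T_def by simp
  \<comment> \<open>The obstruction to extending \<open>u0\<close> over generator \<open>n\<close>;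
    it is a cocycle because \<open>cd Z T E = V\<close>.\<close>
  define W where "W = v n \<oplus>\<^bsub>ct Z T\<^esub> (\<ominus>\<^bsub>ct Z T\<^esub> (s \<odot>\<^bsub>ct Z T\<^esub> E))"
  have vn: "v n \<in> car Z T" using v(1)[OF n] unfolding T_def .
  have sE: "s \<odot>\<^bsub>ct Z T\<^esub> E \<in> car Z T" using E s(1) by (rule M.smult_closed[rotated])
  have Wc: "W \<in> car Z T" unfolding W_def using vn sE by simp
  have "cd Z T W = (zc Z (T + 1))"
   unfolding W_def using vn sE E s(1) V Dv DE
   by (simp add: Z.d_add[of _ _ _ "T + 1"] Z.d_minus[of _ _ "T + 1"] Z.d_smult[of _ _ _ "T + 1"]
    M1.smult_closed M1.M.r_neg)
  then have "W \<in> coboundaries Z T" using acyc Wc unfolding acyclic_complex_def cocycles_def by blast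
  then obtain w where w: "w \<in> car Z (T - 1)" "W = cd Z (T - 1) w" unfolding coboundaries_def by blast
  have vE: "vtx S n \<odot>\<^bsub>ct Z T\<^esub> E = E"
   unfolding E_def ev_def using n u0T vtx
   by (subst M.lin_smult_left[symmetric]) (auto simp: vtx_att)
  have vW: "vtx S n \<odot>\<^bsub>ct Z T\<^esub> W = W"
  proof -
   have "vtx S n \<odot>\<^bsub>ct Z T\<^esub> (s \<odot>\<^bsub>ct Z T\<^esub> E) = s \<odot>\<^bsub>ct Z T\<^esub> (vtx S n \<odot>\<^bsub>ct Z T\<^esub> E)"
    using s(1) s(2)[OF vtx(1)[OF n]] vtx(1)[OF n] E by (simp add: M.smult_assoc[symmetric])
   then show ?thesis
    unfolding W_def using v(2)[OF n] vn sE vtx(1)[OF n] vE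
    by (simp add: M.smult_r_distr M.smult_minus_right T_def[symmetric])
  qed
  \<comment> \<open>Multiplying the primitive by the idempotent enforces the vertex condition and
    keeps the boundary, since \<open>W\<close> is itself fixed by the idempotent.\<close>
  define u where "u = u0(n := vtx S n \<odot>\<^bsub>ct Z (T - 1)\<^esub> w)"
  have ev_u: "ev Z S u g k j (att S g) = ev Z S u0 g k j (att S g)" if "g \<le> n" for g k j
  proof -
   interpret L: left_module R "ct Z j" by (rule Z.lm)
   show ?thesis unfolding ev_def u_def using that by (intro L.lin_cong) auto
  qed
  have "?ok u g" if "g < Suc n" for g
  proof (cases "g = n")
   case True
   have "v n = W \<oplus>\<^bsub>ct Z T\<^esub> s \<odot>\<^bsub>ct Z T\<^esub> E"
    unfolding W_def using vn sE by (simp add: M.M.a_assoc M.M.l_neg)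
   moreover have "cd Z (T - 1) (vtx S n \<odot>\<^bsub>ct Z (T - 1)\<^esub> w) = W"
    using Z.d_smult[OF vtx(1)[OF n] w(1), of T] w(2) vW by simp
   moreover have "vtx S n \<odot>\<^bsub>ct Z (T - 1)\<^esub> (vtx S n \<odot>\<^bsub>ct Z (T - 1)\<^esub> w) = vtx S n \<odot>\<^bsub>ct Z (T - 1)\<^esub> w"
    using vtx[OF n] w(1) by (simp add: M0.smult_assoc[symmetric])
   ultimately show ?thesis
    using True w(1) vtx(1)[OF n] ev_u[of n] E_def M0.smult_closed
    by (simp add: u_def T_def)
  next
   case False
   then have "g < n" "u g = u0 g" using that unfolding u_def by auto
   then show ?thesis using u0 ev_u[of g] by simp
  qed
  then show ?case by blast
 qed simp
 then obtain u where u: "\<forall>g<N. ?ok u g" by blast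
 have "ev Z S u N (degr S g + 1) (degr S g + m) (att S g) = ev Z S u g (degr S g + 1) (degr S g + m) (att S g)"
  if "g < N" for g
 proof (rule ev_att_trunc[OF Z that])
  fix i assume "i < N" "degr S i = degr S g + 1"
  then show "u i \<in> car Z (degr S g + m)"
   using u[rule_format, of i] by (simp add: algebra_simps)
 qed (use that in auto)
 then show ?thesis using u by metis
qed

end

section \<open>Transport of modules and complexes\<close>

text \<open>For injective \<open>\<phi>\<close> this is an isomorphic copy on another type, because
  \<open>derived_equivalent\<close> fixes the type of module elements.\<close>

definition tr_module :: "('m => 'n) => ('a, 'm) module => ('a, 'n) module" where
 "tr_module \<phi> M = \<lparr>carrier = \<phi> ` carrier M, monoid.mult = (%x y. undefined), one = undefined,
   zero = \<phi> \<zero>\<^bsub>M\<^esub>, add = (%x y. \<phi> (inv_into UNIV \<phi> x \<oplus>\<^bsub>M\<^esub> inv_into UNIV \<phi> y)), smult = (%a x. \<phi> (a \<odot>\<^bsub>M\<^esub> inv_into UNIV \<phi> x))\<rparr>"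

definition tr_complex :: "('m => 'n) => ('a, 'm) cochain => ('a, 'n) cochain" where
 "tr_complex \<phi> X = \<lparr>cterm = (%n. tr_module \<phi> (ct X n)),
   cdiff = (%n. \<lambda>x\<in>\<phi> ` car X n. \<phi> (cd X n (inv_into UNIV \<phi> x)))\<rparr>"

lemma tr_module_simps:
 assumes "inj \<phi>"
 shows "carrier (tr_module \<phi> M) = \<phi> ` carrier M" "\<zero>\<^bsub>tr_module \<phi> M\<^esub> = \<phi> \<zero>\<^bsub>M\<^esub>"
  "\<phi> x \<oplus>\<^bsub>tr_module \<phi> M\<^esub> \<phi> y = \<phi> (x \<oplus>\<^bsub>M\<^esub> y)" "a \<odot>\<^bsub>tr_module \<phi> M\<^esub> \<phi> x = \<phi> (a \<odot>\<^bsub>M\<^esub> x)"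
 using assms by (simp_all add: tr_module_def)

lemma left_module_tr:
 assumes \<phi>: "inj \<phi>" and M: "left_module R M"
 shows "left_module R (tr_module \<phi> M)"
proof -
 interpret M: left_module R M by fact
 note s = tr_module_simps[OF \<phi>, of M]
 have "abelian_group (tr_module \<phi> M)"
 proof (rule abelian_groupI)
  fix x assume "x \<in> carrier (tr_module \<phi> M)"
  then obtain y where "y \<in> carrier M" "x = \<phi> y" using s by blast
  then show "\<exists>y\<in>carrier (tr_module \<phi> M). y \<oplus>\<^bsub>tr_module \<phi> M\<^esub> x = \<zero>\<^bsub>tr_module \<phi> M\<^esub>"
   by (intro bexI[of _ "\<phi> (\<ominus>\<^bsub>M\<^esub> y)"]) (simp_all add: s M.l_neg)
 qed (auto simp: s M.a_ac)
 then show ?thesis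
  by (intro left_moduleI)
   (auto simp: s M.smult_closed M.smult_l_distr M.smult_r_distr M.smult_assoc M.smult_one intro: M.R.ring_axioms)
qed

lemma pre_complex_tr:
 assumes \<phi>: "inj \<phi>" and X: "pre_complex R X"
 shows "pre_complex R (tr_complex \<phi> X)"
proof -
 interpret X: complex R X by (rule complex.intro[OF X])
 note s = tr_module_simps[OF \<phi>]
 have t: "ct (tr_complex \<phi> X) n = tr_module \<phi> (ct X n)" for n unfolding tr_complex_def by simp
 have d: "cd (tr_complex \<phi> X) n (\<phi> x) = \<phi> (cd X n x)" if "x \<in> car X n" for n x
  using that \<phi> unfolding tr_complex_def by simp
 have "cd (tr_complex \<phi> X) n \<in> module_hom R (ct (tr_complex \<phi> X) n) (ct (tr_complex \<phi> X) (n + 1))" for n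
 proof -
  interpret M: left_module R "ct X n" by (rule X.lm)
  show ?thesis
  proof (rule module_homI, goal_cases)
   case 1 show ?case unfolding tr_complex_def by (simp add: s)
  qed (auto simp: t s d X.d_closed X.d_add[of _ _ _ "n + 1"] X.d_smult[of _ _ _ "n + 1"] M.smult_closed)
 qed
 then show ?thesis
  unfolding pre_complex_def using left_module_tr[OF \<phi> X.lm]
  by (auto simp: t s d X.d_closed X.d_d[of _ _ "_ + 1" "_ + 1 + 1"])
qed

text \<open>\<open>fin_gen\<close> speaks of a finite set and of \<open>finsum\<close>; an indexed
  family fits the recursion of \<open>lin\<close> and may repeat elements.\<close>

lemma (in left_module) fin_gen_iff:
 "fin_gen R M \<longleftrightarrow> (\<exists>x n. (\<forall>i<n. x i \<in> carrier M) &
   (\<forall>y\<in>carrier M. \<exists>r. (\<forall>i<n. r i \<in> carrier R) & y = lin M x n r))"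
proof
 assume "fin_gen R M"
 then obtain A where A: "finite A" "A \<subseteq> carrier M"
  "\<forall>y\<in>carrier M. \<exists>c\<in>A \<rightarrow> carrier R. y = (\<Oplus>\<^bsub>M\<^esub>s\<in>A. c s \<odot>\<^bsub>M\<^esub> s)" unfolding fin_gen_def by blast
 have "\<exists>x n. (\<forall>i<n. x i \<in> A) & (\<forall>c\<in>A \<rightarrow> carrier R. (\<Oplus>\<^bsub>M\<^esub>s\<in>A. c s \<odot>\<^bsub>M\<^esub> s) = lin M x n (%i. c (x i)))"
  using A(1,2)
 proof (induction A rule: finite_induct)
  case empty then show ?case by (intro exI[of _ "%_. \<zero>\<^bsub>M\<^esub>"] exI[of _ 0]) simp
 next
  case (insert a A)
  then obtain x n where x: "\<forall>i<n. x i \<in> A"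
   "\<forall>c\<in>A \<rightarrow> carrier R. (\<Oplus>\<^bsub>M\<^esub>s\<in>A. c s \<odot>\<^bsub>M\<^esub> s) = lin M x n (%i. c (x i))" by auto
  let ?x = "x(n := a)"
  have "(\<Oplus>\<^bsub>M\<^esub>s\<in>insert a A. c s \<odot>\<^bsub>M\<^esub> s) = lin M ?x (Suc n) (%i. c (?x i))" if c: "c \<in> insert a A \<rightarrow> carrier R" for c
  proof -
   have "lin M ?x n (%i. c (?x i)) = lin M x n (%i. c (x i))" by (intro lin_cong) simp
   moreover have "c \<in> A \<rightarrow> carrier R" using c by auto
   ultimately have "lin M ?x n (%i. c (?x i)) = (\<Oplus>\<^bsub>M\<^esub>s\<in>A. c s \<odot>\<^bsub>M\<^esub> s)"
    using x(2)[rule_format, of c] by metis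
   moreover have "(%s. c s \<odot>\<^bsub>M\<^esub> s) \<in> A \<rightarrow> carrier M" "c a \<odot>\<^bsub>M\<^esub> a \<in> carrier M"
    using c insert by (auto intro!: smult_closed)
   ultimately show ?thesis using insert by (simp add: M.a_comm M.finsum_closed del: fun_upd_apply) (simp add: M.a_comm M.finsum_closed)
  qed
  then have "\<forall>c\<in>insert a A \<rightarrow> carrier R. (\<Oplus>\<^bsub>M\<^esub>s\<in>insert a A. c s \<odot>\<^bsub>M\<^esub> s) = lin M ?x (Suc n) (%i. c (?x i))"
   by blast
  moreover have "\<forall>i<Suc n. ?x i \<in> insert a A" using x(1) by simp
  ultimately show ?case by blast
 qed
 then obtain x n where x: "\<forall>i<n. x i \<in> A"
  "\<forall>c\<in>A \<rightarrow> carrier R. (\<Oplus>\<^bsub>M\<^esub>s\<in>A. c s \<odot>\<^bsub>M\<^esub> s) = lin M x n (%i. c (x i))" by blast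
 show "\<exists>x n. (\<forall>i<n. x i \<in> carrier M) &
   (\<forall>y\<in>carrier M. \<exists>r. (\<forall>i<n. r i \<in> carrier R) & y = lin M x n r)"
 proof (rule exI[of _ x], rule exI[of _ n], intro conjI ballI)
  show "\<forall>i<n. x i \<in> carrier M" using x(1) A(2) by blast
  fix y assume "y \<in> carrier M"
  then obtain c where "c \<in> A \<rightarrow> carrier R" "y = (\<Oplus>\<^bsub>M\<^esub>s\<in>A. c s \<odot>\<^bsub>M\<^esub> s)" using A(3) by blast
  then show "\<exists>r. (\<forall>i<n. r i \<in> carrier R) & y = lin M x n r"
   using x by (intro exI[of _ "%i. c (x i)"]) auto
 qed
next
 assume "\<exists>x n. (\<forall>i<n. x i \<in> carrier M) &
   (\<forall>y\<in>carrier M. \<exists>r. (\<forall>i<n. r i \<in> carrier R) & y = lin M x n r)"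
 then obtain x n where x: "\<forall>i<n. x i \<in> carrier M"
  "\<forall>y\<in>carrier M. \<exists>r. (\<forall>i<n. r i \<in> carrier R) & y = lin M x n r" by blast
 let ?S = "x ` {..<n}"
 \<comment> \<open>Since \<open>x\<close> may take a value several times, coefficients cannot be
   read off index by index; instead the set of all sums over \<open>?S\<close> is shown to contain
   zero and the multiples of each \<open>x i\<close> and to be closed under addition.\<close>
 define X where "X = {y. \<exists>c\<in>?S \<rightarrow> carrier R. y = (\<Oplus>\<^bsub>M\<^esub>s\<in>?S. c s \<odot>\<^bsub>M\<^esub> s)}"
 have S: "?S \<subseteq> carrier M" using x(1) by auto
 have cS: "(%s. c s \<odot>\<^bsub>M\<^esub> s) \<in> ?S \<rightarrow> carrier M" if "c \<in> ?S \<rightarrow> carrier R" for c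
  using that S smult_closed by blast
 have add: "y \<oplus>\<^bsub>M\<^esub> z \<in> X" if yz: "y \<in> X" "z \<in> X" for y z
 proof -
  obtain c c' where c: "c \<in> ?S \<rightarrow> carrier R" "y = (\<Oplus>\<^bsub>M\<^esub>s\<in>?S. c s \<odot>\<^bsub>M\<^esub> s)"
   and c': "c' \<in> ?S \<rightarrow> carrier R" "z = (\<Oplus>\<^bsub>M\<^esub>s\<in>?S. c' s \<odot>\<^bsub>M\<^esub> s)"
   using yz unfolding X_def by blast
  have cc: "(%s. c s \<oplus> c' s) \<in> ?S \<rightarrow> carrier R" using c(1) c'(1) by (simp add: Pi_iff)
  have "y \<oplus>\<^bsub>M\<^esub> z = (\<Oplus>\<^bsub>M\<^esub>s\<in>?S. c s \<odot>\<^bsub>M\<^esub> s \<oplus>\<^bsub>M\<^esub> c' s \<odot>\<^bsub>M\<^esub> s)"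
   unfolding c c' using M.finsum_addf[OF cS[OF c(1)] cS[OF c'(1)]] by simp
  also have "\<dots> = (\<Oplus>\<^bsub>M\<^esub>s\<in>?S. (c s \<oplus> c' s) \<odot>\<^bsub>M\<^esub> s)"
   using c(1) c'(1) S cS[OF cc] by (intro M.finsum_cong') (auto simp: smult_l_distr Pi_iff subset_eq)
  finally show ?thesis unfolding X_def by (intro CollectI bexI[OF _ cc])
 qed
 have single: "a \<odot>\<^bsub>M\<^esub> x i \<in> X" if "a \<in> carrier R" "i < n" for a i
 proof -
  let ?c = "%s. if x i = s then a else \<zero>"
  have c: "?c \<in> ?S \<rightarrow> carrier R" using that by simp
  have "(\<Oplus>\<^bsub>M\<^esub>s\<in>?S. ?c s \<odot>\<^bsub>M\<^esub> s) = (\<Oplus>\<^bsub>M\<^esub>s\<in>?S. if x i = s then a \<odot>\<^bsub>M\<^esub> s else \<zero>\<^bsub>M\<^esub>)"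
   using S that smult_closed by (intro M.finsum_cong') auto
  also have "\<dots> = a \<odot>\<^bsub>M\<^esub> x i"
   using S that smult_closed by (intro M.add.finprod_singleton[where f = "%s. a \<odot>\<^bsub>M\<^esub> s"]) auto
  finally have "a \<odot>\<^bsub>M\<^esub> x i = (\<Oplus>\<^bsub>M\<^esub>s\<in>?S. ?c s \<odot>\<^bsub>M\<^esub> s)" by (rule sym)
  then show ?thesis unfolding X_def by (intro CollectI bexI[OF _ c])
 qed
 have zero: "\<zero>\<^bsub>M\<^esub> \<in> X"
 proof -
  have "(\<Oplus>\<^bsub>M\<^esub>s\<in>?S. \<zero> \<odot>\<^bsub>M\<^esub> s) = (\<Oplus>\<^bsub>M\<^esub>s\<in>?S. \<zero>\<^bsub>M\<^esub>)"
   using S by (intro M.finsum_cong') auto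
  then show ?thesis unfolding X_def by (intro CollectI bexI[of _ "%_. \<zero>"]) auto
 qed
 have "lin M x m r \<in> X" if "m \<le> n" "\<forall>i<n. r i \<in> carrier R" for r m
  using that by (induction m) (auto simp: zero intro!: add single)
 then have "\<forall>y\<in>carrier M. y \<in> X" using x(2) by (metis order_refl)
 then show "fin_gen R M"
  unfolding fin_gen_def X_def using S by (intro exI[of _ ?S]) auto
qed

lemma fin_gen_tr:
 assumes \<phi>: "inj \<phi>" and M: "left_module R M" and fg: "fin_gen R M"
 shows "fin_gen R (tr_module \<phi> M)"
proof -
 interpret M: left_module R M by fact
 interpret T: left_module R "tr_module \<phi> M" by (rule left_module_tr[OF \<phi> M])
 obtain x n where x: "\<forall>i<n. x i \<in> carrier M"
  "\<forall>y\<in>carrier M. \<exists>r. (\<forall>i<n. r i \<in> carrier R) & y = lin M x n r" using fg unfolding M.fin_gen_iff by blast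
 have l: "\<phi> (lin M x n r) = lin (tr_module \<phi> M) (%i. \<phi> (x i)) n r" if "\<forall>i<n. r i \<in> carrier R" for r
  using that x(1) by (intro M.lin_hom) (auto simp: tr_module_simps[OF \<phi>])
 show ?thesis
  unfolding T.fin_gen_iff tr_module_simps[OF \<phi>]
 proof (rule exI[of _ "%i. \<phi> (x i)"], rule exI[of _ n], intro conjI ballI)
  show "\<forall>i<n. \<phi> (x i) \<in> \<phi> ` carrier M" using x(1) by blast
  fix y assume "y \<in> \<phi> ` carrier M"
  then obtain z where "z \<in> carrier M" and y: "y = \<phi> z" by blast
  then obtain r where r: "\<forall>i<n. r i \<in> carrier R" "z = lin M x n r" using x(2) by blast
  show "\<exists>r. (\<forall>i<n. r i \<in> carrier R) & y = lin (tr_module \<phi> M) (%i. \<phi> (x i)) n r"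
   using r l[OF r(1)] y by blast
 qed
qed

text \<open>Injects the elements of semi-free modules into the type to which derived categories are confined.\<close>

definition enc :: "(nat => 'a) => 'a list set" where
 "enc r = range (%i. replicate (Suc i) (r i))"

text \<open>The length of a list in \<open>enc r\<close> gives an index and its entries the value
  there; \<open>Suc\<close> keeps the lists nonempty.\<close>

lemma inj_enc: "inj enc"
proof (rule injI, rule ext)
 fix r q :: "nat => 'a" and i assume "enc r = enc q"
 then have "replicate (Suc i) (r i) \<in> enc q" unfolding enc_def by blast
 then obtain j where j: "replicate (Suc i) (r i) = replicate (Suc j) (q j)" unfolding enc_def by auto
 then have "i = j" by (metis length_replicate nat.inject)
 then show "r i = q i" using j by simp
qed

definition sf_obj :: "'a ring => 'a semifree => ('a, 'a list set) cochain" where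
 "sf_obj R S = tr_complex enc (sf_complex R S)"

context semifree
begin

text \<open>The entry is \<open>vtx S g\<close> and not \<open>\<one>\<close>, because coefficients
  of the g-th generator live in \<open>R e\<close>.\<close>

definition gen :: "nat => nat => 'a" where
 "gen g = (%i. if i = g then vtx S g else \<zero>)"

lemma gen_closed: "g < N ==> gen g \<in> P (degr S g)"
 unfolding gen_def sf_carrier_def using vtx by auto

lemma gen_F: "g < N ==> gen g \<in> carrier F"
 using gen_closed sf_subset by blast

text \<open>The coefficients of \<open>r\<close> are fixed by right multiplication with the
  idempotents, so \<open>r\<close> is the combination of the generators with its own
  entries.\<close>

lemma lin_gen:
 assumes r: "r \<in> P k"
 shows "lin F (%i. if degr S i = k then gen i else \<zero>\<^bsub>F\<^esub>) N r = r"
proof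
 fix j
 have *: "lin F (%i. if degr S i = k then gen i else \<zero>\<^bsub>F\<^esub>) n r j = (if j < n then r j else \<zero>)" if "n \<le> N" for n
  using that
 proof (induction n)
  case (Suc n)
  then have "(r n \<otimes> (if degr S n = k then gen n else (%i. \<zero>)) j) = (if j = n then r j else \<zero>)"
   using r sf_closed[OF r, of n] sf_zero[OF r, of n] unfolding gen_def sf_carrier_def
   by (auto split: if_splits dest: spec[of _ n])
  then show ?case using Suc sf_closed[OF r] by auto
 qed simp
 show "lin F (%i. if degr S i = k then gen i else \<zero>\<^bsub>F\<^esub>) N r j = r j"
  using *[of N] sf_zero[OF r, of j] by auto
qed

lemma sf_lm: "left_module R (F\<lparr>carrier := P k\<rparr>)"
 using pre_complex_sf unfolding pre_complex_def sf_cterm by blast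

lemma lin_upd: "lin (F\<lparr>carrier := C\<rparr>) x n r = lin F x n r"
 by (induction n) auto

lemma bounded_complex_sf_obj: "bounded_complex R (sf_obj R S)"
 unfolding bounded_complex_iff
proof (intro conjI allI)
 show "pre_complex R (sf_obj R S)"
  unfolding sf_obj_def by (rule pre_complex_tr[OF inj_enc pre_complex_sf])
 have t: "ct (sf_obj R S) k = tr_module enc (F\<lparr>carrier := P k\<rparr>)" for k
  unfolding sf_obj_def tr_complex_def sf_complex_def by simp
 show "fin_gen R (ct (sf_obj R S) k)" for k
  unfolding t
 proof (rule fin_gen_tr[OF inj_enc sf_lm])
  interpret M: left_module R "F\<lparr>carrier := P k\<rparr>" by (rule sf_lm)
  show "fin_gen R (F\<lparr>carrier := P k\<rparr>)"
   unfolding M.fin_gen_iff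
  proof (rule exI[of _ "%i. if degr S i = k then gen i else \<zero>\<^bsub>F\<^esub>"], rule exI[of _ N], intro conjI ballI)
   show "\<forall>i<N. (if degr S i = k then gen i else \<zero>\<^bsub>F\<^esub>) \<in> carrier (F\<lparr>carrier := P k\<rparr>)"
    using gen_closed sf_0 by auto
   fix y assume "y \<in> carrier (F\<lparr>carrier := P k\<rparr>)"
   then have y: "y \<in> P k" by simp
   show "\<exists>r. (\<forall>i<N. r i \<in> carrier R) &
    y = lin (F\<lparr>carrier := P k\<rparr>) (%i. if degr S i = k then gen i else \<zero>\<^bsub>F\<^esub>) N r"
    using sf_closed[OF y] lin_gen[OF y] by (intro exI[of _ y]) (simp add: lin_upd)
  qed
 qed
 have "\<exists>B. \<forall>g<n. \<bar>degr S g\<bar> \<le> B" for n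
 proof (induction n)
  case (Suc n)
  then obtain B where "\<forall>g<n. \<bar>degr S g\<bar> \<le> B" by blast
  then show ?case by (intro exI[of _ "max B \<bar>degr S n\<bar>"]) (auto simp: less_Suc_eq)
 qed simp
 then obtain B where B: "\<forall>g<N. \<bar>degr S g\<bar> \<le> B" by blast
 have "P k = {%i. \<zero>}" if "\<bar>k\<bar> > B" for k
 proof -
  have "\<not> (i < N & degr S i = k)" for i using B that by fastforce
  then show ?thesis unfolding sf_carrier_def by auto
 qed
 then show "\<exists>B. \<forall>k. \<bar>k\<bar> > B --> car (sf_obj R S) k = {(zc (sf_obj R S) k)}"
  unfolding t tr_module_simps[OF inj_enc] by (intro exI[of _ B]) auto
qed

lemma sf_obj_cterm: "ct (sf_obj R S) k = tr_module enc (F\<lparr>carrier := P k\<rparr>)"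
 unfolding sf_obj_def tr_complex_def sf_complex_def by simp

lemma sf_obj_carrier: "car (sf_obj R S) k = enc ` P k"
 unfolding sf_obj_cterm tr_module_simps[OF inj_enc] by simp

lemma sf_obj_cdiff: "r \<in> P k ==> cd (sf_obj R S) k (enc r) = enc (dif r)"
 unfolding sf_obj_def tr_complex_def by (simp add: sf_cterm inv_f_f[OF inj_enc] sf_cdiff)

end

section \<open>Morphisms in the derived category out of semi-free complexes\<close>

lemma localising_complexes: "localising (complexes R) (quasi_isos R)"
proof
 fix X :: "('a, 'm) cochain" assume "X \<in> Obj (complexes R)"
 then interpret X: complex R X
  by (auto simp: complexes_def bounded_complex_iff complex_def)
 have "(\<lambda>x\<in>car X n. x) \<in> module_hom R (ct X n) (ct X n)" for n
 proof -
  interpret M: left_module R "ct X n" by (rule X.lm)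
  show ?thesis by (intro module_homI) (auto simp: M.smult_closed)
 qed
 then show "Ident (complexes R) X \<in> Mor (complexes R) X X"
  by (auto simp: complexes_def chain_maps_def X.d_closed)
next
 fix X Y Z :: "('a, 'm) cochain" and f g
 assume "X \<in> Obj (complexes R)" "f \<in> Mor (complexes R) X Y" "g \<in> Mor (complexes R) Y Z"
 then have f: "f \<in> chain_maps R X Y" and g: "g \<in> chain_maps R Y Z" and "complex R X"
  by (auto simp: complexes_def bounded_complex_iff complex_def)
 interpret X: complex R X by fact
 show "Comp (complexes R) X Y Z g f \<in> Mor (complexes R) X Z"
  using module_hom_compose[OF X.lm chain_mapsD(1)[OF f] chain_mapsD(1)[OF g]] chain_mapsD(2)[OF f]
   chain_mapsD(2)[OF g] module_homD(1)[OF chain_mapsD(1)[OF f]]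
  by (auto simp: complexes_def chain_maps_def compose_def X.d_closed)
next
 show "quasi_isos R X Y \<subseteq> Mor (complexes R) X Y" for X Y :: "('a, 'm) cochain"
  by (auto simp: complexes_def quasi_isos_def)
qed

interpretation D: localising "complexes R" "quasi_isos R" for R :: "'a ring"
 by (rule localising_complexes)

lemma chain_map_intro:
 "pre_complex R X ==> pre_complex R Y ==> f \<in> chain_maps R X Y ==> chain_map R X Y f"
 by (simp add: chain_map_def complex_def chain_map_axioms_def)

lemma lin_module_sum: "lin (module_sum M N) (%i. (x i, y i)) n r = (lin M x n r, lin N y n r)"
 by (induction n) (auto simp: module_sum_simps)

section \<open>Homotopy classes of cocycles with values in a complex\<close>

context semifree
begin

abbreviation "dg \<equiv> degr S"
abbreviation "evh Z w k g \<equiv> ev Z S w N (dg g + 1) k (att S g)"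
abbreviation "evd Z u g \<equiv> evh Z u (dg g + 1) g"

text \<open>Chain maps out of the semi-free complex, recorded by the images of the generators.
  Extensionality makes two records equal as functions once they agree below
  \<open>N\<close>.\<close>

definition cocyc :: "('a, 'm) cochain => (nat => 'm) set" where
 "cocyc Z = {u \<in> extensional {..<N}. \<forall>g<N. u g \<in> car Z (dg g) &
   vtx S g \<odot>\<^bsub>ct Z (dg g)\<^esub> u g = u g &
   cd Z (dg g) (u g) = evd Z u g}"

definition null :: "('a, 'm) cochain => (nat => 'm) => (nat => 'm) => bool" where
 "null Z w u \<longleftrightarrow> (\<forall>g<N. w g \<in> car Z (dg g - 1) &
   vtx S g \<odot>\<^bsub>ct Z (dg g - 1)\<^esub> w g = w g &
   u g = cd Z (dg g - 1) (w g) \<oplus>\<^bsub>ct Z (dg g)\<^esub> evh Z w (dg g) g)"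

text \<open>Cocycles and null-homotopies of the degree 0 part of the Hom complex.\<close>

definition homot :: "('a, 'm) cochain => (nat => 'm) => (nat => 'm) => bool" where
 "homot Z u v \<longleftrightarrow> (\<exists>w. null Z w (%g. u g \<oplus>\<^bsub>ct Z (dg g)\<^esub> \<ominus>\<^bsub>ct Z (dg g)\<^esub> v g))"

definition hclass :: "('a, 'm) cochain => (nat => 'm) => (nat => 'm) set" where
 "hclass Z u = {v \<in> cocyc Z. homot Z v u}"

definition post :: "(int => 'm => 'm) => (nat => 'm) => nat => 'm" where
 "post f u = (\<lambda>g\<in>{..<N}. f (dg g) (u g))"

text \<open>Classes are plain sets, so a representative is picked; \<open>hmap_hclass\<close> shows
  that the choice does not matter.\<close>

definition hmap :: "('a, 'm) cochain => ('a, 'm) cochain => (int => 'm => 'm) => (nat => 'm) set => (nat => 'm) set"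
 where "hmap X Y f c = hclass Y (post f (SOME u. u \<in> c))"

lemma cocycD:
 assumes "u \<in> cocyc Z" "g < N"
 shows "u g \<in> car Z (dg g)" "vtx S g \<odot>\<^bsub>ct Z (dg g)\<^esub> u g = u g"
  "cd Z (dg g) (u g) = evd Z u g"
 using assms unfolding cocyc_def by auto

lemma nullD:
 assumes "null Z w u" "g < N"
 shows "w g \<in> car Z (dg g - 1)" "vtx S g \<odot>\<^bsub>ct Z (dg g - 1)\<^esub> w g = w g"
  "u g = cd Z (dg g - 1) (w g) \<oplus>\<^bsub>ct Z (dg g)\<^esub> evh Z w (dg g) g"
 using assms unfolding null_def by auto

context
 fixes Z :: "('a, 'm) cochain"
 assumes Z: "pre_complex R Z"
begin

interpretation Z: complex R Z by (rule complex.intro[OF Z])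

text \<open>\<open>m\<close> is the degree of the family \<open>u\<close>: 0 for chain maps, -1 for
  homotopies.\<close>

lemma ev_closed:
 assumes "!!g. g < N ==> u g \<in> car Z (dg g + m)" "j = k + m" "!!i. r i \<in> carrier R"
 shows "ev Z S u N k j r \<in> car Z j"
proof -
 have j: "j = k + m" by fact
 interpret M: left_module R "ct Z (k + m)" by (rule Z.lm)
 show ?thesis unfolding ev_def j using assms by (intro M.lin_closed) auto
qed

lemma ev_add:
 assumes "!!g. g < N ==> u g \<in> car Z (dg g + m)"
  "!!g. g < N ==> v g \<in> car Z (dg g + m)" "j = k + m" "!!i. r i \<in> carrier R"
 shows "ev Z S (%g. u g \<oplus>\<^bsub>ct Z (dg g + m)\<^esub> v g) N k j r = ev Z S u N k j r \<oplus>\<^bsub>ct Z j\<^esub> ev Z S v N k j r"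
proof -
 have j: "j = k + m" by fact
 interpret M: left_module R "ct Z (k + m)" by (rule Z.lm)
 show ?thesis unfolding ev_def j using assms
  by (subst M.lin_add_right[symmetric]) (auto intro!: M.lin_cong)
qed

lemma ev_minus:
 assumes "!!g. g < N ==> u g \<in> car Z (dg g + m)" "j = k + m" "!!i. r i \<in> carrier R"
 shows "ev Z S (%g. \<ominus>\<^bsub>ct Z (dg g + m)\<^esub> u g) N k j r = \<ominus>\<^bsub>ct Z j\<^esub> ev Z S u N k j r"
proof -
 have j: "j = k + m" by fact
 interpret M: left_module R "ct Z (k + m)" by (rule Z.lm)
 show ?thesis unfolding ev_def j using assms
  by (subst M.lin_minus_right[symmetric]) (auto intro!: M.lin_cong simp: M.M.minus_equality)
qed

lemma ev_cong:
 assumes "!!g. g < N ==> dg g = k ==> u g = v g"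
 shows "ev Z S u N k j r = ev Z S v N k j r"
proof -
 interpret M: left_module R "ct Z j" by (rule Z.lm)
 show ?thesis unfolding ev_def using assms by (intro M.lin_cong) auto
qed

lemma ev_zero:
 assumes "!!i. r i \<in> carrier R" "j = k"
 shows "ev Z S (%g. (zc Z (dg g))) N k j r = (zc Z j)"
proof -
 interpret M: left_module R "ct Z k" by (rule Z.lm)
 show ?thesis unfolding ev_def assms(2) using assms(1) by (intro M.lin_zero) auto
qed

lemma null_add:
 assumes "null Z w u" "null Z x v"
 shows "null Z (%g. w g \<oplus>\<^bsub>ct Z (dg g - 1)\<^esub> x g) (%g. u g \<oplus>\<^bsub>ct Z (dg g)\<^esub> v g)"
 unfolding null_def
proof (intro allI impI conjI)
 fix g assume g: "g < N"
 interpret A: left_module R "ct Z (dg g - 1)" by (rule Z.lm)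
 interpret B: left_module R "ct Z (dg g)" by (rule Z.lm)
 note w = nullD[OF assms(1) g] and x = nullD[OF assms(2) g]
 show "w g \<oplus>\<^bsub>ct Z (dg g - 1)\<^esub> x g \<in> car Z (dg g - 1)" using w x by simp
 show "vtx S g \<odot>\<^bsub>ct Z (dg g - 1)\<^esub> (w g \<oplus>\<^bsub>ct Z (dg g - 1)\<^esub> x g) = w g \<oplus>\<^bsub>ct Z (dg g - 1)\<^esub> x g"
  using w x vtx(1)[OF g] by (simp add: A.smult_r_distr)
 have w': "w g \<in> car Z (dg g + - 1)" "x g \<in> car Z (dg g + - 1)" if "g < N" for g
  using nullD(1)[OF assms(1) that] nullD(1)[OF assms(2) that] by simp_all
 have c: "evh Z w (dg g) g \<in> car Z (dg g)"
  "evh Z x (dg g) g \<in> car Z (dg g)"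
  using g by (auto intro!: ev_closed[where m = "-1"] w')
 have "evh Z (%g. w g \<oplus>\<^bsub>ct Z (dg g + - 1)\<^esub> x g) (dg g) g =
  evh Z w (dg g) g \<oplus>\<^bsub>ct Z (dg g)\<^esub> evh Z x (dg g) g"
  using g by (intro ev_add[where m = "-1"] w') auto
 then show "u g \<oplus>\<^bsub>ct Z (dg g)\<^esub> v g =
  cd Z (dg g - 1) (w g \<oplus>\<^bsub>ct Z (dg g - 1)\<^esub> x g) \<oplus>\<^bsub>ct Z (dg g)\<^esub>
  evh Z (%g. w g \<oplus>\<^bsub>ct Z (dg g - 1)\<^esub> x g) (dg g) g"
  using w x c Z.d_add[of "w g" "dg g - 1" "x g" "dg g"] Z.d_closed'[of "w g"] Z.d_closed'[of "x g"]
  by (simp add: B.a_ac)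
qed

lemma null_minus:
 assumes "null Z w u"
 shows "null Z (%g. \<ominus>\<^bsub>ct Z (dg g - 1)\<^esub> w g) (%g. \<ominus>\<^bsub>ct Z (dg g)\<^esub> u g)"
 unfolding null_def
proof (intro allI impI conjI)
 fix g assume g: "g < N"
 interpret A: left_module R "ct Z (dg g - 1)" by (rule Z.lm)
 interpret B: left_module R "ct Z (dg g)" by (rule Z.lm)
 note w = nullD[OF assms(1) g]
 show "\<ominus>\<^bsub>ct Z (dg g - 1)\<^esub> w g \<in> car Z (dg g - 1)" using w by simp
 show "vtx S g \<odot>\<^bsub>ct Z (dg g - 1)\<^esub> (\<ominus>\<^bsub>ct Z (dg g - 1)\<^esub> w g) = \<ominus>\<^bsub>ct Z (dg g - 1)\<^esub> w g"
  using w vtx(1)[OF g] by (simp add: A.smult_minus_right)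
 have w': "w g \<in> car Z (dg g + - 1)" if "g < N" for g
  using nullD(1)[OF assms(1) that] by simp_all
 have c: "evh Z w (dg g) g \<in> car Z (dg g)"
  using g by (auto intro!: ev_closed[where m = "-1"] w')
 have "evh Z (%g. \<ominus>\<^bsub>ct Z (dg g + - 1)\<^esub> w g) (dg g) g =
  \<ominus>\<^bsub>ct Z (dg g)\<^esub> evh Z w (dg g) g"
  using g by (intro ev_minus[where m = "-1"] w') auto
 then show "\<ominus>\<^bsub>ct Z (dg g)\<^esub> u g =
  cd Z (dg g - 1) (\<ominus>\<^bsub>ct Z (dg g - 1)\<^esub> w g) \<oplus>\<^bsub>ct Z (dg g)\<^esub>
  evh Z (%g. \<ominus>\<^bsub>ct Z (dg g - 1)\<^esub> w g) (dg g) g"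
  using w c Z.d_minus[of "w g" "dg g - 1" "dg g"] Z.d_closed'[of "w g"]
  by (simp add: B.minus_add)
qed

lemma null_cong: "null Z w u ==> (!!g. g < N ==> u g = v g) ==> null Z w v"
 unfolding null_def by auto

lemma null_zero: "null Z (%g. (zc Z (dg g - 1))) (%g. (zc Z (dg g)))"
 unfolding null_def
proof (intro allI impI conjI)
 fix g assume g: "g < N"
 interpret A: left_module R "ct Z (dg g - 1)" by (rule Z.lm)
 interpret B: left_module R "ct Z (dg g)" by (rule Z.lm)
 show "(zc Z (dg g - 1)) \<in> car Z (dg g - 1)" by simp
 show "vtx S g \<odot>\<^bsub>ct Z (dg g - 1)\<^esub> (zc Z (dg g - 1)) = (zc Z (dg g - 1))"
  using vtx(1)[OF g] by simp
 have "evh Z (%g. (zc Z (dg g - 1))) (dg g) g = (zc Z (dg g))"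
  unfolding ev_def using g by (intro B.lin_zero) auto
 then show "(zc Z (dg g)) = cd Z (dg g - 1) (zc Z (dg g - 1)) \<oplus>\<^bsub>ct Z (dg g)\<^esub>
  evh Z (%g. (zc Z (dg g - 1))) (dg g) g"
  by (simp add: Z.d_zero[of "dg g"])
qed

lemma homot_refl: "u \<in> cocyc Z ==> homot Z u u"
 unfolding homot_def
proof (rule exI, rule null_cong[OF null_zero])
 fix g assume "u \<in> cocyc Z" "g < N"
 interpret B: left_module R "ct Z (dg g)" by (rule Z.lm)
 show "(zc Z (dg g)) = u g \<oplus>\<^bsub>ct Z (dg g)\<^esub> \<ominus>\<^bsub>ct Z (dg g)\<^esub> u g"
  using cocycD(1)[OF \<open>u \<in> _\<close> \<open>g < N\<close>] by (simp add: B.r_neg)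
qed

lemma homot_sym:
 assumes "u \<in> cocyc Z" "v \<in> cocyc Z" "homot Z u v" shows "homot Z v u"
proof -
 obtain w where w: "null Z w (%g. u g \<oplus>\<^bsub>ct Z (dg g)\<^esub> \<ominus>\<^bsub>ct Z (dg g)\<^esub> v g)"
  using assms unfolding homot_def by blast
 show ?thesis
  unfolding homot_def
 proof (rule exI, rule null_cong[OF null_minus[OF w]])
  fix g assume g: "g < N"
  interpret B: left_module R "ct Z (dg g)" by (rule Z.lm)
  show "\<ominus>\<^bsub>ct Z (dg g)\<^esub> (u g \<oplus>\<^bsub>ct Z (dg g)\<^esub> \<ominus>\<^bsub>ct Z (dg g)\<^esub> v g) =
   v g \<oplus>\<^bsub>ct Z (dg g)\<^esub> \<ominus>\<^bsub>ct Z (dg g)\<^esub> u g"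
   using cocycD(1)[OF assms(1) g] cocycD(1)[OF assms(2) g] by (simp add: B.minus_add B.a_comm)
 qed
qed

lemma homot_trans:
 assumes c: "u \<in> cocyc Z" "v \<in> cocyc Z" "x \<in> cocyc Z" and "homot Z u v" "homot Z v x"
 shows "homot Z u x"
proof -
 obtain w w' where w: "null Z w (%g. u g \<oplus>\<^bsub>ct Z (dg g)\<^esub> \<ominus>\<^bsub>ct Z (dg g)\<^esub> v g)"
  "null Z w' (%g. v g \<oplus>\<^bsub>ct Z (dg g)\<^esub> \<ominus>\<^bsub>ct Z (dg g)\<^esub> x g)"
  using assms unfolding homot_def by blast
 show ?thesis
  unfolding homot_def
 proof (rule exI, rule null_cong[OF null_add[OF w]])
  fix g assume g: "g < N"
  interpret B: left_module R "ct Z (dg g)" by (rule Z.lm)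
  show "u g \<oplus>\<^bsub>ct Z (dg g)\<^esub> \<ominus>\<^bsub>ct Z (dg g)\<^esub> v g \<oplus>\<^bsub>ct Z (dg g)\<^esub>
   (v g \<oplus>\<^bsub>ct Z (dg g)\<^esub> \<ominus>\<^bsub>ct Z (dg g)\<^esub> x g) =
   u g \<oplus>\<^bsub>ct Z (dg g)\<^esub> \<ominus>\<^bsub>ct Z (dg g)\<^esub> x g"
   using cocycD(1)[OF c(1) g] cocycD(1)[OF c(2) g] cocycD(1)[OF c(3) g]
   by (simp add: B.a_assoc B.M.r_neg1 B.M.r_neg2)
 qed
qed

lemma hclass_eq_iff:
 assumes "u \<in> cocyc Z" "v \<in> cocyc Z"
 shows "hclass Z u = hclass Z v \<longleftrightarrow> homot Z u v"
proof
 assume "hclass Z u = hclass Z v"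
 moreover have "u \<in> hclass Z u" using assms homot_refl unfolding hclass_def by blast
 ultimately show "homot Z u v" unfolding hclass_def by blast
next
 assume "homot Z u v"
 then show "hclass Z u = hclass Z v"
  unfolding hclass_def using assms homot_sym homot_trans by (intro Collect_cong) meson
qed

lemma hclass_SOME:
 assumes "u \<in> cocyc Z"
 shows "(SOME v. v \<in> hclass Z u) \<in> cocyc Z & homot Z (SOME v. v \<in> hclass Z u) u"
proof -
 have "u \<in> hclass Z u" using assms homot_refl unfolding hclass_def by blast
 then have "(SOME v. v \<in> hclass Z u) \<in> hclass Z u" by (rule someI[of "%v. v \<in> hclass Z u"])
 then show ?thesis unfolding hclass_def by blast
qed

end

end

locale semifree_chain_map = semifree R S + f: chain_map R X Y f
 for R :: "'a ring" (structure) and S and X Y :: "('a, 'm) cochain" and f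
begin

lemma ev_f:
 assumes "!!g. g < N ==> u g \<in> car X (dg g + m)" "j = k + m" "!!i. r i \<in> carrier R"
 shows "f j (ev X S u N k j r) = ev Y S (%g. f (dg g + m) (u g)) N k j r"
proof -
 have jk: "dg i + m = j" if "dg i = k" for i using that assms(2) by simp
 interpret M: left_module R "ct X j" by (rule f.X.lm)
 interpret M': left_module R "ct Y j" by (rule f.Y.lm)
 have uj: "u i \<in> car X j" if "i < N" "dg i = k" for i
  using assms(1)[OF that(1)] jk[OF that(2)] by simp
 have "f j (ev X S u N k j r) = lin (ct Y j) (%i. f j (if dg i = k then u i else (zc X j))) N r"
  unfolding ev_def using assms(3) uj by (intro M.lin_hom) (auto simp: f.zero f.add f.smult)
 also have "\<dots> = ev Y S (%g. f (dg g + m) (u g)) N k j r"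
  unfolding ev_def by (intro M'.lin_cong) (auto simp: f.zero jk)
 finally show ?thesis .
qed

lemma post_cocyc:
 assumes u: "u \<in> cocyc X" shows "post f u \<in> cocyc Y"
 unfolding cocyc_def
proof (intro CollectI conjI allI impI)
 show "post f u \<in> extensional {..<N}" unfolding post_def by simp
 fix g assume g: "g < N"
 note c = cocycD[OF u g]
 show "post f u g \<in> car Y (dg g)" using g c f.closed unfolding post_def by simp
 show "vtx S g \<odot>\<^bsub>ct Y (dg g)\<^esub> post f u g = post f u g"
  using g c f.smult[OF vtx(1)[OF g] c(1)] unfolding post_def by simp
 have "cd Y (dg g) (f (dg g) (u g)) = f (dg g + 1) (cd X (dg g) (u g))"
  using f.comm[OF c(1) refl] by simp
 also have "\<dots> = evd Y (%g. f (dg g + 0) (u g)) g"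
  unfolding c(3) using g cocycD(1)[OF u] by (intro ev_f) auto
 also have "\<dots> = evd Y (post f u) g"
  using f.Y.pre_complex by (intro ev_cong) (auto simp: post_def)
 finally show "cd Y (dg g) (post f u g) = evd Y (post f u) g"
  using g unfolding post_def by simp
qed

lemma post_homot:
 assumes uv: "u \<in> cocyc X" "v \<in> cocyc X" "homot X u v"
 shows "homot Y (post f u) (post f v)"
proof -
 obtain w where w: "null X w (%g. u g \<oplus>\<^bsub>ct X (dg g)\<^esub> \<ominus>\<^bsub>ct X (dg g)\<^esub> v g)"
  using uv unfolding homot_def by blast
 have "null Y (%g. f (dg g - 1) (w g)) (%g. post f u g \<oplus>\<^bsub>ct Y (dg g)\<^esub> \<ominus>\<^bsub>ct Y (dg g)\<^esub> post f v g)"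
  unfolding null_def
 proof (intro allI impI conjI)
  fix g assume g: "g < N"
  interpret M: left_module R "ct X (dg g)" by (rule f.X.lm)
  note c = nullD[OF w g]
  show "f (dg g - 1) (w g) \<in> car Y (dg g - 1)" using c f.closed by simp
  show "vtx S g \<odot>\<^bsub>ct Y (dg g - 1)\<^esub> f (dg g - 1) (w g) = f (dg g - 1) (w g)"
   using f.smult[OF vtx(1)[OF g] c(1)] c by simp
  have w': "w g \<in> car X (dg g + - 1)" if "g < N" for g using nullD(1)[OF w that] by simp
  have "f (dg g) (evh X w (dg g) g) =
   evh Y (%g. f (dg g + - 1) (w g)) (dg g) g"
   using g by (intro ev_f w') auto
  moreover have "evh X w (dg g) g \<in> car X (dg g)"
   using g by (intro ev_closed[OF f.X.pre_complex, where m = "-1"] w') auto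
  ultimately have "f (dg g) (u g \<oplus>\<^bsub>ct X (dg g)\<^esub> \<ominus>\<^bsub>ct X (dg g)\<^esub> v g) =
   cd Y (dg g - 1) (f (dg g - 1) (w g)) \<oplus>\<^bsub>ct Y (dg g)\<^esub>
   evh Y (%g. f (dg g - 1) (w g)) (dg g) g"
   unfolding c(3) using c(1) by (simp add: f.add f.X.d_closed' f.comm')
  then show "post f u g \<oplus>\<^bsub>ct Y (dg g)\<^esub> \<ominus>\<^bsub>ct Y (dg g)\<^esub> post f v g =
   cd Y (dg g - 1) (f (dg g - 1) (w g)) \<oplus>\<^bsub>ct Y (dg g)\<^esub>
   evh Y (%g. f (dg g - 1) (w g)) (dg g) g"
   using g cocycD(1)[OF uv(1) g] cocycD(1)[OF uv(2) g] unfolding post_def by (simp add: f.add f.minus)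
 qed
 then show ?thesis unfolding homot_def by blast
qed

lemma hmap_hclass: "u \<in> cocyc X ==> hmap X Y f (hclass X u) = hclass Y (post f u)"
 unfolding hmap_def using hclass_SOME[OF f.X.pre_complex] hclass_eq_iff[OF f.Y.pre_complex] post_cocyc post_homot
 by blast

lemma ev_cone:
 assumes "j' = j + 1"
 shows "ev (cone X Y f) S (%g. (a g, b g)) n k j r = (ev X S a n k j' r, ev Y S b n k j r)"
proof -
 have "(if dg i = k then (a i, b i) else ((zc X j'), (zc Y j))) =
  (if dg i = k then a i else (zc X j'), if dg i = k then b i else (zc Y j))" for i
  by simp
 then show ?thesis unfolding ev_def cone_term[OF assms] module_sum_simps by (simp add: lin_module_sum)
qed

text \<open>The cone of a quasi-isomorphism is acyclic, so \<open>Hom_acyclic\<close> applies to the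
  pairs \<open>(a g, b g)\<close>, and its conclusion is split into components. Choosing
  \<open>a = 0\<close> yields surjectivity of \<open>f\<close> on homotopy classes; choosing for
  \<open>a\<close> a difference of cocycles yields injectivity.\<close>

lemma cone_lift:
 assumes q: "f \<in> quasi_isos R X Y"
  and s: "s \<in> carrier R" "!!r. r \<in> carrier R ==> r \<otimes> s = s \<otimes> r" "s \<otimes> s = \<one>"
  and a: "!!g. g < N ==> a g \<in> car X (dg g + m + 1)"
   "!!g. g < N ==> vtx S g \<odot>\<^bsub>ct X (dg g + m + 1)\<^esub> a g = a g"
   "!!g. g < N ==> \<ominus>\<^bsub>ct X (dg g + m + 1 + 1)\<^esub> cd X (dg g + m + 1) (a g) =
    s \<odot>\<^bsub>ct X (dg g + m + 1 + 1)\<^esub> evh X a (dg g + m + 1 + 1) g"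
  and b: "!!g. g < N ==> b g \<in> car Y (dg g + m)"
   "!!g. g < N ==> vtx S g \<odot>\<^bsub>ct Y (dg g + m)\<^esub> b g = b g"
   "!!g. g < N ==> f (dg g + m + 1) (a g) \<oplus>\<^bsub>ct Y (dg g + m + 1)\<^esub> cd Y (dg g + m) (b g) =
    s \<odot>\<^bsub>ct Y (dg g + m + 1)\<^esub> evh Y b (dg g + m + 1) g"
 obtains p w where "!!g. g < N ==> p g \<in> car X (dg g + m)"
  "!!g. g < N ==> vtx S g \<odot>\<^bsub>ct X (dg g + m)\<^esub> p g = p g"
  "!!g. g < N ==> a g = \<ominus>\<^bsub>ct X (dg g + m + 1)\<^esub> cd X (dg g + m) (p g) \<oplus>\<^bsub>ct X (dg g + m + 1)\<^esub>
   s \<odot>\<^bsub>ct X (dg g + m + 1)\<^esub> evh X p (dg g + m + 1) g"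
  "!!g. g < N ==> w g \<in> car Y (dg g + m - 1)"
  "!!g. g < N ==> vtx S g \<odot>\<^bsub>ct Y (dg g + m - 1)\<^esub> w g = w g"
  "!!g. g < N ==> b g = f (dg g + m) (p g) \<oplus>\<^bsub>ct Y (dg g + m)\<^esub> cd Y (dg g + m - 1) (w g)
   \<oplus>\<^bsub>ct Y (dg g + m)\<^esub> s \<odot>\<^bsub>ct Y (dg g + m)\<^esub> evh Y w (dg g + m) g"
proof -
 let ?C = "cone X Y f"
 note C = f.pre_complex_cone f.acyclic_cone[OF q]
 have "\<exists>u. \<forall>g<N. u g \<in> car ?C (dg g + m - 1) &
  vtx S g \<odot>\<^bsub>ct ?C (dg g + m - 1)\<^esub> u g = u g &
  (a g, b g) = cd ?C (dg g + m - 1) (u g) \<oplus>\<^bsub>ct ?C (dg g + m)\<^esub>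
   s \<odot>\<^bsub>ct ?C (dg g + m)\<^esub> evh ?C u (dg g + m) g"
 proof (rule Hom_acyclic[OF C s])
  fix g assume g: "g < N"
  show "(a g, b g) \<in> car ?C (dg g + m)"
   "vtx S g \<odot>\<^bsub>ct ?C (dg g + m)\<^esub> (a g, b g) = (a g, b g)"
   using a[OF g] b[OF g] unfolding cone_term[OF refl] module_sum_simps by auto
  show "cd ?C (dg g + m) (a g, b g) =
   s \<odot>\<^bsub>ct ?C (dg g + m + 1)\<^esub> evh ?C (%g. (a g, b g)) (dg g + m + 1) g"
   unfolding ev_cone[OF refl] cone_term[OF refl] module_sum_simps cone_diff[OF refl refl a(1)[OF g] b(1)[OF g]]
    a(3)[OF g] b(3)[OF g] by (rule refl)
 qed
 then obtain u where u: "!!g. g < N ==> u g \<in> car ?C (dg g + m - 1) &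
  vtx S g \<odot>\<^bsub>ct ?C (dg g + m - 1)\<^esub> u g = u g &
  (a g, b g) = cd ?C (dg g + m - 1) (u g) \<oplus>\<^bsub>ct ?C (dg g + m)\<^esub>
   s \<odot>\<^bsub>ct ?C (dg g + m)\<^esub> evh ?C u (dg g + m) g" by blast
 show thesis
 proof (rule that[of "%g. fst (u g)" "%g. snd (u g)"])
  fix g assume g: "g < N"
  have T: "dg g + m = dg g + m - 1 + 1" by simp
  note ct = cone_term[OF T, of X Y f]
  obtain p w where pw: "u g = (p, w)" by (cases "u g")
  note ug = u[OF g, unfolded pw ct module_sum_simps, THEN conjunct1]
   u[OF g, unfolded pw ct module_sum_simps, THEN conjunct2, THEN conjunct1]
  show "fst (u g) \<in> car X (dg g + m)" "snd (u g) \<in> car Y (dg g + m - 1)"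
   "vtx S g \<odot>\<^bsub>ct X (dg g + m)\<^esub> fst (u g) = fst (u g)"
   "vtx S g \<odot>\<^bsub>ct Y (dg g + m - 1)\<^esub> snd (u g) = snd (u g)"
   using ug pw by auto
  have "(a g, b g) = cd ?C (dg g + m - 1) (p, w) \<oplus>\<^bsub>ct ?C (dg g + m)\<^esub>
   s \<odot>\<^bsub>ct ?C (dg g + m)\<^esub>
    evh ?C (%g. (fst (u g), snd (u g))) (dg g + m) g"
   using u[OF g] unfolding pw[symmetric] by simp
  also have "cd ?C (dg g + m - 1) (p, w) = (\<ominus>\<^bsub>ct X (dg g + m + 1)\<^esub> cd X (dg g + m) p,
   f (dg g + m) p \<oplus>\<^bsub>ct Y (dg g + m)\<^esub> cd Y (dg g + m - 1) w)"
   using ug by (intro cone_diff[OF T refl]) auto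
  finally have *: "(a g, b g) = (\<ominus>\<^bsub>ct X (dg g + m + 1)\<^esub> cd X (dg g + m) p
    \<oplus>\<^bsub>ct X (dg g + m + 1)\<^esub> s \<odot>\<^bsub>ct X (dg g + m + 1)\<^esub>
     evh X (%g. fst (u g)) (dg g + m + 1) g,
   f (dg g + m) p \<oplus>\<^bsub>ct Y (dg g + m)\<^esub> cd Y (dg g + m - 1) w \<oplus>\<^bsub>ct Y (dg g + m)\<^esub>
    s \<odot>\<^bsub>ct Y (dg g + m)\<^esub> evh Y (%g. snd (u g)) (dg g + m) g)"
   unfolding ev_cone[OF refl] cone_term[OF refl] module_sum_simps .
  show "a g = \<ominus>\<^bsub>ct X (dg g + m + 1)\<^esub> cd X (dg g + m) (fst (u g)) \<oplus>\<^bsub>ct X (dg g + m + 1)\<^esub>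
   s \<odot>\<^bsub>ct X (dg g + m + 1)\<^esub> evh X (%g. fst (u g)) (dg g + m + 1) g"
   using * unfolding pw fst_conv by blast
  show "b g = f (dg g + m) (fst (u g)) \<oplus>\<^bsub>ct Y (dg g + m)\<^esub> cd Y (dg g + m - 1) (snd (u g))
   \<oplus>\<^bsub>ct Y (dg g + m)\<^esub> s \<odot>\<^bsub>ct Y (dg g + m)\<^esub>
    evh Y (%g. snd (u g)) (dg g + m) g"
   using * unfolding pw fst_conv snd_conv by blast
 qed
qed

text \<open>\<open>cone_lift\<close> with sign 1, \<open>a = 0\<close>, degree 0 and
  \<open>b = z\<close>. The component in \<open>X\<close> says \<open>d p = p d\<close>, so
  \<open>p\<close> is a cocycle; the component in \<open>Y\<close> is a homotopy between
  \<open>z\<close> and the image of \<open>p\<close>.\<close>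

lemma cocycle_lift:
 assumes q: "f \<in> quasi_isos R X Y" and z: "z \<in> cocyc Y"
 shows "\<exists>y\<in>cocyc X. homot Y z (post f y)"
proof (rule cone_lift[OF q, of \<one> "%g. (zc X (dg g + 1))" 0 z], goal_cases)
 case (4 g)
 show ?case using abelian_groupE(2)[OF f.X.abg] by simp
next
 case (5 g)
 interpret A: left_module R "ct X (dg g + 1)" by (rule f.X.lm)
 show ?case using vtx(1)[OF 5] by simp
next
 case (6 g)
 define T where "T = dg g + 1 + 1"
 interpret A: left_module R "ct X T" by (rule f.X.lm)
 have "evh X (%g. (zc X (dg g + 1))) T g = (zc X T)"
  unfolding ev_def using 6 by (intro A.lin_zero) (auto simp: T_def[symmetric])
 then show ?case
  unfolding add_0_right T_def[symmetric] f.X.d_zero[OF T_def]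
  by (simp add: A.M.minus_equality)
next
 case (7 g) show ?case using cocycD(1)[OF z 7] by simp
next
 case (8 g) show ?case using cocycD(2)[OF z 8] by simp
next
 case (9 g)
 interpret B: left_module R "ct Y (dg g + 1)" by (rule f.Y.lm)
 have "cd Y (dg g) (z g) \<in> car Y (dg g + 1)"
  using cocycD(1)[OF z 9] f.Y.d_closed by blast
 then show ?case using cocycD(3)[OF z 9] by (simp add: f.zero B.smult_one)
next
 case (10 p w)
 \<comment> \<open>Restricted to the generators, since \<open>cocyc\<close> asks for an extensional
   function.\<close>
 define y where "y = (\<lambda>g\<in>{..<N}. p g)"
 have py: "ev X S p N k j r = ev X S y N k j r" for k j r
  by (intro ev_cong[OF f.X.pre_complex]) (auto simp: y_def)
 have w0: "w g \<in> car Y (dg g + - 1)" if "g < N" for g using 10(4)[OF that] by simp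
 have p0: "p g \<in> car X (dg g + 0)" if "g < N" for g using 10(1)[OF that] .
 have y: "y \<in> cocyc X"
  unfolding cocyc_def
 proof (intro CollectI conjI allI impI)
  fix g assume g: "g < N"
  interpret A: left_module R "ct X (dg g + 1)" by (rule f.X.lm)
  have c: "evd X p g \<in> car X (dg g + 1)"
   using g by (intro ev_closed[OF f.X.pre_complex, where m = 0] p0) auto
  have d: "cd X (dg g) (p g) \<in> car X (dg g + 1)"
   using p0[OF g] f.X.d_closed by simp
  have "\<ominus>\<^bsub>ct X (dg g + 1)\<^esub> cd X (dg g) (p g) \<oplus>\<^bsub>ct X (dg g + 1)\<^esub>
   evd X p g = (zc X (dg g + 1))"
   using 10(3)[OF g] c by (simp add: A.smult_one)
  then have "\<ominus>\<^bsub>ct X (dg g + 1)\<^esub> evd X p g =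
   \<ominus>\<^bsub>ct X (dg g + 1)\<^esub> cd X (dg g) (p g)"
   using c d by (intro A.M.minus_equality) auto
  then have "cd X (dg g) (p g) = evd X p g"
   using c d by (metis A.M.minus_minus)
  then show "cd X (dg g) (y g) = evd X y g"
   using g unfolding py by (simp add: y_def)
 qed (use 10(1,2) in \<open>auto simp: y_def\<close>)
 have "null Y w (%g. z g \<oplus>\<^bsub>ct Y (dg g)\<^esub> \<ominus>\<^bsub>ct Y (dg g)\<^esub> post f y g)"
  unfolding null_def
 proof (intro allI impI conjI)
  fix g assume g: "g < N"
  interpret B: left_module R "ct Y (dg g)" by (rule f.Y.lm)
  have e: "evh Y w (dg g) g \<in> car Y (dg g)"
   using g by (intro ev_closed[OF f.Y.pre_complex, where m = "-1"] w0) auto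
  have fp: "f (dg g) (p g) \<in> car Y (dg g)" using p0[OF g] f.closed by simp
  have d: "cd Y (dg g - 1) (w g) \<in> car Y (dg g)" using w0[OF g] f.Y.d_closed' by simp
  have "z g = f (dg g) (p g) \<oplus>\<^bsub>ct Y (dg g)\<^esub> (cd Y (dg g - 1) (w g) \<oplus>\<^bsub>ct Y (dg g)\<^esub>
   evh Y w (dg g) g)"
   using 10(6)[OF g] e fp d by (simp add: B.smult_one B.a_assoc)
  then have "z g \<oplus>\<^bsub>ct Y (dg g)\<^esub> \<ominus>\<^bsub>ct Y (dg g)\<^esub> f (dg g) (p g) =
   (cd Y (dg g - 1) (w g) \<oplus>\<^bsub>ct Y (dg g)\<^esub> evh Y w (dg g) g)
   \<oplus>\<^bsub>ct Y (dg g)\<^esub> f (dg g) (p g) \<oplus>\<^bsub>ct Y (dg g)\<^esub> \<ominus>\<^bsub>ct Y (dg g)\<^esub> f (dg g) (p g)"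
   using e fp d by (simp add: B.M.a_comm)
  also have "\<dots> = cd Y (dg g - 1) (w g) \<oplus>\<^bsub>ct Y (dg g)\<^esub> evh Y w (dg g) g"
   using e fp d by (simp add: B.M.a_assoc B.M.r_neg)
  finally show "z g \<oplus>\<^bsub>ct Y (dg g)\<^esub> \<ominus>\<^bsub>ct Y (dg g)\<^esub> post f y g =
   cd Y (dg g - 1) (w g) \<oplus>\<^bsub>ct Y (dg g)\<^esub> evh Y w (dg g) g"
   using g by (simp add: post_def y_def)
 qed (use 10(4,5) in auto)
 then show ?case using y unfolding homot_def by blast
qed auto

text \<open>\<open>cone_lift\<close> with sign -1 in degree -1: \<open>a = u - v\<close> and
  \<open>b = - w\<close>, where \<open>w\<close> contracts the difference of the images. The result
  is \<open>a = - d p - p d\<close>, so \<open>- p\<close> contracts \<open>u - v\<close>.\<close>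

lemma homot_reflect:
 assumes q: "f \<in> quasi_isos R X Y" and uv: "u \<in> cocyc X" "v \<in> cocyc X"
  and h: "homot Y (post f u) (post f v)"
 shows "homot X u v"
proof -
 define a where "a g = u g \<oplus>\<^bsub>ct X (dg g + 0)\<^esub> \<ominus>\<^bsub>ct X (dg g + 0)\<^esub> v g" for g
 obtain w where w: "null Y w (%g. post f u g \<oplus>\<^bsub>ct Y (dg g)\<^esub> \<ominus>\<^bsub>ct Y (dg g)\<^esub> post f v g)"
  using h unfolding homot_def by blast
 have u0: "u g \<in> car X (dg g + 0)" "v g \<in> car X (dg g + 0)" if "g < N" for g
  using cocycD(1) uv that by auto
 have w0: "w g \<in> car Y (dg g + - 1)" if "g < N" for g using nullD(1)[OF w that] by simp
 have ac: "a g \<in> car X (dg g)" if "g < N" for g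
 proof -
  interpret A: left_module R "ct X (dg g)" by (rule f.X.lm)
  show ?thesis unfolding a_def using u0[OF that] by simp
 qed
 have minus_one: "(\<ominus> \<one>) \<odot>\<^bsub>M\<^esub> x = \<ominus>\<^bsub>M\<^esub> x" if "left_module R M" "x \<in> carrier M" for M :: "('a, 'm) module" and x
  using left_module.smult_minus_left[OF that(1) one_closed that(2)] left_module.smult_one[OF that] by simp
 show ?thesis
 proof (rule cone_lift[OF q, of "\<ominus> \<one>" a "-1" "%g. \<ominus>\<^bsub>ct Y (dg g + -1)\<^esub> w g"], goal_cases)
  case 1 show ?case by simp
 next
  case (2 r) then show ?case by (simp add: l_minus r_minus)
 next
  case 3 show ?case by (simp add: l_minus r_minus)
 next
  case (4 g) then show ?case using ac by simp
 next
  case (5 g)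
  interpret A: left_module R "ct X (dg g)" by (rule f.X.lm)
  show ?case
   using u0[OF 5] vtx(1)[OF 5] cocycD(2)[OF uv(1) 5] cocycD(2)[OF uv(2) 5]
   by (simp add: a_def A.smult_r_distr A.smult_minus_right)
 next
  case (6 g)
  interpret A: left_module R "ct X (dg g)" by (rule f.X.lm)
  interpret A1: left_module R "ct X (dg g + 1)" by (rule f.X.lm)
  note c = u0[OF 6, simplified]
  have ag: "a g = u g \<oplus>\<^bsub>ct X (dg g)\<^esub> \<ominus>\<^bsub>ct X (dg g)\<^esub> v g" by (simp add: a_def)
  have um: "\<ominus>\<^bsub>ct X (dg g + 0)\<^esub> v g \<in> car X (dg g + 0)" if "g < N" for g
   using abelian_group.a_inv_closed[OF f.X.abg] u0[OF that] by blast
  have e: "evd X u g \<in> car X (dg g + 1)"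
   "evd X v g \<in> car X (dg g + 1)"
   using 6 by (auto intro!: ev_closed[OF f.X.pre_complex, where m = 0] u0)
  have "evd X a g =
   evd X u g \<oplus>\<^bsub>ct X (dg g + 1)\<^esub>
   evd X (%g. \<ominus>\<^bsub>ct X (dg g + 0)\<^esub> v g) g"
   unfolding a_def using 6 by (intro ev_add[OF f.X.pre_complex] u0 um) auto
  also have "evd X (%g. \<ominus>\<^bsub>ct X (dg g + 0)\<^esub> v g) g =
   \<ominus>\<^bsub>ct X (dg g + 1)\<^esub> evd X v g"
   using 6 by (intro ev_minus[OF f.X.pre_complex] u0) auto
  finally have "cd X (dg g) (a g) = evd X a g"
   using c cocycD(3)[OF uv(1) 6] cocycD(3)[OF uv(2) 6]
   by (simp add: ag f.X.d_add[OF _ _ refl] f.X.d_minus[OF _ refl])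
  moreover have "cd X (dg g) (a g) \<in> car X (dg g + 1)"
   using ac[OF 6] f.X.d_closed by blast
  ultimately show ?case using minus_one[OF A1.left_module_axioms] by simp
 next
  case (7 g) then show ?case using abelian_group.a_inv_closed[OF f.Y.abg] w0 by blast
 next
  case (8 g)
  interpret B: left_module R "ct Y (dg g - 1)" by (rule f.Y.lm)
  show ?case using nullD(1,2)[OF w 8] vtx(1)[OF 8] by (simp add: B.smult_minus_right)
 next
  case (9 g)
  interpret B: left_module R "ct Y (dg g)" by (rule f.Y.lm)
  have e: "evh Y w (dg g) g \<in> car Y (dg g)"
   using 9 by (intro ev_closed[OF f.Y.pre_complex, where m = "-1"] w0) auto
  have d: "cd Y (dg g - 1) (w g) \<in> car Y (dg g)" using w0[OF 9] f.Y.d_closed' by simp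
  have "f (dg g) (a g) = cd Y (dg g - 1) (w g) \<oplus>\<^bsub>ct Y (dg g)\<^esub>
   evh Y w (dg g) g"
   using nullD(3)[OF w 9] 9 u0[OF 9] abelian_group.a_inv_closed[OF f.X.abg, of "v g" "dg g"]
   by (simp add: a_def post_def f.add f.minus)
  moreover have "cd Y (dg g - 1) (\<ominus>\<^bsub>ct Y (dg g - 1)\<^esub> w g) =
   \<ominus>\<^bsub>ct Y (dg g)\<^esub> cd Y (dg g - 1) (w g)"
   using f.Y.d_minus[of "w g" "dg g - 1" "dg g"] w0[OF 9] by simp
  moreover have "evh Y (%g. \<ominus>\<^bsub>ct Y (dg g + - 1)\<^esub> w g) (dg g) g =
   \<ominus>\<^bsub>ct Y (dg g)\<^esub> evh Y w (dg g) g"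
   using 9 by (intro ev_minus[OF f.Y.pre_complex, where m = "-1"] w0) auto
  ultimately show ?case
   using e d minus_one[OF B.left_module_axioms] by (simp add: B.M.a_ac B.M.r_neg1 B.M.r_neg2 B.M.r_neg)
 next
  case (10 p x)
  have p0: "p g \<in> car X (dg g + - 1)" if "g < N" for g using 10(1)[OF that] .
  have "null X (%g. \<ominus>\<^bsub>ct X (dg g - 1)\<^esub> p g) (%g. u g \<oplus>\<^bsub>ct X (dg g)\<^esub> \<ominus>\<^bsub>ct X (dg g)\<^esub> v g)"
   unfolding null_def
  proof (intro allI impI conjI)
   fix g assume g: "g < N"
   interpret A0: left_module R "ct X (dg g - 1)" by (rule f.X.lm)
   interpret A: left_module R "ct X (dg g)" by (rule f.X.lm)
   have p1: "p g \<in> car X (dg g - 1)" using p0[OF g] by simp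
   show "\<ominus>\<^bsub>ct X (dg g - 1)\<^esub> p g \<in> car X (dg g - 1)" using p1 by simp
   show "vtx S g \<odot>\<^bsub>ct X (dg g - 1)\<^esub> (\<ominus>\<^bsub>ct X (dg g - 1)\<^esub> p g) = \<ominus>\<^bsub>ct X (dg g - 1)\<^esub> p g"
    using 10(2)[OF g] p1 vtx(1)[OF g] by (simp add: A0.smult_minus_right)
   have e: "evh X p (dg g) g \<in> car X (dg g)"
    using g by (intro ev_closed[OF f.X.pre_complex, where m = "-1"] p0) auto
   have m: "evh X (%g. \<ominus>\<^bsub>ct X (dg g + - 1)\<^esub> p g) (dg g) g =
    \<ominus>\<^bsub>ct X (dg g)\<^esub> evh X p (dg g) g"
    using g by (intro ev_minus[OF f.X.pre_complex, where m = "-1"] p0) auto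
   have "cd X (dg g - 1) (\<ominus>\<^bsub>ct X (dg g - 1)\<^esub> p g) = \<ominus>\<^bsub>ct X (dg g)\<^esub> cd X (dg g - 1) (p g)"
    using f.X.d_minus[of "p g" "dg g - 1" "dg g"] p1 by simp
   then show "u g \<oplus>\<^bsub>ct X (dg g)\<^esub> \<ominus>\<^bsub>ct X (dg g)\<^esub> v g =
    cd X (dg g - 1) (\<ominus>\<^bsub>ct X (dg g - 1)\<^esub> p g) \<oplus>\<^bsub>ct X (dg g)\<^esub>
    evh X (%g. \<ominus>\<^bsub>ct X (dg g - 1)\<^esub> p g) (dg g) g"
    using 10(3)[OF g] m e minus_one[OF A.left_module_axioms] by (simp add: a_def)
  qed
  then show ?case unfolding homot_def by blast
 qed
qed

lemma bij_hmap:
 assumes q: "f \<in> quasi_isos R X Y"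
 shows "bij_betw (hmap X Y f) (hclass X ` cocyc X) (hclass Y ` cocyc Y)"
proof -
 note surj = cocycle_lift[OF q] and inj = homot_reflect[OF q]
 show ?thesis
  unfolding bij_betw_def
 proof
  show "inj_on (hmap X Y f) (hclass X ` cocyc X)"
   unfolding inj_on_def using inj hclass_eq_iff[OF f.Y.pre_complex] hclass_eq_iff[OF f.X.pre_complex] post_cocyc
   by (auto simp: hmap_hclass)
  show "hmap X Y f ` hclass X ` cocyc X = hclass Y ` cocyc Y"
  proof
   show "hmap X Y f ` hclass X ` cocyc X \<subseteq> hclass Y ` cocyc Y" using post_cocyc by (auto simp: hmap_hclass)
   show "hclass Y ` cocyc Y \<subseteq> hmap X Y f ` hclass X ` cocyc X"
   proof
    fix c assume "c \<in> hclass Y ` cocyc Y"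
    then obtain z where z: "z \<in> cocyc Y" "c = hclass Y z" by blast
    then obtain y where y: "y \<in> cocyc X" "homot Y z (post f y)" using surj by blast
    then have "c = hmap X Y f (hclass X y)"
     using z hclass_eq_iff[OF f.Y.pre_complex] post_cocyc by (simp add: hmap_hclass)
    then show "c \<in> hmap X Y f ` hclass X ` cocyc X" using y by blast
   qed
  qed
 qed
qed

end

text \<open>Homotopy classes form a functor on complexes under which quasi-isomorphisms become
  bijections by \<open>bij_hmap\<close>, so \<open>D.act_ze\<close> lets zigzags act on them
  compatibly with \<open>zigzag_eq\<close>.\<close>

lemma (in semifree) act_D:
 assumes "zigzag_eq (complexes R) (quasi_isos R) A B p q" "t \<in> hclass A ` cocyc A"
 shows "D.act (%X. hclass X ` cocyc X) hmap p t = D.act (%X. hclass X ` cocyc X) hmap q t"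
proof (rule D.act_ze[where T = "%X. hclass X ` cocyc X" and Tm = hmap, OF _ _ _ _ assms], goal_cases)
 case (1 X Y f t)
 then interpret semifree_chain_map R S X Y f
  by (intro semifree_chain_map.intro semifree_axioms chain_map_intro) (auto simp: complexes_def bounded_complex_iff)
 show ?case using 1 post_cocyc by (auto simp: hmap_hclass)
next
 case (2 X t)
 then obtain u where u: "u \<in> cocyc X" "t = hclass X u" by blast
 have "Ident (complexes R) X \<in> chain_maps R X X"
  using localising.Ident_Mor[OF localising_complexes 2(1)] by (simp add: complexes_def)
 then interpret semifree_chain_map R S X X "Ident (complexes R) X"
  using 2 by (intro semifree_chain_map.intro semifree_axioms chain_map_intro) (auto simp: complexes_def bounded_complex_iff)
 have "post (Ident (complexes R) X) u = u"
 proof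
  fix g show "post (Ident (complexes R) X) u g = u g"
   using cocycD(1)[OF u(1), of g] u(1) unfolding cocyc_def
   by (auto simp: post_def complexes_def extensional_def)
 qed
 then show ?case using u by (simp add: hmap_hclass)
next
 case (3 X Y Z f g t)
 then obtain u where u: "u \<in> cocyc X" "t = hclass X u" by blast
 interpret f: semifree_chain_map R S X Y f
  using 3 by (intro semifree_chain_map.intro semifree_axioms chain_map_intro) (auto simp: complexes_def bounded_complex_iff)
 interpret g: semifree_chain_map R S Y Z g
  using 3 by (intro semifree_chain_map.intro semifree_axioms chain_map_intro) (auto simp: complexes_def bounded_complex_iff)
 have "Comp (complexes R) X Y Z g f \<in> chain_maps R X Z"
  using localising.Comp_Mor[OF localising_complexes 3(1-5)] by (simp add: complexes_def)
 then interpret gf: semifree_chain_map R S X Z "Comp (complexes R) X Y Z g f"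
  using 3 by (intro semifree_chain_map.intro semifree_axioms chain_map_intro) (auto simp: complexes_def bounded_complex_iff)
 have "post (Comp (complexes R) X Y Z g f) u = post g (post f u)"
 proof
  fix i show "post (Comp (complexes R) X Y Z g f) u i = post g (post f u) i"
   using cocycD(1)[OF u(1), of i] by (auto simp: post_def complexes_def compose_def)
 qed
 then show ?case using u f.post_cocyc by (simp add: f.hmap_hclass g.hmap_hclass gf.hmap_hclass)
next
 case (4 X Y s)
 then interpret semifree_chain_map R S X Y s
  by (intro semifree_chain_map.intro semifree_axioms chain_map_intro)
   (auto simp: complexes_def bounded_complex_iff quasi_isos_def)
 show ?case using 4 by (intro bij_hmap)
qed

section \<open>Corepresentability by the universal cocycle\<close>

context semifree
begin

text \<open>The chain map out of \<open>sf_obj R S\<close> that corresponds to the cocycle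
  \<open>u\<close>; its arguments are decoded first.\<close>

definition classify :: "('a, 'm) cochain => (nat => 'm) => int => 'a list set => 'm" where
 "classify Z u k = (\<lambda>x\<in>enc ` P k. ev Z S u N k k (inv_into UNIV enc x))"

lemma classify_enc: "r \<in> P k ==> classify Z u k (enc r) = ev Z S u N k k r"
 unfolding classify_def by (simp add: inv_f_f[OF inj_enc])

lemma pre_complex_sf_obj: "pre_complex R (sf_obj R S)"
 using bounded_complex_sf_obj unfolding bounded_complex_iff by blast

lemma classify_chain_map:
 assumes Z: "pre_complex R Z" and u: "u \<in> cocyc Z"
 shows "classify Z u \<in> chain_maps R (sf_obj R S) Z"
proof -
 interpret Z: complex R Z by (rule complex.intro[OF Z])
 have u0: "u g \<in> car Z (dg g + 0)" if "g < N" for g using cocycD(1)[OF u that] by simp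
 have uk: "u g \<in> car Z k" if "g < N" "dg g = k" for g k using cocycD(1)[OF u that(1)] that(2) by simp
 note tr = tr_module_simps[OF inj_enc]
 have hom: "classify Z u k \<in> module_hom R (ct (sf_obj R S) k) (ct Z k)" for k
  unfolding sf_obj_cterm
 proof (rule module_homI, goal_cases)
  case 1 show ?case unfolding tr classify_def by simp
 next
  case (2 x)
  then obtain r where "r \<in> P k" "x = enc r" unfolding tr by auto
  then show ?case using sf_closed by (auto simp: classify_enc intro!: ev_closed[OF Z u0])
 next
  case (3 x y)
  then obtain r q where r: "r \<in> P k" "x = enc r" and q: "q \<in> P k" "y = enc q" unfolding tr by auto
  interpret M: left_module R "ct Z k" by (rule Z.lm)
  have "ev Z S u N k k (%i. r i \<oplus> q i) = ev Z S u N k k r \<oplus>\<^bsub>ct Z k\<^esub> ev Z S u N k k q"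
   unfolding ev_def using sf_closed[OF r(1)] sf_closed[OF q(1)] uk by (intro M.lin_add_left) auto
  then show ?case using r q sf_add[OF _ r(1) q(1)] by (simp add: tr classify_enc)
 next
  case (4 a x)
  then obtain r where r: "r \<in> P k" "x = enc r" unfolding tr by auto
  interpret M: left_module R "ct Z k" by (rule Z.lm)
  have "ev Z S u N k k (%i. a \<otimes> r i) = a \<odot>\<^bsub>ct Z k\<^esub> ev Z S u N k k r"
   unfolding ev_def using sf_closed[OF r(1)] uk 4 by (intro M.lin_smult_left) auto
  then show ?case using r 4 sf_smult[OF _ r(1) 4(1)] by (simp add: tr classify_enc)
 qed
 have comm: "classify Z u (k + 1) (cd (sf_obj R S) k x) = cd Z k (classify Z u k x)"
  if "x \<in> car (sf_obj R S) k" for k x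
 proof -
  obtain r where r: "r \<in> P k" "x = enc r" using \<open>x \<in> _\<close> unfolding sf_obj_carrier by auto
  interpret M: left_module R "ct Z k" by (rule Z.lm)
  interpret M1: left_module R "ct Z (k + 1)" by (rule Z.lm)
  let ?u = "%i. if dg i = k + 1 then u i else (zc Z (k + 1))"
  have "cd Z k (ev Z S u N k k r) =
   lin (ct Z (k + 1)) (%i. cd Z k (if dg i = k then u i else (zc Z k))) N r"
   unfolding ev_def using sf_closed[OF r(1)] uk by (intro M.lin_hom Z.d_zero Z.d_add Z.d_smult) auto
  also have "\<dots> = lin (ct Z (k + 1)) (%g. lin (ct Z (k + 1)) ?u N (att S g)) N r"
  proof (rule M1.lin_cong, goal_cases)
   case (1 i)
   show ?case
   proof (cases "dg i = k")
    case True then show ?thesis using cocycD(3)[OF u 1] by (simp add: ev_def)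
   next
    case False
    then have "r i = \<zero>" using sf_zero[OF r(1)] by blast
    moreover have "lin (ct Z (k + 1)) ?u N (att S i) \<in> car Z (k + 1)"
     using 1 uk by (intro M1.lin_closed) auto
    ultimately show ?thesis using False by (simp add: Z.d_zero)
   qed
  qed
  also have "\<dots> = lin (ct Z (k + 1)) ?u N (dif r)"
   using sf_closed[OF r(1)] uk by (intro lin_lin[symmetric] Z.lm) auto
  finally show ?thesis using r lin_att_sf by (simp add: sf_obj_cdiff classify_enc ev_def)
 qed
 show ?thesis unfolding chain_maps_def using hom comm by blast
qed

text \<open>The cocycle of the identity.\<close>

definition univ :: "nat => 'a list set" where
 "univ = (\<lambda>g\<in>{..<N}. enc (gen g))"

lemma lin_att_gen: "g < N ==> dif (gen g) = att S g"
 unfolding gen_def using F.lin_single[of g N "vtx S g" "att S"] vtx(1) vtx_att by simp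

lemma univ_cocyc: "univ \<in> cocyc (sf_obj R S)"
 unfolding cocyc_def
proof (intro CollectI conjI allI impI)
 show "univ \<in> extensional {..<N}" unfolding univ_def by simp
 fix g assume g: "g < N"
 note tr = tr_module_simps[OF inj_enc]
 show "univ g \<in> car (sf_obj R S) (dg g)"
  unfolding sf_obj_carrier univ_def using g gen_closed by simp
 show "vtx S g \<odot>\<^bsub>ct (sf_obj R S) (dg g)\<^esub> univ g = univ g"
 proof -
  have "(%i. vtx S g \<otimes> gen g i) = gen g" unfolding gen_def using g vtx by auto
  then show ?thesis unfolding sf_obj_cterm univ_def using g by (simp add: tr)
 qed
 define k where "k = dg g + 1"
 interpret M: left_module R "F\<lparr>carrier := P k\<rparr>" by (rule sf_lm)
 have a: "att S g \<in> P k" using sf_mono[OF att_sf[OF g]] g unfolding k_def by simp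
 have "ev (sf_obj R S) S univ N k k (att S g) =
  lin (tr_module enc (F\<lparr>carrier := P k\<rparr>)) (%i. enc (if dg i = k then gen i else \<zero>\<^bsub>F\<^esub>)) N (att S g)"
 proof -
  interpret T: left_module R "tr_module enc (F\<lparr>carrier := P k\<rparr>)" by (rule left_module_tr[OF inj_enc sf_lm])
  show ?thesis unfolding ev_def sf_obj_cterm
   by (intro T.lin_cong) (simp add: univ_def tr)
 qed
 also have "\<dots> = enc (lin (F\<lparr>carrier := P k\<rparr>) (%i. if dg i = k then gen i else \<zero>\<^bsub>F\<^esub>) N (att S g))"
  using a g gen_closed sf_0 by (intro M.lin_hom[symmetric]) (auto simp: tr)
 also have "\<dots> = enc (att S g)" using lin_gen[OF a] by (simp add: lin_upd)
 finally show "cd (sf_obj R S) (dg g) (univ g) =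
  evd (sf_obj R S) univ g"
  unfolding k_def[symmetric] using g gen_closed by (simp add: univ_def sf_obj_cdiff lin_att_gen)
qed

text \<open>The Yoneda argument: the g-th generator has the single coefficient
  \<open>vtx S g\<close>, which fixes \<open>u g\<close>, so evaluating the classified map at the
  universal cocycle gives back \<open>u\<close>.\<close>

lemma post_univ:
 assumes Z: "pre_complex R Z" and u: "u \<in> cocyc Z"
 shows "post (classify Z u) univ = u"
proof
 fix g
 interpret Z: complex R Z by (rule complex.intro[OF Z])
 show "post (classify Z u) univ g = u g"
 proof (cases "g < N")
  case True
  interpret M: left_module R "ct Z (dg g)" by (rule Z.lm)
  have "u i \<in> car Z (dg g)" if "i < N" "dg i = dg g" for i
   using cocycD(1)[OF u that(1)] that(2) by simp
  then have "ev Z S u N (dg g) (dg g) (gen g) = u g"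
   unfolding ev_def gen_def using True vtx(1) cocycD(2)[OF u True]
   by (subst M.lin_single) auto
  then show ?thesis using True gen_closed by (simp add: post_def univ_def classify_enc)
 next
  case False
  then show ?thesis using u unfolding cocyc_def post_def by (auto simp: extensional_def)
 qed
qed

definition zero_cocyc :: "('a, 'm) cochain => nat => 'm" where
 "zero_cocyc Z = (\<lambda>g\<in>{..<N}. (zc Z (dg g)))"

lemma zero_cocyc:
 assumes Z: "pre_complex R Z" shows "zero_cocyc Z \<in> cocyc Z"
 unfolding cocyc_def
proof (intro CollectI conjI allI impI)
 interpret Z: complex R Z by (rule complex.intro[OF Z])
 fix g assume g: "g < N"
 interpret M: left_module R "ct Z (dg g)" by (rule Z.lm)
 show "zero_cocyc Z g \<in> car Z (dg g)"
  "vtx S g \<odot>\<^bsub>ct Z (dg g)\<^esub> zero_cocyc Z g = zero_cocyc Z g"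
  using g vtx(1)[OF g] unfolding zero_cocyc_def by simp_all
 have "evd Z (zero_cocyc Z) g =
  evd Z (%g. (zc Z (dg g))) g"
  by (intro ev_cong[OF Z]) (simp add: zero_cocyc_def)
 also have "\<dots> = (zc Z (dg g + 1))" using g by (intro ev_zero[OF Z]) auto
 finally show "cd Z (dg g) (zero_cocyc Z g) = evd Z (zero_cocyc Z) g"
  using g by (simp add: zero_cocyc_def Z.d_zero[OF refl])
qed (simp add: zero_cocyc_def)

text \<open>In a thin hom-set the morphisms classified by \<open>u\<close> and \<open>v\<close>
  coincide. Letting both act on the class of \<open>univ\<close> produces the classes of
  \<open>u\<close> and \<open>v\<close>, which are therefore equal.\<close>

lemma thin_imp_homot:
 assumes Z: "bounded_complex R Z" and thin: "thin (derived_cat R) (sf_obj R S) Z"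
  and u: "u \<in> cocyc Z" and v: "v \<in> cocyc Z"
 shows "homot Z u v"
proof -
 have Z': "pre_complex R Z" using Z unfolding bounded_complex_iff by blast
 have zz: "zigzag (complexes R) (quasi_isos R) (sf_obj R S) [Fwd (sf_obj R S) Z (classify Z u)] Z"
  if "u \<in> cocyc Z" for u
  using classify_chain_map[OF Z' that] bounded_complex_sf_obj Z
  by (intro localising.zz_Fwd[OF localising_complexes]) (auto simp: complexes_def)
 have "zigzag_eq (complexes R) (quasi_isos R) (sf_obj R S) Z
  [Fwd (sf_obj R S) Z (classify Z u)] [Fwd (sf_obj R S) Z (classify Z v)]"
  using thin zz[OF u] zz[OF v] unfolding derived_cat_def localising.thin_L[OF localising_complexes] by blast
 from act_D[OF this imageI[OF univ_cocyc]]
 have "hmap (sf_obj R S) Z (classify Z u) (hclass (sf_obj R S) univ) =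
  hmap (sf_obj R S) Z (classify Z v) (hclass (sf_obj R S) univ)" by simp
 moreover have "hmap (sf_obj R S) Z (classify Z u) (hclass (sf_obj R S) univ) = hclass Z u" if "u \<in> cocyc Z" for u
 proof -
  interpret semifree_chain_map R S "sf_obj R S" Z "classify Z u"
   using pre_complex_sf_obj Z' classify_chain_map[OF Z' that]
   by (intro semifree_chain_map.intro semifree_axioms chain_map_intro) auto
  show ?thesis by (simp add: hmap_hclass univ_cocyc post_univ[OF Z' that])
 qed
 ultimately show ?thesis using u v hclass_eq_iff[OF Z' u v] by simp
qed

end

section \<open>Points, cylinders and morphisms out of a point\<close>

definition sf_point :: "'a ring => 'a => int => 'a semifree" where
 "sf_point R e d = \<lparr>gens = Suc 0, vtx = (%_. e), degr = (%_. d), att = (%_ _. \<zero>\<^bsub>R\<^esub>)\<rparr>"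

text \<open>Two copies \<open>x\<^sub>0\<close>, \<open>x\<^sub>1\<close> of the generator in degree
  \<open>d\<close> and one generator \<open>x\<^sub>2\<close> in degree \<open>d - 1\<close> with
  differential \<open>x\<^sub>1 - x\<^sub>0\<close>. Maps out of it are homotopies between maps out
  of the point.\<close>

definition sf_cylinder :: "'a ring => 'a => int => 'a semifree" where
 "sf_cylinder R e d = \<lparr>gens = Suc (Suc (Suc 0)), vtx = (%_. e), degr = (%i. if i = 2 then d - 1 else d),
   att = (%g i. if g = 2 & i = 0 then \<ominus>\<^bsub>R\<^esub> e else if g = 2 & i = 1 then e else \<zero>\<^bsub>R\<^esub>)\<rparr>"

context semifree
begin

lemma classify_post:
 assumes X: "pre_complex R X" and Y: "pre_complex R Y" and f: "f \<in> chain_maps R X Y" and u: "u \<in> cocyc X"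
 shows "Comp (complexes R) (sf_obj R S) X Y f (classify X u) = classify Y (post f u)"
proof -
 interpret semifree_chain_map R S X Y f
  using X Y f by (intro semifree_chain_map.intro semifree_axioms chain_map_intro)
 have "f k (ev X S u N k k r) = ev Y S (post f u) N k k r" if "r \<in> P k" for k r
 proof -
  have "f k (ev X S u N k k r) = ev Y S (%g. f (degr S g + 0) (u g)) N k k r"
   using that sf_closed cocycD(1)[OF u] by (intro ev_f) auto
  also have "\<dots> = ev Y S (post f u) N k k r" by (intro ev_cong[OF Y]) (simp add: post_def)
  finally show ?thesis .
 qed
 then show ?thesis
  unfolding complexes_def
  by (auto simp: fun_eq_iff compose_def sf_obj_carrier classify_enc) (auto simp: classify_def)
qed

lemma classify_univ: "classify (sf_obj R S) univ = Ident (complexes R) (sf_obj R S)"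
proof -
 have "ev (sf_obj R S) S univ N k k r = enc r" if r: "r \<in> P k" for k r
 proof -
  note tr = tr_module_simps[OF inj_enc]
  interpret M: left_module R "F\<lparr>carrier := P k\<rparr>" by (rule sf_lm)
  interpret T: left_module R "tr_module enc (F\<lparr>carrier := P k\<rparr>)" by (rule left_module_tr[OF inj_enc sf_lm])
  have "ev (sf_obj R S) S univ N k k r =
   lin (tr_module enc (F\<lparr>carrier := P k\<rparr>)) (%i. enc (if degr S i = k then gen i else \<zero>\<^bsub>F\<^esub>)) N r"
   unfolding ev_def sf_obj_cterm by (intro T.lin_cong) (simp add: univ_def tr)
  also have "\<dots> = enc (lin (F\<lparr>carrier := P k\<rparr>) (%i. if degr S i = k then gen i else \<zero>\<^bsub>F\<^esub>) N r)"
   using r gen_closed sf_0 sf_closed by (intro M.lin_hom[symmetric]) (auto simp: tr)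
  finally show ?thesis using lin_gen[OF r] by (simp add: lin_upd)
 qed
 then show ?thesis
  by (auto simp: fun_eq_iff complexes_def sf_obj_carrier classify_enc) (auto simp: classify_def)
qed

text \<open>Induction along the zigzag keeps a single forward step in front of it. A forward step is
  composed; a backward step along a quasi-isomorphism is crossed by lifting the cocycle up to
  homotopy, which is where \<open>homot_eq\<close> is consumed. That premise is discharged for
  points by \<open>homot_ze\<close>.\<close>

lemma zigzag_classify:
 assumes homot_eq: "!!Y u v. bounded_complex R Y ==> u \<in> cocyc Y ==> v \<in> cocyc Y ==> homot Y u v ==>
   zigzag_eq (complexes R) (quasi_isos R) (sf_obj R S) Y
    [Fwd (sf_obj R S) Y (classify Y u)] [Fwd (sf_obj R S) Y (classify Y v)]"
  and p: "zigzag (complexes R) (quasi_isos R) (sf_obj R S) p Z"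
 shows "\<exists>u\<in>cocyc Z. zigzag_eq (complexes R) (quasi_isos R) (sf_obj R S) Z p
  [Fwd (sf_obj R S) Z (classify Z u)]"
proof -
 let ?P = "sf_obj R S" and ?C = "complexes R" and ?W = "quasi_isos R"
 have PObj: "?P \<in> Obj ?C" using bounded_complex_sf_obj by (simp add: complexes_def)
 have pc: "pre_complex R X" if "X \<in> Obj ?C" for X :: "('a, 'a list set) cochain"
  using that by (auto simp: complexes_def bounded_complex_iff)
 have zzc: "zigzag ?C ?W ?P [Fwd ?P X (classify X u)] X" if "X \<in> Obj ?C" "u \<in> cocyc X" for X u
  using classify_chain_map[OF pc that(2)] that PObj
  by (intro localising.zz_Fwd[OF localising_complexes]) (auto simp: complexes_def)
 have "\<exists>v\<in>cocyc B. zigzag_eq ?C ?W ?P B (Fwd ?P A (classify A u) # p) [Fwd ?P B (classify B v)]"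
  if "zigzag ?C ?W A p B" "u \<in> cocyc A" for A p B u
  using that
 proof (induction arbitrary: u rule: zigzag.induct)
  case (zz_nil X)
  then show ?case using zigzag_eq.ze_refl[OF zzc[OF zz_nil]] by blast
 next
  case (zz_fwd X f Y p Z)
  have Y: "Y \<in> Obj ?C" using zz_fwd(3) localising.zz_Obj[OF localising_complexes] by blast
  have f: "f \<in> chain_maps R X Y" using zz_fwd(2) by (simp add: complexes_def)
  interpret semifree_chain_map R S X Y f
   using pc[OF zz_fwd(1)] pc[OF Y] f by (intro semifree_chain_map.intro semifree_axioms chain_map_intro)
  obtain v where v: "v \<in> cocyc Z"
   "zigzag_eq ?C ?W ?P Z (Fwd ?P Y (classify Y (post f u)) # p) [Fwd ?P Z (classify Z v)]"
   using zz_fwd.IH post_cocyc zz_fwd.prems by blast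
  have "classify X u \<in> Mor ?C ?P X"
   using classify_chain_map[OF pc[OF zz_fwd(1)] zz_fwd.prems] by (simp add: complexes_def)
  then have "zigzag_eq ?C ?W ?P Z ([] @ [Fwd ?P X (classify X u), Fwd X Y f] @ p)
   ([] @ [Fwd ?P Y (Comp ?C ?P X Y f (classify X u))] @ p)"
   using PObj zz_fwd by (intro zigzag_eq.ze_comp zigzag.zz_nil) auto
  then show ?case
   using v zigzag_eq.ze_trans classify_post[OF pc[OF zz_fwd(1)] pc[OF Y] f zz_fwd.prems] by fastforce
 next
  case (zz_bwd Y s X p Z)
  have X: "X \<in> Obj ?C" using zz_bwd(3) localising.zz_Obj[OF localising_complexes] by blast
  have s: "s \<in> chain_maps R X Y" using zz_bwd(2) by (simp add: quasi_isos_def)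
  interpret semifree_chain_map R S X Y s
   using pc[OF X] pc[OF zz_bwd(1)] s by (intro semifree_chain_map.intro semifree_axioms chain_map_intro)
  obtain y where y: "y \<in> cocyc X" "homot Y u (post s y)" using cocycle_lift[OF zz_bwd(2) zz_bwd.prems] by blast
  obtain v where v: "v \<in> cocyc Z"
   "zigzag_eq ?C ?W ?P Z (Fwd ?P X (classify X y) # p) [Fwd ?P Z (classify Z v)]"
   using zz_bwd.IH y(1) by blast
  have zp: "zigzag ?C ?W Y (Bwd X Y s # p) Z" using zz_bwd by (intro zigzag.zz_bwd)
  have "zigzag_eq ?C ?W ?P Y [Fwd ?P Y (classify Y u)] [Fwd ?P Y (classify Y (post s y))]"
   using zz_bwd y post_cocyc by (intro homot_eq) (auto simp: complexes_def)
  from localising.ze_append_right[OF localising_complexes this zp]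
  have 1: "zigzag_eq ?C ?W ?P Z (Fwd ?P Y (classify Y u) # Bwd X Y s # p)
   (Fwd ?P Y (classify Y (post s y)) # Bwd X Y s # p)" by simp
  have "classify X y \<in> Mor ?C ?P X" "s \<in> Mor ?C X Y"
   using classify_chain_map[OF pc[OF X] y(1)] s by (auto simp: complexes_def)
  then have "zigzag_eq ?C ?W ?P Z ([] @ [Fwd ?P X (classify X y), Fwd X Y s] @ Bwd X Y s # p)
   ([] @ [Fwd ?P Y (Comp ?C ?P X Y s (classify X y))] @ Bwd X Y s # p)"
   using PObj X zp by (intro zigzag_eq.ze_comp zigzag.zz_nil) auto
  then have 2: "zigzag_eq ?C ?W ?P Z (Fwd ?P Y (classify Y (post s y)) # Bwd X Y s # p)
   (Fwd ?P X (classify X y) # Fwd X Y s # Bwd X Y s # p)"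
   using classify_post[OF pc[OF X] pc[OF zz_bwd(1)] s y(1)] zigzag_eq.ze_sym by fastforce
  have "zigzag_eq ?C ?W ?P Z ([Fwd ?P X (classify X y)] @ [Fwd X Y s, Bwd X Y s] @ p) ([Fwd ?P X (classify X y)] @ p)"
   using zzc[OF X y(1)] zz_bwd by (intro zigzag_eq.ze_inv1) auto
  then have 3: "zigzag_eq ?C ?W ?P Z (Fwd ?P X (classify X y) # Fwd X Y s # Bwd X Y s # p) (Fwd ?P X (classify X y) # p)"
   by simp
  show ?case using v zigzag_eq.ze_trans[OF 1 zigzag_eq.ze_trans[OF 2 zigzag_eq.ze_trans[OF 3 v(2)]]] by blast
 qed
 \<comment> \<open>The identity of the semi-free object, inserted as the map classified by
   \<open>univ\<close>, starts the induction.\<close>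
 then obtain v where v: "v \<in> cocyc Z"
  "zigzag_eq ?C ?W ?P Z (Fwd ?P ?P (classify ?P univ) # p) [Fwd ?P Z (classify Z v)]"
  using p univ_cocyc by blast
 have "zigzag_eq ?C ?W ?P Z ([] @ [Fwd ?P ?P (Ident ?C ?P)] @ p) ([] @ p)"
  using PObj p by (intro zigzag_eq.ze_ident zigzag.zz_nil)
 then have "zigzag_eq ?C ?W ?P Z p (Fwd ?P ?P (classify ?P univ) # p)"
  unfolding classify_univ using zigzag_eq.ze_sym by fastforce
 from zigzag_eq.ze_trans[OF this v(2)] show ?thesis using v(1) by blast
qed

end

locale sf_pt = ring R for R :: "'a ring" (structure) +
 fixes e :: 'a and d :: int
 assumes e: "e \<in> carrier R" "e \<otimes> e = e"
begin

abbreviation "pt \<equiv> sf_point R e d"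
abbreviation "cyl \<equiv> sf_cylinder R e d"

sublocale p: semifree R pt
 using e by unfold_locales (auto simp: is_semifree_def sf_point_def sf_carrier_def)

lemma cyl_att: "att cyl g = (if g = 2 then (%i::nat. if i = 0 then \<ominus> e else if i = 1 then e else \<zero>) else (%_. \<zero>))"
 unfolding sf_cylinder_def by (auto simp: fun_eq_iff)

lemma cyl_lin:
 assumes "!!i. r i \<in> carrier R" "r 2 \<otimes> e = r 2"
 shows "lin (fmod R) (att cyl) (gens cyl) r = (%i::nat. if i = 0 then \<ominus> r 2 else if i = 1 then r 2 else \<zero>)"
 using assms e by (auto simp: sf_cylinder_def fun_eq_iff r_minus numeral_2_eq_2)

sublocale c: semifree R cyl
proof (unfold_locales, unfold is_semifree_def, intro allI impI conjI)
 fix g i assume g: "g < gens cyl"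
 show "vtx cyl g \<in> carrier R" "vtx cyl g \<otimes> vtx cyl g = vtx cyl g" using e by (auto simp: sf_cylinder_def)
 show "vtx cyl g \<otimes> att cyl g i = att cyl g i" using e by (simp add: cyl_att r_minus) (simp add: sf_cylinder_def r_minus)
 show "att cyl g \<in> sf_carrier R cyl g (degr cyl g + 1)"
  using e by (auto simp: cyl_att sf_carrier_def sf_cylinder_def l_minus)
 show "lin (fmod R) (att cyl) (gens cyl) (att cyl g) = (%i. \<zero>)"
  using e by (subst cyl_lin) (auto simp: cyl_att)
qed

lemma pt_carrier: "r \<in> p.P k \<longleftrightarrow> (\<forall>i. r i \<in> carrier R & r i \<otimes> e = r i & (i = 0 & k = d \<or> r i = \<zero>))"
proof -
 have "(if i < gens pt & degr pt i = k then r i \<in> carrier R & r i \<otimes> vtx pt i = r i else r i = \<zero>) \<longleftrightarrow>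
  r i \<in> carrier R & r i \<otimes> e = r i & (i = 0 & k = d \<or> r i = \<zero>)" for i
  using e by (cases "i = 0") (auto simp: sf_point_def)
 then show ?thesis unfolding sf_carrier_def by blast
qed

lemma cyl_carrier: "r \<in> c.P k \<longleftrightarrow>
  (\<forall>i. r i \<in> carrier R & r i \<otimes> e = r i & (i < 2 & k = d \<or> i = 2 & k = d - 1 \<or> r i = \<zero>))"
proof -
 have "(if i < gens cyl & degr cyl i = k then r i \<in> carrier R & r i \<otimes> vtx cyl i = r i else r i = \<zero>) \<longleftrightarrow>
  r i \<in> carrier R & r i \<otimes> e = r i & (i < 2 & k = d \<or> i = 2 & k = d - 1 \<or> r i = \<zero>)" for i
  using e by (cases "i < 2"; cases "i = 2") (auto simp: sf_cylinder_def)
 then show ?thesis unfolding sf_carrier_def by blast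
qed

abbreviation "PO \<equiv> sf_obj R pt"
abbreviation "CO \<equiv> sf_obj R cyl"

text \<open>The projection of the cylinder onto the point: both ends go to the generator, the middle
  generator goes to zero.\<close>

definition proj_coc :: "nat => 'a list set" where
 "proj_coc = (\<lambda>g\<in>{..<gens cyl}. enc (if g < 2 then p.gen 0 else (%_. \<zero>)))"

lemma cyl_simps: "gens cyl = Suc (Suc (Suc 0))" "vtx cyl g = e" "degr cyl g = (if g = 2 then d - 1 else d)"
 unfolding sf_cylinder_def by auto

lemma pt_simps: "gens pt = Suc 0" "vtx pt g = e" "degr pt g = d" "att pt g = (%_. \<zero>)"
 unfolding sf_point_def by auto

lemma ev_cyl:
 assumes Z: "pre_complex R Z" and u: "!!g. g < 3 ==> u g \<in> car Z (degr cyl g)" and k: "k = d"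
 shows "ev Z cyl u (gens cyl) k k (att cyl 2) =
  \<ominus>\<^bsub>ct Z k\<^esub> (e \<odot>\<^bsub>ct Z k\<^esub> u 0) \<oplus>\<^bsub>ct Z k\<^esub> e \<odot>\<^bsub>ct Z k\<^esub> u 1"
proof -
 interpret M: left_module R "ct Z k" using Z by (simp add: pre_complex_def)
 have "u 0 \<in> car Z k" "u 1 \<in> car Z k" using u[of 0] u[of 1] k by (auto simp: cyl_simps)
 moreover have "degr cyl 0 = k" "degr cyl (Suc 0) = k" "degr cyl (Suc (Suc 0)) ~= k"
  using k by (auto simp: cyl_simps)
 ultimately show ?thesis
  unfolding ev_def using e by (simp add: cyl_simps(1) cyl_att M.smult_minus_left M.smult_closed)
qed

lemma cyl_cocycI:
 assumes Z: "pre_complex R Z" and ext: "u \<in> extensional {..<gens cyl}"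
  and u: "!!g. g < 3 ==> u g \<in> car Z (degr cyl g)"
   "!!g. g < 3 ==> e \<odot>\<^bsub>ct Z (degr cyl g)\<^esub> u g = u g"
  and du: "cd Z d (u 0) = (zc Z (d + 1))" "cd Z d (u 1) = (zc Z (d + 1))"
   "cd Z (d - 1) (u 2) = \<ominus>\<^bsub>ct Z d\<^esub> u 0 \<oplus>\<^bsub>ct Z d\<^esub> u 1"
 shows "u \<in> c.cocyc Z"
 unfolding c.cocyc_def
proof (intro CollectI conjI allI impI)
 fix g assume g: "g < gens cyl"
 then have g3: "g < 3" by (simp add: cyl_simps)
 show "u g \<in> car Z (degr cyl g)" "vtx cyl g \<odot>\<^bsub>ct Z (degr cyl g)\<^esub> u g = u g"
  using u[OF g3] by (auto simp: cyl_simps)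
 have z: "ev Z cyl u (gens cyl) (d + 1) (d + 1) (%_. \<zero>) = (zc Z (d + 1))"
 proof -
  interpret M: left_module R "ct Z (d + 1)" using Z by (simp add: pre_complex_def)
  show ?thesis unfolding ev_def using u[of 0] by (intro M.lin_zero) (auto simp: cyl_simps)
 qed
 have "u 0 \<in> car Z d" "e \<odot>\<^bsub>ct Z d\<^esub> u 0 = u 0" "e \<odot>\<^bsub>ct Z d\<^esub> u 1 = u 1"
  using u[of 0] u[of 1] by (auto simp: cyl_simps)
 then have 2: "ev Z cyl u (gens cyl) d d (att cyl 2) = \<ominus>\<^bsub>ct Z d\<^esub> u 0 \<oplus>\<^bsub>ct Z d\<^esub> u 1"
  using ev_cyl[OF Z u(1) refl] by simp
 consider "g = 0" | "g = 1" | "g = 2" using g3 by linarith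
 then show "cd Z (degr cyl g) (u g) = ev Z cyl u (gens cyl) (degr cyl g + 1) (degr cyl g + 1) (att cyl g)"
 proof cases
  case 1 then show ?thesis using z du(1) by (simp add: cyl_simps(3) cyl_att)
 next
  case 2 then show ?thesis using z du(2) by (simp add: cyl_simps(3) cyl_att)
 next
  case 3 then show ?thesis using 2 du(3) by (simp add: cyl_simps(3))
 qed
qed (rule ext)

lemma proj_coc: "proj_coc \<in> c.cocyc PO"
proof (rule cyl_cocycI[OF p.pre_complex_sf_obj])
 note tr = tr_module_simps[OF inj_enc]
 have g0: "p.gen 0 = (%i::nat. if i = 0 then e else \<zero>)" unfolding p.gen_def by (auto simp: pt_simps)
 have gP: "p.gen 0 \<in> p.P d" using e by (auto simp: pt_carrier g0)
 show "proj_coc \<in> extensional {..<gens cyl}" unfolding proj_coc_def by simp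
 fix g :: nat assume g: "g < 3"
 show "proj_coc g \<in> car PO (degr cyl g)"
  using g gP p.sf_0 by (auto simp: proj_coc_def p.sf_obj_carrier cyl_simps)
 show "e \<odot>\<^bsub>ct PO (degr cyl g)\<^esub> proj_coc g = proj_coc g"
  using g e by (auto simp: proj_coc_def p.sf_obj_cterm tr cyl_simps g0 intro!: arg_cong[where f = enc])
next
 note tr = tr_module_simps[OF inj_enc]
 have g0: "p.gen 0 = (%i::nat. if i = 0 then e else \<zero>)" unfolding p.gen_def by (auto simp: pt_simps)
 have gP: "p.gen 0 \<in> p.P d" using e by (auto simp: pt_carrier g0)
 have z: "(%i. \<zero>) \<in> p.P k" for k by (auto simp: pt_carrier e)
 have D: "cd PO k (enc r) = enc (%i. \<zero>)" if "r \<in> p.P k" for k r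
  using that p.sf_closed[OF that] by (simp add: p.sf_obj_cdiff) (simp add: pt_simps)
 show "cd PO d (proj_coc 0) = (zc PO (d + 1))" "cd PO d (proj_coc 1) = (zc PO (d + 1))"
  using D[OF gP] by (auto simp: proj_coc_def cyl_simps p.sf_obj_cterm tr)
 interpret M: left_module R "ct PO d" using p.pre_complex_sf_obj by (simp add: pre_complex_def)
 have "enc (p.gen 0) \<in> car PO d" using gP by (simp add: p.sf_obj_carrier)
 then show "cd PO (d - 1) (proj_coc 2) = \<ominus>\<^bsub>ct PO d\<^esub> proj_coc 0 \<oplus>\<^bsub>ct PO d\<^esub> proj_coc 1"
  using D[OF z, of "d - 1"] M.l_neg[of "enc (p.gen 0)"]
  by (simp add: proj_coc_def cyl_simps) (simp add: p.sf_obj_cterm tr)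
qed

lemma p_gen: "p.gen 0 = (%i::nat. if i = 0 then e else \<zero>)"
 unfolding p.gen_def by (auto simp: pt_simps)

lemma classify_proj:
 assumes r: "r \<in> c.P k"
 shows "c.classify PO proj_coc k (enc r) = enc (%i::nat. if i = 0 then r 0 \<oplus> r 1 else \<zero>)"
proof -
 note tr = tr_module_simps[OF inj_enc]
 have r': "r i \<in> carrier R" "r i \<otimes> e = r i" "k ~= d ==> i < 2 ==> r i = \<zero>" for i
  using r[unfolded cyl_carrier, rule_format, of i] by auto
 let ?z = "enc (%_. \<zero>)"
 have "lin (ct PO k) (%i. if degr cyl i = k then proj_coc i else (zc PO k)) (gens cyl) r =
  lin (ct PO k) (%i. enc (if degr cyl i = k & i < 2 then p.gen 0 else (%_. \<zero>))) (gens cyl) r"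
 proof -
  interpret M: left_module R "ct PO k" using p.pre_complex_sf_obj by (simp add: pre_complex_def)
  show ?thesis by (intro M.lin_cong) (auto simp: proj_coc_def p.sf_obj_cterm tr)
 qed
 also have "\<dots> = enc (lin (fmod R) (%i. if degr cyl i = k & i < 2 then p.gen 0 else (%_. \<zero>)) (gens cyl) r)"
  using e r'(1) by (intro p.F.lin_hom[symmetric]) (auto simp: p.sf_obj_cterm tr p_gen)
 also have "lin (fmod R) (%i. if degr cyl i = k & i < 2 then p.gen 0 else (%_. \<zero>)) (gens cyl) r =
  (%i::nat. if i = 0 then r 0 \<oplus> r 1 else \<zero>)"
  using r'(1,2) r'(3)[of 0] r'(3)[of 1] e unfolding p_gen by (auto simp: cyl_simps fun_eq_iff)
 finally show ?thesis using r by (simp add: c.classify_enc ev_def)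
qed

lemma cyl_cdiff:
 assumes "r \<in> c.P k"
 shows "cd CO k (enc r) = enc (%i::nat. if i = 0 then \<ominus> r 2 else if i = 1 then r 2 else \<zero>)"
 using assms cyl_lin[of r] by (simp add: c.sf_obj_cdiff cyl_carrier)

text \<open>A cocycle of the cylinder has no component at \<open>x\<^sub>2\<close>, and the cocycles
  killed by the projection are the multiples of \<open>x\<^sub>1 - x\<^sub>0\<close>, which are
  boundaries. For surjectivity the end \<open>x\<^sub>0\<close> serves as a section.\<close>

lemma proj_quasi_iso: "c.classify PO proj_coc \<in> quasi_isos R CO PO"
proof -
 interpret f: chain_map R CO PO "c.classify PO proj_coc"
  by (rule chain_map_intro[OF c.pre_complex_sf_obj p.pre_complex_sf_obj
   c.classify_chain_map[OF p.pre_complex_sf_obj proj_coc]])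
 note tr = tr_module_simps[OF inj_enc]
 have zero: "(zc PO k) = enc (%_. \<zero>)" "(zc CO k) = enc (%_. \<zero>)" for k
  by (simp_all add: p.sf_obj_cterm c.sf_obj_cterm tr)
 have encI: "enc r = enc q \<longleftrightarrow> r = q" for r q :: "nat => 'a" using inj_enc by (auto dest: injD)
 show ?thesis
  unfolding f.quasi_isos_iff
 proof (intro allI conjI ballI impI)
  fix k z assume "z \<in> cocycles PO k"
  then obtain r where r: "r \<in> p.P k" "z = enc r" unfolding cocycles_def p.sf_obj_carrier by blast
  have r0: "r i \<in> carrier R & r i \<otimes> e = r i & (i = 0 & k = d \<or> r i = \<zero>)" for i
   using r(1) unfolding pt_carrier by blast
  have rc: "r \<in> c.P k"
   unfolding cyl_carrier
  proof
   fix i show "r i \<in> carrier R & r i \<otimes> e = r i & (i < 2 & k = d \<or> i = 2 & k = d - 1 \<or> r i = \<zero>)"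
    using r0[of i] by auto
  qed
  have r2: "r 2 = \<zero>" "r 1 = \<zero>" using r0[of 2] r0[of 1] by auto
  have "(%i::nat. if i = 0 then \<ominus> r 2 else if i = 1 then r 2 else \<zero>) = (%_. \<zero>)" using r2 by auto
  then have "enc r \<in> cocycles CO k"
   unfolding cocycles_def c.sf_obj_carrier using rc by (simp add: cyl_cdiff zero)
  moreover have "(%i::nat. if i = 0 then r 0 \<oplus> r 1 else \<zero>) = r"
  proof
   fix i show "(if i = 0 then r 0 \<oplus> r 1 else \<zero>) = r i" using r0[of i] r2 by auto
  qed
  then have "c.classify PO proj_coc k (enc r) = z" using classify_proj[OF rc] r by simp
  moreover have "z \<in> car PO k" using r by (simp add: p.sf_obj_carrier)
  ultimately show "\<exists>x\<in>cocycles CO k. \<exists>b\<in>coboundaries PO k. z = b \<oplus>\<^bsub>ct PO k\<^esub> c.classify PO proj_coc k x"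
   using f.Y.coboundaries_subgroup(2)[of k] abelian_monoid.l_zero[OF abelian_group.axioms(1)[OF f.Y.abg[of k]], of z]
   by (metis (no_types, lifting))
 next
  fix k x assume "x \<in> cocycles CO k" and b: "c.classify PO proj_coc k x \<in> coboundaries PO k"
  then obtain r where r: "r \<in> c.P k" "x = enc r" and dr: "cd CO k (enc r) = (zc CO (k + 1))"
   unfolding cocycles_def c.sf_obj_carrier by auto
  have r': "r i \<in> carrier R" "r i \<otimes> e = r i" "i < 2 & k = d \<or> i = 2 & k = d - 1 \<or> r i = \<zero>" for i
   using r(1) by (auto simp: cyl_carrier)
  have "(%i::nat. if i = 0 then \<ominus> r 2 else if i = 1 then r 2 else \<zero>) = (%_. \<zero>)"
   using dr r by (simp add: cyl_cdiff zero encI)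
  from fun_cong[OF this, of 1] have r2: "r 2 = \<zero>" by (simp split: if_splits)
  obtain q where q: "q \<in> p.P (k - 1)" "c.classify PO proj_coc k x = cd PO (k - 1) (enc q)"
   using b unfolding coboundaries_def p.sf_obj_carrier by blast
  have "cd PO (k - 1) (enc q) = enc (%_. \<zero>)"
   using q(1) p.sf_closed[OF q(1)] by (simp add: p.sf_obj_cdiff) (simp add: pt_simps)
  then have "(%i::nat. if i = 0 then r 0 \<oplus> r 1 else \<zero>) = (%_. \<zero>)"
   using q(2) classify_proj[OF r(1)] r(2) by (simp add: encI)
  from fun_cong[OF this, of 0] have r0: "r 0 = \<ominus> r 1"
   using r'(1)[of 0] r'(1)[of 1] minus_equality by simp
  \<comment> \<open>The multiple of \<open>x\<^sub>2\<close> by \<open>r 1\<close>: its differential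
    has the coefficients \<open>\<ominus> r 1\<close> and \<open>r 1\<close>, which are those of
    \<open>r\<close>.\<close>
  define q' where "q' i = (if i = 2 then r 1 else \<zero>)" for i :: nat
  have q': "q' \<in> c.P (k - 1)" unfolding cyl_carrier q'_def using r' r'(3)[of 1] e by auto
  have "(%i::nat. if i = 0 then \<ominus> q' 2 else if i = 1 then q' 2 else \<zero>) = r"
  proof
   fix i
   show "(if i = 0 then \<ominus> q' 2 else if i = 1 then q' 2 else \<zero>) = r i"
    using r0 r2 r'(3)[of i] unfolding q'_def by (cases "i = 0"; cases "i = 1"; cases "i = 2") auto
  qed
  then have "x = cd CO (k - 1) (enc q')" using q' r(2) by (simp add: cyl_cdiff)
  then show "x \<in> coboundaries CO k" unfolding coboundaries_def c.sf_obj_carrier using q' by blast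
 qed
qed

definition incl_coc :: "nat => nat => 'a list set" where
 "incl_coc j = (\<lambda>g\<in>{..<gens pt}. enc (c.gen j))"

text \<open>With one generator and zero differential, a chain map out of the point is a cocycle of
  \<open>Z\<close> in degree \<open>d\<close> that is fixed by \<open>e\<close>.\<close>

lemma pt_cocyc_iff:
 assumes Z: "pre_complex R Z"
 shows "u \<in> p.cocyc Z \<longleftrightarrow> u \<in> extensional {..<gens pt} & u 0 \<in> car Z d & e \<odot>\<^bsub>ct Z d\<^esub> u 0 = u 0 &
  cd Z d (u 0) = (zc Z (d + 1))"
proof -
 have "ev Z pt u (gens pt) (d + 1) (d + 1) (att pt 0) = (zc Z (d + 1))"
 proof -
  interpret M: left_module R "ct Z (d + 1)" using Z by (simp add: pre_complex_def)
  show ?thesis unfolding ev_def by (intro M.lin_zero) (auto simp: pt_simps)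
 qed
 then show ?thesis unfolding p.cocyc_def by (auto simp: pt_simps)
qed

lemma c_gen: "j < 3 ==> c.gen j = (%i. if i = j then e else \<zero>)"
 unfolding c.gen_def by (auto simp: cyl_simps)

lemma incl_coc: "j < 2 ==> incl_coc j \<in> p.cocyc CO"
proof -
 assume j: "j < 2"
 note tr = tr_module_simps[OF inj_enc]
 have g: "c.gen j \<in> c.P d" using j e by (auto simp: cyl_carrier c_gen)
 have "(%i::nat. if i = 0 then \<ominus> c.gen j 2 else if i = 1 then c.gen j 2 else \<zero>) = (%_. \<zero>)"
  using j by (auto simp: c_gen)
 then show ?thesis
  unfolding pt_cocyc_iff[OF c.pre_complex_sf_obj] incl_coc_def using g j e cyl_cdiff[OF g]
  by (auto simp: pt_simps c.sf_obj_carrier c.sf_obj_cterm tr c_gen intro!: arg_cong[where f = enc])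
qed

text \<open>The two inclusions into the cylinder agree, being sections of the same quasi-isomorphism.\<close>

lemma homot_ze:
 assumes Y: "bounded_complex R Y" and uv: "u \<in> p.cocyc Y" "v \<in> p.cocyc Y" and h: "p.homot Y u v"
 shows "zigzag_eq (complexes R) (quasi_isos R) PO Y
  [Fwd PO Y (p.classify Y u)] [Fwd PO Y (p.classify Y v)]"
proof -
 let ?C = "complexes R" and ?W = "quasi_isos R" and ?\<pi> = "c.classify PO proj_coc"
 let ?i = "%j. p.classify CO (incl_coc j)"
 have Y': "pre_complex R Y" using Y unfolding bounded_complex_iff by blast
 interpret Y: complex R Y by (rule complex.intro[OF Y'])
 interpret M: left_module R "ct Y d" by (rule Y.lm)
 have Obj: "PO \<in> Obj ?C" "CO \<in> Obj ?C" "Y \<in> Obj ?C"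
  using p.bounded_complex_sf_obj c.bounded_complex_sf_obj Y by (auto simp: complexes_def)
 obtain w where w: "p.null Y w (%g. u g \<oplus>\<^bsub>ct Y (degr pt g)\<^esub> \<ominus>\<^bsub>ct Y (degr pt g)\<^esub> v g)"
  using h unfolding p.homot_def by blast
 note uc = uv(1)[unfolded pt_cocyc_iff[OF Y']] and vc = uv(2)[unfolded pt_cocyc_iff[OF Y']]
 have w0: "w 0 \<in> car Y (d - 1)" "e \<odot>\<^bsub>ct Y (d - 1)\<^esub> w 0 = w 0"
  "cd Y (d - 1) (w 0) = u 0 \<oplus>\<^bsub>ct Y d\<^esub> \<ominus>\<^bsub>ct Y d\<^esub> v 0"
 proof -
  have n: "0 < gens pt" by (simp add: pt_simps)
  show "w 0 \<in> car Y (d - 1)" "e \<odot>\<^bsub>ct Y (d - 1)\<^esub> w 0 = w 0"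
   using p.nullD(1,2)[OF w n] by (auto simp: pt_simps)
  have "ev Y pt w (gens pt) (d + 1) d (att pt 0) = (zc Y d)"
   unfolding ev_def by (intro M.lin_zero) (auto simp: pt_simps)
  moreover have "cd Y (d - 1) (w 0) \<in> car Y d"
   using p.nullD(1)[OF w n] Y.d_closed' by (simp add: pt_simps)
  ultimately show "cd Y (d - 1) (w 0) = u 0 \<oplus>\<^bsub>ct Y d\<^esub> \<ominus>\<^bsub>ct Y d\<^esub> v 0"
   using p.nullD(3)[OF w n] by (simp add: pt_simps)
 qed
 \<comment> \<open>A homotopy between \<open>v\<close> and \<open>u\<close> is a map out of the
   cylinder: \<open>d w = u - v\<close> matches the differential
   \<open>x\<^sub>1 - x\<^sub>0\<close> of \<open>x\<^sub>2\<close>, so \<open>v\<close> sits at end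
   0 and \<open>u\<close> at end 1.\<close>
 define H where "H = (\<lambda>g\<in>{..<gens cyl}. if g = 0 then v 0 else if g = 1 then u 0 else w 0)"
 have H: "H \<in> c.cocyc Y"
 proof (rule cyl_cocycI[OF Y'])
  show "H \<in> extensional {..<gens cyl}" unfolding H_def by simp
  fix g :: nat assume "g < 3"
  then have "g = 0 \<or> g = 1 \<or> g = 2" by linarith
  then show "H g \<in> car Y (degr cyl g)" "e \<odot>\<^bsub>ct Y (degr cyl g)\<^esub> H g = H g"
   unfolding H_def using uc vc w0 by (auto simp: cyl_simps)
 next
  show "cd Y d (H 0) = (zc Y (d + 1))" "cd Y d (H 1) = (zc Y (d + 1))"
   "cd Y (d - 1) (H 2) = \<ominus>\<^bsub>ct Y d\<^esub> H 0 \<oplus>\<^bsub>ct Y d\<^esub> H 1"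
   using uc vc w0 by (auto simp: H_def cyl_simps M.M.a_comm)
 qed
 have cm: "?i j \<in> chain_maps R PO CO" if "j < 2" for j
  by (rule p.classify_chain_map[OF c.pre_complex_sf_obj incl_coc[OF that]])
 have \<pi>: "?\<pi> \<in> chain_maps R CO PO" by (rule c.classify_chain_map[OF p.pre_complex_sf_obj proj_coc])
 have Hm: "c.classify Y H \<in> chain_maps R CO Y" by (rule c.classify_chain_map[OF Y' H])
 have post: "p.post (c.classify Z x) (incl_coc j) = (\<lambda>g\<in>{..<gens pt}. x j)"
  if "j < 2" "pre_complex R Z" "x \<in> c.cocyc Z" for j x and Z :: "('a, 'a list set) cochain"
 proof -
  have "c.post (c.classify Z x) c.univ j = x j" using c.post_univ[OF that(2,3)] by simp
  moreover have "degr cyl j = d" "j < gens cyl" using that(1) by (auto simp: cyl_simps)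
  ultimately have "c.classify Z x d (enc (c.gen j)) = x j" by (simp add: c.post_def c.univ_def)
  then show ?thesis unfolding p.post_def incl_coc_def by (intro restrict_ext) (simp add: pt_simps)
 qed
 have \<pi>i: "Comp ?C PO CO PO ?\<pi> (?i j) = p.classify PO (\<lambda>g\<in>{..<gens pt}. enc (p.gen 0))" if j: "j < 2" for j
 proof -
  have "proj_coc j = enc (p.gen 0)" using j by (simp add: proj_coc_def cyl_simps)
  then show ?thesis
   using p.classify_post[OF c.pre_complex_sf_obj p.pre_complex_sf_obj \<pi> incl_coc[OF j]]
    post[OF j p.pre_complex_sf_obj proj_coc] by simp
 qed
 have Hi: "Comp ?C PO CO Y (c.classify Y H) (?i j) = p.classify Y (if j = 0 then v else u)" if j: "j < 2" for j
 proof -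
  have "(\<lambda>g\<in>{..<gens pt}. H j) = (if j = 0 then v else u)"
   using j uc vc unfolding H_def by (auto simp: fun_eq_iff pt_simps cyl_simps extensional_def)
  then show ?thesis
   using p.classify_post[OF c.pre_complex_sf_obj Y' Hm incl_coc[OF j]] post[OF j Y' H] by simp
 qed
 have zi: "zigzag ?C ?W PO [Fwd PO CO (?i j)] CO" if "j < 2" for j
  using cm[OF that] Obj by (intro localising.zz_Fwd[OF localising_complexes]) (auto simp: complexes_def)
 have zb: "zigzag ?C ?W PO [Bwd CO PO ?\<pi>] CO"
  using proj_quasi_iso Obj by (intro localising.zz_Bwd[OF localising_complexes])
 have zH: "zigzag ?C ?W CO [Fwd CO Y (c.classify Y H)] Y"
  using Hm Obj by (intro localising.zz_Fwd[OF localising_complexes]) (auto simp: complexes_def)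
 \<comment> \<open>Following an inclusion by the projection and its formal inverse changes nothing,
   and the composite of inclusion and projection does not depend on \<open>j\<close>. Hence neither
   does the inclusion as a morphism of the localisation.\<close>
 have i_eq: "zigzag_eq ?C ?W PO CO [Fwd PO CO (?i j)]
  [Fwd PO PO (p.classify PO (\<lambda>g\<in>{..<gens pt}. enc (p.gen 0))), Bwd CO PO ?\<pi>]" if j: "j < 2" for j
 proof -
  have "zigzag_eq ?C ?W PO CO ([Fwd PO CO (?i j)] @ [Fwd CO PO ?\<pi>, Bwd CO PO ?\<pi>] @ []) ([Fwd PO CO (?i j)] @ [])"
   using zi[OF j] Obj proj_quasi_iso by (intro zigzag_eq.ze_inv1 zigzag.zz_nil)
  moreover have "zigzag_eq ?C ?W PO CO ([] @ [Fwd PO CO (?i j), Fwd CO PO ?\<pi>] @ [Bwd CO PO ?\<pi>])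
   ([] @ [Fwd PO PO (Comp ?C PO CO PO ?\<pi> (?i j))] @ [Bwd CO PO ?\<pi>])"
   using Obj zb cm[OF j] \<pi> by (intro zigzag_eq.ze_comp zigzag.zz_nil) (auto simp: complexes_def)
  ultimately show ?thesis
   unfolding \<pi>i[OF j] using zigzag_eq.ze_sym zigzag_eq.ze_trans by fastforce
 qed
 have "zigzag_eq ?C ?W PO CO [Fwd PO CO (?i 0)] [Fwd PO CO (?i 1)]"
  using zigzag_eq.ze_trans[OF i_eq[of 0] zigzag_eq.ze_sym[OF i_eq[of 1]]] by simp
 from localising.ze_append_right[OF localising_complexes this zH]
 have "zigzag_eq ?C ?W PO Y [Fwd PO CO (?i 0), Fwd CO Y (c.classify Y H)] [Fwd PO CO (?i 1), Fwd CO Y (c.classify Y H)]"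
  by simp
 moreover have "zigzag_eq ?C ?W PO Y [Fwd PO CO (?i j), Fwd CO Y (c.classify Y H)]
  [Fwd PO Y (p.classify Y (if j = 0 then v else u))]" if j: "j < 2" for j
 proof -
  have "zigzag_eq ?C ?W PO Y ([] @ [Fwd PO CO (?i j), Fwd CO Y (c.classify Y H)] @ [])
   ([] @ [Fwd PO Y (Comp ?C PO CO Y (c.classify Y H) (?i j))] @ [])"
   using Obj cm[OF j] Hm by (intro zigzag_eq.ze_comp zigzag.zz_nil) (auto simp: complexes_def)
  then show ?thesis unfolding Hi[OF j] by simp
 qed
 from this[of 0] this[of 1] have
  "zigzag_eq ?C ?W PO Y [Fwd PO CO (?i 0), Fwd CO Y (c.classify Y H)] [Fwd PO Y (p.classify Y v)]"
  "zigzag_eq ?C ?W PO Y [Fwd PO CO (?i 1), Fwd CO Y (c.classify Y H)] [Fwd PO Y (p.classify Y u)]" by auto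
 ultimately show ?thesis by (meson zigzag_eq.ze_sym zigzag_eq.ze_trans)
qed

text \<open>Every morphism out of the point is classified by an element of \<open>e Z\<close> in
  degree \<open>d\<close>; if that corner is zero, only one cocycle remains.\<close>

lemma thin_pt:
 assumes Z: "bounded_complex R Z" and zero: "!!z. z \<in> car Z d ==> e \<odot>\<^bsub>ct Z d\<^esub> z = z ==> z = (zc Z d)"
 shows "thin (derived_cat R) PO Z"
 unfolding derived_cat_def localising.thin_L[OF localising_complexes]
proof (intro allI impI)
 fix p q
 assume p: "zigzag (complexes R) (quasi_isos R) PO p Z" and q: "zigzag (complexes R) (quasi_isos R) PO q Z"
 have Z': "pre_complex R Z" using Z unfolding bounded_complex_iff by blast
 obtain u where u: "u \<in> p.cocyc Z" "zigzag_eq (complexes R) (quasi_isos R) PO Z p [Fwd PO Z (p.classify Z u)]"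
  using p.zigzag_classify[OF homot_ze p] by blast
 obtain v where v: "v \<in> p.cocyc Z" "zigzag_eq (complexes R) (quasi_isos R) PO Z q [Fwd PO Z (p.classify Z v)]"
  using p.zigzag_classify[OF homot_ze q] by blast
 have "u 0 = v 0" "u \<in> extensional {..<gens pt}" "v \<in> extensional {..<gens pt}"
  using u(1) v(1) zero[of "u 0"] zero[of "v 0"] unfolding pt_cocyc_iff[OF Z'] by simp_all
 then have "u = v" by (intro extensionalityI[of _ "{..<gens pt}"]) (auto simp: pt_simps)
 then show "zigzag_eq (complexes R) (quasi_isos R) PO Z p q"
  using u(2) v(2) zigzag_eq.ze_sym zigzag_eq.ze_trans by metis
qed

text \<open>Thinness would contract the identity. The point has zero differential, so the
  contraction would force its generator, and with it \<open>e\<close>, to be zero.\<close>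

lemma not_thin_pt:
 assumes "e ~= \<zero>" shows "\<not> thin (derived_cat R) PO PO"
proof
 assume "thin (derived_cat R) PO PO"
 from p.thin_imp_homot[OF p.bounded_complex_sf_obj this p.univ_cocyc p.zero_cocyc[OF p.pre_complex_sf_obj]]
 obtain w where w: "p.null PO w (%g. p.univ g \<oplus>\<^bsub>ct PO (degr pt g)\<^esub>
  \<ominus>\<^bsub>ct PO (degr pt g)\<^esub> p.zero_cocyc PO g)" unfolding p.homot_def by blast
 interpret C: complex R PO by (rule complex.intro[OF p.pre_complex_sf_obj])
 interpret M: left_module R "ct PO d" by (rule C.lm)
 have n: "0 < gens pt" by (simp add: pt_simps)
 obtain q where q: "q \<in> p.P (d - 1)" "w 0 = enc q"
  using p.nullD(1)[OF w n] unfolding p.sf_obj_carrier by (auto simp: pt_simps)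
 have "cd PO (d - 1) (w 0) = enc (%_. \<zero>)"
  unfolding q(2) using q(1) p.sf_closed[OF q(1)] by (simp add: p.sf_obj_cdiff) (simp add: pt_simps)
 then have d: "cd PO (d - 1) (w 0) = (zc PO d)"
  by (simp add: p.sf_obj_cterm tr_module_simps[OF inj_enc])
 have "ev PO pt w (gens pt) (d + 1) d (att pt 0) = (zc PO d)"
  unfolding ev_def by (intro M.lin_zero) (auto simp: pt_simps)
 moreover have u: "enc (p.gen 0) \<in> car PO d"
  using p.gen_closed[OF n] by (simp add: p.sf_obj_carrier pt_simps)
 ultimately have "enc (p.gen 0) = (zc PO d)"
  using p.nullD(3)[OF w n] d by (simp add: pt_simps p.univ_def p.zero_cocyc_def)
 then have "p.gen 0 = (%_. \<zero>)"
  using inj_enc by (auto simp: p.sf_obj_cterm tr_module_simps[OF inj_enc] dest: injD)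
 from fun_cong[OF this, of 0] show False using assms by (simp add: p_gen)
qed

end

section \<open>Semi-free resolutions over triangular algebras\<close>

text \<open>\<open>\<iota>\<close> is the structure map of the ground field into the centre. Scalars
  act through the ring elements \<open>\<iota> c\<close>, so linear algebra over the field can reuse
  \<open>lin\<close>.\<close>

locale k_algebra = ring R for R :: "'a ring" (structure) +
 fixes \<iota> :: "'k::field => 'a"
 assumes \<iota>_closed [simp]: "\<iota> c \<in> carrier R"
  and \<iota>_add: "\<iota> (c + d) = \<iota> c \<oplus> \<iota> d"
  and \<iota>_mult: "\<iota> (c * d) = \<iota> c \<otimes> \<iota> d"
  and \<iota>_one: "\<iota> 1 = \<one>"
  and \<iota>_central: "r \<in> carrier R ==> \<iota> c \<otimes> r = r \<otimes> \<iota> c"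
begin

lemma \<iota>_zero: "\<iota> 0 = \<zero>"
proof -
 have "\<iota> 0 \<oplus> \<iota> 0 = \<iota> 0" using \<iota>_add[of 0 0] by simp
 then show ?thesis using add.l_cancel_one[of "\<iota> 0" "\<iota> 0"] by simp
qed

lemma \<iota>_minus: "\<iota> (- c) = \<ominus> \<iota> c"
 using \<iota>_add[of "- c" c] \<iota>_zero minus_equality[of "\<iota> (- c)" "\<iota> c"] by simp

definition klin :: "('a, 'm) module => (nat => 'm) => nat => (nat => 'k) => 'm" where
 "klin M x m c = lin M x m (%i. \<iota> (c i))"

text \<open>\<open>W\<close> is any set inside the span of finitely many vectors, so the notion
  passes to subsets.\<close>

definition fdim :: "('a, 'm) module => 'm set => bool" where
 "fdim M W \<longleftrightarrow> (\<exists>x m. (\<forall>i<m. x i \<in> carrier M) & W \<subseteq> range (klin M x m))"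

definition subspace :: "('a, 'm) module => 'm set => bool" where
 "subspace M W \<longleftrightarrow> W \<subseteq> carrier M & \<zero>\<^bsub>M\<^esub> \<in> W & (\<forall>x\<in>W. \<forall>y\<in>W. x \<oplus>\<^bsub>M\<^esub> y \<in> W) &
   (\<forall>c. \<forall>x\<in>W. \<iota> c \<odot>\<^bsub>M\<^esub> x \<in> W)"

context
 fixes M :: "('a, 'm) module"
 assumes M: "left_module R M"
begin

interpretation M: left_module R M by (rule M)

lemma klin_closed: "(!!i. i < m ==> x i \<in> carrier M) ==> klin M x m c \<in> carrier M"
 unfolding klin_def by (intro M.lin_closed) auto

lemma klin_add: "(!!i. i < m ==> x i \<in> carrier M) ==>
  klin M x m (%i. c i + d i) = klin M x m c \<oplus>\<^bsub>M\<^esub> klin M x m d"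
 unfolding klin_def \<iota>_add by (intro M.lin_add_left) auto

lemma klin_smult: "(!!i. i < m ==> x i \<in> carrier M) ==>
  klin M x m (%i. a * c i) = \<iota> a \<odot>\<^bsub>M\<^esub> klin M x m c"
 unfolding klin_def \<iota>_mult by (intro M.lin_smult_left) auto

text \<open>Elimination of the last spanning vector: if some \<open>w0\<close> in \<open>W\<close>
  involves it, \<open>w0\<close> is taken as a generator and the rest of \<open>W\<close> is reduced
  modulo \<open>w0\<close>. The generators have to lie in \<open>W\<close> itself, since cells will
  be attached along them.\<close>

lemma subspace_spanning:
 assumes "\<forall>i<m. x i \<in> carrier M" "W \<subseteq> range (klin M x m)" "subspace M W"
 shows "\<exists>y p. (\<forall>i<p. y i \<in> W) & W \<subseteq> range (klin M y p)"
 using assms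
proof (induction m arbitrary: W)
 case 0
 then have "W \<subseteq> range (klin M x 0)" by simp
 then show ?case by (intro exI[of _ x] exI[of _ 0]) simp
next
 case (Suc m)
 have xc: "x i \<in> carrier M" if "i \<le> m" for i using Suc.prems(1) that by auto
 note W = Suc.prems(3)[unfolded subspace_def]
 show ?case
 proof (cases "W \<subseteq> range (klin M x m)")
  case True then show ?thesis using Suc by auto
 next
  case False
  then obtain w0 where w0: "w0 \<in> W" "w0 \<notin> range (klin M x m)" by blast
  obtain c0 where c0: "w0 = klin M x (Suc m) c0" using w0(1) Suc.prems(2) by blast
  have c0m: "c0 m ~= 0"
  proof
   assume "c0 m = 0"
   then have "w0 = klin M x m c0" using c0 klin_closed[of m x c0] xc by (simp add: klin_def \<iota>_zero)
   then show False using w0(2) by blast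
  qed
  let ?W = "W \<inter> range (klin M x m)"
  have rng: "subspace M (range (klin M x m))"
   unfolding subspace_def
  proof (intro conjI ballI allI)
   show "range (klin M x m) \<subseteq> carrier M" using klin_closed xc by auto
   have "klin M x m (%_. 0) = \<zero>\<^bsub>M\<^esub>" unfolding klin_def \<iota>_zero using xc by (intro M.lin_zero) auto
   then show "\<zero>\<^bsub>M\<^esub> \<in> range (klin M x m)" by (metis rangeI)
   fix a b assume "a \<in> range (klin M x m)" "b \<in> range (klin M x m)"
   then obtain c d where "a = klin M x m c" "b = klin M x m d" by blast
   then have "a \<oplus>\<^bsub>M\<^esub> b = klin M x m (%i. c i + d i)" using klin_add[of m x c d] xc by simp
   then show "a \<oplus>\<^bsub>M\<^esub> b \<in> range (klin M x m)" by blast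
  next
   fix a b assume "b \<in> range (klin M x m)"
   then obtain c where "b = klin M x m c" by blast
   then have "\<iota> a \<odot>\<^bsub>M\<^esub> b = klin M x m (%i. a * c i)" using klin_smult[of m x a c] xc by simp
   then show "\<iota> a \<odot>\<^bsub>M\<^esub> b \<in> range (klin M x m)" by blast
  qed
  have "subspace M ?W" using Suc.prems(3) rng unfolding subspace_def by blast
  then obtain y p where y: "\<forall>i<p. y i \<in> ?W" "?W \<subseteq> range (klin M y p)" using Suc.IH[of ?W] xc by auto
  have "W \<subseteq> range (klin M (y(p := w0)) (Suc p))"
  proof
   fix w assume w: "w \<in> W"
   then obtain c where c: "w = klin M x (Suc m) c" using Suc.prems(2) by blast
   \<comment> \<open>Chosen so that the last coefficient of \<open>w - a w0\<close>
     vanishes.\<close>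
   define a where "a = c m / c0 m"
   have wc: "w \<in> carrier M" "w0 \<in> carrier M" using w w0 W by auto
   define v where "v = w \<oplus>\<^bsub>M\<^esub> \<iota> (- a) \<odot>\<^bsub>M\<^esub> w0"
   have vW: "v \<in> W" using w w0 W unfolding v_def by blast
   have "v = klin M x (Suc m) c \<oplus>\<^bsub>M\<^esub> klin M x (Suc m) (%i. - a * c0 i)"
    unfolding v_def c c0 using klin_smult[of "Suc m" x "- a" c0] xc by (simp add: less_Suc_eq_le)
   also have "\<dots> = klin M x (Suc m) (%i. c i + - a * c0 i)"
    using klin_add[of "Suc m" x c "%i. - a * c0 i"] xc by (simp add: less_Suc_eq_le)
   also have "\<dots> = klin M x m (%i. c i + - a * c0 i)"
    using c0m klin_closed[of m x "%i. c i + - a * c0 i"] xc unfolding a_def by (simp add: klin_def \<iota>_zero)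
   finally have "v \<in> ?W" using vW by blast
   then obtain b where b: "v = klin M y p b" using y(2) by blast
   have "w = v \<oplus>\<^bsub>M\<^esub> \<iota> a \<odot>\<^bsub>M\<^esub> w0"
    unfolding v_def \<iota>_minus using wc
    by (simp add: M.smult_minus_left M.smult_closed M.M.a_assoc M.M.l_neg)
   also have "\<dots> = klin M (y(p := w0)) (Suc p) (b(p := a))"
   proof -
    have "klin M (y(p := w0)) p (b(p := a)) = klin M y p b" unfolding klin_def by (intro M.lin_cong) auto
    then show ?thesis unfolding b by (simp add: klin_def)
   qed
   finally show "w \<in> range (klin M (y(p := w0)) (Suc p))" by blast
  qed
  moreover have "\<forall>i<Suc p. (y(p := w0)) i \<in> W" using y(1) w0(1) by (auto simp: less_Suc_eq)
  ultimately show ?thesis by blast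
 qed
qed

lemma fdim_sum:
 assumes "fdim M V" "fdim M W"
 shows "fdim M {v \<oplus>\<^bsub>M\<^esub> w | v w. v \<in> V & w \<in> W}"
proof -
 obtain x m where x: "\<forall>i<m. x i \<in> carrier M" "V \<subseteq> range (klin M x m)" using assms(1) unfolding fdim_def by blast
 obtain y p where y: "\<forall>i<p. y i \<in> carrier M" "W \<subseteq> range (klin M y p)" using assms(2) unfolding fdim_def by blast
 define z where "z i = (if i < m then x i else y (i - m))" for i
 have *: "klin M z (m + q) (%i. if i < m then c i else d (i - m)) = klin M x m c \<oplus>\<^bsub>M\<^esub> klin M y q d"
  if "q \<le> p" for q c d
  using that
 proof (induction q)
  case 0
  have "klin M z m (%i. if i < m then c i else d (i - m)) = klin M x m c"
   unfolding klin_def z_def by (intro M.lin_cong) auto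
  moreover have "klin M x m c \<in> carrier M" using x klin_closed by blast
  ultimately show ?case by (simp add: klin_def)
 next
  case (Suc q)
  have "klin M x m c \<in> carrier M" "klin M y q d \<in> carrier M" "y q \<in> carrier M"
   using x y klin_closed Suc.prems by auto
  then show ?case using Suc by (simp add: klin_def z_def M.a_assoc M.smult_closed)
 qed
 have "{v \<oplus>\<^bsub>M\<^esub> w | v w. v \<in> V & w \<in> W} \<subseteq> range (klin M z (m + p))"
 proof
  fix a assume "a \<in> {v \<oplus>\<^bsub>M\<^esub> w | v w. v \<in> V & w \<in> W}"
  then obtain c d where "a = klin M x m c \<oplus>\<^bsub>M\<^esub> klin M y p d" using x y by blast
  then have "a = klin M z (m + p) (%i. if i < m then c i else d (i - m))" using *[of p c d] by simp
  then show "a \<in> range (klin M z (m + p))" by blast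
 qed
 moreover have "\<forall>i<m + p. z i \<in> carrier M" unfolding z_def using x y by auto
 ultimately show ?thesis unfolding fdim_def by blast
qed

end

lemma fdim_mono: "fdim M W ==> V \<subseteq> W ==> fdim M V"
 unfolding fdim_def by blast

lemma fdim_image:
 assumes M: "left_module R M" and N: "left_module R N"
  and \<phi>: "!!x. x \<in> carrier M ==> \<phi> x \<in> carrier N" "\<phi> \<zero>\<^bsub>M\<^esub> = \<zero>\<^bsub>N\<^esub>"
   "!!x y. x \<in> carrier M ==> y \<in> carrier M ==> \<phi> (x \<oplus>\<^bsub>M\<^esub> y) = \<phi> x \<oplus>\<^bsub>N\<^esub> \<phi> y"
   "!!c x. x \<in> carrier M ==> \<phi> (\<iota> c \<odot>\<^bsub>M\<^esub> x) = \<iota> c \<odot>\<^bsub>N\<^esub> \<phi> x"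
  and W: "fdim M W"
 shows "fdim N (\<phi> ` W)"
proof -
 interpret M: left_module R M by fact
 obtain x m where x: "\<forall>i<m. x i \<in> carrier M" "W \<subseteq> range (klin M x m)" using W unfolding fdim_def by blast
 have *: "\<phi> (klin M x m c) = klin N (%i. \<phi> (x i)) m c" for c
  using x(1)
 proof (induction m)
  case (Suc m)
  have "klin M x m c \<in> carrier M" using Suc by (intro klin_closed M) auto
  then show ?case using Suc \<phi> by (simp add: klin_def M.smult_closed)
 qed (simp add: klin_def \<phi>)
 have "\<phi> ` W \<subseteq> range (klin N (%i. \<phi> (x i)) m)"
 proof
  fix y assume "y \<in> \<phi> ` W"
  then obtain w where w: "w \<in> W" "y = \<phi> w" by blast
  then obtain c where "w = klin M x m c" using x(2) by blast
  then have "y = klin N (%i. \<phi> (x i)) m c" using w(2) *[of c] by (simp only:)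
  then show "y \<in> range (klin N (%i. \<phi> (x i)) m)" by (simp only: rangeI)
 qed
 moreover have "\<forall>i<m. \<phi> (x i) \<in> carrier N" using x(1) \<phi>(1) by simp
 ultimately show ?thesis unfolding fdim_def by (intro exI conjI)
qed

end

definition rmod :: "'a ring => ('a, 'a) module" where
 "rmod R = \<lparr>carrier = carrier R, monoid.mult = (%x y. undefined), one = undefined,
   zero = \<zero>\<^bsub>R\<^esub>, add = add R, smult = monoid.mult R\<rparr>"

lemma rmod_simps [simp]:
 fixes R :: "'a ring"
 shows "carrier (rmod R) = carrier R" "\<zero>\<^bsub>rmod R\<^esub> = \<zero>\<^bsub>R\<^esub>" "a \<oplus>\<^bsub>rmod R\<^esub> b = a \<oplus>\<^bsub>R\<^esub> b"
  "a \<odot>\<^bsub>rmod R\<^esub> b = a \<otimes>\<^bsub>R\<^esub> b"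
 unfolding rmod_def by auto

lemma left_module_rmod:
 fixes R :: "'a ring" (structure)
 assumes "ring R" shows "left_module R (rmod R)"
proof -
 interpret ring R by fact
 have "abelian_group (rmod R)"
 proof (rule abelian_groupI)
  fix x assume "x \<in> carrier (rmod R)"
  then show "\<exists>y\<in>carrier (rmod R). y \<oplus>\<^bsub>rmod R\<^esub> x = \<zero>\<^bsub>rmod R\<^esub>"
   by (intro bexI[of _ "\<ominus> x"]) (auto simp: l_neg)
 qed (auto simp: a_ac)
 then show ?thesis by (intro left_moduleI) (auto simp: l_distr r_distr m_assoc ring_axioms)
qed

locale fin_dim_algebra = k_algebra R \<iota> for R :: "'a ring" (structure) and \<iota> :: "'k::field => 'a" +
 assumes fin_dim: "fdim (rmod R) (carrier R)"
begin

text \<open>Each summand is the image of \<open>carrier R\<close> under a linear map, and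
  \<open>R\<close> is finite-dimensional.\<close>

lemma fdim_lin:
 assumes M: "left_module R M" and x: "\<forall>i<n. x i \<in> carrier M"
 shows "fdim M {lin M x n r | r. \<forall>i<n. r i \<in> carrier R}"
proof -
 interpret M: left_module R M by fact
 show ?thesis
  using x
 proof (induction n)
  case 0
  have "{lin M x 0 r | r. \<forall>i<0. r i \<in> carrier R} \<subseteq> range (klin M x 0)" by (auto simp: klin_def)
  then show ?case unfolding fdim_def by (intro exI[of _ x] exI[of _ 0]) auto
 next
  case (Suc n)
  have xn: "x n \<in> carrier M" using Suc by simp
  have "fdim M ((%r. r \<odot>\<^bsub>M\<^esub> x n) ` carrier R)"
   using xn by (intro fdim_image[OF left_module_rmod[OF ring_axioms] M _ _ _ _ fin_dim])
    (auto simp: M.smult_closed M.smult_l_distr M.smult_assoc)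
  from fdim_sum[OF M Suc.IH this] Suc.prems
  have "fdim M {v \<oplus>\<^bsub>M\<^esub> w | v w. v \<in> {lin M x n r | r. \<forall>i<n. r i \<in> carrier R} &
   w \<in> (%r. r \<odot>\<^bsub>M\<^esub> x n) ` carrier R}" by auto
  then show ?case
  proof (rule fdim_mono, intro subsetI)
   fix y assume "y \<in> {lin M x (Suc n) r | r. \<forall>i<Suc n. r i \<in> carrier R}"
   then obtain r where "y = lin M x n r \<oplus>\<^bsub>M\<^esub> r n \<odot>\<^bsub>M\<^esub> x n" "\<forall>i<n. r i \<in> carrier R" "r n \<in> carrier R" by auto
   then show "y \<in> {v \<oplus>\<^bsub>M\<^esub> w | v w. v \<in> {lin M x n r | r. \<forall>i<n. r i \<in> carrier R} &
    w \<in> (%r. r \<odot>\<^bsub>M\<^esub> x n) ` carrier R}" by blast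
  qed
 qed
qed

lemma fdim_fin_gen:
 assumes M: "left_module R M" and fg: "fin_gen R M"
 shows "fdim M (carrier M)"
proof -
 interpret M: left_module R M by fact
 obtain x n where x: "\<forall>i<n. x i \<in> carrier M"
  "\<forall>y\<in>carrier M. \<exists>r. (\<forall>i<n. r i \<in> carrier R) & y = lin M x n r" using fg unfolding M.fin_gen_iff by blast
 have "fdim M {lin M x n r | r. \<forall>i<n. r i \<in> carrier R}" by (rule fdim_lin[OF M x(1)])
 moreover have "carrier M \<subseteq> {lin M x n r | r. \<forall>i<n. r i \<in> carrier R}" using x(2) by blast
 ultimately show ?thesis by (rule fdim_mono)
qed

lemma fdim_module_sum:
 assumes M: "left_module R M" and N: "left_module R N" and V: "fdim M V" and W: "fdim N W" and
  sub: "V \<subseteq> carrier M" "W \<subseteq> carrier N"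
 shows "fdim (module_sum M N) (V \<times> W)"
proof -
 interpret M: left_module R M by fact
 interpret N: left_module R N by fact
 note S = left_module_module_sum[OF M N]
 have "fdim (module_sum M N) ((%x. (x, \<zero>\<^bsub>N\<^esub>)) ` V)"
  by (intro fdim_image[OF M S _ _ _ _ V]) (auto simp: module_sum_simps)
 moreover have "fdim (module_sum M N) ((%x. (\<zero>\<^bsub>M\<^esub>, x)) ` W)"
  by (intro fdim_image[OF N S _ _ _ _ W]) (auto simp: module_sum_simps)
 ultimately have "fdim (module_sum M N) {v \<oplus>\<^bsub>module_sum M N\<^esub> w | v w.
  v \<in> (%x. (x, \<zero>\<^bsub>N\<^esub>)) ` V & w \<in> (%x. (\<zero>\<^bsub>M\<^esub>, x)) ` W}" by (rule fdim_sum[OF S])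
 then show ?thesis
 proof (rule fdim_mono)
  show "V \<times> W \<subseteq> {v \<oplus>\<^bsub>module_sum M N\<^esub> w | v w.
   v \<in> (%x. (x, \<zero>\<^bsub>N\<^esub>)) ` V & w \<in> (%x. (\<zero>\<^bsub>M\<^esub>, x)) ` W}"
  proof
   fix p assume "p \<in> V \<times> W"
   then obtain v w where p: "p = (v, w)" "v \<in> V" "w \<in> W" by blast
   then have "p = (v, \<zero>\<^bsub>N\<^esub>) \<oplus>\<^bsub>module_sum M N\<^esub> (\<zero>\<^bsub>M\<^esub>, w)"
    using sub by (auto simp: module_sum_simps)
   then show "p \<in> {v \<oplus>\<^bsub>module_sum M N\<^esub> w | v w.
    v \<in> (%x. (x, \<zero>\<^bsub>N\<^esub>)) ` V & w \<in> (%x. (\<zero>\<^bsub>M\<^esub>, x)) ` W}" using p by blast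
  qed
 qed
qed

end

text \<open>A copy of \<open>R e i\<close> is invisible at vertices below \<open>i\<close>, since
  the corners \<open>e j R e i\<close> with \<open>j < i\<close> vanish, and at \<open>i\<close>
  itself it adds only scalar multiples of \<open>e i\<close>. These two facts make finite
  resolutions possible.\<close>

locale triangular_algebra = fin_dim_algebra R \<iota> for R :: "'a ring" (structure) and \<iota> :: "'k::field => 'a" +
 fixes n :: nat and e :: "nat => 'a"
 assumes e_closed: "i < n ==> e i \<in> carrier R" and e_idem: "i < n ==> e i \<otimes> e i = e i"
  and e_sum: "(\<Oplus>i\<in>{..<n}. e i) = \<one>"
  and triangular: "i < j ==> j < n ==> r \<in> carrier R ==> e i \<otimes> (r \<otimes> e j) = \<zero>"
  and local: "i < n ==> r \<in> carrier R ==> \<exists>c. e i \<otimes> (r \<otimes> e i) = \<iota> c \<otimes> e i"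

section \<open>Attaching cells to a partial resolution\<close>

locale partial_resolution = triangular_algebra R \<iota> n e + semifree R S
 for R :: "'a ring" (structure) and \<iota> :: "'k::field => 'a" and n e and S +
 fixes U :: "('a, 'm) cochain" and u :: "nat => 'm"
 assumes U: "bounded_complex R U" and u: "u \<in> cocyc U"
  and vertices: "g < gens S ==> vtx S g \<in> e ` {..<n}"
begin

sublocale U: complex R U
 using U by (simp add: complex_def bounded_complex_iff)

text \<open>The ambient module uses all of \<open>F\<close>, so it does not change when cells are
  attached, and cocycles of successive cones can be compared.\<close>

definition C :: "int => ('a, (nat => 'a) \<times> 'm) module" where
 "C k = module_sum F (ct U k)"

definition f :: "int => (nat => 'a) => 'm" where
 "f k r = ev U S u N k k r"

text \<open>
 Cocycles and coboundaries of the mapping cone of \<open>f\<close>, with sign conventions changed so as to avoid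
 negations.
\<close>

definition Zc :: "int => ((nat => 'a) \<times> 'm) set" where
 "Zc k = {(r, y). r \<in> P (k + 1) & y \<in> car U k & dif r = \<zero>\<^bsub>F\<^esub> &
   f (k + 1) r \<oplus>\<^bsub>ct U (k + 1)\<^esub> cd U k y = (zc U (k + 1))}"

definition Bc :: "int => ((nat => 'a) \<times> 'm) set" where
 "Bc k = {(r, y). y \<in> car U k & (\<exists>q\<in>P k. \<exists>x\<in>car U (k - 1).
   r = dif q & y \<oplus>\<^bsub>ct U k\<^esub> f k q = cd U (k - 1) x)}"

definition Zv :: "nat => int => ((nat => 'a) \<times> 'm) set" where
 "Zv i k = {p \<in> Zc k. e i \<odot>\<^bsub>C k\<^esub> p = p}"

text \<open>The cone has no cohomology at vertex \<open>i\<close>; once this holds at all vertices,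
  the comparison map is a quasi-isomorphism.\<close>

definition resolved :: "nat => bool" where
 "resolved i \<longleftrightarrow> (\<forall>k. Zv i k \<subseteq> Bc k)"

lemma lm_C: "left_module R (C k)"
 unfolding C_def by (rule left_module_module_sum[OF F.left_module_axioms U.lm])

lemma C_simps:
 "(r, y) \<in> carrier (C k) \<longleftrightarrow> r \<in> carrier F & y \<in> car U k"
 "\<zero>\<^bsub>C k\<^esub> = (\<zero>\<^bsub>F\<^esub>, (zc U k))"
 "(r, y) \<oplus>\<^bsub>C k\<^esub> (q, x) = (r \<oplus>\<^bsub>F\<^esub> q, y \<oplus>\<^bsub>ct U k\<^esub> x)"
 "a \<odot>\<^bsub>C k\<^esub> (r, y) = (a \<odot>\<^bsub>F\<^esub> r, a \<odot>\<^bsub>ct U k\<^esub> y)"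
 unfolding C_def by (rule module_sum_simps)+

lemma uk: "g < N ==> degr S g = k ==> u g \<in> car U k"
 using cocycD(1)[OF u] by blast

lemma f_closed: "(!!i. r i \<in> carrier R) ==> f k r \<in> car U k"
 unfolding f_def using cocycD(1)[OF u] by (intro ev_closed[OF U.pre_complex, where m = 0]) auto

lemma f_add: "(!!i. r i \<in> carrier R) ==> (!!i. q i \<in> carrier R) ==>
  f k (%i. r i \<oplus> q i) = f k r \<oplus>\<^bsub>ct U k\<^esub> f k q"
proof -
 assume a: "!!i. r i \<in> carrier R" "!!i. q i \<in> carrier R"
 interpret M: left_module R "ct U k" by (rule U.lm)
 show ?thesis unfolding f_def ev_def using uk a by (intro M.lin_add_left) auto
qed

lemma f_smult: "a \<in> carrier R ==> (!!i. r i \<in> carrier R) ==>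
  f k (%i. a \<otimes> r i) = a \<odot>\<^bsub>ct U k\<^esub> f k r"
proof -
 assume a: "a \<in> carrier R" "!!i. r i \<in> carrier R"
 interpret M: left_module R "ct U k" by (rule U.lm)
 show ?thesis unfolding f_def ev_def using uk a by (intro M.lin_smult_left) auto
qed

lemma f_zero: "f k (%i. \<zero>) = (zc U k)"
proof -
 interpret M: left_module R "ct U k" by (rule U.lm)
 show ?thesis unfolding f_def ev_def using uk by (intro M.lin_zero) auto
qed

lemma D_add: "(!!i. r i \<in> carrier R) ==> (!!i. q i \<in> carrier R) ==>
  dif (%i. r i \<oplus> q i) = dif r \<oplus>\<^bsub>F\<^esub> dif q"
 by (intro F.lin_add_left) auto

lemma D_smult: "a \<in> carrier R ==> (!!i. r i \<in> carrier R) ==>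
  dif (%i. a \<otimes> r i) = a \<odot>\<^bsub>F\<^esub> dif r"
 by (intro F.lin_smult_left) auto

lemma D_zero: "dif (%i. \<zero>) = (%i. \<zero>)"
 using F.lin_zero[of N "%i. \<zero>" "att S"] by simp

lemma Zc_add: "p \<in> Zc k ==> p' \<in> Zc k ==> p \<oplus>\<^bsub>C k\<^esub> p' \<in> Zc k"
proof (cases p; cases p')
 fix r y q x assume *: "p \<in> Zc k" "p' \<in> Zc k" "p = (r, y)" "p' = (q, x)"
 interpret M: left_module R "ct U k" by (rule U.lm)
 interpret M1: left_module R "ct U (k + 1)" by (rule U.lm)
 have c: "r \<in> P (k + 1)" "q \<in> P (k + 1)" "y \<in> car U k" "x \<in> car U k"
  "dif r = \<zero>\<^bsub>F\<^esub>" "dif q = \<zero>\<^bsub>F\<^esub>"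
  "f (k + 1) r \<oplus>\<^bsub>ct U (k + 1)\<^esub> cd U k y = (zc U (k + 1))"
  "f (k + 1) q \<oplus>\<^bsub>ct U (k + 1)\<^esub> cd U k x = (zc U (k + 1))" using * unfolding Zc_def by auto
 have rq: "r i \<in> carrier R" "q i \<in> carrier R" for i using c sf_closed by blast+
 have fc: "f (k + 1) r \<in> car U (k + 1)" "f (k + 1) q \<in> car U (k + 1)"
  "cd U k y \<in> car U (k + 1)" "cd U k x \<in> car U (k + 1)"
  using f_closed rq U.d_closed c by auto
 have "f (k + 1) (%i. r i \<oplus> q i) \<oplus>\<^bsub>ct U (k + 1)\<^esub> cd U k (y \<oplus>\<^bsub>ct U k\<^esub> x) =
  (f (k + 1) r \<oplus>\<^bsub>ct U (k + 1)\<^esub> cd U k y) \<oplus>\<^bsub>ct U (k + 1)\<^esub>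
  (f (k + 1) q \<oplus>\<^bsub>ct U (k + 1)\<^esub> cd U k x)"
  using fc by (simp add: f_add rq U.d_add[OF c(3,4) refl] M1.M.a_ac)
 also have "\<dots> = (zc U (k + 1))" unfolding c by simp
 finally show ?thesis
  using c sf_add[OF _ c(1,2)] D_add[of r q] rq * unfolding Zc_def by (simp add: C_simps)
qed

lemma Zc_smult: "p \<in> Zc k ==> a \<in> carrier R ==> a \<odot>\<^bsub>C k\<^esub> p \<in> Zc k"
proof (cases p)
 fix r y assume *: "p \<in> Zc k" "a \<in> carrier R" "p = (r, y)"
 interpret M: left_module R "ct U k" by (rule U.lm)
 interpret M1: left_module R "ct U (k + 1)" by (rule U.lm)
 have c: "r \<in> P (k + 1)" "y \<in> car U k" "dif r = \<zero>\<^bsub>F\<^esub>"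
  "f (k + 1) r \<oplus>\<^bsub>ct U (k + 1)\<^esub> cd U k y = (zc U (k + 1))" using * unfolding Zc_def by auto
 have rq: "r i \<in> carrier R" for i using c sf_closed by blast
 have fc: "f (k + 1) r \<in> car U (k + 1)" "cd U k y \<in> car U (k + 1)"
  using f_closed rq U.d_closed c by auto
 have "f (k + 1) (%i. a \<otimes> r i) \<oplus>\<^bsub>ct U (k + 1)\<^esub> cd U k (a \<odot>\<^bsub>ct U k\<^esub> y) =
  a \<odot>\<^bsub>ct U (k + 1)\<^esub> (f (k + 1) r \<oplus>\<^bsub>ct U (k + 1)\<^esub> cd U k y)"
  using fc * by (simp add: f_smult rq U.d_smult[OF *(2) c(2) refl] M1.smult_r_distr)
 then show ?thesis
  using c sf_smult[OF _ c(1) *(2)] D_smult[OF *(2), of r] rq * M.smult_closed unfolding Zc_def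
  by (simp add: C_simps)
qed

lemma Bc_add: "p \<in> Bc k ==> p' \<in> Bc k ==> p \<oplus>\<^bsub>C k\<^esub> p' \<in> Bc k"
proof (cases p; cases p')
 fix r y r' y' assume *: "p \<in> Bc k" "p' \<in> Bc k" "p = (r, y)" "p' = (r', y')"
 interpret M: left_module R "ct U k" by (rule U.lm)
 interpret M0: left_module R "ct U (k - 1)" by (rule U.lm)
 obtain q x where q: "q \<in> P k" "x \<in> car U (k - 1)" "r = dif q"
  "y \<oplus>\<^bsub>ct U k\<^esub> f k q = cd U (k - 1) x" "y \<in> car U k" using * unfolding Bc_def by auto
 obtain q' x' where q': "q' \<in> P k" "x' \<in> car U (k - 1)" "r' = dif q'"
  "y' \<oplus>\<^bsub>ct U k\<^esub> f k q' = cd U (k - 1) x'" "y' \<in> car U k" using * unfolding Bc_def by auto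
 have qc: "q i \<in> carrier R" "q' i \<in> carrier R" for i using q q' sf_closed by blast+
 have "y \<oplus>\<^bsub>ct U k\<^esub> y' \<oplus>\<^bsub>ct U k\<^esub> f k (%i. q i \<oplus> q' i) =
  (y \<oplus>\<^bsub>ct U k\<^esub> f k q) \<oplus>\<^bsub>ct U k\<^esub> (y' \<oplus>\<^bsub>ct U k\<^esub> f k q')"
  using q(5) q'(5) by (simp add: f_add qc f_closed M.M.a_ac)
 also have "\<dots> = cd U (k - 1) (x \<oplus>\<^bsub>ct U (k - 1)\<^esub> x')"
  unfolding q(4) q'(4) using q(2) q'(2) by (simp add: U.d_add[of x "k - 1" x' k])
 finally have "y \<oplus>\<^bsub>ct U k\<^esub> y' \<oplus>\<^bsub>ct U k\<^esub> f k (%i. q i \<oplus> q' i) =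
  cd U (k - 1) (x \<oplus>\<^bsub>ct U (k - 1)\<^esub> x')" .
 moreover have "(%i. q i \<oplus> q' i) \<in> P k" using sf_add[OF _ q(1) q'(1)] by simp
 moreover have "x \<oplus>\<^bsub>ct U (k - 1)\<^esub> x' \<in> car U (k - 1)" using q q' by simp
 moreover have "r \<oplus>\<^bsub>F\<^esub> r' = dif (%i. q i \<oplus> q' i)" using D_add[of q q'] qc q q' by simp
 moreover have "y \<oplus>\<^bsub>ct U k\<^esub> y' \<in> car U k" using q q' by simp
 ultimately show ?thesis unfolding *(3,4) C_simps Bc_def by blast
qed

lemma Bc_smult: "p \<in> Bc k ==> a \<in> carrier R ==> a \<odot>\<^bsub>C k\<^esub> p \<in> Bc k"
proof (cases p)
 fix r y assume *: "p \<in> Bc k" "a \<in> carrier R" "p = (r, y)"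
 interpret M: left_module R "ct U k" by (rule U.lm)
 interpret M0: left_module R "ct U (k - 1)" by (rule U.lm)
 obtain q x where q: "q \<in> P k" "x \<in> car U (k - 1)" "r = dif q"
  "y \<oplus>\<^bsub>ct U k\<^esub> f k q = cd U (k - 1) x" "y \<in> car U k" using * unfolding Bc_def by auto
 have qc: "q i \<in> carrier R" for i using q sf_closed by blast
 have "a \<odot>\<^bsub>ct U k\<^esub> y \<oplus>\<^bsub>ct U k\<^esub> f k (%i. a \<otimes> q i) = a \<odot>\<^bsub>ct U k\<^esub> (y \<oplus>\<^bsub>ct U k\<^esub> f k q)"
  using q(5) *(2) by (simp add: f_smult qc f_closed M.smult_r_distr)
 also have "\<dots> = cd U (k - 1) (a \<odot>\<^bsub>ct U (k - 1)\<^esub> x)"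
  unfolding q(4) using q(2) * by (simp add: U.d_smult[of a x "k - 1" k])
 finally have "a \<odot>\<^bsub>ct U k\<^esub> y \<oplus>\<^bsub>ct U k\<^esub> f k (%i. a \<otimes> q i) = cd U (k - 1) (a \<odot>\<^bsub>ct U (k - 1)\<^esub> x)" .
 moreover have "(%i. a \<otimes> q i) \<in> P k" using sf_smult[OF _ q(1) *(2)] by simp
 moreover have "a \<odot>\<^bsub>ct U (k - 1)\<^esub> x \<in> car U (k - 1)" using q * M0.smult_closed by simp
 moreover have "a \<odot>\<^bsub>F\<^esub> r = dif (%i. a \<otimes> q i)" using D_smult[of a q] qc q * by simp
 moreover have "a \<odot>\<^bsub>ct U k\<^esub> y \<in> car U k" using q * M.smult_closed by simp
 ultimately show ?thesis unfolding *(3) C_simps Bc_def by blast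
qed

lemma Bc_zero: "\<zero>\<^bsub>C k\<^esub> \<in> Bc k"
proof -
 interpret M: left_module R "ct U k" by (rule U.lm)
 interpret M0: left_module R "ct U (k - 1)" by (rule U.lm)
 have "(zc U k) \<oplus>\<^bsub>ct U k\<^esub> f k (%i. \<zero>) = cd U (k - 1) (zc U (k - 1))"
  by (simp add: f_zero U.d_zero[of k])
 moreover have "(%i. \<zero>) \<in> P k" "\<zero>\<^bsub>F\<^esub> = dif (%i. \<zero>)" using sf_0 D_zero by auto
 ultimately show ?thesis unfolding C_simps Bc_def using M.M.zero_closed M0.M.zero_closed by blast
qed

lemma Bc_carrier: "Bc k \<subseteq> carrier (C k)"
 unfolding Bc_def C_def using lin_att_sf sf_closed by (auto simp: module_sum_simps) blast

lemma Zc_carrier: "Zc k \<subseteq> carrier (C k)"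
 unfolding Zc_def C_def using sf_closed by (auto simp: module_sum_simps)

text \<open>A cocycle is the sum of its parts \<open>e i p\<close> because the idempotents sum to
  one, and each part is a coboundary.\<close>

lemma resolved_imp_exact:
 assumes res: "!!i. i < n ==> resolved i"
 shows "Zc k \<subseteq> Bc k"
proof
 fix p assume p: "p \<in> Zc k"
 interpret C: left_module R "C k" by (rule lm_C)
 have pc: "p \<in> carrier (C k)" using p Zc_carrier by blast
 have *: "(\<Oplus>i\<in>{..<m}. e i) \<in> carrier R & (\<Oplus>i\<in>{..<m}. e i) \<odot>\<^bsub>C k\<^esub> p \<in> Bc k" if "m \<le> n" for m
  using that
 proof (induction m)
  case 0
  then show ?case using pc Bc_zero by simp
 next
  case (Suc m)
  have em: "e m \<in> carrier R" "e m \<otimes> e m = e m" using Suc e_closed e_idem by auto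
  have "e m \<odot>\<^bsub>C k\<^esub> p \<in> Zv m k"
   unfolding Zv_def using Zc_smult[OF p em(1)] em pc by (simp add: C.smult_assoc[symmetric])
  then have "e m \<odot>\<^bsub>C k\<^esub> p \<in> Bc k" using res[of m] Suc.prems unfolding resolved_def by auto
  moreover have "(\<Oplus>i\<in>{..<Suc m}. e i) = e m \<oplus> (\<Oplus>i\<in>{..<m}. e i)"
   using Suc e_closed by (auto simp: lessThan_Suc intro!: finsum_insert)
  ultimately show ?case using Suc em pc by (simp add: C.smult_l_distr Bc_add)
 qed
 show "p \<in> Bc k" using *[of n] e_sum pc by (simp add: C.smult_one)
qed

text \<open>A cocycle \<open>z\<close> of \<open>U\<close> is read as the cone cocycle
  \<open>(0, z)\<close>, which gives surjectivity on cohomology. A cocycle \<open>r\<close> with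
  \<open>f r = d y\<close> is read as the cone cocycle \<open>(r, - y)\<close> one degree lower,
  which gives injectivity.\<close>

lemma quasi_iso:
 assumes U2: "pre_complex R U" and res: "!!i. i < n ==> resolved i"
 shows "\<forall>k. (\<forall>z\<in>cocycles U k. \<exists>q\<in>P k. dif q = \<zero>\<^bsub>F\<^esub> &
   (\<exists>b\<in>coboundaries U k. z = b \<oplus>\<^bsub>ct U k\<^esub> f k q)) &
  (\<forall>r\<in>P k. dif r = \<zero>\<^bsub>F\<^esub> --> f k r \<in> coboundaries U k --> (\<exists>q\<in>P (k - 1). r = dif q))"
proof (intro allI conjI ballI impI)
 fix k z assume z: "z \<in> cocycles U k"
 interpret M: left_module R "ct U k" by (rule U.lm)
 interpret M1: left_module R "ct U (k + 1)" by (rule U.lm)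
 have "((%i. \<zero>), z) \<in> Zc k"
  using z sf_0[of N] unfolding Zc_def cocycles_def by (simp add: D_zero f_zero)
 then have "((%i. \<zero>), z) \<in> Bc k" using resolved_imp_exact[OF res] by blast
 then obtain q x where q: "q \<in> P k" "x \<in> car U (k - 1)" "(%i. \<zero>) = dif q"
  "z \<oplus>\<^bsub>ct U k\<^esub> f k q = cd U (k - 1) x" "z \<in> car U k" unfolding Bc_def by auto
 \<comment> \<open>The sign convention of \<open>Bc\<close> yields \<open>z + f q = d x\<close>, so
   the wanted preimage is \<open>- q\<close>.\<close>
 let ?q = "%i. \<ominus> \<one> \<otimes> q i"
 have qc: "q i \<in> carrier R" for i using q sf_closed by blast
 have fq: "f k ?q = \<ominus>\<^bsub>ct U k\<^esub> f k q"
  using f_smult[of "\<ominus> \<one>" q k] qc f_closed[of q k] by (simp add: M.smult_minus_left M.smult_one)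
 have "dif ?q = \<zero>\<^bsub>F\<^esub>" using D_smult[of "\<ominus> \<one>" q] qc q(3)[symmetric] by simp
 moreover have "z = cd U (k - 1) x \<oplus>\<^bsub>ct U k\<^esub> f k ?q"
  unfolding fq q(4)[symmetric] using q(5) f_closed[OF qc] by (simp add: M.M.a_assoc M.M.r_neg)
 moreover have "?q \<in> P k" using sf_smult[OF _ q(1), of "\<ominus> \<one>"] by simp
 ultimately show "\<exists>q\<in>P k. dif q = \<zero>\<^bsub>F\<^esub> & (\<exists>b\<in>coboundaries U k. z = b \<oplus>\<^bsub>ct U k\<^esub> f k q)"
  unfolding coboundaries_def using q(2) by blast
next
 fix k r assume r: "r \<in> P k" "dif r = \<zero>\<^bsub>F\<^esub>" "f k r \<in> coboundaries U k"
 interpret M: left_module R "ct U (k - 1)" by (rule U.lm)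
 interpret M1: left_module R "ct U k" by (rule U.lm)
 obtain y where y: "y \<in> car U (k - 1)" "f k r = cd U (k - 1) y" using r(3) unfolding coboundaries_def by blast
 have "(r, \<ominus>\<^bsub>ct U (k - 1)\<^esub> y) \<in> Zc (k - 1)"
  using r y U.d_minus[of y "k - 1" k] U.d_closed'[of y k] unfolding Zc_def by (simp add: M1.M.r_neg)
 then have "(r, \<ominus>\<^bsub>ct U (k - 1)\<^esub> y) \<in> Bc (k - 1)" using resolved_imp_exact[OF res] by blast
 then show "\<exists>q\<in>P (k - 1). r = dif q" unfolding Bc_def by blast
qed

end

definition attach :: "'a semifree => 'a => int => (nat => 'a) => 'a semifree" where
 "attach S e d r = \<lparr>gens = Suc (gens S), vtx = (vtx S)(gens S := e), degr = (degr S)(gens S := d),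
   att = (att S)(gens S := r)\<rparr>"

lemma attach_simps [simp]:
 "gens (attach S e d r) = Suc (gens S)" "vtx (attach S e d r) = (vtx S)(gens S := e)"
 "degr (attach S e d r) = (degr S)(gens S := d)" "att (attach S e d r) = (att S)(gens S := r)"
 unfolding attach_def by simp_all

text \<open>The new generator is made to bound the cocycle \<open>(r0, y0)\<close>: its differential
  is \<open>r0\<close> and its image in \<open>U\<close> is \<open>- y0\<close>. The two are
  compatible because \<open>f r0 + d y0 = 0\<close>.\<close>

locale attaching = partial_resolution R \<iota> n e S U u
 for R :: "'a ring" (structure) and \<iota> :: "'k::field => 'a" and n e S and U :: "('a, 'm) cochain" and u +
 fixes i :: nat and d :: int and r0 :: "nat => 'a" and y0 :: 'm
 assumes i: "i < n" and z0: "(r0, y0) \<in> Zv i d"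
begin

definition S' :: "'a semifree" where "S' = attach S (e i) d r0"
definition u' :: "nat => 'm" where "u' = u(N := \<ominus>\<^bsub>ct U d\<^esub> y0)"

lemma S'_simps [simp]: "gens S' = Suc N" "vtx S' = (vtx S)(N := e i)" "degr S' = (degr S)(N := d)"
 "att S' = (att S)(N := r0)"
 unfolding S'_def by simp_all

lemma gens_S': "gens S' = Suc N"
 by simp

lemma z0D: "r0 \<in> P (d + 1)" "y0 \<in> car U d" "dif r0 = (%i. \<zero>)"
 "f (d + 1) r0 \<oplus>\<^bsub>ct U (d + 1)\<^esub> cd U d y0 = (zc U (d + 1))"
 "!!j. e i \<otimes> r0 j = r0 j" "e i \<odot>\<^bsub>ct U d\<^esub> y0 = y0"
 using z0 unfolding Zv_def Zc_def by (auto simp: C_simps dest: fun_cong)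

lemma r0_closed [simp]: "r0 j \<in> carrier R" using z0D(1) sf_closed by blast

lemma sf_carrier_S': "m \<le> N ==> sf_carrier R S' m k = sf_carrier R S m k"
proof -
 assume m: "m \<le> N"
 have "(if j < m & degr S' j = k then r j \<in> carrier R & r j \<otimes> vtx S' j = r j else r j = \<zero>) \<longleftrightarrow>
  (if j < m & degr S j = k then r j \<in> carrier R & r j \<otimes> vtx S j = r j else r j = \<zero>)" for r j
  using m by (cases "j < m") simp_all
 then show ?thesis unfolding sf_carrier_def by presburger
qed

text \<open>Separates an element into its old part and the coefficient of the new generator, which
  lives in place \<open>N\<close>.\<close>

lemma P'_iff: "r \<in> sf_carrier R S' (Suc N) k \<longleftrightarrow> r(N := \<zero>) \<in> P k &
  (if k = d then r N \<in> carrier R & r N \<otimes> e i = r N else r N = \<zero>)"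
proof -
 let ?a = "%j. if j < Suc N & degr S' j = k then r j \<in> carrier R & r j \<otimes> vtx S' j = r j else r j = \<zero>"
 let ?b = "%j. if j < N & degr S j = k then (r(N := \<zero>)) j \<in> carrier R & (r(N := \<zero>)) j \<otimes> vtx S j = (r(N := \<zero>)) j
  else (r(N := \<zero>)) j = \<zero>"
 let ?c = "if k = d then r N \<in> carrier R & r N \<otimes> e i = r N else r N = \<zero>"
 have ab: "?a j \<longleftrightarrow> ?b j" if "j ~= N" for j using that by (cases "j < N") simp_all
 have aN: "?a N \<longleftrightarrow> ?c" by (cases "k = d") simp_all
 have bN: "?b N" by simp
 have "(\<forall>j. ?a j) \<longleftrightarrow> (\<forall>j. ?b j) & ?c"
 proof
  assume *: "\<forall>j. ?a j"
  show "(\<forall>j. ?b j) & ?c"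
  proof
   show "\<forall>j. ?b j"
   proof
    fix j show "?b j" using *[rule_format, of j] ab[of j] bN by (cases "j = N") blast+
   qed
   show ?c using * aN by blast
  qed
 next
  assume *: "(\<forall>j. ?b j) & ?c"
  show "\<forall>j. ?a j"
  proof
   fix j show "?a j" using *[THEN conjunct1, rule_format, of j] *[THEN conjunct2] ab[of j] aN
    by (cases "j = N") blast+
  qed
 qed
 then show ?thesis unfolding sf_carrier_def by simp
qed

lemma P_upd: "r \<in> P k ==> r(N := \<zero>) = r"
 using sf_zero[of r N k N] by auto

lemma P_subset: "P k \<subseteq> sf_carrier R S' (Suc N) k"
proof
 fix r assume r: "r \<in> P k"
 then have "r N = \<zero>" using sf_zero by blast
 then show "r \<in> sf_carrier R S' (Suc N) k" unfolding P'_iff using r P_upd[OF r] e_closed[OF i] by simp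
qed

lemma D': "(!!j. r j \<in> carrier R) ==>
  lin F (att S') (Suc N) r = (%j. dif (r(N := \<zero>)) j \<oplus> r N \<otimes> r0 j)"
proof -
 have "lin F (att S') N r = dif (r(N := \<zero>))" by (intro F.lin_cong) simp
 then show ?thesis by simp
qed

lemma D'_P: "r \<in> P k ==> lin F (att S') (Suc N) r = dif r"
proof -
 assume r: "r \<in> P k"
 have "r N = \<zero>" using sf_zero[OF r] by blast
 moreover have "dif r j \<in> carrier R" for j using lin_att_sf[OF r] sf_closed by blast
 ultimately show ?thesis using r sf_closed[OF r] P_upd[OF r] by (subst D') auto
qed

lemma f': "ev U S' u' (Suc N) k k r = f k (r(N := \<zero>)) \<oplus>\<^bsub>ct U k\<^esub>
  (if k = d then r N \<odot>\<^bsub>ct U k\<^esub> (\<ominus>\<^bsub>ct U k\<^esub> y0) else r N \<odot>\<^bsub>ct U k\<^esub> (zc U k))"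
proof -
 interpret M: left_module R "ct U k" by (rule U.lm)
 have "lin (ct U k) (%j. if degr S' j = k then u' j else (zc U k)) N r = f k (r(N := \<zero>))"
  unfolding f_def ev_def by (intro M.lin_cong) (simp add: u'_def)
 then show ?thesis unfolding ev_def by (cases "k = d") (simp_all add: u'_def)
qed

lemma f'_P: "r \<in> P k ==> ev U S' u' (Suc N) k k r = f k r"
proof -
 assume r: "r \<in> P k"
 interpret M: left_module R "ct U k" by (rule U.lm)
 interpret Md: left_module R "ct U d" by (rule U.lm)
 have "r N = \<zero>" using sf_zero[OF r] by blast
 moreover have "f k r \<in> car U k" using sf_closed[OF r] f_closed by blast
 moreover have "\<ominus>\<^bsub>ct U d\<^esub> y0 \<in> car U d"
  using z0D(2) abelian_group.a_inv_closed[OF U.abg] by blast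
 ultimately show ?thesis
  using P_upd[OF r] left_module.smult_zero_left[OF U.lm, of "\<ominus>\<^bsub>ct U d\<^esub> y0" d] Md.M.r_zero
  by (cases "k = d") (simp_all add: f')
qed

sublocale new: semifree R S'
proof (unfold_locales, unfold is_semifree_def, intro allI impI)
 fix g assume "g < gens S'"
 then consider "g < N" | "g = N" by fastforce
 then show "vtx S' g \<in> carrier R & vtx S' g \<otimes> vtx S' g = vtx S' g &
   att S' g \<in> sf_carrier R S' g (degr S' g + 1) & (\<forall>i. vtx S' g \<otimes> att S' g i = att S' g i) &
   lin (fmod R) (att S') (gens S') (att S' g) = (%i. \<zero>)"
 proof cases
  case 1
  have "att S g \<in> P (degr S g + 1)" using sf_mono[OF att_sf[OF 1]] 1 by simp
  then have "lin F (att S') (Suc N) (att S g) = (%i. \<zero>)" using att_att[OF 1] D'_P by simp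
  then show ?thesis using 1 vtx[OF 1] att_sf[OF 1] vtx_att[OF 1] sf_carrier_S'[of g "degr S g + 1"] by simp
 next
  case 2
  have "lin F (att S') (Suc N) r0 = (%i. \<zero>)" using D'_P[OF z0D(1)] z0D(3) by simp
  then show ?thesis using 2 e_closed[OF i] e_idem[OF i] z0D sf_carrier_S'[of N "d + 1"] by simp
 qed
qed

lemma u'_cocyc: "u' \<in> new.cocyc U"
 unfolding new.cocyc_def
proof (intro CollectI conjI allI impI)
 show "u' \<in> extensional {..<gens S'}" using u unfolding cocyc_def u'_def by (auto simp: extensional_def)
 fix g assume "g < gens S'"
 then consider "g < N" | "g = N" by fastforce
 then have "u' g \<in> car U (degr S' g) & vtx S' g \<odot>\<^bsub>ct U (degr S' g)\<^esub> u' g = u' g &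
  cd U (degr S' g) (u' g) = ev U S' u' (gens S') (degr S' g + 1) (degr S' g + 1) (att S' g)"
 proof cases
  case 1
  have "att S g \<in> P (degr S g + 1)" using sf_mono[OF att_sf[OF 1]] 1 by simp
  then have "ev U S' u' (gens S') (degr S g + 1) (degr S g + 1) (att S g) =
   ev U S u N (degr S g + 1) (degr S g + 1) (att S g)" using f'_P by (simp add: f_def)
  then show ?thesis using 1 cocycD[OF u 1] by (simp add: u'_def)
 next
  case 2
  interpret M: left_module R "ct U d" by (rule U.lm)
  interpret M1: left_module R "ct U (d + 1)" by (rule U.lm)
  have fc: "f (d + 1) r0 \<in> car U (d + 1)" "cd U d y0 \<in> car U (d + 1)"
   using f_closed z0D(2) U.d_closed by auto
  have "f (d + 1) r0 = \<ominus>\<^bsub>ct U (d + 1)\<^esub> cd U d y0"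
   using M1.M.minus_equality[OF z0D(4)] fc by simp
  then have "cd U d (\<ominus>\<^bsub>ct U d\<^esub> y0) = ev U S' u' (Suc N) (d + 1) (d + 1) r0"
   using f'_P[OF z0D(1)] U.d_minus[OF z0D(2) refl] by simp
  then show ?thesis
   using 2 z0D(2,6) e_closed[OF i] by (simp add: u'_def M.smult_minus_right)
 qed
 then show "u' g \<in> car U (degr S' g)" "vtx S' g \<odot>\<^bsub>ct U (degr S' g)\<^esub> u' g = u' g"
  "cd U (degr S' g) (u' g) = ev U S' u' (gens S') (degr S' g + 1) (degr S' g + 1) (att S' g)" by blast+
qed

sublocale new: partial_resolution R \<iota> n e S' U u'
 using U u'_cocyc vertices i by unfold_locales (auto simp: less_Suc_eq)

lemma Bc_subset: "Bc k \<subseteq> new.Bc k"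
proof
 fix p assume "p \<in> Bc k"
 then obtain r y q x where q: "p = (r, y)" "y \<in> car U k" "q \<in> P k" "x \<in> car U (k - 1)"
  "r = dif q" "y \<oplus>\<^bsub>ct U k\<^esub> f k q = cd U (k - 1) x" unfolding Bc_def by blast
 have "q \<in> new.P k" using subsetD[OF P_subset q(3)] unfolding gens_S' .
 moreover have "r = lin F (att S') (gens S') q" unfolding q(5) gens_S' D'_P[OF q(3)] ..
 moreover have "y \<oplus>\<^bsub>ct U k\<^esub> new.f k q = cd U (k - 1) x"
  unfolding new.f_def gens_S' f'_P[OF q(3)] by (rule q(6))
 ultimately show "p \<in> new.Bc k" unfolding q(1) new.Bc_def using q(2,4) by blast
qed

text \<open>Witnessed by the new generator itself, with coefficient \<open>e i\<close> in place
  \<open>N\<close>, together with zero in \<open>U\<close>.\<close>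

lemma z0_Bc: "(r0, y0) \<in> new.Bc d"
proof -
 interpret M: left_module R "ct U d" by (rule U.lm)
 interpret M0: left_module R "ct U (d - 1)" by (rule U.lm)
 let ?g = "%j. if j = N then e i else \<zero>"
 have z: "(?g(N := \<zero>)) = (%j. \<zero>)" by auto
 have "?g \<in> new.P d" unfolding gens_S' P'_iff using z sf_0 e_closed[OF i] e_idem[OF i] by simp
 moreover have "r0 = lin F (att S') (gens S') ?g"
 proof -
  have "?g j \<in> carrier R" for j using e_closed[OF i] by simp
  from D'[of ?g, OF this] have "lin F (att S') (gens S') ?g = (%j. \<zero> \<oplus> e i \<otimes> r0 j)"
   unfolding z D_zero gens_S' by simp
  then show ?thesis using z0D(5) by simp
 qed
 moreover have "new.f d ?g = \<ominus>\<^bsub>ct U d\<^esub> y0"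
  using f'[of d ?g] z0D(2,6) e_closed[OF i] unfolding z new.f_def gens_S'
  by (simp add: f_zero M.smult_minus_right)
 then have "y0 \<oplus>\<^bsub>ct U d\<^esub> new.f d ?g = cd U (d - 1) (zc U (d - 1))"
  using z0D(2) U.d_zero[of d "d - 1"] by (simp add: M.M.r_neg)
 ultimately show ?thesis unfolding new.Bc_def using z0D(2) M0.M.zero_closed by blast
qed

lemma new_ZvD:
 assumes p: "(r, y) \<in> new.Zv j k"
 shows "r(N := \<zero>) \<in> P (k + 1)" "r N \<in> carrier R" "k + 1 = d ==> r N \<otimes> e i = r N"
  "k + 1 ~= d ==> r N = \<zero>" "e j \<otimes> r N = r N" "e j \<odot>\<^bsub>C k\<^esub> (r, y) = (r, y)"
  "y \<in> car U k" "lin F (att S') (Suc N) r = \<zero>\<^bsub>F\<^esub>"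
  "new.f (k + 1) r \<oplus>\<^bsub>ct U (k + 1)\<^esub> cd U k y = (zc U (k + 1))" "!!i. r i \<in> carrier R"
proof -
 have Z: "(r, y) \<in> new.Zc k" and e: "e j \<odot>\<^bsub>C k\<^esub> (r, y) = (r, y)" using p unfolding new.Zv_def by auto
 have rP: "r \<in> new.P (k + 1)" using Z unfolding new.Zc_def by blast
 note P' = rP[unfolded gens_S' P'_iff]
 show "r(N := \<zero>) \<in> P (k + 1)" using P' by blast
 show "r N \<in> carrier R" using new.sf_closed[OF rP] .
 show "r N \<otimes> e i = r N" if "k + 1 = d" using P' that by simp
 show "r N = \<zero>" if "k + 1 ~= d" using P' that by simp
 show "e j \<odot>\<^bsub>C k\<^esub> (r, y) = (r, y)" by (rule e)
 have "(%l. e j \<otimes> r l) = r" using e unfolding C_simps by simp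
 from fun_cong[OF this, of N] show "e j \<otimes> r N = r N" .
 show "y \<in> car U k" "lin F (att S') (Suc N) r = \<zero>\<^bsub>F\<^esub>"
  "new.f (k + 1) r \<oplus>\<^bsub>ct U (k + 1)\<^esub> cd U k y = (zc U (k + 1))"
  using Z unfolding new.Zc_def gens_S' by auto
 show "!!i. r i \<in> carrier R" using new.sf_closed[OF rP] .
qed

lemma Zv_subset:
 assumes p: "(r, y) \<in> new.Zv j k" and rN: "r N = \<zero>"
 shows "(r, y) \<in> Zv j k"
proof -
 note p' = new_ZvD[OF p]
 have "r(N := \<zero>) = r" using rN by auto
 then have rP: "r \<in> P (k + 1)" using p'(1) by simp
 have "new.f (k + 1) r = f (k + 1) r" using f'_P[OF rP] unfolding new.f_def gens_S' .
 then show ?thesis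
  using p'(6,7,9) p'(8)[unfolded D'_P[OF rP]] rP unfolding Zv_def Zc_def by simp
qed

text \<open>The coefficient of the new generator lies in \<open>e j R e i\<close>, which vanishes by
  triangularity.\<close>

lemma Zv_lower:
 assumes "j < i" shows "new.Zv j k \<subseteq> Zv j k"
proof
 fix p assume p: "p \<in> new.Zv j k"
 obtain r y where py: "p = (r, y)" by (cases p)
 note p' = new_ZvD[OF p[unfolded py]]
 have "e j \<otimes> (r N \<otimes> e i) = \<zero>" using triangular[OF assms i p'(2)] .
 then have "r N = \<zero>" using p'(3,4,5) by (cases "k + 1 = d") simp_all
 then show "p \<in> Zv j k" using Zv_subset p py by blast
qed

text \<open>By \<open>local\<close> the new coefficient is a multiple of \<open>e i\<close> by a
  scalar \<open>c\<close>. If \<open>c\<close> were nonzero, the old part of the cocycle divided by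
  \<open>- c\<close> would already bound \<open>(r0, y0)\<close>. So killing a class at
  \<open>i\<close> creates no new cocycle at \<open>i\<close>.\<close>

lemma Zv_same:
 assumes nB: "(r0, y0) \<notin> Bc d" shows "new.Zv i k \<subseteq> Zv i k"
proof
 fix p assume p: "p \<in> new.Zv i k"
 obtain r y where py: "p = (r, y)" by (cases p)
 note p' = new_ZvD[OF p[unfolded py]]
 note rN = p'(2-5) and rP = p'(1) and y = p'(7) and fr = p'(9)
 have Dr: "lin F (att S') (Suc N) r = (%i. \<zero>)" using p'(8) unfolding fmod_simps .
 have "r N = \<zero>"
 proof (rule ccontr)
  assume nz: "r N ~= \<zero>"
  then have k: "k + 1 = d" using rN by blast
  then have k1: "d - 1 = k" by simp
  obtain c where "e i \<otimes> (r N \<otimes> e i) = \<iota> c \<otimes> e i" using local[OF i rN(1)] by blast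
  then have c: "r N = \<iota> c \<otimes> e i" using rN(2)[OF k] rN(4) by simp
  have c0: "c ~= 0" using nz c e_closed[OF i] by (auto simp: \<iota>_zero)
  define q where "q = r(N := \<zero>)"
  have qc: "q j \<in> carrier R" for j using rP sf_closed unfolding q_def by blast
  interpret M: left_module R "ct U d" by (rule U.lm)
  interpret M0: left_module R "ct U (d - 1)" by (rule U.lm)
  have ck: "\<iota> (- inverse c) \<otimes> (\<iota> c \<otimes> x) = \<ominus> x" if "x \<in> carrier R" for x
  proof -
   have "\<iota> (- inverse c) \<otimes> \<iota> c = \<ominus> \<one>"
    using c0 \<iota>_minus[of 1] \<iota>_one by (simp add: \<iota>_mult[symmetric])
   then show ?thesis using that by (simp add: m_assoc[symmetric] l_minus)
  qed
  have rNr0: "r N \<otimes> r0 j = \<iota> c \<otimes> r0 j" for j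
   unfolding c using z0D(5)[of j] e_closed[OF i] by (simp add: m_assoc)
  let ?b = "\<iota> (- inverse c)"
  have "dif q j \<oplus> \<iota> c \<otimes> r0 j = \<zero>" for j
  proof -
   have "lin F (att S') (Suc N) r j = dif q j \<oplus> r N \<otimes> r0 j"
    unfolding D'[of r, OF p'(10)] q_def ..
   then show ?thesis unfolding Dr rNr0 by (rule sym)
  qed
  moreover have Dqc: "dif q j \<in> carrier R" for j
   using lin_att_sf[OF rP] sf_closed unfolding q_def by blast
  ultimately have "dif q j = \<ominus> (\<iota> c \<otimes> r0 j)" for j
   using minus_equality by (metis \<iota>_closed m_closed r0_closed)
  then have "?b \<otimes> dif q j = r0 j" for j
   using ck[OF r0_closed] by (simp add: r_minus)
  then have 1: "r0 = dif (%j. ?b \<otimes> q j)"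
   using D_smult[of ?b q] qc by (simp add: fun_eq_iff)
  have fq: "f d q \<in> car U d" "cd U k y \<in> car U d"
   using f_closed[of q d] qc U.d_closed[OF y k[symmetric]] by auto
  have cy: "\<iota> c \<odot>\<^bsub>ct U d\<^esub> y0 \<in> car U d" using z0D(2) M.smult_closed by simp
  have "r N \<odot>\<^bsub>ct U d\<^esub> (\<ominus>\<^bsub>ct U d\<^esub> y0) = \<ominus>\<^bsub>ct U d\<^esub> (\<iota> c \<odot>\<^bsub>ct U d\<^esub> y0)"
   using z0D(2,6) e_closed[OF i] unfolding c by (simp add: M.smult_minus_right M.smult_assoc)
  then have "new.f d r = f d q \<oplus>\<^bsub>ct U d\<^esub> \<ominus>\<^bsub>ct U d\<^esub> (\<iota> c \<odot>\<^bsub>ct U d\<^esub> y0)"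
   unfolding new.f_def q_def gens_S' f' by simp
  then have e0: "f d q \<oplus>\<^bsub>ct U d\<^esub> \<ominus>\<^bsub>ct U d\<^esub> (\<iota> c \<odot>\<^bsub>ct U d\<^esub> y0) \<oplus>\<^bsub>ct U d\<^esub> cd U k y = (zc U d)"
   using fr unfolding k by simp
  have b1: "?b \<odot>\<^bsub>ct U d\<^esub> (\<ominus>\<^bsub>ct U d\<^esub> (\<iota> c \<odot>\<^bsub>ct U d\<^esub> y0)) = y0"
  proof -
   have "?b \<otimes> \<iota> c = \<ominus> \<one>" using ck[of \<one>] by simp
   then have "?b \<odot>\<^bsub>ct U d\<^esub> (\<iota> c \<odot>\<^bsub>ct U d\<^esub> y0) = \<ominus>\<^bsub>ct U d\<^esub> y0"
    using z0D(2) by (simp add: M.smult_assoc[symmetric] M.smult_minus_left M.smult_one)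
   then show ?thesis using cy z0D(2) by (simp add: M.smult_minus_right)
  qed
  have "?b \<odot>\<^bsub>ct U d\<^esub> (f d q \<oplus>\<^bsub>ct U d\<^esub> \<ominus>\<^bsub>ct U d\<^esub> (\<iota> c \<odot>\<^bsub>ct U d\<^esub> y0) \<oplus>\<^bsub>ct U d\<^esub> cd U k y) =
   f d (%j. ?b \<otimes> q j) \<oplus>\<^bsub>ct U d\<^esub> y0 \<oplus>\<^bsub>ct U d\<^esub> cd U (d - 1) (?b \<odot>\<^bsub>ct U (d - 1)\<^esub> y)"
   using fq cy y b1 f_smult[of ?b q d] qc U.d_smult[of ?b y k d] k unfolding k1
   by (simp add: M.smult_r_distr)
  then have e1: "f d (%j. ?b \<otimes> q j) \<oplus>\<^bsub>ct U d\<^esub> y0 \<oplus>\<^bsub>ct U d\<^esub> cd U (d - 1) (?b \<odot>\<^bsub>ct U (d - 1)\<^esub> y) = (zc U d)"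
   unfolding e0 by simp
  let ?x = "\<ominus>\<^bsub>ct U (d - 1)\<^esub> (?b \<odot>\<^bsub>ct U (d - 1)\<^esub> y)"
  have x: "?b \<odot>\<^bsub>ct U (d - 1)\<^esub> y \<in> car U (d - 1)" "?x \<in> car U (d - 1)"
   using y M0.smult_closed[of ?b y] abelian_group.a_inv_closed[OF U.abg, of "?b \<odot>\<^bsub>ct U k\<^esub> y" k]
   unfolding k1 by auto
  have fb: "f d (%j. ?b \<otimes> q j) \<in> car U d" using f_closed qc by simp
  have dx: "cd U (d - 1) (?b \<odot>\<^bsub>ct U (d - 1)\<^esub> y) \<in> car U d" using U.d_closed' x(1) by blast
  have "\<ominus>\<^bsub>ct U d\<^esub> cd U (d - 1) (?b \<odot>\<^bsub>ct U (d - 1)\<^esub> y) = f d (%j. ?b \<otimes> q j) \<oplus>\<^bsub>ct U d\<^esub> y0"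
   using M.M.minus_equality[OF e1] fb dx z0D(2) by simp
  then have "y0 \<oplus>\<^bsub>ct U d\<^esub> f d (%j. ?b \<otimes> q j) = cd U (d - 1) ?x"
   using U.d_minus[OF x(1), of d] fb z0D(2) by (simp add: M.M.a_comm)
  moreover have "(%j. ?b \<otimes> q j) \<in> P d" using sf_smult[OF _ rP, of ?b] unfolding q_def k by simp
  ultimately have "(r0, y0) \<in> Bc d" unfolding Bc_def using 1 x(2) z0D(2) by blast
  then show False using nB by blast
 qed
 then show "p \<in> Zv i k" using Zv_subset p py by blast
qed

end

context attaching
begin

lemma Zv_mono: "Zv j k \<subseteq> new.Zv j k"
proof
 fix p assume p: "p \<in> Zv j k"
 obtain r y where py: "p = (r, y)" by (cases p)
 have Z: "(r, y) \<in> Zc k" and e: "e j \<odot>\<^bsub>C k\<^esub> (r, y) = (r, y)" using p py unfolding Zv_def by auto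
 have r: "r \<in> P (k + 1)" using Z unfolding Zc_def by blast
 have "r \<in> new.P (k + 1)" using subsetD[OF P_subset r] unfolding gens_S' .
 moreover have "new.f (k + 1) r = f (k + 1) r" unfolding new.f_def gens_S' f'_P[OF r] f_def ..
 moreover have "lin F (att S') (gens S') r = dif r" unfolding gens_S' by (rule D'_P[OF r])
 ultimately show "p \<in> new.Zv j k" using Z e unfolding py new.Zv_def new.Zc_def Zc_def by simp
qed

end

context partial_resolution
begin

lemma subspace_Bc: "subspace (C k) (Bc k)"
 unfolding subspace_def using Bc_carrier Bc_zero Bc_add Bc_smult \<iota>_closed by blast

lemma subspace_Zv:
 assumes "i < n" shows "subspace (C k) (Zv i k)"
proof -
 interpret C: left_module R "C k" by (rule lm_C)
 have Zv: "p \<in> Zv i k ==> p \<in> Zc k & p \<in> carrier (C k) & e i \<odot>\<^bsub>C k\<^esub> p = p" for p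
  using Zc_carrier unfolding Zv_def by blast
 have ei: "e i \<in> carrier R" using e_closed assms .
 show ?thesis
  unfolding subspace_def
 proof (intro conjI ballI allI)
  show "Zv i k \<subseteq> carrier (C k)" using Zv by blast
  interpret M: left_module R "ct U k" by (rule U.lm)
  interpret M1: left_module R "ct U (k + 1)" by (rule U.lm)
  have "\<zero>\<^bsub>C k\<^esub> \<in> Zc k"
   using sf_0[of N "k + 1"] unfolding C_simps Zc_def by (simp add: D_zero f_zero U.d_zero[OF refl])
  then show "\<zero>\<^bsub>C k\<^esub> \<in> Zv i k" unfolding Zv_def using C.smult_zero_right[OF ei] by simp
  fix p q assume pq: "p \<in> Zv i k" "q \<in> Zv i k"
  have "e i \<odot>\<^bsub>C k\<^esub> (p \<oplus>\<^bsub>C k\<^esub> q) = p \<oplus>\<^bsub>C k\<^esub> q"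
   using Zv[OF pq(1)] Zv[OF pq(2)] C.smult_r_distr[OF ei, of p q] by simp
  then show "p \<oplus>\<^bsub>C k\<^esub> q \<in> Zv i k"
   using Zv[OF pq(1)] Zv[OF pq(2)] Zc_add[of p k q] unfolding Zv_def by blast
 next
  fix c p assume p: "p \<in> Zv i k"
  have "e i \<odot>\<^bsub>C k\<^esub> (\<iota> c \<odot>\<^bsub>C k\<^esub> p) = \<iota> c \<odot>\<^bsub>C k\<^esub> (e i \<odot>\<^bsub>C k\<^esub> p)"
   using Zv[OF p] C.smult_assoc[OF ei \<iota>_closed, of p c] C.smult_assoc[OF \<iota>_closed ei, of p c]
   unfolding \<iota>_central[OF ei, of c] by (elim conjE) (simp only:)
  then show "\<iota> c \<odot>\<^bsub>C k\<^esub> p \<in> Zv i k"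
   using Zv[OF p] Zc_smult[of p k "\<iota> c"] unfolding Zv_def by simp
 qed
qed

lemma fdim_P: "fdim F (P k)"
proof -
 let ?x = "%i. if degr S i = k then gen i else \<zero>\<^bsub>F\<^esub>"
 have x: "\<forall>i<N. ?x i \<in> carrier F" using gen_F by simp
 have "P k \<subseteq> {lin F ?x N r | r. \<forall>i<N. r i \<in> carrier R}"
 proof
  fix r assume r: "r \<in> P k"
  have "r = lin F ?x N r" by (rule lin_gen[OF r, symmetric])
  moreover have "\<forall>i<N. r i \<in> carrier R" using sf_closed[OF r] by blast
  ultimately show "r \<in> {lin F ?x N r | r. \<forall>i<N. r i \<in> carrier R}" by blast
 qed
 then show ?thesis by (rule fdim_mono[OF fdim_lin[OF F.left_module_axioms x]])
qed

text \<open>Finite dimension of \<open>P (k + 1)\<close> and of the terms of \<open>U\<close> bounds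
  \<open>Zv i k\<close>. The span is described through all subspaces containing the list, so that
  \<open>resolve_vertex\<close> can adjoin the coboundaries to it.\<close>

lemma Zv_spanning:
 assumes i: "i < n"
 shows "\<exists>ps. set ps \<subseteq> Zv i k & (\<forall>V. subspace (C k) V --> set ps \<subseteq> V --> Zv i k \<subseteq> V)"
proof -
 have "fdim (C k) (P (k + 1) \<times> car U k)"
  unfolding C_def
 proof (rule fdim_module_sum[OF F.left_module_axioms U.lm fdim_P])
  show "fdim (ct U k) (car U k)"
   using U unfolding bounded_complex_iff by (intro fdim_fin_gen U.lm) blast
 qed (use sf_closed in auto)
 moreover have "Zv i k \<subseteq> P (k + 1) \<times> car U k" unfolding Zv_def Zc_def by auto
 ultimately have "fdim (C k) (Zv i k)" by (rule fdim_mono)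
 then obtain x m where "\<forall>j<m. x j \<in> carrier (C k)" "Zv i k \<subseteq> range (klin (C k) x m)"
  unfolding fdim_def by blast
 from subspace_spanning[OF lm_C this subspace_Zv[OF i]]
 obtain y p where y: "\<forall>j<p. y j \<in> Zv i k" "Zv i k \<subseteq> range (klin (C k) y p)" by blast
 show ?thesis
 proof (intro exI[of _ "map y [0..<p]"] conjI allI impI)
  show "set (map y [0..<p]) \<subseteq> Zv i k" using y(1) by auto
  fix V assume V: "subspace (C k) V" "set (map y [0..<p]) \<subseteq> V"
  have "klin (C k) y q c \<in> V" if "q \<le> p" for q c
   using that
  proof (induction q)
   case 0 then show ?case using V(1) unfolding klin_def subspace_def by simp
  next
   case (Suc q)
   then have "y q \<in> V" "klin (C k) y q c \<in> V" using V(2) by auto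
   then show ?case using V(1) unfolding klin_def subspace_def by simp
  qed
  then show "Zv i k \<subseteq> V" using y(2) by blast
 qed
qed

lemma Zv_bounded: "\<exists>K. \<forall>k. \<bar>k\<bar> > K --> Zv i k \<subseteq> {\<zero>\<^bsub>C k\<^esub>}"
proof -
 obtain K where K: "\<forall>k. \<bar>k\<bar> > K --> car U k = {(zc U k)}"
  using U unfolding bounded_complex_iff by blast
 obtain L where L: "\<forall>k. \<bar>k\<bar> > L --> car (sf_obj R S) k = {(zc (sf_obj R S) k)}"
  using bounded_complex_sf_obj unfolding bounded_complex_iff by blast
 have "Zv i k \<subseteq> {\<zero>\<^bsub>C k\<^esub>}" if k: "\<bar>k\<bar> > max K (L + 1)" for k
 proof
  fix p assume "p \<in> Zv i k"
  then obtain r y where p: "p = (r, y)" "r \<in> P (k + 1)" "y \<in> car U k" unfolding Zv_def Zc_def by auto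
  have "y = (zc U k)" using K k p(3) by auto
  moreover have "\<bar>k + 1\<bar> > L" using k by linarith
  then have "enc ` P (k + 1) = {(zc (sf_obj R S) (k + 1))}" using L unfolding sf_obj_carrier by blast
  then have "enc r = enc (%i. \<zero>)" using p(2) sf_0[of N "k + 1"] by blast
  then have "r = (%i. \<zero>)" by (rule injD[OF inj_enc])
  ultimately show "p \<in> {\<zero>\<^bsub>C k\<^esub>}" unfolding p(1) C_simps by simp
 qed
 then show ?thesis by blast
qed

text \<open>Outside a bounded range of degrees there are no nonzero cocycles, so finitely many lists
  can be concatenated; each entry carries its degree.\<close>

lemma Zv_list:
 assumes i: "i < n"
 shows "\<exists>zs. (\<forall>(k, p)\<in>set zs. p \<in> Zv i k) &
  (\<forall>k V. subspace (C k) V --> (\<forall>p. (k, p) \<in> set zs --> p \<in> V) --> Zv i k \<subseteq> V)"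
proof -
 obtain L where L: "!!k. set (L k) \<subseteq> Zv i k"
  "!!k V. subspace (C k) V ==> set (L k) \<subseteq> V ==> Zv i k \<subseteq> V" using Zv_spanning[OF i] by metis
 obtain K where K: "!!k. \<bar>k\<bar> > K ==> Zv i k \<subseteq> {\<zero>\<^bsub>C k\<^esub>}" using Zv_bounded by blast
 define zs where "zs = concat (map (%k. map (Pair k) (L k)) [-K..K])"
 have zs: "(k, p) \<in> set zs \<longleftrightarrow> \<bar>k\<bar> \<le> K & p \<in> set (L k)" for k p
 proof -
  have "(k, p) \<in> set zs \<longleftrightarrow> k \<in> {-K..K} & p \<in> set (L k)" unfolding zs_def by auto
  then show ?thesis by auto
 qed
 show ?thesis
 proof (intro exI[of _ zs] conjI allI impI)
  show "\<forall>(k, p)\<in>set zs. p \<in> Zv i k"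
  proof (intro ballI, clarify)
   fix k r y assume "(k, r, y) \<in> set zs"
   then show "(r, y) \<in> Zv i k" using L(1) unfolding zs by blast
  qed
  fix k V assume V: "subspace (C k) V" "\<forall>p. (k, p) \<in> set zs --> p \<in> V"
  show "Zv i k \<subseteq> V"
  proof (cases "\<bar>k\<bar> \<le> K")
   case True then show ?thesis using L(2)[OF V(1)] V(2) zs by blast
  next
   case False
   then have "Zv i k \<subseteq> {\<zero>\<^bsub>C k\<^esub>}" using K by simp
   then show ?thesis using V(1) unfolding subspace_def by blast
  qed
 qed
qed

end

section \<open>Existence of semi-free resolutions\<close>

context triangular_algebra
begin

text \<open>
 Attaching cells at the vertex \<open>i\<close> kills cohomology at \<open>i\<close> and, by triangularity, creates no new
 cohomology at the vertices below \<open>i\<close>.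
\<close>

lemma resolve_vertex:
 assumes "partial_resolution R \<iota> n e S U u" "i < n" "\<forall>j<i. partial_resolution.resolved R e S U u j"
  and "\<forall>(k, p)\<in>set zs. p \<in> partial_resolution.Zv R e S U u i k"
  and "\<forall>k V. subspace (partial_resolution.C R U k) V --> partial_resolution.Bc R S U u k \<subseteq> V -->
   (\<forall>p. (k, p) \<in> set zs --> p \<in> V) --> partial_resolution.Zv R e S U u i k \<subseteq> V"
 shows "\<exists>S' u'. partial_resolution R \<iota> n e S' U u' & (\<forall>j\<le>i. partial_resolution.resolved R e S' U u' j)"
 using assms
proof (induction zs arbitrary: S u)
 case Nil
 interpret partial_resolution R \<iota> n e S U u by (rule Nil)
 have "Zv i k \<subseteq> Bc k" for k using Nil.prems(5) subspace_Bc by simp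
 then have "resolved i" unfolding resolved_def by blast
 then have "\<forall>j\<le>i. resolved j" using Nil.prems(3) by (auto simp: le_less)
 then show ?case using Nil.prems(1) by blast
next
 case (Cons z zs)
 interpret partial_resolution R \<iota> n e S U u by (rule Cons)
 note span = Cons.prems(5)[rule_format]
 obtain d r0 y0 where z: "z = (d, r0, y0)" by (cases z)
 show ?case
 \<comment> \<open>Invariant: the remaining list and the coboundaries together generate
   \<open>Zv i k\<close>. The head is dropped if it is a coboundary; otherwise a cell is attached
   along it and it becomes one.\<close>
 proof (cases "(r0, y0) \<in> Bc d")
  case True
  show ?thesis
  proof (rule Cons.IH[OF Cons.prems(1-3)])
   show "\<forall>(k, p)\<in>set zs. p \<in> Zv i k" using Cons.prems(4) by simp
   show "\<forall>k V. subspace (C k) V --> Bc k \<subseteq> V --> (\<forall>p. (k, p) \<in> set zs --> p \<in> V) --> Zv i k \<subseteq> V"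
   proof (intro allI impI)
    fix k V assume V: "subspace (C k) V" "Bc k \<subseteq> V" "\<forall>p. (k, p) \<in> set zs --> p \<in> V"
    show "Zv i k \<subseteq> V" using V(2,3) True z by (intro span V(1,2)) auto
   qed
  qed
 next
  case False
  have "(r0, y0) \<in> Zv i d" using Cons.prems(4) z by simp
  then interpret attaching R \<iota> n e S U u i d r0 y0 using Cons.prems(2) by unfold_locales
  show ?thesis
  proof (rule Cons.IH[OF new.partial_resolution_axioms Cons.prems(2)])
   show "\<forall>j<i. new.resolved j"
   proof (intro allI impI)
    fix j assume j: "j < i"
    then have "resolved j" using Cons.prems(3) by blast
    then show "new.resolved j" unfolding resolved_def new.resolved_def
     using Zv_lower[OF j] Bc_subset by blast
   qed
   show "\<forall>(k, p)\<in>set zs. p \<in> new.Zv i k"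
   proof (intro ballI, clarify)
    fix k r y assume "(k, r, y) \<in> set zs"
    then have "(r, y) \<in> Zv i k" using Cons.prems(4) by auto
    then show "(r, y) \<in> new.Zv i k" using Zv_mono by blast
   qed
   show "\<forall>k V. subspace (C k) V --> new.Bc k \<subseteq> V --> (\<forall>p. (k, p) \<in> set zs --> p \<in> V) --> new.Zv i k \<subseteq> V"
   proof (intro allI impI)
    fix k V assume V: "subspace (C k) V" "new.Bc k \<subseteq> V" "\<forall>p. (k, p) \<in> set zs --> p \<in> V"
    have "Bc k \<subseteq> V" using V(2) Bc_subset by blast
    moreover have "p \<in> V" if p: "(k, p) \<in> set (z # zs)" for p
    proof (cases "(k, p) = z")
     case True then show ?thesis using V(2) z0_Bc z by blast
    next
     case False
     then have "(k, p) \<in> set zs" using p unfolding list.set insert_iff by blast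
     then show ?thesis using V(3) by blast
    qed
    ultimately have "Zv i k \<subseteq> V" using span V(1) by blast
    then show "new.Zv i k \<subseteq> V" using Zv_same[OF False] by blast
   qed
  qed
 qed
qed

text \<open>Starting from the zero complex, the vertices are treated in increasing order; attaching
  cells at \<open>m\<close> preserves exactness at the vertices below.\<close>

lemma resolution_exists:
 assumes U: "bounded_complex R U"
 shows "\<exists>S u. partial_resolution R \<iota> n e S U u & (\<forall>j<n. partial_resolution.resolved R e S U u j)"
proof -
 have "\<exists>S u. partial_resolution R \<iota> n e S U u & (\<forall>j<m. partial_resolution.resolved R e S U u j)" if "m \<le> n" for m
  using that
 proof (induction m)
  case 0
  let ?S = "\<lparr>gens = 0, vtx = undefined, degr = undefined, att = undefined\<rparr> :: 'a semifree"
  interpret semifree R ?S by unfold_locales (simp add: is_semifree_def)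
  have "partial_resolution R \<iota> n e ?S U (%_. undefined)"
   using U by unfold_locales (simp_all add: cocyc_def)
  then show ?case by blast
 next
  case (Suc m)
  then obtain S u where S: "partial_resolution R \<iota> n e S U u" "\<forall>j<m. partial_resolution.resolved R e S U u j" by auto
  interpret partial_resolution R \<iota> n e S U u by (rule S)
  have m: "m < n" using Suc by simp
  obtain zs where zs: "\<forall>(k, p)\<in>set zs. p \<in> Zv m k"
   "\<forall>k V. subspace (C k) V --> (\<forall>p. (k, p) \<in> set zs --> p \<in> V) --> Zv m k \<subseteq> V" using Zv_list[OF m] by blast
  from resolve_vertex[OF S(1) m S(2) zs(1)] zs(2) show ?case by (simp add: less_Suc_eq_le)
 qed
 then show ?thesis by blast
qed

text \<open>Translates exactness of the cone, which concerns unencoded elements, into a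
  quasi-isomorphism between objects and so into an isomorphism of the derived category.\<close>

lemma semifree_resolution:
 fixes U :: "('a, 'a list set) cochain"
 assumes U: "bounded_complex R U"
 shows "\<exists>S. semifree R S & (\<forall>g<gens S. vtx S g \<in> e ` {..<n}) & isomorphic (derived_cat R) (sf_obj R S) U"
proof -
 obtain S u where S: "partial_resolution R \<iota> n e S U u" "\<forall>j<n. partial_resolution.resolved R e S U u j"
  using resolution_exists[OF U] by blast
 interpret partial_resolution R \<iota> n e S U u by (rule S)
 have U': "pre_complex R U" using U unfolding bounded_complex_iff by blast
 interpret c: chain_map R "sf_obj R S" U "classify U u"
  by (intro chain_map_intro pre_complex_sf_obj U' classify_chain_map u)
 note q = quasi_iso[OF U' S(2)[rule_format]]
 have "classify U u \<in> quasi_isos R (sf_obj R S) U"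
  unfolding c.quasi_isos_iff
 proof (intro allI conjI ballI impI)
  fix k z assume "z \<in> cocycles U k"
  then obtain r b where r: "r \<in> P k" "dif r = \<zero>\<^bsub>F\<^esub>" "b \<in> coboundaries U k"
   "z = b \<oplus>\<^bsub>ct U k\<^esub> f k r" using q by blast
  have "enc r \<in> cocycles (sf_obj R S) k"
   unfolding cocycles_def using r(1,2)
   by (simp add: sf_obj_carrier sf_obj_cdiff sf_obj_cterm tr_module_simps[OF inj_enc])
  moreover have "z = b \<oplus>\<^bsub>ct U k\<^esub> classify U u k (enc r)" using r by (simp add: classify_enc f_def)
  ultimately show "\<exists>x\<in>cocycles (sf_obj R S) k. \<exists>b\<in>coboundaries U k. z = b \<oplus>\<^bsub>ct U k\<^esub> classify U u k x"
   using r(3) by blast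
 next
  fix k x assume x: "x \<in> cocycles (sf_obj R S) k" "classify U u k x \<in> coboundaries U k"
  then obtain r where r: "r \<in> P k" "x = enc r" unfolding cocycles_def sf_obj_carrier by blast
  have "enc (dif r) = enc \<zero>\<^bsub>F\<^esub>"
   using x(1) r unfolding cocycles_def by (simp add: sf_obj_cdiff sf_obj_cterm tr_module_simps[OF inj_enc])
  then have "dif r = \<zero>\<^bsub>F\<^esub>" by (rule injD[OF inj_enc])
  moreover have "f k r \<in> coboundaries U k" using x(2) r by (simp add: classify_enc f_def)
  ultimately obtain s where s: "s \<in> P (k - 1)" "r = dif s" using q r(1) by blast
  show "x \<in> coboundaries (sf_obj R S) k"
   unfolding coboundaries_def sf_obj_carrier r(2) s(2) sf_obj_cdiff[OF s(1), symmetric]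
   by (intro imageI s(1))
 qed
 then have "isomorphic (derived_cat R) (sf_obj R S) U"
  unfolding derived_cat_def using U bounded_complex_sf_obj
  by (intro localising.isomorphic_L_W[OF localising_complexes]) (auto simp: complexes_def)
 then show ?thesis using vertices semifree_axioms by blast
qed

end

section \<open>The shift functor\<close>

text \<open>Unpacks isomorphisms into representing zigzags, because the shift acts on zigzags step
  by step.\<close>

lemma (in localising) isomorphic_L_iff:
 "isomorphic L X Y \<longleftrightarrow> (\<exists>p q. zz X p Y & zz Y q X & ze X X (p @ q) [] & ze Y Y (q @ p) [])"
proof
 assume "isomorphic L X Y"
 then obtain p q where pq: "zz X p Y" "zz Y q X" "cls X X (p @ q) = cls X X []" "cls Y Y (q @ p) = cls Y Y []"
  unfolding isomorphic_def is_iso_def Mor_L Ident_L using Comp_L by (auto simp: Comp_L)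
 moreover have "zz X [] X" "zz Y [] Y" using zz_Obj[OF pq(1)] by (auto intro: zz_nil)
 ultimately show "\<exists>p q. zz X p Y & zz Y q X & ze X X (p @ q) [] & ze Y Y (q @ p) []"
  using cls_eq_iff zz_append by metis
next
 assume "\<exists>p q. zz X p Y & zz Y q X & ze X X (p @ q) [] & ze Y Y (q @ p) []"
 then obtain p q where pq: "zz X p Y" "zz Y q X" "ze X X (p @ q) []" "ze Y Y (q @ p) []" by blast
 then have "cls X X (p @ q) = cls X X []" "cls Y Y (q @ p) = cls Y Y []"
  using cls_eq_iff ze_zz by metis+
 then have "is_iso L X Y (cls X Y p)"
  unfolding is_iso_def Mor_L Ident_L using pq(1,2) Comp_L by auto
 then show "isomorphic L X Y" unfolding isomorphic_def by blast
qed

lemma shift_simps [simp]: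
 "ct (shift X) n = ct X (n + 1)"
 "cd (shift X) n = (\<lambda>x\<in>car X (n + 1). \<ominus>\<^bsub>ct X (n + 1 + 1)\<^esub> cd X (n + 1) x)"
 unfolding shift_def by simp_all

lemma (in complex) pre_complex_shift: "pre_complex R (shift X)"
 unfolding pre_complex_def
proof (intro allI conjI ballI)
 fix n :: int
 obtain m where m: "n + 1 = m" by simp
 interpret M: left_module R "ct X m" by (rule lm)
 interpret M1: left_module R "ct X (m + 1)" by (rule lm)
 interpret M2: left_module R "ct X (m + 1 + 1)" by (rule lm)
 show "left_module R (ct (shift X) n)" by (simp add: lm)
 show "cd (shift X) n \<in> module_hom R (ct (shift X) n) (ct (shift X) (n + 1))"
  unfolding shift_simps m
  by (intro module_homI)
   (auto simp: d_closed[OF _ refl] d_add[OF _ _ refl] d_smult[OF _ _ refl] M.smult_closed M1.smult_minus_right M1.M.minus_add)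
 fix x assume "x \<in> car (shift X) n"
 then have x: "x \<in> car X m" unfolding shift_simps m .
 have "cd X (m + 1) (\<ominus>\<^bsub>ct X (m + 1)\<^esub> cd X m x) = \<ominus>\<^bsub>ct X (m + 1 + 1)\<^esub> (zc X (m + 1 + 1))"
  using d_minus[OF d_closed[OF x refl] refl] d_d[OF x refl] by simp
 also have "\<dots> = (zc X (m + 1 + 1))" by (rule M2.minus_zero)
 finally have 1: "cd X (m + 1) (\<ominus>\<^bsub>ct X (m + 1)\<^esub> cd X m x) = (zc X (m + 1 + 1))" .
 have "\<ominus>\<^bsub>ct X (m + 1)\<^esub> cd X m x \<in> car X (m + 1)" using d_closed[OF x refl] by simp
 with 1 show "cd (shift X) (n + 1) (cd (shift X) n x) = (zc (shift X) (n + 1 + 1))"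
  unfolding shift_simps m using x M2.minus_zero by (simp only: restrict_apply if_True)
qed

lemma bounded_complex_shift: "bounded_complex R X ==> bounded_complex R (shift X)"
proof -
 assume X: "bounded_complex R X"
 then interpret complex R X by (simp add: complex_def bounded_complex_iff)
 obtain K where K: "\<forall>n. \<bar>n\<bar> > K --> car X n = {(zc X n)}"
  using X unfolding bounded_complex_iff by blast
 have "\<forall>n. \<bar>n\<bar> > K + 1 --> car (shift X) n = {(zc (shift X) n)}"
  unfolding shift_simps
 proof (intro allI impI)
  fix n :: int assume "\<bar>n\<bar> > K + 1"
  then have "\<bar>n + 1\<bar> > K" by linarith
  then show "car X (n + 1) = {(zc X (n + 1))}" using K by blast
 qed
 then show ?thesis using X pre_complex_shift unfolding bounded_complex_iff by auto
qed

lemma chain_maps_shift: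
 fixes X Y :: "('a, 'm) cochain"
 assumes X: "pre_complex R X" and Y: "pre_complex R Y" and f: "f \<in> chain_maps R X Y"
 shows "(%n. f (n + 1)) \<in> chain_maps R (shift X) (shift Y)"
proof -
 interpret chain_map R X Y f using X Y f by (rule chain_map_intro)
 show ?thesis
  unfolding chain_maps_def
 proof (intro CollectI allI conjI ballI)
  fix n :: int
  obtain m where m: "n + 1 = m" by simp
  show "f (n + 1) \<in> module_hom R (ct (shift X) n) (ct (shift Y) n)"
   unfolding shift_simps m by (rule chain_mapsD(1)[OF f])
  fix x assume "x \<in> car (shift X) n"
  then have x: "x \<in> car X m" unfolding shift_simps m .
  show "f (n + 1 + 1) (cd (shift X) n x) = cd (shift Y) n (f (n + 1) x)"
   unfolding shift_simps m using x closed[OF x] minus[OF X.d_closed[OF x refl]] comm[OF x refl] by simp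
 qed
qed

lemma (in complex) cocycles_shift: "cocycles (shift X) n = cocycles X (n + 1)"
proof -
 obtain m where m: "n + 1 = m" by simp
 interpret M: left_module R "ct X m" by (rule lm)
 interpret M1: left_module R "ct X (m + 1)" by (rule lm)
 have "\<ominus>\<^bsub>ct X (m + 1)\<^esub> cd X m x = (zc X (m + 1)) \<longleftrightarrow> cd X m x = (zc X (m + 1))"
  if "x \<in> car X m" for x
  using M1.M.minus_minus[OF d_closed[OF that refl]] M1.minus_zero by metis
 then show ?thesis unfolding cocycles_def shift_simps m by auto
qed

text \<open>The sign in the shifted differential is absorbed by replacing an element with its
  negative, so images do not change.\<close>

lemma (in complex) coboundaries_shift: "coboundaries (shift X) n = coboundaries X (n + 1)"
proof -
 obtain k where k: "n - 1 + 1 = k" by simp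
 have nk: "n + 1 - 1 = k" "n = k" using k by simp_all
 interpret M: left_module R "ct X k" by (rule lm)
 interpret M1: left_module R "ct X (k + 1)" by (rule lm)
 have "\<ominus>\<^bsub>ct X (k + 1)\<^esub> cd X k x = cd X k (\<ominus>\<^bsub>ct X k\<^esub> x)" if "x \<in> car X k" for x
  using d_minus[OF that refl] by simp
 moreover have "cd X k x = \<ominus>\<^bsub>ct X (k + 1)\<^esub> cd X k (\<ominus>\<^bsub>ct X k\<^esub> x)" if "x \<in> car X k" for x
  using d_minus[OF that refl] d_closed[OF that refl] by simp
 moreover have "\<ominus>\<^bsub>ct X k\<^esub> x \<in> car X k" if "x \<in> car X k" for x
  using that by simp
 ultimately have "(%x. \<ominus>\<^bsub>ct X (k + 1)\<^esub> cd X k x) ` car X k = cd X k ` car X k"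
  by (intro equalityI image_subsetI) (metis imageI)+
 then show ?thesis
  unfolding coboundaries_def shift_simps nk(1) k by (simp add: image_def)
qed

text \<open>Cohomology of the shift is literally the same set one degree higher, so the same
  bijections serve.\<close>

lemma quasi_isos_shift:
 fixes X Y :: "('a, 'm) cochain"
 assumes X: "pre_complex R X" and Y: "pre_complex R Y" and f: "f \<in> quasi_isos R X Y"
 shows "(%n. f (n + 1)) \<in> quasi_isos R (shift X) (shift Y)"
proof -
 have "cohomology (shift Z) n = cohomology Z (n + 1)" if "pre_complex R Z" for n and Z :: "('a, 'm) cochain"
  using complex.cocycles_shift[OF complex.intro[OF that]] complex.coboundaries_shift[OF complex.intro[OF that]]
  unfolding cohomology_def by simp
 moreover have "cohomology_map (shift Y) (%n. f (n + 1)) n = cohomology_map Y f (n + 1)" for n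
  using complex.coboundaries_shift[OF complex.intro[OF Y]] unfolding cohomology_map_def by (intro ext) simp
 ultimately show ?thesis
  using f X Y chain_maps_shift[OF X Y] unfolding quasi_isos_def by auto
qed

lemma Obj_complexes: "Obj (complexes R) = Collect (bounded_complex R)"
 by (simp add: complexes_def)

lemma zigzag_shift:
 "zigzag (complexes R) (quasi_isos R) X p Y ==>
  zigzag (complexes R) (quasi_isos R) (shift X) (map shift_zstep p) (shift Y)"
proof (induction rule: zigzag.induct)
 case (zz_nil X)
 then show ?case by (auto simp: Obj_complexes bounded_complex_shift intro: zigzag.zz_nil)
next
 case (zz_fwd X f Y p Z)
 then have "pre_complex R X" "pre_complex R Y" using D.zz_Obj[OF zz_fwd(3)]
  by (auto simp: Obj_complexes bounded_complex_iff)
 then show ?case using zz_fwd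
  by (auto simp: Obj_complexes bounded_complex_shift intro!: zigzag.zz_fwd)
   (auto simp: complexes_def chain_maps_shift)
next
 case (zz_bwd Y s X p Z)
 then have "pre_complex R X" "pre_complex R Y" using D.zz_Obj[OF zz_bwd(3)]
  by (auto simp: Obj_complexes bounded_complex_iff)
 then show ?case using zz_bwd
  by (auto simp: Obj_complexes bounded_complex_shift quasi_isos_shift intro!: zigzag.zz_bwd)
qed

lemma zigzag_eq_shift:
 "zigzag_eq (complexes R) (quasi_isos R) A B p q ==>
  zigzag_eq (complexes R) (quasi_isos R) (shift A) (shift B) (map shift_zstep p) (map shift_zstep q)"
proof (induction rule: zigzag_eq.induct)
 case (ze_refl A p B) then show ?case using zigzag_shift zigzag_eq.ze_refl by metis
next
 case (ze_sym A B p q) from zigzag_eq.ze_sym[OF ze_sym(2)] show ?case .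
next
 case (ze_trans A B p q r) from zigzag_eq.ze_trans[OF ze_trans(3,4)] show ?case .
next
 case (ze_ident A p X q B)
 from zigzag_eq.ze_ident[OF zigzag_shift[OF ze_ident(1)] zigzag_shift[OF ze_ident(2)]]
 show ?case by (simp add: complexes_def)
next
 case (ze_comp A p X Y Z q B f g)
 have c: "pre_complex R X" "pre_complex R Y" "pre_complex R Z" "bounded_complex R Y"
  using D.zz_Obj[OF ze_comp(1)] D.zz_Obj[OF ze_comp(3)] ze_comp(2) by (auto simp: Obj_complexes bounded_complex_iff)
 have "(%n. f (n + 1)) \<in> Mor (complexes R) (shift X) (shift Y)" "(%n. g (n + 1)) \<in> Mor (complexes R) (shift Y) (shift Z)"
  using c ze_comp(4,5) by (auto simp: complexes_def chain_maps_shift)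
 moreover have "shift Y \<in> Obj (complexes R)" using bounded_complex_shift[OF c(4)] by (simp add: Obj_complexes)
 ultimately show ?case
  using zigzag_eq.ze_comp[OF zigzag_shift[OF ze_comp(1)] _ zigzag_shift[OF ze_comp(3)]] by (simp add: complexes_def)
next
 case (ze_inv1 A p X q B Y s)
 have c: "pre_complex R X" "pre_complex R Y" "bounded_complex R Y"
  using D.zz_Obj[OF ze_inv1(1)] ze_inv1(3) by (auto simp: Obj_complexes bounded_complex_iff)
 have "shift Y \<in> Obj (complexes R)" using bounded_complex_shift[OF c(3)] by (simp add: Obj_complexes)
 from zigzag_eq.ze_inv1[OF zigzag_shift[OF ze_inv1(1)] zigzag_shift[OF ze_inv1(2)] this quasi_isos_shift[OF c(1,2) ze_inv1(4)]]
 show ?case by simp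
next
 case (ze_inv2 A p Y q B X s)
 have c: "pre_complex R X" "pre_complex R Y" "bounded_complex R X"
  using D.zz_Obj[OF ze_inv2(1)] ze_inv2(3) by (auto simp: Obj_complexes bounded_complex_iff)
 have "shift X \<in> Obj (complexes R)" using bounded_complex_shift[OF c(3)] by (simp add: Obj_complexes)
 from zigzag_eq.ze_inv2[OF zigzag_shift[OF ze_inv2(1)] zigzag_shift[OF ze_inv2(2)] this quasi_isos_shift[OF c(1,2) ze_inv2(4)]]
 show ?case by simp
qed

lemma isomorphic_shift: "isomorphic (derived_cat R) X Y ==> isomorphic (derived_cat R) (shift X) (shift Y)"
 unfolding derived_cat_def D.isomorphic_L_iff
proof (elim exE conjE)
 fix p q
 let ?C = "complexes R" and ?W = "quasi_isos R"
 assume "zigzag ?C ?W X p Y" "zigzag ?C ?W Y q X" "zigzag_eq ?C ?W X X (p @ q) []" "zigzag_eq ?C ?W Y Y (q @ p) []"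
 from zigzag_shift[OF this(1)] zigzag_shift[OF this(2)] zigzag_eq_shift[OF this(3)] zigzag_eq_shift[OF this(4)]
 show "\<exists>p q. zigzag ?C ?W (shift X) p (shift Y) & zigzag ?C ?W (shift Y) q (shift X) &
  zigzag_eq ?C ?W (shift X) (shift X) (p @ q) [] & zigzag_eq ?C ?W (shift Y) (shift Y) (q @ p) []"
  by (intro exI conjI) simp_all
qed

lemma Obj_derived_cat: "Obj (derived_cat R) = Collect (bounded_complex R)"
 by (simp add: derived_cat_def Obj_complexes)

lemma category_derived_cat: "category (derived_cat R)"
 unfolding derived_cat_def by (rule D.category_L)

lemma Obj_shift_pow: "X \<in> Obj (derived_cat R) ==> (shift ^^ n) X \<in> Obj (derived_cat R)"
 by (induction n) (auto simp: Obj_derived_cat bounded_complex_shift)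

lemma isomorphic_shift_pow:
 "isomorphic (derived_cat R) X Y ==> isomorphic (derived_cat R) ((shift ^^ n) X) ((shift ^^ n) Y)"
 by (induction n) (auto intro: isomorphic_shift)

lemma derived_tri_cat_simps:
 "Obj (derived_tri_cat R) = Obj (derived_cat R)" "Mor (derived_tri_cat R) = Mor (derived_cat R)"
 "Ident (derived_tri_cat R) = Ident (derived_cat R)" "Comp (derived_tri_cat R) = Comp (derived_cat R)"
 "shift_obj (derived_tri_cat R) = shift"
 unfolding derived_tri_cat_def Let_def by simp_all

text \<open>Thinness is about equality of morphisms, so it transfers along faithful functors in both
  directions, and \<open>\<theta>\<close> moves the shifts past \<open>Fo\<close> up to isomorphism.
  Powers of the shift stand on both arguments, so that positive and negative degrees are reached
  with natural exponents.\<close>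

lemma derived_equivalent_thin:
 fixes A :: "'a ring" and B :: "'b ring"
 assumes "derived_equivalent A B"
 obtains Fo :: "('a, 'a list set) cochain => ('b, 'b list set) cochain" where
  "!!X. X \<in> Obj (derived_cat A) ==> Fo X \<in> Obj (derived_cat B)"
  "!!X Y m n. X \<in> Obj (derived_cat A) ==> Y \<in> Obj (derived_cat A) ==>
   thin (derived_cat A) ((shift ^^ m) X) ((shift ^^ n) Y) \<longleftrightarrow>
   thin (derived_cat B) ((shift ^^ m) (Fo X)) ((shift ^^ n) (Fo Y))"
proof -
 let ?A = "derived_cat A :: (('a, 'a list set) cochain, _) cat"
 let ?B = "derived_cat B :: (('b, 'b list set) cochain, _) cat"
 interpret A: category ?A by (rule category_derived_cat)
 interpret B: category ?B by (rule category_derived_cat)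
 have is_functor: "is_functor (derived_tri_cat R) (derived_tri_cat R') = is_functor (derived_cat R) (derived_cat R')"
  for R :: "'x ring" and R' :: "'y ring"
  unfolding is_functor_def derived_tri_cat_simps ..
 have natural_iso: "natural_iso (derived_tri_cat R) (derived_tri_cat R') = natural_iso (derived_cat R) (derived_cat R')"
  for R :: "'x ring" and R' :: "'y ring"
  unfolding natural_iso_def is_iso_def derived_tri_cat_simps ..
 from assms obtain Fo Fm \<theta> Go Gm \<eta> \<kappa> where
  t: "triangle_functor (derived_tri_cat A :: (('a, 'a list set) cochain, _) tri_cat)
   (derived_tri_cat B :: (('b, 'b list set) cochain, _) tri_cat) Fo Fm \<theta>" and G: "is_functor ?B ?A Go Gm"
  and \<eta>: "natural_iso ?A ?A (%X. X) (%X Y f. f) (%X. Go (Fo X)) (%X Y f. Gm (Fo X) (Fo Y) (Fm X Y f)) \<eta>"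
  and \<kappa>: "natural_iso ?B ?B (%X. Fo (Go X)) (%X Y f. Fm (Go X) (Go Y) (Gm X Y f)) (%X. X) (%X Y f. f) \<kappa>"
  unfolding derived_equivalent_def triangle_equivalent_def is_functor natural_iso by blast
 have F: "is_functor ?A ?B Fo Fm"
  using t unfolding triangle_functor_def is_functor_def derived_tri_cat_simps by blast
 have sh: "isomorphic ?B (Fo (shift X)) (shift (Fo X))" if "X \<in> Obj ?A" for X
  using t that unfolding triangle_functor_def natural_iso_def is_iso_def isomorphic_def derived_tri_cat_simps by blast
 have Fo: "Fo X \<in> Obj ?B" if "X \<in> Obj ?A" for X using F that unfolding is_functor_def by blast
 have Go: "Go X \<in> Obj ?A" if "X \<in> Obj ?B" for X using G that unfolding is_functor_def by blast
 have Fm: "Fm X Y f \<in> Mor ?B (Fo X) (Fo Y)" if "X \<in> Obj ?A" "Y \<in> Obj ?A" "f \<in> Mor ?A X Y" for X Y f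
  using F that unfolding is_functor_def by blast
 have Gm: "Gm X Y f \<in> Mor ?A (Go X) (Go Y)" if "X \<in> Obj ?B" "Y \<in> Obj ?B" "f \<in> Mor ?B X Y" for X Y f
  using G that unfolding is_functor_def by blast
 have shn: "isomorphic ?B (Fo ((shift ^^ n) X)) ((shift ^^ n) (Fo X))" if X: "X \<in> Obj ?A" for X n
 proof (induction n)
  case 0
  have "isomorphic ?B (Fo X) (Fo X)"
   using B.ident_in[OF Fo[OF X]] B.ident_comp[OF Fo[OF X] Fo[OF X]]
   unfolding isomorphic_def is_iso_def by (blast intro: B.ident_comp B.comp_ident Fo X)
  then show ?case by simp
 next
  case (Suc n)
  have "isomorphic ?B (shift (Fo ((shift ^^ n) X))) (shift ((shift ^^ n) (Fo X)))"
   by (rule isomorphic_shift[OF Suc])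
  moreover have "Fo (shift ((shift ^^ n) X)) \<in> Obj ?B" using Fo[OF Obj_shift_pow[OF X, of "Suc n"]] by simp
  moreover have "shift (Fo ((shift ^^ n) X)) \<in> Obj ?B"
   using Obj_shift_pow[OF Fo[OF Obj_shift_pow[OF X, of n]], of 1] by simp
  moreover have "shift ((shift ^^ n) (Fo X)) \<in> Obj ?B" using Obj_shift_pow[OF Fo[OF X], of "Suc n"] by simp
  ultimately show ?case using B.isomorphic_trans[OF _ _ _ sh[OF Obj_shift_pow[OF X, of n]]] by simp
 qed
 have iso: "isomorphic ?A X (Go (Fo X))" if "X \<in> Obj ?A" for X
  using \<eta> that unfolding natural_iso_def isomorphic_def by blast
 \<comment> \<open>Forwards through \<open>Gm\<close>, faithful by \<open>\<kappa>\<close>, after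
   replacing \<open>X\<close> and \<open>Y\<close> by their images under \<open>Go\<close> and
   \<open>Fo\<close>; backwards through \<open>Fm\<close>, faithful by
   \<open>\<eta>\<close>.\<close>
 have thin: "thin ?A X Y \<longleftrightarrow> thin ?B (Fo X) (Fo Y)" if XY: "X \<in> Obj ?A" "Y \<in> Obj ?A" for X Y
 proof
  assume "thin ?A X Y"
  then have *: "thin ?A (Go (Fo X)) (Go (Fo Y))"
   using A.thin_isomorphic[OF XY _ _ iso iso] XY Fo Go by blast
  show "thin ?B (Fo X) (Fo Y)"
   unfolding thin_def
  proof (intro ballI)
   fix f g assume fg: "f \<in> Mor ?B (Fo X) (Fo Y)" "g \<in> Mor ?B (Fo X) (Fo Y)"
   have "Gm (Fo X) (Fo Y) f = Gm (Fo X) (Fo Y) g" using * Gm fg Fo XY unfolding thin_def by blast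
   then show "f = g"
    using faithful_if_natural_iso'[OF B.category_axioms \<kappa> _ _ Fo[OF XY(1)] Fo[OF XY(2)] fg] Fo Fm Go Gm by simp
  qed
 next
  assume *: "thin ?B (Fo X) (Fo Y)"
  show "thin ?A X Y"
   unfolding thin_def
  proof (intro ballI)
   fix f g assume fg: "f \<in> Mor ?A X Y" "g \<in> Mor ?A X Y"
   have "Fm X Y f = Fm X Y g" using * Fm fg XY unfolding thin_def by blast
   then show "f = g" using A.faithful_if_natural_iso[OF \<eta> _ XY fg] Fo Go by simp
  qed
 qed
 show thesis
 proof (rule that[OF Fo])
  fix X Y m n assume XY: "X \<in> Obj ?A" "Y \<in> Obj ?A"
  let ?X = "(shift ^^ m) X" and ?Y = "(shift ^^ n) Y" and ?X' = "(shift ^^ m) (Fo X)" and ?Y' = "(shift ^^ n) (Fo Y)"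
  have O: "?X \<in> Obj ?A" "?Y \<in> Obj ?A" "?X' \<in> Obj ?B" "?Y' \<in> Obj ?B" "Fo ?X \<in> Obj ?B" "Fo ?Y \<in> Obj ?B"
   using Obj_shift_pow XY Fo by blast+
  have "thin ?B (Fo ?X) (Fo ?Y) \<longleftrightarrow> thin ?B ?X' ?Y'"
   using B.thin_isomorphic[OF O(5,6,3,4) shn[OF XY(1)] shn[OF XY(2)]]
    B.thin_isomorphic[OF O(3,4,5,6) B.isomorphic_sym[OF shn[OF XY(1)]] B.isomorphic_sym[OF shn[OF XY(2)]]] by blast
  then show "thin ?A ?X ?Y \<longleftrightarrow> thin ?B ?X' ?Y'" using thin[OF O(1,2)] by blast
 qed
qed

section \<open>Shifts of semi-free complexes\<close>

definition sf_shift :: "'a ring => 'a semifree => 'a semifree" where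
 "sf_shift R S = \<lparr>gens = gens S, vtx = vtx S, degr = (%g. degr S g - 1), att = (%g i. \<ominus>\<^bsub>R\<^esub> att S g i)\<rparr>"

lemma sf_shift_simps [simp]:
 "gens (sf_shift R S) = gens S" "vtx (sf_shift R S) = vtx S" "degr (sf_shift R S) g = degr S g - 1"
 "att (sf_shift R S) g i = \<ominus>\<^bsub>R\<^esub> att S g i"
 unfolding sf_shift_def by simp_all

lemma sf_carrier_shift: "sf_carrier R (sf_shift R S) m k = sf_carrier R S m (k + 1)"
 unfolding sf_carrier_def by (simp add: algebra_simps)

context semifree
begin

lemma lin_att_shift:
 assumes r: "!!i. r i \<in> carrier R"
 shows "lin F (att (sf_shift R S)) N r = (%i. \<ominus> dif r i)"
proof -
 have att: "g < N ==> att S g \<in> carrier F" for g using att_closed by simp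
 have m: "\<ominus>\<^bsub>F\<^esub> x = (%i. \<ominus> x i)" if "x \<in> carrier F" for x
 proof -
  have "\<ominus>\<^bsub>F\<^esub> x = (\<ominus> \<one>) \<odot>\<^bsub>F\<^esub> x" using F.smult_minus_left[OF one_closed that] F.smult_one[OF that] by (simp only:)
  then show ?thesis using that by (auto simp: l_minus)
 qed
 have "lin F (att (sf_shift R S)) N r = lin F (%g. \<ominus>\<^bsub>F\<^esub> att S g) N r"
  using att by (intro F.lin_cong) (simp add: m sf_shift_def)
 also have "\<dots> = \<ominus>\<^bsub>F\<^esub> dif r" using att r by (intro F.lin_minus_right)
 also have "\<dots> = (%i. \<ominus> dif r i)" using F.lin_closed[of N r "att S"] att r by (intro m) blast
 finally show ?thesis .
qed

lemma semifree_shift: "semifree R (sf_shift R S)"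
proof (unfold_locales, unfold is_semifree_def, intro allI impI)
 fix g assume "g < gens (sf_shift R S)"
 then have g: "g < N" by simp
 have att: "att (sf_shift R S) g = (%i. \<ominus> \<one> \<otimes> att S g i)"
  using att_closed[OF g] by (auto simp: l_minus)
 have "(%i. \<ominus> \<one> \<otimes> att S g i) \<in> sf_carrier R S g (degr S g + 1)"
  using sf_smult[of g "att S g"] att_sf[OF g] g by simp
 moreover have "vtx S g \<otimes> (\<ominus> \<one> \<otimes> att S g i) = \<ominus> \<one> \<otimes> att S g i" for i
  using vtx_att[OF g, of i] vtx(1)[OF g] att_closed[OF g, of i] by (simp add: l_minus r_minus)
 moreover have "lin F (att (sf_shift R S)) N (%i. \<ominus> \<one> \<otimes> att S g i) = (%i. \<zero>)"
 proof -
  have "dif (%i. \<ominus> \<one> \<otimes> att S g i) = (\<ominus> \<one>) \<odot>\<^bsub>F\<^esub> dif (att S g)"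
   using att_closed g by (intro F.lin_smult_left) auto
  then show ?thesis using att_att[OF g] att_closed[OF g] by (subst lin_att_shift) auto
 qed
 ultimately show "vtx (sf_shift R S) g \<in> carrier R & vtx (sf_shift R S) g \<otimes> vtx (sf_shift R S) g = vtx (sf_shift R S) g &
  att (sf_shift R S) g \<in> sf_carrier R (sf_shift R S) g (degr (sf_shift R S) g + 1) &
  (\<forall>i. vtx (sf_shift R S) g \<otimes> att (sf_shift R S) g i = att (sf_shift R S) g i) &
  lin F (att (sf_shift R S)) (gens (sf_shift R S)) (att (sf_shift R S) g) = (%i. \<zero>)"
  unfolding att sf_carrier_shift using vtx[OF g] by simp
qed

text \<open>An equality of complexes, not just an isomorphism: both sides encode the same
  coefficient sequences by \<open>enc\<close>, and the sign of the shifted differential has been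
  moved into \<open>att\<close>.\<close>

lemma shift_sf_obj: "shift (sf_obj R S) = sf_obj R (sf_shift R S)"
proof -
 interpret s: semifree R "sf_shift R S" by (rule semifree_shift)
 interpret X: complex R "sf_obj R S" by (rule complex.intro[OF pre_complex_sf_obj])
 have t: "ct (shift (sf_obj R S)) k = ct (sf_obj R (sf_shift R S)) k" for k
  unfolding shift_simps sf_obj_cterm s.sf_obj_cterm sf_carrier_shift by simp
 have "cd (shift (sf_obj R S)) k x = cd (sf_obj R (sf_shift R S)) k x" for k x
 proof (cases "x \<in> enc ` P (k + 1)")
  case True
  then obtain r where r: "r \<in> P (k + 1)" "x = enc r" by blast
  interpret M: left_module R "ct (sf_obj R S) (k + 1 + 1)" by (rule X.lm)
  have Dr: "dif r \<in> P (k + 1 + 1)" by (rule lin_att_sf[OF r(1)])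
  have c: "enc (dif r) \<in> car (sf_obj R S) (k + 1 + 1)"
   using Dr unfolding sf_obj_carrier by blast
  have "\<ominus>\<^bsub>ct (sf_obj R S) (k + 1 + 1)\<^esub> enc (dif r) =
   (\<ominus> \<one>) \<odot>\<^bsub>ct (sf_obj R S) (k + 1 + 1)\<^esub> enc (dif r)"
   using M.smult_minus_left[OF one_closed c] M.smult_one[OF c] by (simp only:)
  also have "\<dots> = enc (%i. \<ominus> dif r i)"
   unfolding sf_obj_cterm tr_module_simps[OF inj_enc] using sf_closed[OF Dr] by (simp add: l_minus)
  finally have "cd (shift (sf_obj R S)) k x = enc (%i. \<ominus> dif r i)"
   unfolding shift_simps r(2) using r(1) by (simp add: sf_obj_carrier sf_obj_cdiff)
  moreover have "r \<in> s.P k" using r(1) by (simp add: sf_carrier_shift)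
  then have "cd (sf_obj R (sf_shift R S)) k x = enc (%i. \<ominus> dif r i)"
   unfolding r(2) using s.sf_obj_cdiff[of r k] lin_att_shift[OF sf_closed[OF r(1)]] by simp
  ultimately show ?thesis by simp
 next
  case False
  then show ?thesis
   unfolding shift_simps sf_obj_carrier unfolding sf_obj_def tr_complex_def
   by (simp add: sf_cterm s.sf_cterm sf_carrier_shift)
 qed
 then show ?thesis using t by (intro cochain.equality) (auto intro!: ext)
qed

lemma shift_pow_sf_obj:
 "semifree R ((sf_shift R ^^ n) S) & (shift ^^ n) (sf_obj R S) = sf_obj R ((sf_shift R ^^ n) S)"
proof (induction n)
 case 0 then show ?case using semifree_axioms by simp
next
 case (Suc n)
 then show ?case using semifree.shift_sf_obj semifree.semifree_shift by fastforce
qed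

end

section \<open>The Hom complex of two semi-free complexes\<close>

text \<open>The negative of the usual sign \<open>(-1)^q\<close>, so that the Hom differential
  becomes a sum instead of a difference.\<close>

definition hom_sign :: "'a ring => int => 'a" where
 "hom_sign R q = (if even q then \<ominus>\<^bsub>R\<^esub> \<one>\<^bsub>R\<^esub> else \<one>\<^bsub>R\<^esub>)"

definition hom_set :: "'a ring => 'a semifree => 'a semifree => int => (nat => nat => 'a) set" where
 "hom_set R S T q = {U. \<forall>g. if g < gens S
   then U g \<in> sf_carrier R T (gens T) (degr S g + q) & (\<forall>h. vtx S g \<otimes>\<^bsub>R\<^esub> U g h = U g h)
   else U g = (%h. \<zero>\<^bsub>R\<^esub>)}"

text \<open>A map \<open>U\<close> sends the generator \<open>x\<^sub>g\<close> to \<open>\<Sum>\<^sub>h U g h y\<^sub>h\<close>; its differential is \<open>d U - (-1)\<^sup>q U d\<close>.\<close>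

definition hom_diff ::
 "'a ring => 'a semifree => 'a semifree => int => (nat => nat => 'a) => nat => nat => 'a" where
 "hom_diff R S T q U = (%g. if g < gens S
   then lin (fmod R) (att T) (gens T) (U g) \<oplus>\<^bsub>fmod R\<^esub>
    hom_sign R q \<odot>\<^bsub>fmod R\<^esub> lin (fmod R) U (gens S) (att S g)
   else (%h. \<zero>\<^bsub>R\<^esub>))"

definition hom_exact :: "'a ring => 'a semifree => 'a semifree => int => bool" where
 "hom_exact R S T q \<longleftrightarrow> (\<forall>U\<in>hom_set R S T q. hom_diff R S T q U = (%g h. \<zero>\<^bsub>R\<^esub>) -->
   (\<exists>W\<in>hom_set R S T (q - 1). hom_diff R S T (q - 1) W = U))"

lemma inv_enc [simp]: "inv_into UNIV enc (enc r) = r"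
 by (simp add: inv_f_f[OF inj_enc])

lemma lin_tr_enc: "lin (tr_module enc M) (%i. enc (x i)) n r = enc (lin M x n r)"
 by (induction n) (simp_all add: tr_module_simps[OF inj_enc])

lemma lin_carrier_update: "lin (M\<lparr>carrier := A\<rparr>) x n r = lin M x n r"
 by (induction n) simp_all

context semifree
begin

lemma lin_fmod_comp:
 assumes y: "!!i. i < m ==> y i \<in> carrier (fmod R)" and x: "!!i. i < n ==> x i \<in> carrier (fmod R)"
  and r: "!!i. i < n ==> r i \<in> carrier R"
 shows "lin (fmod R) y m (lin (fmod R) x n r) = lin (fmod R) (%i. lin (fmod R) y m (x i)) n r"
proof -
 show ?thesis
 proof (rule F.lin_hom)
  show "lin (fmod R) y m \<zero>\<^bsub>fmod R\<^esub> = \<zero>\<^bsub>fmod R\<^esub>" using y by (intro F.lin_zero) (simp add: F.smult_zero_left)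
  show "lin (fmod R) y m (a \<oplus>\<^bsub>fmod R\<^esub> b) = lin (fmod R) y m a \<oplus>\<^bsub>fmod R\<^esub> lin (fmod R) y m b"
   if "a \<in> carrier (fmod R)" "b \<in> carrier (fmod R)" for a b
   using F.lin_add_left[of m a b y] that y by simp
  show "lin (fmod R) y m (a \<odot>\<^bsub>fmod R\<^esub> b) = a \<odot>\<^bsub>fmod R\<^esub> lin (fmod R) y m b"
   if "a \<in> carrier R" "b \<in> carrier (fmod R)" for a b
   using F.lin_smult_left[of a m b y] that y by simp
 qed (use x r in auto)
qed

lemma hom_sign_closed [simp]: "hom_sign R q \<in> carrier R"
 unfolding hom_sign_def by simp

lemma hom_sign_central: "r \<in> carrier R ==> r \<otimes> hom_sign R q = hom_sign R q \<otimes> r"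
 unfolding hom_sign_def by (simp add: l_minus r_minus)

lemma hom_sign_Suc: "hom_sign R (q + 1) = \<ominus> hom_sign R q"
 unfolding hom_sign_def by simp

end

locale semifree_pair = S: semifree R S + T: semifree R T
 for R :: "'a ring" (structure) and S T :: "'a semifree"
begin

abbreviation "F \<equiv> fmod R"
abbreviation "D r \<equiv> lin F (att T) (gens T) r"
abbreviation "ext U r \<equiv> lin F U (gens S) r"
abbreviation "H q \<equiv> hom_set R S T q"
abbreviation "\<delta> q U \<equiv> hom_diff R S T q U"

lemma HD:
 assumes "U \<in> H q"
 shows "g < gens S ==> U g \<in> T.P (degr S g + q)" "g < gens S ==> vtx S g \<otimes> U g h = U g h"
  "\<not> g < gens S ==> U g = (%h. \<zero>)" "U g h \<in> carrier R" "U g \<in> carrier F"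
proof -
 have *: "if g < gens S then U g \<in> T.P (degr S g + q) & (\<forall>h. vtx S g \<otimes> U g h = U g h) else U g = (%h. \<zero>)" for g
  using assms unfolding hom_set_def by blast
 show 1: "g < gens S ==> U g \<in> T.P (degr S g + q)" for g using *[of g] by simp
 show "g < gens S ==> vtx S g \<otimes> U g h = U g h" using *[of g] by simp
 show 2: "\<not> g < gens S ==> U g = (%h. \<zero>)" for g using *[of g] by simp
 show 3: "U g h \<in> carrier R" for h using 1[of g] 2[of g] T.sf_closed by (cases "g < gens S") auto
 then show "U g \<in> carrier F" by simp
qed

lemma HI:
 assumes "!!g. g < gens S ==> U g \<in> T.P (degr S g + q)" "!!g h. g < gens S ==> vtx S g \<otimes> U g h = U g h"
  "!!g. \<not> g < gens S ==> U g = (%h. \<zero>)"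
 shows "U \<in> H q"
 unfolding hom_set_def using assms by simp

lemma D_closed: "r \<in> carrier F ==> D r \<in> carrier F"
 using S.F.lin_closed[of "gens T" r "att T"] by simp

lemma ext_closed: "(!!g. U g \<in> carrier F) ==> r \<in> carrier F ==> ext U r \<in> carrier F"
 using S.F.lin_closed[of "gens S" r U] by simp

lemma ext_P:
 assumes U: "U \<in> H q" and r: "r \<in> S.P k"
 shows "ext U r \<in> T.P (k + q)"
proof -
 have "lin F U m r \<in> T.P (k + q)" if "m \<le> gens S" for m
  using that
 proof (induction m)
  case 0 then show ?case using T.sf_0[of "gens T"] by simp
 next
  case (Suc m)
  have "(%h. r m \<otimes> U m h) \<in> T.P (k + q)"
  proof (cases "degr S m = k")
   case True
   then show ?thesis using T.sf_smult[OF _ HD(1)[OF U, of m] S.sf_closed[OF r, of m]] Suc.prems by simp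
  next
   case False
   then have "r m = \<zero>" using S.sf_zero[OF r] by blast
   then show ?thesis using T.sf_0[of "gens T"] HD(4)[OF U] by simp
  qed
  then show ?case using T.sf_add[OF _ Suc.IH] Suc.prems by simp
 qed
 then show ?thesis by simp
qed

lemma diff_apply: "g < gens S ==> \<delta> q U g h = D (U g) h \<oplus> hom_sign R q \<otimes> ext U (att S g) h"
 unfolding hom_diff_def by simp

lemma vtx_lin:
 assumes v: "v \<in> carrier R" and c: "!!i. i < m ==> r i \<in> carrier R" "!!i. i < m ==> x i \<in> carrier F"
  and e: "!!i. i < m ==> v \<otimes> r i = r i"
 shows "v \<otimes> lin F x m r h = lin F x m r h"
proof -
 have "v \<odot>\<^bsub>F\<^esub> lin F x m r = lin F x m (%i. v \<otimes> r i)" by (rule S.F.lin_smult_left[symmetric]) (use v c in auto)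
 also have "\<dots> = lin F x m r" using e by (intro S.F.lin_cong) simp
 finally show ?thesis by (simp add: fun_eq_iff)
qed

lemma diff_H: "U \<in> H q ==> \<delta> q U \<in> H (q + 1)"
proof (rule HI)
 assume U: "U \<in> H q"
 fix g assume g: "g < gens S"
 have att: "att S g \<in> S.P (degr S g + 1)" using S.sf_mono[OF S.att_sf[OF g]] g by simp
 have e1: "ext U (att S g) \<in> T.P (degr S g + (q + 1))" using ext_P[OF U att] by (simp add: algebra_simps)
 have e2: "D (U g) \<in> T.P (degr S g + (q + 1))" using T.lin_att_sf[OF HD(1)[OF U g]] by (simp add: algebra_simps)
 show "\<delta> q U g \<in> T.P (degr S g + (q + 1))"
  using T.sf_add[OF _ e2 T.sf_smult[OF _ e1 S.hom_sign_closed]] g unfolding hom_diff_def by simp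
 fix h
 have c: "D (U g) h \<in> carrier R" "ext U (att S g) h \<in> carrier R" "vtx S g \<in> carrier R"
  using T.sf_closed[OF e1] T.sf_closed[OF e2] S.vtx[OF g] by auto
 have "vtx S g \<otimes> D (U g) h = D (U g) h" "vtx S g \<otimes> ext U (att S g) h = ext U (att S g) h"
  using S.vtx(1)[OF g] HD[OF U] S.vtx_att[OF g] S.att_closed[OF g] g by (intro vtx_lin; simp)+
 moreover have "vtx S g \<otimes> (hom_sign R q \<otimes> ext U (att S g) h) = hom_sign R q \<otimes> (vtx S g \<otimes> ext U (att S g) h)"
  using c S.hom_sign_central[OF c(3), of q] by (simp add: S.m_assoc[symmetric])
 ultimately show "vtx S g \<otimes> \<delta> q U g h = \<delta> q U g h"
  using c g by (simp add: diff_apply S.r_distr)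
qed (simp add: hom_diff_def)

text \<open>The mixed terms, differential of \<open>T\<close> after \<open>U\<close> after
  differential of \<open>S\<close>, occur with the signs of degrees \<open>q\<close> and
  \<open>q + 1\<close>, which are opposite.\<close>

lemma diff_diff:
 assumes U: "U \<in> H q" shows "\<delta> (q + 1) (\<delta> q U) = (%g h. \<zero>)"
proof
 fix g
 show "\<delta> (q + 1) (\<delta> q U) g = (%h. \<zero>)"
 proof (cases "g < gens S")
  case g: True
  let ?s = "hom_sign R q" and ?E = "%i. ext U (att S i)"
  have Uc: "U i \<in> carrier F" for i using HD(5)[OF U] .
  have attc: "att S i \<in> carrier F" if "i < gens S" for i using that by simp
  have Ec: "?E i \<in> carrier F" if "i < gens S" for i using ext_closed Uc attc that by blast
  have DE: "D (?E g) = ext (%i. D (U i)) (att S g)"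
   by (rule S.lin_fmod_comp) (use Uc g in auto)
  have DU: "\<delta> q U i = D (U i) \<oplus>\<^bsub>F\<^esub> ?s \<odot>\<^bsub>F\<^esub> ?E i" if "i < gens S" for i
   using that unfolding hom_diff_def by simp
  have "D (\<delta> q U g) = D (D (U g)) \<oplus>\<^bsub>F\<^esub> ?s \<odot>\<^bsub>F\<^esub> D (?E g)"
  proof -
   have "D (%i. D (U g) i \<oplus> ?s \<otimes> ?E g i) = D (D (U g)) \<oplus>\<^bsub>F\<^esub> D (%i. ?s \<otimes> ?E g i)"
    using D_closed[OF Uc, of g] Ec[OF g] by (intro S.F.lin_add_left) auto
   moreover have "D (%i. ?s \<otimes> ?E g i) = ?s \<odot>\<^bsub>F\<^esub> D (?E g)"
    using Ec[OF g] by (intro S.F.lin_smult_left) auto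
   ultimately show ?thesis unfolding DU[OF g] fmod_simps by simp
  qed
  also have "\<dots> = ?s \<odot>\<^bsub>F\<^esub> D (?E g)"
   using T.d_d_zero[of "U g"] HD(4)[OF U] D_closed[OF Ec[OF g]] by simp
  finally have 1: "D (\<delta> q U g) = ?s \<odot>\<^bsub>F\<^esub> D (?E g)" .
  have "ext (\<delta> q U) (att S g) = ext (%i. D (U i) \<oplus>\<^bsub>F\<^esub> ?s \<odot>\<^bsub>F\<^esub> ?E i) (att S g)"
   using DU by (intro S.F.lin_cong) simp
  also have "\<dots> = ext (%i. D (U i)) (att S g) \<oplus>\<^bsub>F\<^esub> ext (%i. ?s \<odot>\<^bsub>F\<^esub> ?E i) (att S g)"
   by (rule S.F.lin_add_right) (use D_closed[OF Uc] Ec g S.F.smult_closed in auto)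
  also have "ext (%i. ?s \<odot>\<^bsub>F\<^esub> ?E i) (att S g) = ?s \<odot>\<^bsub>F\<^esub> ext ?E (att S g)"
   by (rule S.F.lin_central_right) (use Ec g S.hom_sign_central in auto)
  also have "ext ?E (att S g) = ext U (lin F (att S) (gens S) (att S g))"
   by (rule S.lin_fmod_comp[symmetric]) (use Uc g in auto)
  also have "\<dots> = \<zero>\<^bsub>F\<^esub>" unfolding S.att_att[OF g] using Uc by (intro S.F.lin_zero) (simp add: S.F.smult_zero_left)
  finally have 2: "ext (\<delta> q U) (att S g) = D (?E g)"
   unfolding DE using D_closed[OF Ec[OF g]] unfolding DE by simp
  have "\<delta> (q + 1) (\<delta> q U) g h = \<zero>" for h
   unfolding diff_apply[OF g] 1 2 S.hom_sign_Suc using D_closed[OF Ec[OF g]]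
   by (simp add: S.l_minus S.r_neg)
  then show ?thesis by blast
 qed (simp add: hom_diff_def)
qed

text \<open>Since \<open>hom_sign R 0\<close> is -1, a degree 0 cocycle of the Hom complex becomes
  an element of \<open>cocyc\<close> after encoding, and thinness makes it homotopic to zero. In
  degree -1 the sign is 1, so the contraction is exactly a preimage under the Hom
  differential.\<close>

lemma thin_imp_exact:
 assumes thin: "thin (derived_cat R) (sf_obj R S) (sf_obj R T)"
 shows "hom_exact R S T 0"
 unfolding hom_exact_def
proof (intro ballI impI)
 fix U assume U: "U \<in> H 0" and dU: "\<delta> 0 U = (%g h. \<zero>)"
 let ?Z = "sf_obj R T"
 interpret Z: complex R ?Z by (rule complex.intro[OF T.pre_complex_sf_obj])
 have ev_enc: "ev ?Z S (%g. enc (W g)) (gens S) k j (att S g) = enc (ext W (att S g))"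
  if g: "g < gens S" and k: "k = degr S g + 1" and W: "!!i. i < gens S ==> W i \<in> carrier F" for W k j g
 proof -
  have "(%i. if degr S i = k then enc (W i) else (zc ?Z j)) =
   (%i. enc (if degr S i = k then W i else (%h. \<zero>)))"
   unfolding T.sf_obj_cterm tr_module_simps[OF inj_enc] by (intro ext) simp
  then have "ev ?Z S (%g. enc (W g)) (gens S) k j (att S g) =
   enc (ext (%i. if degr S i = k then W i else (%h. \<zero>)) (att S g))"
   unfolding ev_def T.sf_obj_cterm by (simp add: lin_tr_enc lin_carrier_update)
  also have "ext (%i. if degr S i = k then W i else (%h. \<zero>)) (att S g) = ext W (att S g)"
  proof (rule S.F.lin_cong)
   fix i assume "i < gens S"
   then show "att S g i \<odot>\<^bsub>F\<^esub> (if degr S i = k then W i else (%h. \<zero>)) = att S g i \<odot>\<^bsub>F\<^esub> W i"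
    using S.att_zero[OF g, of i] W[of i] k by auto
  qed
  finally show ?thesis .
 qed
 define u where "u = (\<lambda>g\<in>{..<gens S}. enc (U g))"
 have u: "u \<in> S.cocyc ?Z"
  unfolding S.cocyc_def
 proof (intro CollectI conjI allI impI)
  show "u \<in> extensional {..<gens S}" unfolding u_def by simp
  fix g assume g: "g < gens S"
  have Ug: "U g \<in> T.P (degr S g)" using HD(1)[OF U g] by simp
  show "u g \<in> car ?Z (degr S g)" using g Ug unfolding u_def by (simp add: T.sf_obj_carrier)
  show "vtx S g \<odot>\<^bsub>ct ?Z (degr S g)\<^esub> u g = u g"
   using g HD(2)[OF U g] unfolding u_def T.sf_obj_cterm by (simp add: tr_module_simps[OF inj_enc])
  have "D (U g) h = ext U (att S g) h" for h
  proof -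
   have c: "D (U g) h \<in> carrier R" "ext U (att S g) h \<in> carrier R"
    using D_closed[OF HD(5)[OF U]] ext_closed[OF HD(5)[OF U]] g by auto
   have "D (U g) h \<oplus> \<ominus> ext U (att S g) h = \<zero>"
    using fun_cong[OF fun_cong[OF dU, of g], of h] c g
    by (simp add: diff_apply hom_sign_def S.l_minus)
   then show ?thesis using c S.minus_equality[of "D (U g) h" "\<ominus> ext U (att S g) h"] by simp
  qed
  then have "D (U g) = ext U (att S g)" by blast
  moreover have "ev ?Z S u (gens S) (degr S g + 1) (degr S g + 1) (att S g) =
   ev ?Z S (%g. enc (U g)) (gens S) (degr S g + 1) (degr S g + 1) (att S g)"
   by (intro S.ev_cong[OF T.pre_complex_sf_obj]) (simp add: u_def)
  ultimately show "cd ?Z (degr S g) (u g) = ev ?Z S u (gens S) (degr S g + 1) (degr S g + 1) (att S g)"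
   using g Ug HD(5)[OF U] unfolding u_def by (simp add: T.sf_obj_cdiff ev_enc)
 qed
 from S.thin_imp_homot[OF T.bounded_complex_sf_obj thin u S.zero_cocyc[OF T.pre_complex_sf_obj]]
 obtain w where "S.null ?Z w (%g. u g \<oplus>\<^bsub>ct ?Z (degr S g)\<^esub> \<ominus>\<^bsub>ct ?Z (degr S g)\<^esub> S.zero_cocyc ?Z g)"
  unfolding S.homot_def by blast
 note null = this[unfolded S.null_def, rule_format]
 have w: "!!g. g < gens S ==> w g \<in> car ?Z (degr S g - 1)"
  "!!g. g < gens S ==> vtx S g \<odot>\<^bsub>ct ?Z (degr S g - 1)\<^esub> w g = w g"
  "!!g. g < gens S ==> u g \<oplus>\<^bsub>ct ?Z (degr S g)\<^esub> \<ominus>\<^bsub>ct ?Z (degr S g)\<^esub> S.zero_cocyc ?Z g =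
   cd ?Z (degr S g - 1) (w g) \<oplus>\<^bsub>ct ?Z (degr S g)\<^esub> ev ?Z S w (gens S) (degr S g + 1) (degr S g) (att S g)"
 proof -
  fix g assume g: "g < gens S"
  note n = null[OF g]
  show "w g \<in> car ?Z (degr S g - 1)" by (rule conjunct1[OF n])
  show "vtx S g \<odot>\<^bsub>ct ?Z (degr S g - 1)\<^esub> w g = w g" by (rule conjunct1[OF conjunct2[OF n]])
  show "u g \<oplus>\<^bsub>ct ?Z (degr S g)\<^esub> \<ominus>\<^bsub>ct ?Z (degr S g)\<^esub> S.zero_cocyc ?Z g =
   cd ?Z (degr S g - 1) (w g) \<oplus>\<^bsub>ct ?Z (degr S g)\<^esub> ev ?Z S w (gens S) (degr S g + 1) (degr S g) (att S g)"
   by (rule conjunct2[OF conjunct2[OF n]])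
 qed
 define W where "W g = (if g < gens S then inv_into UNIV enc (w g) else (%h. \<zero>))" for g
 have wW: "w g = enc (W g)" and WP: "W g \<in> T.P (degr S g - 1)" if "g < gens S" for g
 proof -
  obtain r where r: "r \<in> T.P (degr S g - 1)" "w g = enc r"
   using w(1)[OF \<open>g < gens S\<close>] unfolding T.sf_obj_carrier by blast
  then have "W g = r" using \<open>g < gens S\<close> by (simp add: W_def)
  then show "w g = enc (W g)" "W g \<in> T.P (degr S g - 1)" using r by blast+
 qed
 have W: "W \<in> H (0 - 1)"
 proof (rule HI)
  fix g assume g: "g < gens S"
  show "W g \<in> T.P (degr S g + (0 - 1))" using WP[OF g] by simp
  have "enc (%h. vtx S g \<otimes> W g h) = enc (W g)"
   using w(2)[OF g] unfolding wW[OF g] T.sf_obj_cterm by (simp add: tr_module_simps[OF inj_enc])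
  then have "(%h. vtx S g \<otimes> W g h) = W g" by (rule injD[OF inj_enc])
  then show "vtx S g \<otimes> W g h = W g h" for h by (rule fun_cong)
 qed (simp add: W_def)
 have "\<delta> (0 - 1) W g = U g" for g
 proof (cases "g < gens S")
  case g: True
  interpret M: left_module R "ct ?Z (degr S g)" by (rule Z.lm)
  have "u g \<in> car ?Z (degr S g)" using S.cocycD(1)[OF u g] .
  then have "enc (U g) = cd ?Z (degr S g - 1) (w g) \<oplus>\<^bsub>ct ?Z (degr S g)\<^esub>
   ev ?Z S w (gens S) (degr S g + 1) (degr S g) (att S g)"
   using w(3)[OF g] g by (simp add: S.zero_cocyc_def M.minus_zero u_def)
  also have "ev ?Z S w (gens S) (degr S g + 1) (degr S g) (att S g) =
   ev ?Z S (%g. enc (W g)) (gens S) (degr S g + 1) (degr S g) (att S g)"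
   by (intro S.ev_cong[OF T.pre_complex_sf_obj]) (simp add: wW)
  also have "\<dots> = enc (ext W (att S g))" by (rule ev_enc[OF g refl HD(5)[OF W]])
  also have "cd ?Z (degr S g - 1) (w g) = enc (D (W g))" unfolding wW[OF g] by (rule T.sf_obj_cdiff[OF WP[OF g]])
  finally have "enc (U g) = enc (D (W g) \<oplus>\<^bsub>F\<^esub> ext W (att S g))"
   unfolding T.sf_obj_cterm by (simp add: tr_module_simps[OF inj_enc])
  then have UW: "U g = D (W g) \<oplus>\<^bsub>F\<^esub> ext W (att S g)" by (rule injD[OF inj_enc])
  have "ext W (att S g) \<in> carrier F" using ext_closed[OF HD(5)[OF W]] g by simp
  then show ?thesis using g unfolding hom_diff_def UW by (simp add: hom_sign_def)
 next
  case False then show ?thesis using HD(3)[OF U] by (simp add: hom_diff_def)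
 qed
 then show "\<exists>W\<in>H (0 - 1). \<delta> (0 - 1) W = U" using W by blast
qed

text \<open>Maps of degree \<open>q\<close> into the shift of \<open>T\<close> are maps of degree
  \<open>q + 1\<close> into \<open>T\<close>, with the opposite differential; hence the preimage is
  negated.\<close>

lemma exact_shift_right:
 assumes ex: "hom_exact R S (sf_shift R T) q" shows "hom_exact R S T (q + 1)"
proof -
 interpret T1: semifree R "sf_shift R T" by (rule T.semifree_shift)
 interpret p1: semifree_pair R S "sf_shift R T" ..
 have H1: "p1.H k = H (k + 1)" for k
  unfolding hom_set_def sf_carrier_shift by (simp add: algebra_simps)
 have d1: "p1.\<delta> k U = (%g h. \<ominus> \<delta> (k + 1) U g h)" if U: "U \<in> H (k + 1)" for k U
 proof (intro ext)
  fix g h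
  show "p1.\<delta> k U g h = \<ominus> \<delta> (k + 1) U g h"
  proof (cases "g < gens S")
   case g: True
   have c: "D (U g) h \<in> carrier R" "ext U (att S g) h \<in> carrier R"
    using D_closed[OF HD(5)[OF U]] ext_closed[OF HD(5)[OF U]] g by auto
   have "p1.D (U g) h = \<ominus> D (U g) h" using T.lin_att_shift[of "U g"] HD(4)[OF U] by simp
   then show ?thesis using c g
    by (simp add: diff_apply p1.diff_apply S.hom_sign_Suc S.l_minus S.minus_add)
  qed (simp add: hom_diff_def)
 qed
 show ?thesis
  unfolding hom_exact_def
 proof (intro ballI impI)
  fix U assume U: "U \<in> H (q + 1)" and dU: "\<delta> (q + 1) U = (%g h. \<zero>)"
  have "p1.\<delta> q U = (%g h. \<zero>)" unfolding d1[OF U] dU by simp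
  then obtain W where W: "W \<in> p1.H (q - 1)" "p1.\<delta> (q - 1) W = U"
   using ex U unfolding hom_exact_def H1 by blast
  have W': "W \<in> H q" using W(1) unfolding H1 by simp
  let ?W = "%g h. \<ominus> \<one> \<otimes> W g h"
  have Wc: "W g h \<in> carrier R" for g h by (rule HD(4)[OF W'])
  have WH: "?W \<in> H q"
  proof (rule HI)
   fix g assume g: "g < gens S"
   show "?W g \<in> T.P (degr S g + q)" using T.sf_smult[OF _ HD(1)[OF W' g], of "\<ominus> \<one>"] by simp
   show "vtx S g \<otimes> ?W g h = ?W g h" for h
    using HD(2)[OF W' g] S.vtx(1)[OF g] Wc by (simp add: S.l_minus S.r_minus)
  qed (use HD(3)[OF W'] in simp)
  have "\<delta> q ?W g h = \<ominus> \<delta> q W g h" for g h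
  proof (cases "g < gens S")
   case g: True
   have "D (?W g) = (\<ominus> \<one>) \<odot>\<^bsub>F\<^esub> D (W g)" using Wc by (intro S.F.lin_smult_left) auto
   moreover have "ext ?W (att S g) = ext (%g. (\<ominus> \<one>) \<odot>\<^bsub>F\<^esub> W g) (att S g)" by simp
   moreover have "ext (%g. (\<ominus> \<one>) \<odot>\<^bsub>F\<^esub> W g) (att S g) = (\<ominus> \<one>) \<odot>\<^bsub>F\<^esub> ext W (att S g)"
    using Wc g by (intro S.F.lin_central_right) (auto simp: S.l_minus S.r_minus)
   moreover have "D (W g) h \<in> carrier R" "ext W (att S g) h \<in> carrier R"
    using D_closed[OF HD(5)[OF W']] ext_closed[OF HD(5)[OF W']] g by auto
   ultimately show ?thesis using g by (simp add: diff_apply S.l_minus S.r_minus S.minus_add)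
  qed (simp add: hom_diff_def)
  moreover have "\<ominus> \<delta> q W g h = U g h" for g h
   using fun_cong[OF fun_cong[OF W(2)]] d1[of W "q - 1"] W' by simp
  ultimately have "\<delta> q ?W = U" by (intro ext) simp
  then show "\<exists>W\<in>H (q + 1 - 1). \<delta> (q + 1 - 1) W = U" using WH by auto
 qed
qed

text \<open>Here the sign of the shifted \<open>att\<close> cancels against the change of
  \<open>hom_sign\<close>, so the two differentials agree.\<close>

lemma exact_shift_left:
 assumes ex: "hom_exact R (sf_shift R S) T (q + 1)" shows "hom_exact R S T q"
proof -
 interpret S1: semifree R "sf_shift R S" by (rule S.semifree_shift)
 interpret p1: semifree_pair R "sf_shift R S" T ..
 have H1: "p1.H (k + 1) = H k" for k
  unfolding hom_set_def by (simp add: algebra_simps)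
 have d1: "p1.\<delta> (k + 1) U = \<delta> k U" if U: "U \<in> H k" for k U
 proof (intro ext)
  fix g h
  show "p1.\<delta> (k + 1) U g h = \<delta> k U g h"
  proof (cases "g < gens S")
   case g: True
   have c: "ext U (att S g) h \<in> carrier R"
    using ext_closed[OF HD(5)[OF U]] g by auto
   have "ext U (att (sf_shift R S) g) = ext U (%i. \<ominus> \<one> \<otimes> att S g i)"
    using g by (intro S.F.lin_cong) (simp add: S.l_minus)
   also have "\<dots> = (\<ominus> \<one>) \<odot>\<^bsub>F\<^esub> ext U (att S g)" using HD(5)[OF U] g by (intro S.F.lin_smult_left) auto
   finally show ?thesis using g c
    by (simp add: diff_apply p1.diff_apply S.hom_sign_Suc S.l_minus S.r_minus)
  qed (simp add: hom_diff_def)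
 qed
 show ?thesis
  unfolding hom_exact_def
 proof (intro ballI impI)
  fix U assume U: "U \<in> H q" and dU: "\<delta> q U = (%g h. \<zero>)"
  then obtain W where W: "W \<in> p1.H q" "p1.\<delta> q W = U"
   using ex d1[OF U] unfolding hom_exact_def H1 by auto
  have W': "W \<in> H (q - 1)" using W(1) H1[of "q - 1"] by simp
  then have "\<delta> (q - 1) W = U" using W(2) d1[OF W'] by simp
  then show "\<exists>W\<in>H (q - 1). \<delta> (q - 1) W = U" using W' by blast
 qed
qed

end

context semifree_pair
begin

lemma thin_shift_right_imp_exact:
 assumes "thin (derived_cat R) (sf_obj R S) ((shift ^^ n) (sf_obj R T))"
 shows "hom_exact R S T (int n)"
proof -
 have "hom_exact R S T' (int m) ==> hom_exact R S T'' (int m + int n)"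
  if "T' = (sf_shift R ^^ n) T''" "semifree R T''" for T' T'' m
  using that
 proof (induction n arbitrary: T'' m)
  case (Suc n)
  interpret T2: semifree R T'' by fact
  interpret p: semifree_pair R S T'' ..
  have "hom_exact R S (sf_shift R T'') (int m + int n)"
   by (rule Suc.IH) (use Suc.prems T2.semifree_shift in \<open>simp_all add: funpow_swap1\<close>)
  then show ?case using p.exact_shift_right[of "int m + int n"] by (simp add: algebra_simps)
 qed simp
 moreover have "hom_exact R S ((sf_shift R ^^ n) T) (int 0)"
 proof -
  interpret T': semifree R "(sf_shift R ^^ n) T" using T.shift_pow_sf_obj by blast
  interpret p: semifree_pair R S "(sf_shift R ^^ n) T" ..
  show ?thesis using p.thin_imp_exact assms T.shift_pow_sf_obj by simp
 qed
 ultimately have "hom_exact R S T (int 0 + int n)" using T.semifree_axioms by blast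
 then show ?thesis by simp
qed

lemma thin_shift_left_imp_exact:
 assumes "thin (derived_cat R) ((shift ^^ n) (sf_obj R S)) (sf_obj R T)"
 shows "hom_exact R S T (- int n)"
proof -
 have "hom_exact R S' T 0 ==> hom_exact R S'' T (- int n)"
  if "S' = (sf_shift R ^^ n) S''" "semifree R S''" for S' S''
  using that
 proof (induction n arbitrary: S'')
  case (Suc n)
  interpret S2: semifree R S'' by fact
  interpret p: semifree_pair R S'' T ..
  have "hom_exact R (sf_shift R S'') T (- int n)"
   by (rule Suc.IH) (use Suc.prems S2.semifree_shift in \<open>simp_all add: funpow_swap1\<close>)
  then show ?case using p.exact_shift_left[of "- 1 - int n"] by simp
 qed simp
 moreover have "hom_exact R ((sf_shift R ^^ n) S) T 0"
 proof -
  interpret S': semifree R "(sf_shift R ^^ n) S" using S.shift_pow_sf_obj by blast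
  interpret p: semifree_pair R "(sf_shift R ^^ n) S" T ..
  show ?thesis using p.thin_imp_exact assms S.shift_pow_sf_obj by simp
 qed
 ultimately show ?thesis using S.semifree_axioms by blast
qed

end

context semifree
begin

text \<open>An endomorphism complex that is exact in degree \<open>0\<close> contracts the identity.\<close>

lemma exact_imp_thin:
 assumes ex: "hom_exact R S S 0"
 shows "thin (derived_cat R) (sf_obj R S) (sf_obj R S)"
proof -
 interpret p: semifree_pair R S S ..
 let ?X = "sf_obj R S"
 \<comment> \<open>The identity as an element of the Hom complex.\<close>
 define U where "U g = (if g < N then gen g else (%h. \<zero>))" for g
 have genF: "U g \<in> carrier F" for g unfolding U_def using gen_F by simp
 have lin_U: "lin F U N r = r" if "r \<in> P k" for r k
 proof -
  have "lin F U N r = lin F (%i. if degr S i = k then gen i else \<zero>\<^bsub>F\<^esub>) N r"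
  proof (rule F.lin_cong)
   fix i assume "i < N"
   then show "r i \<odot>\<^bsub>F\<^esub> U i = r i \<odot>\<^bsub>F\<^esub> (if degr S i = k then gen i else \<zero>\<^bsub>F\<^esub>)"
    using sf_zero[OF that, of i] genF[of i] by (simp add: U_def)
  qed
  then show ?thesis using lin_gen[OF that] by simp
 qed
 have U: "U \<in> hom_set R S S 0"
 proof (rule p.HI)
  fix g assume g: "g < N"
  show "U g \<in> P (degr S g + 0)" using gen_closed[OF g] g by (simp add: U_def)
  show "vtx S g \<otimes> U g h = U g h" for h using vtx[OF g] g by (simp add: U_def gen_def)
 qed (simp add: U_def)
 have "hom_diff R S S 0 U g h = \<zero>" for g h
 proof (cases "g < N")
  case g: True
  have "att S g \<in> P (degr S g + 1)" using sf_mono[OF att_sf[OF g]] g by simp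
  then have 1: "lin F U N (att S g) = att S g" by (rule lin_U)
  have "dif (U g) = vtx S g \<odot>\<^bsub>F\<^esub> att S g"
   unfolding U_def gen_def using g vtx(1)[OF g] by (simp add: F.lin_single)
  then have "dif (U g) = att S g" using vtx_att[OF g] by simp
  then show ?thesis using g 1 by (simp add: p.diff_apply hom_sign_def l_minus r_neg)
 qed (simp add: hom_diff_def)
 then obtain W where W: "W \<in> hom_set R S S (0 - 1)" "hom_diff R S S (0 - 1) W = U"
  using ex U unfolding hom_exact_def by blast
 \<comment> \<open>With \<open>U\<close> the identity and \<open>U = d W + W d\<close>, a cocycle
   \<open>r\<close> satisfies \<open>r = d (W r)\<close>.\<close>
 have contract: "\<exists>s\<in>P (k - 1). r = dif s" if r: "r \<in> P k" and Dr: "dif r = (%h. \<zero>)" for r k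
 proof -
  have rc: "r i \<in> carrier R" for i using sf_closed[OF r] .
  have Wc: "W g \<in> carrier F" for g using p.HD(5)[OF W(1)] .
  let ?E = "%g. lin F W N (att S g)"
  have Ec: "?E g \<in> carrier F" if "g < N" for g using p.ext_closed[OF Wc] that by simp
  have "r = lin F (%g. dif (W g) \<oplus>\<^bsub>F\<^esub> ?E g) N r"
  proof -
   have "lin F U N r = lin F (%g. dif (W g) \<oplus>\<^bsub>F\<^esub> ?E g) N r"
   proof (rule F.lin_cong)
    fix g assume g: "g < N"
    have "U g = dif (W g) \<oplus>\<^bsub>F\<^esub> ?E g"
     unfolding W(2)[symmetric] hom_diff_def using g Ec[OF g] by (simp add: hom_sign_def)
    then show "r g \<odot>\<^bsub>F\<^esub> U g = r g \<odot>\<^bsub>F\<^esub> (dif (W g) \<oplus>\<^bsub>F\<^esub> ?E g)" by simp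
   qed
   then show ?thesis using lin_U[OF r] by simp
  qed
  also have "\<dots> = lin F (%g. dif (W g)) N r \<oplus>\<^bsub>F\<^esub> lin F ?E N r"
   by (rule F.lin_add_right) (use rc p.D_closed[OF Wc] Ec in auto)
  also have "lin F ?E N r = lin F W N (dif r)"
   by (rule lin_fmod_comp[symmetric]) (use Wc rc in auto)
  also have "\<dots> = \<zero>\<^bsub>F\<^esub>" unfolding Dr using Wc by (intro F.lin_zero) (simp add: F.smult_zero_left)
  also have "lin F (%g. dif (W g)) N r = dif (lin F W N r)"
   by (rule lin_fmod_comp[symmetric]) (use Wc rc in auto)
  also have "dif (lin F W N r) \<oplus>\<^bsub>F\<^esub> \<zero>\<^bsub>F\<^esub> = dif (lin F W N r)"
   using p.D_closed[OF p.ext_closed[OF Wc, of r]] rc by (intro F.M.r_zero) simp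
  finally have "r = dif (lin F W N r)" .
  moreover have "lin F W N r \<in> P (k - 1)" using p.ext_P[OF W(1) r] by simp
  ultimately show ?thesis by blast
 qed
 interpret Z: sf_pt R \<zero> 0 by unfold_locales simp_all
 let ?Z = "sf_obj R (sf_point R \<zero> 0)"
 have P0: "r = (%h. \<zero>)" if "r \<in> Z.p.P k" for r k
 proof
  fix h have "r h \<in> carrier R" "r h \<otimes> \<zero> = r h" using that unfolding Z.pt_carrier by auto
  then show "r h = \<zero>" by (metis r_null)
 qed
 have Zc: "car ?Z k = {enc (%h. \<zero>)}" for k
 proof -
  have "Z.p.P k = {%h. \<zero>}" using P0[of _ k] Z.p.sf_0[of "gens (sf_point R \<zero> 0)" k] by blast
  then show ?thesis unfolding Z.p.sf_obj_carrier by simp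
 qed
 have Z0: "(zc ?Z k) = enc (%h. \<zero>)" for k
  unfolding Z.p.sf_obj_cterm tr_module_simps[OF inj_enc] by simp
 have thinZ: "thin (derived_cat R) ?Z ?Z"
  by (rule Z.thin_pt[OF Z.p.bounded_complex_sf_obj]) (simp add: Zc Z0)
 interpret f: chain_map R ?X ?Z "classify ?Z (zero_cocyc ?Z)"
  by (intro chain_map_intro pre_complex_sf_obj Z.p.pre_complex_sf_obj classify_chain_map zero_cocyc)
 have zero_cocyc0: "enc (%h. \<zero>) \<in> cocycles ?X k" for k
  using sf_0[of N k] F.lin_zero[of N "%h. \<zero>" "att S"] unfolding cocycles_def
  by (simp add: sf_obj_carrier sf_obj_cdiff sf_obj_cterm tr_module_simps[OF inj_enc])
 have "classify ?Z (zero_cocyc ?Z) \<in> quasi_isos R ?X ?Z"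
  unfolding f.quasi_isos_iff
 proof (intro allI conjI ballI impI)
  fix k z assume "z \<in> cocycles ?Z k"
  then have z: "z = enc (%h. \<zero>)" unfolding cocycles_def Zc by simp
  have "enc (%h. \<zero>) \<in> coboundaries ?Z k"
  proof -
   have "cd ?Z (k - 1) (enc (%h. \<zero>)) = enc (%h. \<zero>)"
    using f.Y.d_closed'[of "enc (%h. \<zero>)" k] unfolding Zc by simp
   then show ?thesis unfolding coboundaries_def Zc by simp
  qed
  moreover have "classify ?Z (zero_cocyc ?Z) k (enc (%h. \<zero>)) = enc (%h. \<zero>)"
   using f.closed[of "enc (%h. \<zero>)" k] zero_cocyc0[of k] unfolding Zc cocycles_def by simp
  moreover have "enc (%h. \<zero>) \<oplus>\<^bsub>ct ?Z k\<^esub> enc (%h. \<zero>) = enc (%h. \<zero>)"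
   unfolding Z.p.sf_obj_cterm tr_module_simps[OF inj_enc] by simp
  ultimately show "\<exists>x\<in>cocycles ?X k. \<exists>b\<in>coboundaries ?Z k. z = b \<oplus>\<^bsub>ct ?Z k\<^esub> classify ?Z (zero_cocyc ?Z) k x"
   using zero_cocyc0[of k] unfolding z by metis
 next
  fix k x assume x: "x \<in> cocycles ?X k"
  then obtain r where r: "r \<in> P k" "x = enc r" unfolding cocycles_def sf_obj_carrier by blast
  have "enc (dif r) = enc \<zero>\<^bsub>F\<^esub>"
   using x r unfolding cocycles_def by (simp add: sf_obj_cdiff sf_obj_cterm tr_module_simps[OF inj_enc])
  then have "dif r = \<zero>\<^bsub>F\<^esub>" by (rule injD[OF inj_enc])
  then obtain s where s: "s \<in> P (k - 1)" "r = dif s" using contract[OF r(1)] by auto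
  show "x \<in> coboundaries ?X k"
   unfolding coboundaries_def sf_obj_carrier r(2) s(2) sf_obj_cdiff[OF s(1), symmetric] by (intro imageI s(1))
 qed
 then have "isomorphic (derived_cat R) ?X ?Z"
  unfolding derived_cat_def using bounded_complex_sf_obj Z.p.bounded_complex_sf_obj
  by (intro D.isomorphic_L_W) (auto simp: complexes_def)
 then have iso: "isomorphic (derived_cat R) ?Z ?X"
  by (rule category.isomorphic_sym[OF category_derived_cat])
 have "?X \<in> Obj (derived_cat R)" "?Z \<in> Obj (derived_cat R)"
  using bounded_complex_sf_obj Z.p.bounded_complex_sf_obj by (simp_all add: Obj_derived_cat)
 then show ?thesis
  using category.thin_isomorphic[OF category_derived_cat _ _ _ _ iso iso thinZ] by blast
qed

end

section \<open>Euler characteristics\<close>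

text \<open>Functions on an index set serve as coordinate spaces; \<open>fs\<close> and
  \<open>fsp\<close> provide dimension theory for them.\<close>

abbreviation fscale :: "'k::field => ('i => 'k) => 'i => 'k" where
 "fscale c f \<equiv> (%x. c * f x)"

interpretation fs: vector_space fscale
 by unfold_locales (auto simp: algebra_simps)

interpretation fsp: vector_space_pair fscale fscale ..

text \<open>The coordinate space on \<open>J\<close>, as a subspace of all functions, so that all
  degrees of a complex share one type.\<close>

definition supp_space :: "'i set => ('i => 'k::field) set" where
 "supp_space J = {f. \<forall>x. x \<notin> J --> f x = 0}"

definition unit_fun :: "'i => 'i => 'k::field" where
 "unit_fun x = (%y. if y = x then 1 else 0)"

lemma sum_fun_apply: "(\<Sum>a\<in>A. f a) x = (\<Sum>a\<in>A. (f a x :: 'b::comm_monoid_add))"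
 by (induction A rule: infinite_finite_induct) auto

lemma inj_unit_fun: "inj (unit_fun :: 'i => 'i => 'k::field)"
proof
 fix x y :: 'i assume "(unit_fun x :: 'i => 'k) = unit_fun y"
 then have "(unit_fun x :: 'i => 'k) x = unit_fun y x" by simp
 then show "x = y" unfolding unit_fun_def by (auto split: if_splits)
qed

lemma subspace_supp: "fs.subspace (supp_space J)"
 unfolding fs.subspace_def supp_space_def by auto

lemma supp_span: "finite J ==> (supp_space J :: ('i => 'k::field) set) \<subseteq> fs.span (unit_fun ` J)"
proof
 fix f :: "'i => 'k" assume J: "finite J" and f: "f \<in> supp_space J"
 have "f = (\<Sum>x\<in>J. fscale (f x) (unit_fun x))"
 proof
  fix y
  have "(\<Sum>x\<in>J. fscale (f x) (unit_fun x) y) = (\<Sum>x\<in>J. if y = x then f x else 0)"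
   by (intro sum.cong) (auto simp: unit_fun_def)
  also have "\<dots> = f y" using J f unfolding supp_space_def by (auto simp: sum.delta')
  finally show "f y = (\<Sum>x\<in>J. fscale (f x) (unit_fun x)) y" by (simp add: sum_fun_apply)
 qed
 also have "\<dots> \<in> fs.span (unit_fun ` J)" by (intro fs.span_sum fs.span_scale fs.span_base) auto
 finally show "f \<in> fs.span (unit_fun ` J)" .
qed

lemma dim_supp:
 assumes J: "finite J" shows "fs.dim (supp_space J :: ('i => 'k::field) set) = card J"
proof (rule fs.dim_unique[of "unit_fun ` J"])
 show "unit_fun ` J \<subseteq> (supp_space J :: ('i => 'k) set)" unfolding supp_space_def unit_fun_def by auto
 show "(supp_space J :: ('i => 'k) set) \<subseteq> fs.span (unit_fun ` J)" by (rule supp_span[OF J])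
 show "card (unit_fun ` J :: ('i => 'k) set) = card J"
  by (intro card_image inj_on_subset[OF inj_unit_fun]) auto
 show "fs.independent (unit_fun ` J :: ('i => 'k) set)"
 proof
  assume "fs.dependent (unit_fun ` J :: ('i => 'k) set)"
  then obtain u :: "('i => 'k) => 'k" and v where u: "v \<in> unit_fun ` J" "u v ~= 0"
   "(\<Sum>v\<in>unit_fun ` J. fscale (u v) v) = 0" using J by (auto simp: fs.dependent_finite)
  obtain y where y: "y \<in> J" "v = unit_fun y" using u(1) by blast
  have "(\<Sum>v\<in>unit_fun ` J. fscale (u v) v) y = (\<Sum>x\<in>J. u (unit_fun x) * unit_fun x y)"
   unfolding sum_fun_apply by (subst sum.reindex) (auto intro: inj_on_subset[OF inj_unit_fun])
  also have "\<dots> = (\<Sum>x\<in>J. if y = x then u (unit_fun x) else 0)" by (intro sum.cong) (auto simp: unit_fun_def)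
  also have "\<dots> = u v" using J y by (simp add: sum.delta')
  finally show False using u by simp
 qed
qed

lemma subspace_dim_le:
 fixes V W :: "('i => 'k::field) set"
 assumes "V \<subseteq> W" "W \<subseteq> fs.span B" "finite B"
 shows "fs.dim V \<le> fs.dim W" "fs.subspace V ==> fs.dim V = fs.dim W ==> W \<subseteq> V"
proof -
 obtain A where A: "A \<subseteq> V" "fs.independent A" "V \<subseteq> fs.span A" by (rule fs.maximal_independent_subset)
 obtain C where C: "A \<subseteq> C" "C \<subseteq> W" "fs.independent C" "W \<subseteq> fs.span C"
  using fs.maximal_independent_subset_extend[OF subset_trans[OF A(1) assms(1)] A(2)] by blast
 have fin: "finite C" using fs.independent_span_bound[OF assms(3) C(3)] C(2) assms(2) by blast
 have d: "fs.dim V = card A" "fs.dim W = card C" using A C by (auto intro: fs.dim_unique)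
 show "fs.dim V \<le> fs.dim W" unfolding d using C fin by (intro card_mono)
 assume V: "fs.subspace V" "fs.dim V = fs.dim W"
 then have "A = C" using d C(1) fin card_subset_eq by metis
 then show "W \<subseteq> V" using C(4) A(1) fs.span_minimal[OF A(1) V(1)] by blast
qed

text \<open>A basis of the kernel in \<open>W\<close> is extended to a basis of \<open>W\<close>; on
  the span of the added vectors the map is injective, and these vectors go to a basis of the
  image.\<close>

lemma rank_nullity:
 fixes f :: "('i => 'k::field) => 'j => 'k"
 assumes f: "Vector_Spaces.linear fscale fscale f" and W: "fs.subspace W" "W \<subseteq> fs.span B" "finite B"
 shows "fs.dim W = fs.dim {x \<in> W. f x = 0} + fs.dim (f ` W)"
proof -
 interpret f: Vector_Spaces.linear fscale fscale f by (rule f)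
 define K where "K = {x \<in> W. f x = 0}"
 have K: "fs.subspace K" using W(1) unfolding fs.subspace_def K_def by (auto simp: f.add f.scale f.zero)
 obtain A where A: "A \<subseteq> K" "fs.independent A" "K \<subseteq> fs.span A" by (rule fs.maximal_independent_subset)
 have "A \<subseteq> W" using A(1) K_def by blast
 then obtain C where C: "A \<subseteq> C" "C \<subseteq> W" "fs.independent C" "W \<subseteq> fs.span C"
  using fs.maximal_independent_subset_extend[OF _ A(2)] by blast
 have fin: "finite C" using fs.independent_span_bound[OF W(3) C(3)] C(2) W(2) by blast
 have iCA: "fs.independent (C - A)" using C(3) fs.independent_mono by blast
 have inj: "inj_on f (fs.span (C - A))"
 proof (rule inj_onI)
  fix x y assume xy: "x \<in> fs.span (C - A)" "y \<in> fs.span (C - A)" "f x = f y"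
  define z where "z = x - y"
  have z: "z \<in> fs.span (C - A)" "f z = 0" using xy unfolding z_def by (auto simp: f.diff fs.span_diff)
  have "fs.span (C - A) \<subseteq> W" using C(2) W(1) by (intro fs.span_minimal) auto
  then have "z \<in> K" using z unfolding K_def by blast
  then have zA: "z \<in> fs.span A" using A(3) by blast
  \<comment> \<open>\<open>z\<close> lies in the spans of two disjoint parts of a basis, so all its
    coefficients vanish.\<close>
  have "fs.representation C z = fs.representation (C - A) z"
   using fs.representation_extend[OF C(3) z(1)] by blast
  moreover have "fs.representation C z = fs.representation A z"
   using fs.representation_extend[OF C(3) zA C(1)] .
  ultimately have "fs.representation C z b = 0" for b
   using fs.representation_ne_zero[of "C - A" z b] fs.representation_ne_zero[of A z b] by force
  moreover have "z \<in> fs.span C" using z(1) fs.span_mono[of "C - A" C] by blast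
  ultimately have "z = 0"
   using fs.sum_nonzero_representation_eq[OF C(3), of z] by simp
  then show "x = y" unfolding z_def by simp
 qed
 have i: "fs.independent (f ` (C - A))" by (rule fsp.linear_independent_injective_image[OF f iCA inj])
 have sp: "f ` W \<subseteq> fs.span (f ` (C - A))"
 proof -
  have "f ` W \<subseteq> f ` fs.span C" using C(4) by blast
  also have "\<dots> = fs.span (f ` C)" by (rule fsp.linear_span_image[OF f, symmetric])
  also have "f ` C \<subseteq> insert 0 (f ` (C - A))" using A(1) unfolding K_def by auto
  then have "fs.span (f ` C) \<subseteq> fs.span (insert 0 (f ` (C - A)))" by (rule fs.span_mono)
  also have "\<dots> = fs.span (f ` (C - A))" by simp
  finally show ?thesis .
 qed
 have "fs.dim W = card C" "fs.dim K = card A" using A C by (auto intro: fs.dim_unique)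
 moreover have "fs.dim (f ` W) = card (f ` (C - A))" using i sp C by (intro fs.dim_unique) auto
 moreover have "card (f ` (C - A)) = card (C - A)"
  using inj fs.span_superset by (intro card_image) (rule inj_on_subset)
 moreover have "card C = card A + card (C - A)"
  using C(1) fin by (metis card_Diff_subset card_mono finite_subset le_add_diff_inverse)
 ultimately show ?thesis unfolding K_def by simp
qed

section \<open>Euler characteristic of a bounded cochain complex\<close>

locale linear_cochain =
 fixes J :: "int => 'i set" and d :: "int => ('i => 'k::field) => 'i => 'k" and M :: int
 assumes fin: "finite (J q)" and lin: "Vector_Spaces.linear fscale fscale (d q)"
  and d_supp: "f \<in> supp_space (J q) ==> d q f \<in> supp_space (J (q + 1))"
  and d_d: "f \<in> supp_space (J q) ==> d (q + 1) (d q f) = 0"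
  and bounded: "\<bar>q\<bar> > M ==> J q = {}" and M: "M \<ge> 0"
begin

definition Z :: "int => ('i => 'k) set" where "Z q = {f \<in> supp_space (J q). d q f = 0}"
definition B :: "int => ('i => 'k) set" where "B q = d (q - 1) ` supp_space (J (q - 1))"
definition exact :: "int => bool" where "exact q \<longleftrightarrow> Z q \<subseteq> B q"
definition \<chi> :: int where "\<chi> = (\<Sum>q\<in>{-M..M}. (if even q then 1 else -1) * int (card (J q)))"

lemma B_Z: "B q \<subseteq> Z q"
proof
 fix f assume "f \<in> B q"
 then obtain g where "g \<in> supp_space (J (q - 1))" "f = d (q - 1) g" unfolding B_def by blast
 then show "f \<in> Z q" unfolding Z_def using d_supp[of g "q - 1"] d_d[of g "q - 1"] by simp
qed

lemma subspace_B: "fs.subspace (B q)"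
 unfolding B_def by (rule fsp.linear_subspace_image[OF lin subspace_supp])

lemma Z_span: "Z q \<subseteq> fs.span (unit_fun ` J q)"
 unfolding Z_def using supp_span[OF fin] by blast

lemma dim_B_le: "fs.dim (B q) \<le> fs.dim (Z q)"
 by (rule subspace_dim_le(1)[OF B_Z Z_span]) (simp add: fin)

lemma exact_iff: "exact q \<longleftrightarrow> fs.dim (B q) = fs.dim (Z q)"
proof
 assume "exact q" then have "Z q = B q" using B_Z unfolding exact_def by blast
 then show "fs.dim (B q) = fs.dim (Z q)" by simp
next
 assume "fs.dim (B q) = fs.dim (Z q)"
 then show "exact q"
  unfolding exact_def by (intro subspace_dim_le(2)[OF B_Z Z_span _ subspace_B]) (simp_all add: fin)
qed

lemma card_eq: "card (J q) = fs.dim (Z q) + fs.dim (B (q + 1))"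
 using rank_nullity[OF lin subspace_supp supp_span[OF fin], of q q] unfolding Z_def B_def
 by (simp add: dim_supp[OF fin] fin)

text \<open>\<open>card_eq\<close> splits \<open>card (J q)\<close> into the dimensions of
  \<open>Z q\<close> and \<open>B (q + 1)\<close>; shifting the index in the second sum flips the
  sign.\<close>

lemma euler_char: "\<chi> = (\<Sum>q\<in>{-M..M}. (if even q then 1 else -1) * (int (fs.dim (Z q)) - int (fs.dim (B q))))"
proof -
 let ?s = "%q::int. (if even q then 1 else -1) :: int" and ?b = "%q. int (fs.dim (B q))"
 \<comment> \<open>Coboundaries vanish at both ends of the range, so the summation interval may be
   moved by one.\<close>
 have b0: "?b q = 0" if "q = - M \<or> q = M + 1" for q
 proof -
  have "Z q \<subseteq> {0} \<or> supp_space (J (q - 1)) \<subseteq> {0 :: 'i => 'k}"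
   using that bounded[of q] bounded[of "q - 1"] M unfolding Z_def supp_space_def by (auto simp: fun_eq_iff)
  then have "B q \<subseteq> {0}"
   using B_Z[of q] fsp.linear_0[OF lin, of "q - 1"] unfolding B_def by auto
  then have "fs.dim (B q) \<le> card ({} :: ('i => 'k) set)" by (intro fs.dim_le_card) auto
  then show ?thesis by simp
 qed
 have "(\<Sum>q\<in>{-M..M}. ?s q * ?b (q + 1)) = (\<Sum>q\<in>{-M+1..M+1}. - (?s q * ?b q))"
  by (rule sum.reindex_bij_witness[of _ "%q. q - 1" "%q. q + 1"]) auto
 also have "\<dots> = (\<Sum>q\<in>{-M..M+1}. - (?s q * ?b q))"
 proof (rule sum.mono_neutral_left)
  show "\<forall>q\<in>{-M..M+1} - {-M+1..M+1}. - (?s q * ?b q) = 0"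
  proof
   fix q assume "q \<in> {-M..M+1} - {-M+1..M+1}"
   then have "q = - M" by auto
   then show "- (?s q * ?b q) = 0" using b0[of q] by simp
  qed
 qed auto
 also have "\<dots> = (\<Sum>q\<in>{-M..M}. - (?s q * ?b q))"
 proof (rule sum.mono_neutral_right)
  show "\<forall>q\<in>{-M..M+1} - {-M..M}. - (?s q * ?b q) = 0"
  proof
   fix q assume "q \<in> {-M..M+1} - {-M..M}"
   then have "q = M + 1" by auto
   then show "- (?s q * ?b q) = 0" using b0[of q] by simp
  qed
 qed auto
 finally have *: "(\<Sum>q\<in>{-M..M}. ?s q * ?b (q + 1)) = (\<Sum>q\<in>{-M..M}. - (?s q * ?b q))" .
 have "\<chi> = (\<Sum>q\<in>{-M..M}. ?s q * int (fs.dim (Z q))) + (\<Sum>q\<in>{-M..M}. ?s q * ?b (q + 1))"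
  unfolding \<chi>_def card_eq sum.distrib[symmetric] by (intro sum.cong) (auto simp: algebra_simps)
 then show ?thesis
  unfolding * sum.distrib[symmetric] by (simp only: right_diff_distrib) (simp only: diff_conv_add_uminus)
qed

lemma exact_imp_euler_zero: "(!!q. exact q) ==> \<chi> = 0"
 unfolding euler_char by (intro sum.neutral) (simp add: exact_iff)

text \<open>Odd degrees contribute nothing, even degrees the nonnegative dimension of cohomology,
  and degree 0 a positive one.\<close>

lemma odd_exact_imp_euler_pos:
 assumes "!!q. odd q ==> exact q" "\<not> exact 0" shows "\<chi> > 0"
 unfolding euler_char
proof (rule sum_pos2[of _ 0])
 have "fs.dim (B 0) < fs.dim (Z 0)" using assms(2) dim_B_le[of 0] by (simp add: exact_iff)
 then show "0 < (if even (0::int) then 1 else -1) * (int (fs.dim (Z 0)) - int (fs.dim (B 0)))" by simp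
 show "0 \<le> (if even q then 1 else -1) * (int (fs.dim (Z q)) - int (fs.dim (B q)))" for q
  using assms(1)[of q] dim_B_le[of q] by (simp add: exact_iff)
qed (use M in auto)

end

section \<open>Hom complexes in coordinates\<close>

locale coordinates = triangular_algebra R \<iota> n e
 for R :: "'a ring" (structure) and \<iota> :: "'k::field => 'a" and n e +
 fixes co :: "'a => 'b => 'k" and Bs :: "nat => nat => 'b set"
 assumes finite_Bs: "i < n ==> j < n ==> finite (Bs i j)"
  and co_add: "r \<in> carrier R ==> s \<in> carrier R ==> co (r \<oplus> s) x = co r x + co s x"
  and co_smult: "r \<in> carrier R ==> co (\<iota> c \<otimes> r) x = c * co r x"
  and co_bij: "i < n ==> j < n ==>
   bij_betw co {r \<in> carrier R. e i \<otimes> r = r & r \<otimes> e j = r} (supp_space (Bs i j))"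

text \<open>\<open>a\<close> and \<open>b\<close> record at which vertex a generator sits. In the
  Hom complex an entry \<open>U g h\<close> then lies in the corner between \<open>e (a g)\<close>
  and \<open>e (b h)\<close>, with coordinates indexed by \<open>Bs (a g) (b h)\<close>.\<close>

locale hom_coordinates = coordinates R \<iota> n e co Bs + semifree_pair R S T
 for R :: "'a ring" (structure) and \<iota> :: "'k::field => 'a" and n e and co :: "'a => 'b => 'k" and Bs S T +
 fixes a b :: "nat => nat"
 assumes a: "g < gens S ==> a g < n & vtx S g = e (a g)"
  and b: "h < gens T ==> b h < n & vtx T h = e (b h)"
begin

definition J :: "int => (nat \<times> nat \<times> 'b) set" where
 "J q = (SIGMA g:{..<gens S}. SIGMA h:{..<gens T}. if degr T h = degr S g + q then Bs (a g) (b h) else {})"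

definition E :: "nat => nat => 'a set" where
 "E i j = {r \<in> carrier R. e i \<otimes> r = r & r \<otimes> e j = r}"

definition Co :: "(nat => nat => 'a) => nat \<times> nat \<times> 'b => 'k" where
 "Co U = (%(g, h, x). co (U g h) x)"

text \<open>Inverse of \<open>Co\<close> in degree \<open>q\<close>. Cutting \<open>f\<close> off to
  \<open>Bs\<close> makes it meaningful on every function, so that \<open>d\<close> is linear on the
  whole function space, as \<open>linear_cochain\<close> asks.\<close>

definition dec :: "int => (nat \<times> nat \<times> 'b => 'k) => nat => nat => 'a" where
 "dec q f = (%g h. if g < gens S & h < gens T & degr T h = degr S g + q
   then inv_into (E (a g) (b h)) co (%x. if x \<in> Bs (a g) (b h) then f (g, h, x) else 0) else \<zero>)"

text \<open>A crude bound for the difference of the degrees of two generators.\<close>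

definition M :: int where
 "M = (\<Sum>g<gens S. \<bar>degr S g\<bar>) + (\<Sum>h<gens T. \<bar>degr T h\<bar>)"

lemma co_zero: "co \<zero> x = 0"
 using co_smult[of \<zero> 0 x] by (simp add: \<iota>_zero)

lemma E_add: "i < n ==> j < n ==> r \<in> E i j ==> s \<in> E i j ==> r \<oplus> s \<in> E i j"
 unfolding E_def using e_closed by (auto simp: r_distr l_distr)

lemma E_smult: "i < n ==> j < n ==> r \<in> E i j ==> \<iota> c \<otimes> r \<in> E i j"
proof -
 assume ij: "i < n" "j < n" "r \<in> E i j"
 have c: "e i \<in> carrier R" "e j \<in> carrier R" "r \<in> carrier R" "e i \<otimes> r = r" "r \<otimes> e j = r"
  using ij e_closed unfolding E_def by auto
 have "e i \<otimes> (\<iota> c \<otimes> r) = \<iota> c \<otimes> (e i \<otimes> r)"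
  using \<iota>_central[OF c(1), of c] c(1,3) by (simp add: m_assoc[symmetric])
 then show ?thesis unfolding E_def using c by (simp add: m_assoc)
qed

lemma co_inv:
 assumes "i < n" "j < n" "f \<in> supp_space (Bs i j)"
 shows "inv_into (E i j) co f \<in> E i j" "co (inv_into (E i j) co f) = f"
 using co_bij[OF assms(1,2)] assms(3) unfolding E_def[symmetric]
 by (metis bij_betw_def inv_into_into, metis bij_betw_inv_into_right)

lemma co_inj: "i < n ==> j < n ==> r \<in> E i j ==> s \<in> E i j ==> co r = co s ==> r = s"
 using co_bij[of i j] unfolding E_def[symmetric] bij_betw_def inj_on_def by blast

lemma co_supp: "i < n ==> j < n ==> r \<in> E i j ==> co r \<in> supp_space (Bs i j)"
 using co_bij[of i j] unfolding E_def[symmetric] bij_betw_def by blast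

lemma H_E: "U \<in> H q \<longleftrightarrow> (\<forall>g h. if g < gens S & h < gens T & degr T h = degr S g + q
  then U g h \<in> E (a g) (b h) else U g h = \<zero>)" (is "_ \<longleftrightarrow> ?r")
proof
 assume U: "U \<in> H q"
 show ?r
 proof (intro allI)
  fix g h
  show "if g < gens S & h < gens T & degr T h = degr S g + q then U g h \<in> E (a g) (b h) else U g h = \<zero>"
  proof (cases "g < gens S")
   case g: True
   have "U g \<in> T.P (degr S g + q)" using HD(1)[OF U g] .
   then have "if h < gens T & degr T h = degr S g + q then U g h \<in> carrier R & U g h \<otimes> vtx T h = U g h
    else U g h = \<zero>" unfolding sf_carrier_def by blast
   then show ?thesis using g a[OF g] b[of h] HD(2)[OF U g, of h] unfolding E_def by (auto split: if_splits)
  next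
   case False then show ?thesis using HD(3)[OF U False] by simp
  qed
 qed
next
 assume r: ?r
 show "U \<in> H q"
 proof (rule HI)
  fix g assume g: "g < gens S"
  have r': "if h < gens T & degr T h = degr S g + q then U g h \<in> E (a g) (b h) else U g h = \<zero>" for h
   using r[rule_format, of g h] g by simp
  show "U g \<in> T.P (degr S g + q)"
   unfolding sf_carrier_def mem_Collect_eq
  proof
   fix h show "if h < gens T & degr T h = degr S g + q then U g h \<in> carrier R & U g h \<otimes> vtx T h = U g h
    else U g h = \<zero>" using r'[of h] b[of h] unfolding E_def by (auto split: if_splits)
  qed
  show "vtx S g \<otimes> U g h = U g h" for h
   using r'[of h] a[OF g] S.vtx(1)[OF g] unfolding E_def by (auto split: if_splits)
 next
  fix g assume "\<not> g < gens S"
  then show "U g = (%h. \<zero>)" using r by (intro ext) simp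
 qed
qed

lemma supp_restrict: "(%x. if x \<in> B then f x else 0) \<in> supp_space B"
 unfolding supp_space_def by simp

lemma dec_H: "dec q f \<in> H q"
 unfolding H_E dec_def using a b co_inv(1)[OF _ _ supp_restrict] by simp

text \<open>Elements of the Hom complex are determined by their coordinates in \<open>J q\<close>;
  linearity of \<open>dec\<close> is obtained by comparing these.\<close>

lemma dec_eqI:
 assumes U: "U \<in> H q"
  and eq: "!!g h x. (g, h, x) \<in> J q ==> co (U g h) x = f (g, h, x)"
 shows "dec q f = U"
proof (intro ext)
 fix g h
 show "dec q f g h = U g h"
 proof (cases "g < gens S & h < gens T & degr T h = degr S g + q")
  case True
  then have n: "a g < n" "b h < n" using a b by auto
  have UE: "U g h \<in> E (a g) (b h)" using U True unfolding H_E by metis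
  have "co (U g h) x = (if x \<in> Bs (a g) (b h) then f (g, h, x) else 0)" for x
   using eq[of g h x] co_supp[OF n UE] True unfolding J_def supp_space_def by auto
  then have "co (U g h) = (%x. if x \<in> Bs (a g) (b h) then f (g, h, x) else 0)" by blast
  then have "co (dec q f g h) = co (U g h)" using co_inv(2)[OF n supp_restrict] True unfolding dec_def by simp
  moreover have "dec q f g h \<in> E (a g) (b h)" using co_inv(1)[OF n supp_restrict] True unfolding dec_def by simp
  ultimately show ?thesis using co_inj[OF n _ UE] by blast
 next
  case False then show ?thesis using U unfolding H_E dec_def by metis
 qed
qed

lemma co_dec: "(g, h, x) \<in> J q ==> co (dec q f g h) x = f (g, h, x)"
proof -
 assume x: "(g, h, x) \<in> J q"
 then have gh: "g < gens S" "h < gens T" "degr T h = degr S g + q" "x \<in> Bs (a g) (b h)"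
  unfolding J_def by (auto split: if_splits)
 show ?thesis using a[OF gh(1)] b[OF gh(2)] co_inv(2)[OF _ _ supp_restrict] gh unfolding dec_def by simp
qed

lemma Co_supp: "U \<in> H q ==> Co U \<in> supp_space (J q)"
proof -
 assume U: "U \<in> H q"
 have "co (U g h) x = 0" if "(g, h, x) \<notin> J q" for g h x
 proof (cases "g < gens S & h < gens T & degr T h = degr S g + q")
  case True
  then have "U g h \<in> E (a g) (b h)" using U unfolding H_E by metis
  then have "co (U g h) \<in> supp_space (Bs (a g) (b h))" using a b True by (intro co_supp) auto
  then show ?thesis using that True unfolding J_def supp_space_def by auto
 next
  case False
  then have "U g h = \<zero>" using U unfolding H_E by metis
  then show ?thesis by (simp add: co_zero)
 qed
 then show ?thesis unfolding supp_space_def Co_def by auto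
qed

lemma dec_Co: "U \<in> H q ==> dec q (Co U) = U"
 by (intro dec_eqI) (auto simp: Co_def)

lemma Co_dec: "f \<in> supp_space (J q) ==> Co (dec q f) = f"
proof
 fix p :: "nat \<times> nat \<times> 'b" assume f: "f \<in> supp_space (J q)"
 obtain g h x where p: "p = (g, h, x)" by (cases p)
 show "Co (dec q f) p = f p"
 proof (cases "p \<in> J q")
  case True then show ?thesis using co_dec[of g h x q f] unfolding p Co_def by simp
 next
  case False
  then show ?thesis using f Co_supp[OF dec_H, of q f] unfolding supp_space_def mem_Collect_eq by metis
 qed
qed

lemma H_add: "U \<in> H q ==> V \<in> H q ==> (%g h. U g h \<oplus> V g h) \<in> H q"
 unfolding H_E using a b E_add by auto

lemma H_smult: "U \<in> H q ==> (%g h. \<iota> c \<otimes> U g h) \<in> H q"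
 unfolding H_E using a b E_smult by auto

lemma diff_add:
 assumes U: "U \<in> H q" and V: "V \<in> H q"
 shows "\<delta> q (%g h. U g h \<oplus> V g h) = (%g h. \<delta> q U g h \<oplus> \<delta> q V g h)"
proof (intro ext)
 fix g h
 show "\<delta> q (%g h. U g h \<oplus> V g h) g h = \<delta> q U g h \<oplus> \<delta> q V g h"
 proof (cases "g < gens S")
  case g: True
  have "D (%h. U g h \<oplus> V g h) = D (U g) \<oplus>\<^bsub>F\<^esub> D (V g)"
   using HD(4)[OF U] HD(4)[OF V] by (intro S.F.lin_add_left) auto
  moreover have "ext (%g. U g \<oplus>\<^bsub>F\<^esub> V g) (att S g) = ext U (att S g) \<oplus>\<^bsub>F\<^esub> ext V (att S g)"
   using HD(5)[OF U] HD(5)[OF V] g by (intro S.F.lin_add_right) auto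
  moreover have "D (U g) h \<in> carrier R" "D (V g) h \<in> carrier R" "ext U (att S g) h \<in> carrier R" "ext V (att S g) h \<in> carrier R"
   using D_closed[OF HD(5)[OF U]] D_closed[OF HD(5)[OF V]] ext_closed[OF HD(5)[OF U]] ext_closed[OF HD(5)[OF V]] g by auto
  ultimately show ?thesis using g S.hom_sign_closed[of q] by (simp add: diff_apply r_distr a_ac)
 qed (simp add: hom_diff_def)
qed

lemma diff_smult:
 assumes U: "U \<in> H q"
 shows "\<delta> q (%g h. \<iota> c \<otimes> U g h) = (%g h. \<iota> c \<otimes> \<delta> q U g h)"
proof (intro ext)
 fix g h
 show "\<delta> q (%g h. \<iota> c \<otimes> U g h) g h = \<iota> c \<otimes> \<delta> q U g h"
 proof (cases "g < gens S")
  case g: True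
  have "D (%h. \<iota> c \<otimes> U g h) = \<iota> c \<odot>\<^bsub>F\<^esub> D (U g)"
   using HD(4)[OF U] by (intro S.F.lin_smult_left) auto
  moreover have "ext (%g. \<iota> c \<odot>\<^bsub>F\<^esub> U g) (att S g) = \<iota> c \<odot>\<^bsub>F\<^esub> ext U (att S g)"
   using HD(5)[OF U] g \<iota>_central by (intro S.F.lin_central_right) auto
  moreover have c: "D (U g) h \<in> carrier R" "ext U (att S g) h \<in> carrier R"
   using D_closed[OF HD(5)[OF U]] ext_closed[OF HD(5)[OF U]] g by auto
  moreover have "hom_sign R q \<otimes> (\<iota> c \<otimes> ext U (att S g) h) = \<iota> c \<otimes> (hom_sign R q \<otimes> ext U (att S g) h)"
   using c S.hom_sign_central[of "\<iota> c" q] S.hom_sign_closed[of q] by (simp add: m_assoc[symmetric])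
  ultimately show ?thesis using g S.hom_sign_closed[of q] by (simp add: diff_apply r_distr)
 qed (simp add: hom_diff_def)
qed

definition d :: "int => (nat \<times> nat \<times> 'b => 'k) => nat \<times> nat \<times> 'b => 'k" where
 "d q f = Co (\<delta> q (dec q f))"

sublocale cc: linear_cochain J d M
proof
 fix q :: int
 show "finite (J q)" unfolding J_def using finite_Bs a b by (intro finite_SigmaI) auto
 have Vs: "dec q (f + f') = (%g h. dec q f g h \<oplus> dec q f' g h)" for f f'
  using co_dec HD(4)[OF dec_H] by (intro dec_eqI H_add dec_H) (simp add: co_add)
 have Vm: "dec q (fscale c f) = (%g h. \<iota> c \<otimes> dec q f g h)" for c f
  using co_dec HD(4)[OF dec_H] by (intro dec_eqI H_smult dec_H) (simp add: co_smult)
 show "d q (f + f') = d q f + d q f'" for f f'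
  unfolding d_def Vs diff_add[OF dec_H dec_H]
  using HD(4)[OF diff_H[OF dec_H]] by (auto simp: Co_def co_add fun_eq_iff)
 show "d q (fscale c f) = fscale c (d q f)" for c f
  unfolding d_def Vm diff_smult[OF dec_H]
  using HD(4)[OF diff_H[OF dec_H]] by (auto simp: Co_def co_smult fun_eq_iff)
 fix f
 show "d q f \<in> supp_space (J (q + 1))" unfolding d_def by (intro Co_supp diff_H dec_H)
 show "d (q + 1) (d q f) = 0"
  unfolding d_def dec_Co[OF diff_H[OF dec_H]] diff_diff[OF dec_H] by (auto simp: Co_def co_zero fun_eq_iff)
next
 show "J q = {}" if q: "\<bar>q\<bar> > M" for q
 proof (rule ccontr)
  assume "J q ~= {}"
  then obtain g h where gh: "g < gens S" "h < gens T" "degr T h = degr S g + q"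
   unfolding J_def by (auto split: if_splits)
  have "\<bar>degr S g\<bar> \<le> (\<Sum>g<gens S. \<bar>degr S g\<bar>)" using gh(1) by (intro member_le_sum) auto
  moreover have "\<bar>degr T h\<bar> \<le> (\<Sum>h<gens T. \<bar>degr T h\<bar>)" using gh(2) by (intro member_le_sum) auto
  ultimately show False using q gh(3) unfolding M_def by linarith
 qed
 show "M \<ge> 0" unfolding M_def by (intro add_nonneg_nonneg sum_nonneg) auto
qed

lemma exact_iff_hom_exact: "cc.exact q \<longleftrightarrow> hom_exact R S T q"
proof
 assume ex: "cc.exact q"
 show "hom_exact R S T q"
  unfolding hom_exact_def
 proof (intro ballI impI)
  fix U assume U: "U \<in> H q" "\<delta> q U = (%g h. \<zero>)"
  have "d q (Co U) = 0"
   unfolding d_def dec_Co[OF U(1)] U(2) by (auto simp: Co_def co_zero fun_eq_iff)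
  then have "Co U \<in> cc.Z q" unfolding cc.Z_def using Co_supp[OF U(1)] by blast
  then obtain f where "Co U = d (q - 1) f" using ex unfolding cc.exact_def cc.B_def by blast
  then have "dec q (Co U) = dec q (Co (\<delta> (q - 1) (dec (q - 1) f)))" unfolding d_def by simp
  moreover have "\<delta> (q - 1) (dec (q - 1) f) \<in> H q" using diff_H[OF dec_H, of "q - 1"] by simp
  ultimately have "U = \<delta> (q - 1) (dec (q - 1) f)" using dec_Co U(1) by simp
  then show "\<exists>W\<in>H (q - 1). \<delta> (q - 1) W = U" using dec_H by blast
 qed
next
 assume ex: "hom_exact R S T q"
 show "cc.exact q"
  unfolding cc.exact_def
 proof
  fix f assume f: "f \<in> cc.Z q"
  then have fs: "f \<in> supp_space (J q)" and df: "Co (\<delta> q (dec q f)) = 0" unfolding cc.Z_def d_def by auto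
  have "dec (q + 1) (Co (\<delta> q (dec q f))) = \<delta> q (dec q f)" by (rule dec_Co[OF diff_H[OF dec_H]])
  moreover have "dec (q + 1) 0 = (%g h. \<zero>)"
   by (intro dec_eqI) (use a b e_closed in \<open>auto simp: H_E E_def co_zero\<close>)
  ultimately have "\<delta> q (dec q f) = (%g h. \<zero>)" unfolding df by simp
  then obtain W where W: "W \<in> H (q - 1)" "\<delta> (q - 1) W = dec q f"
   using ex dec_H unfolding hom_exact_def by blast
  have "d (q - 1) (Co W) = f" unfolding d_def dec_Co[OF W(1)] W(2) by (rule Co_dec[OF fs])
  then show "f \<in> cc.B q" unfolding cc.B_def using Co_supp[OF W(1)] by blast
 qed
qed

text \<open>Nonnegative degrees are reached by shifting the target, nonpositive ones by shifting the
  source.\<close>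

lemma exact_if_thin:
 assumes "q \<ge> 0 ==> thin (derived_cat R) (sf_obj R S) ((shift ^^ nat q) (sf_obj R T))"
  and "q \<le> 0 ==> thin (derived_cat R) ((shift ^^ nat (- q)) (sf_obj R S)) (sf_obj R T)"
 shows "cc.exact q"
 unfolding exact_iff_hom_exact
 using thin_shift_right_imp_exact[of "nat q"] thin_shift_left_imp_exact[of "nat (- q)"] assms by (cases "q \<ge> 0") auto

text \<open>A pair of generators contributes in the single degree
  \<open>degr T h - degr S g\<close>, so exchanging the sums leaves a sum over pairs.\<close>

lemma euler_char_eq:
 "cc.\<chi> = (\<Sum>g<gens S. \<Sum>h<gens T. (if even (degr T h - degr S g) then 1 else -1) * int (card (Bs (a g) (b h))))"
proof -
 let ?s = "%q::int. (if even q then 1 else -1) :: int"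
 let ?c = "%g h. int (card (Bs (a g) (b h)))"
 have card: "int (card (J q)) = (\<Sum>g<gens S. \<Sum>h<gens T. if q = degr T h - degr S g then ?c g h else 0)" for q
 proof -
  have "card (J q) = (\<Sum>g<gens S. card (SIGMA h:{..<gens T}. if degr T h = degr S g + q then Bs (a g) (b h) else {}))"
   unfolding J_def using finite_Bs a b by (intro card_SigmaI) auto
  also have "\<dots> = (\<Sum>g<gens S. \<Sum>h<gens T. card (if degr T h = degr S g + q then Bs (a g) (b h) else {}))"
   using finite_Bs a b by (intro sum.cong card_SigmaI refl) auto
  finally show ?thesis by (auto intro!: sum.cong)
 qed
 have "cc.\<chi> = (\<Sum>q\<in>{-M..M}. \<Sum>g<gens S. \<Sum>h<gens T. if q = degr T h - degr S g then ?s q * ?c g h else 0)"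
  unfolding cc.\<chi>_def card by (auto simp: sum_distrib_left intro!: sum.cong)
 also have "\<dots> = (\<Sum>g<gens S. \<Sum>h<gens T. \<Sum>q\<in>{-M..M}. if q = degr T h - degr S g then ?s q * ?c g h else 0)"
  by (subst sum.swap, intro sum.cong refl, subst sum.swap) simp
 also have "\<dots> = (\<Sum>g<gens S. \<Sum>h<gens T. ?s (degr T h - degr S g) * ?c g h)"
 proof (intro sum.cong refl)
  fix g h assume "g \<in> {..<gens S}" "h \<in> {..<gens T}"
  then have "\<bar>degr S g\<bar> \<le> (\<Sum>g<gens S. \<bar>degr S g\<bar>)" "\<bar>degr T h\<bar> \<le> (\<Sum>h<gens T. \<bar>degr T h\<bar>)"
   by (auto intro!: member_le_sum)
  then have "degr T h - degr S g \<in> {-M..M}" unfolding M_def by auto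
  then show "(\<Sum>q\<in>{-M..M}. if q = degr T h - degr S g then ?s q * ?c g h else 0) = ?s (degr T h - degr S g) * ?c g h"
   by (simp add: sum.delta')
 qed
 finally show ?thesis .
qed

end

context coordinates
begin

text \<open>The sign attached to a pair of generators is the product of their individual signs.
  After symmetrising, each pair is weighted by the same number 2, so the double sum factors and
  \<open>\<rho>\<close> comes out as the alternating number of generators.\<close>

lemma no_euler_orthogonal_pair:
 fixes X Y :: "('a, 'a list set) cochain"
 assumes Bs: "!!i j. i < n ==> j < n ==> card (Bs i j) + card (Bs j i) = 2"
  and X: "bounded_complex R X" and Y: "bounded_complex R Y"
  and XY: "!!m. thin (derived_cat R) ((shift ^^ m) X) Y" "!!m. thin (derived_cat R) X ((shift ^^ m) Y)"
  and YX: "!!m. thin (derived_cat R) ((shift ^^ m) Y) X" "!!m. thin (derived_cat R) Y ((shift ^^ m) X)"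
  and XX: "!!m. odd m ==> thin (derived_cat R) ((shift ^^ m) X) X" "!!m. odd m ==> thin (derived_cat R) X ((shift ^^ m) X)"
   "\<not> thin (derived_cat R) X X"
  and YY: "!!m. odd m ==> thin (derived_cat R) ((shift ^^ m) Y) Y" "!!m. odd m ==> thin (derived_cat R) Y ((shift ^^ m) Y)"
   "\<not> thin (derived_cat R) Y Y"
 shows False
proof -
 let ?D = "derived_cat R"
 interpret D: category ?D by (rule category_derived_cat)
 obtain S where S: "semifree R S" "\<forall>g<gens S. vtx S g \<in> e ` {..<n}" "isomorphic ?D (sf_obj R S) X"
  using semifree_resolution[OF X] by blast
 obtain T where T: "semifree R T" "\<forall>g<gens T. vtx T g \<in> e ` {..<n}" "isomorphic ?D (sf_obj R T) Y"
  using semifree_resolution[OF Y] by blast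
 interpret S: semifree R S by (rule S)
 interpret T: semifree R T by (rule T)
 obtain a where a: "!!g. g < gens S ==> a g < n & vtx S g = e (a g)"
  using S(2) unfolding image_iff lessThan_iff by (metis (no_types, lifting) lessThan_iff)
 obtain b where b: "!!g. g < gens T ==> b g < n & vtx T g = e (b g)"
  using T(2) unfolding image_iff lessThan_iff by (metis (no_types, lifting) lessThan_iff)
 have O: "X \<in> Obj ?D" "Y \<in> Obj ?D" "sf_obj R S \<in> Obj ?D" "sf_obj R T \<in> Obj ?D"
  using X Y S.bounded_complex_sf_obj T.bounded_complex_sf_obj by (simp_all add: Obj_derived_cat)
 \<comment> \<open>Thinness is given for \<open>X\<close> and \<open>Y\<close>, exactness is wanted
   for their resolutions; shifts of isomorphic objects are isomorphic.\<close>
 have transfer: "thin ?D ((shift ^^ m) U) ((shift ^^ m') V) \<longleftrightarrow> thin ?D ((shift ^^ m) U') ((shift ^^ m') V')"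
  if "U \<in> Obj ?D" "V \<in> Obj ?D" "U' \<in> Obj ?D" "V' \<in> Obj ?D" "isomorphic ?D U' U" "isomorphic ?D V' V" for U V U' V' m m'
 proof -
  note o = Obj_shift_pow[OF that(1), of m] Obj_shift_pow[OF that(2), of m']
   Obj_shift_pow[OF that(3), of m] Obj_shift_pow[OF that(4), of m']
  note i = isomorphic_shift_pow[OF that(5), of m] isomorphic_shift_pow[OF that(6), of m']
  show ?thesis
   using D.thin_isomorphic[OF o(3,4,1,2) i] D.thin_isomorphic[OF o(1,2,3,4) D.isomorphic_sym[OF i(1)] D.isomorphic_sym[OF i(2)]]
   by blast
 qed
 have tr: "thin ?D ((shift ^^ m) U) V \<longleftrightarrow> thin ?D ((shift ^^ m) U') V'"
  "thin ?D U ((shift ^^ m) V) \<longleftrightarrow> thin ?D U' ((shift ^^ m) V')" "thin ?D U V \<longleftrightarrow> thin ?D U' V'"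
  if "U \<in> Obj ?D" "V \<in> Obj ?D" "U' \<in> Obj ?D" "V' \<in> Obj ?D" "isomorphic ?D U' U" "isomorphic ?D V' V" for U V U' V' m
  using transfer[OF that, of m 0] transfer[OF that, of 0 m] transfer[OF that, of 0 0] by simp_all
 interpret ST: hom_coordinates R \<iota> n e co Bs S T a b using a b by unfold_locales
 interpret TS: hom_coordinates R \<iota> n e co Bs T S b a using a b by unfold_locales
 interpret SS: hom_coordinates R \<iota> n e co Bs S S a a using a by unfold_locales
 interpret TT: hom_coordinates R \<iota> n e co Bs T T b b using b by unfold_locales
 have ST: "ST.cc.exact q" for q
  by (rule ST.exact_if_thin) (simp_all add: tr(1,2)[OF O(1,2,3,4) S(3) T(3), symmetric] XY)
 have TS: "TS.cc.exact q" for q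
  by (rule TS.exact_if_thin) (simp_all add: tr(1,2)[OF O(2,1,4,3) T(3) S(3), symmetric] YX)
 have SS: "SS.cc.exact q" if "odd q" for q
  by (rule SS.exact_if_thin) (use that in \<open>simp_all add: tr(1,2)[OF O(1,1,3,3) S(3) S(3), symmetric] XX even_nat_iff\<close>)
 have TT: "TT.cc.exact q" if "odd q" for q
  by (rule TT.exact_if_thin) (use that in \<open>simp_all add: tr(1,2)[OF O(2,2,4,4) T(3) T(3), symmetric] YY even_nat_iff\<close>)
 have SS0: "\<not> SS.cc.exact 0"
  unfolding SS.exact_iff_hom_exact using S.exact_imp_thin XX(3) tr(3)[OF O(1,1,3,3) S(3) S(3)] by blast
 have TT0: "\<not> TT.cc.exact 0"
  unfolding TT.exact_iff_hom_exact using T.exact_imp_thin YY(3) tr(3)[OF O(2,2,4,4) T(3) T(3)] by blast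
 define s :: "int => int" where "s k = (if even k then 1 else -1)" for k
 have s_diff: "(if even (k - l) then 1 else -1) = s l * s k" for k l unfolding s_def by auto
 define \<rho> where "\<rho> U = (\<Sum>g<gens U. s (degr U g))" for U :: "'a semifree"
 let ?d = "%i j. int (card (Bs i j))"
 have d: "?d i j + ?d j i = 2" if "i < n" "j < n" for i j using Bs[OF that] by linarith
 have sum2: "(\<Sum>g<gens U. \<Sum>h<gens V. s (degr U g) * s (degr V h) * (?d (c g) (c' h) + ?d (c' h) (c g))) = 2 * (\<rho> U * \<rho> V)"
  if "!!g. g < gens U ==> c g < n" "!!h. h < gens V ==> c' h < n" for U V c c'
 proof -
  have "(\<Sum>g<gens U. \<Sum>h<gens V. s (degr U g) * s (degr V h) * (?d (c g) (c' h) + ?d (c' h) (c g))) =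
   (\<Sum>g<gens U. \<Sum>h<gens V. s (degr U g) * s (degr V h) * 2)"
   using that d by (intro sum.cong refl) simp
  also have "\<dots> = 2 * (\<rho> U * \<rho> V)"
   unfolding \<rho>_def sum_product by (simp add: sum_distrib_left mult.commute)
  finally show ?thesis .
 qed
 have "ST.cc.\<chi> + TS.cc.\<chi> = (\<Sum>g<gens S. \<Sum>h<gens T. s (degr S g) * s (degr T h) * (?d (a g) (b h) + ?d (b h) (a g)))"
 proof -
  have "TS.cc.\<chi> = (\<Sum>h<gens S. \<Sum>g<gens T. s (degr T g) * s (degr S h) * ?d (b g) (a h))"
   unfolding TS.euler_char_eq s_diff by (rule sum.swap)
  then show ?thesis unfolding ST.euler_char_eq s_diff
   by (simp add: sum.distrib[symmetric] distrib_left mult.commute mult.left_commute)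
 qed
 also have "\<dots> = 2 * (\<rho> S * \<rho> T)" using a b by (intro sum2) auto
 finally have ST0: "2 * (\<rho> S * \<rho> T) = 0" using ST.cc.exact_imp_euler_zero[OF ST] TS.cc.exact_imp_euler_zero[OF TS] by simp
 \<comment> \<open>Adding the Euler characteristic to itself with the order of summation exchanged
   brings in the symmetrised dimensions. So it equals the square of \<open>\<rho> U\<close> and is
   positive only if \<open>\<rho> U\<close> is nonzero.\<close>
 have \<rho>: "\<rho> U ~= 0"
  if pos: "(\<Sum>g<gens U. \<Sum>h<gens U. s (degr U g) * s (degr U h) * ?d (c g) (c h)) > 0"
   and c: "!!g. g < gens U ==> c g < n" for U c
 proof -
  let ?x = "\<Sum>g<gens U. \<Sum>h<gens U. s (degr U g) * s (degr U h) * ?d (c g) (c h)"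
  have "?x = (\<Sum>h<gens U. \<Sum>g<gens U. s (degr U g) * s (degr U h) * ?d (c g) (c h))" by (rule sum.swap)
  then have "?x + ?x = ?x + (\<Sum>h<gens U. \<Sum>g<gens U. s (degr U g) * s (degr U h) * ?d (c g) (c h))" by simp
  also have "\<dots> = (\<Sum>g<gens U. \<Sum>h<gens U. s (degr U g) * s (degr U h) * (?d (c g) (c h) + ?d (c h) (c g)))"
   by (simp add: sum.distrib[symmetric] distrib_left mult.commute mult.left_commute)
  also have "\<dots> = 2 * (\<rho> U * \<rho> U)" using c by (intro sum2)
  finally show ?thesis using pos by auto
 qed
 have "\<rho> S ~= 0"
  using SS.cc.odd_exact_imp_euler_pos[OF SS SS0] a unfolding SS.euler_char_eq s_diff by (intro \<rho>[of S a]) auto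
 moreover have "\<rho> T ~= 0"
  using TT.cc.odd_exact_imp_euler_pos[OF TT TT0] b unfolding TT.euler_char_eq s_diff by (intro \<rho>[of T b]) auto
 ultimately show False using ST0 by simp
qed

end

section \<open>Path algebras with relations\<close>

definition avoids :: "('e \<times> 'e) set => 'e list => bool" where
 "avoids \<rho> = successively (%\<beta> \<gamma>. (\<beta>, \<gamma>) \<notin> \<rho>)"

lemma avoids_take: "avoids \<rho> p ==> avoids \<rho> (take i p)"
 unfolding avoids_def by (metis append_take_drop_id successively_append_iff)

lemma avoids_drop: "avoids \<rho> p ==> avoids \<rho> (drop i p)"
 unfolding avoids_def by (metis append_take_drop_id successively_append_iff)

lemma not_avoids: "\<not> avoids \<rho> p ==> \<exists>q \<beta> \<gamma> r. p = q @ [\<beta>, \<gamma>] @ r & (\<beta>, \<gamma>) \<in> \<rho>"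
proof (induction p)
 case (Cons a p)
 show ?case
 proof (cases "avoids \<rho> p")
  case True
  then obtain b r where "p = b # r" "(a, b) \<in> \<rho>"
   using Cons.prems unfolding avoids_def by (cases p) auto
  then show ?thesis by (intro exI[of _ "[]"] exI[of _ a] exI[of _ b] exI[of _ r]) simp
 next
  case False
  then obtain q \<beta> \<gamma> r where "p = q @ [\<beta>, \<gamma>] @ r" "(\<beta>, \<gamma>) \<in> \<rho>" using Cons.IH by blast
  then show ?thesis by (intro exI[of _ "a # q"] exI[of _ \<beta>] exI[of _ \<gamma>] exI[of _ r]) simp
 qed
qed (simp add: avoids_def)

text \<open>\<open>fin_avoiding\<close> is finite-dimensionality of the quotient, whose basis
  consists of the paths avoiding \<open>\<rho>\<close>.\<close>

locale bound_quiver = wf_digraph Q for Q :: "('v, 'e) pre_digraph" +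
 fixes \<rho> :: "('e \<times> 'e) set" and I :: "('v \<times> 'e list => 'k::field) set"
 assumes fin_verts: "finite (verts Q)"
  and \<rho>: "\<rho> \<subseteq> {(\<beta>, \<gamma>). composable Q \<beta> \<gamma>}"
  and I: "I = Idl\<^bsub>path_algebra Q\<^esub> ((%(\<beta>, \<gamma>). two_path Q \<beta> \<gamma>) ` \<rho>)"
  and fin_avoiding: "finite {(u, p). (u, p) \<in> paths Q & avoids \<rho> p}"
begin

abbreviation A :: "('v \<times> 'e list => 'k) ring" where "A \<equiv> path_algebra Q"

lemma paths_iff: "(u, p) \<in> paths Q \<longleftrightarrow> awalk u p (awlast u p)"
 unfolding paths_def by auto

lemma paths_append: "(u, p @ q) \<in> paths Q \<longleftrightarrow> (u, p) \<in> paths Q & (awlast u p, q) \<in> paths Q"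
 unfolding paths_iff by (simp add: awlast_append)

lemma paths_Nil: "(u, []) \<in> paths Q \<longleftrightarrow> u \<in> verts Q"
 unfolding paths_iff by (simp add: awalk_Nil_iff)

lemma awlast_verts: "(u, p) \<in> paths Q ==> awlast u p \<in> verts Q"
 unfolding paths_iff by auto

lemma carrier_A: "f \<in> carrier A \<longleftrightarrow> finite {x. f x ~= 0} & (\<forall>x. x \<notin> paths Q --> f x = 0)"
 unfolding path_algebra_def by simp

lemma carrierD: "f \<in> carrier A ==> x \<notin> paths Q ==> f x = 0" "f \<in> carrier A ==> finite {x. f x ~= 0}"
 unfolding carrier_A by blast+

lemma A_simps: "f \<oplus>\<^bsub>A\<^esub> g = (%x. f x + g x)" "\<zero>\<^bsub>A\<^esub> = (%x. 0)"
 "\<one>\<^bsub>A\<^esub> (u, p) = (if u \<in> verts Q & p = [] then 1 else 0)"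
 "(f \<otimes>\<^bsub>A\<^esub> g) (u, p) = (\<Sum>i\<le>length p. f (awlast u (take i p), drop i p) * g (u, take i p))"
 unfolding path_algebra_def by simp_all

lemma scale_closed: "f \<in> carrier A ==> fscale c f \<in> carrier A"
proof -
 assume f: "f \<in> carrier A"
 have "{x. c * f x ~= 0} \<subseteq> {x. f x ~= 0}" by auto
 then show ?thesis using f finite_subset unfolding carrier_A by auto
qed

lemma add_closed: "f \<in> carrier A ==> g \<in> carrier A ==> (%x. f x + g x) \<in> carrier A"
proof -
 assume fg: "f \<in> carrier A" "g \<in> carrier A"
 have "{x. f x + g x ~= 0} \<subseteq> {x. f x ~= 0} \<union> {x. g x ~= 0}" by auto
 then show ?thesis using fg unfolding carrier_A by (auto intro: finite_subset)
qed

lemma path_elem_closed: "x \<in> paths Q ==> path_elem x \<in> carrier A"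
 unfolding carrier_A path_elem_def by (auto simp: finite_subset[of _ "{x}"])

lemma mult_closed: "f \<in> carrier A ==> g \<in> carrier A ==> f \<otimes>\<^bsub>A\<^esub> g \<in> carrier A"
proof -
 assume fg: "f \<in> carrier A" "g \<in> carrier A"
 have nz: "\<exists>i. f (awlast u (take i p), drop i p) ~= 0 & g (u, take i p) ~= 0" if "(f \<otimes>\<^bsub>A\<^esub> g) (u, p) ~= 0" for u p
  using that unfolding A_simps by (metis (no_types, lifting) mult_eq_0_iff sum.neutral)
 have "{x. (f \<otimes>\<^bsub>A\<^esub> g) x ~= 0} \<subseteq> (%((u, q), (w, r)). (u, q @ r)) ` ({x. g x ~= 0} \<times> {x. f x ~= 0})"
 proof
  fix x assume x: "x \<in> {x. (f \<otimes>\<^bsub>A\<^esub> g) x ~= 0}"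
  obtain u p where up: "x = (u, p)" by (cases x)
  then obtain i where "f (awlast u (take i p), drop i p) ~= 0" "g (u, take i p) ~= 0" using nz x by blast
  then show "x \<in> (%((u, q), (w, r)). (u, q @ r)) ` ({x. g x ~= 0} \<times> {x. f x ~= 0})"
   unfolding up by (intro image_eqI[of _ _ "((u, take i p), (awlast u (take i p), drop i p))"]) auto
 qed
 then have "finite {x. (f \<otimes>\<^bsub>A\<^esub> g) x ~= 0}"
  using fg carrierD(2) by (meson finite_SigmaI finite_imageI finite_subset)
 moreover have "(f \<otimes>\<^bsub>A\<^esub> g) x = 0" if "x \<notin> paths Q" for x
 proof (rule ccontr)
  assume nz0: "(f \<otimes>\<^bsub>A\<^esub> g) x ~= 0"
  obtain u p where up: "x = (u, p)" by (cases x)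
  then obtain i where "f (awlast u (take i p), drop i p) ~= 0" "g (u, take i p) ~= 0" using nz nz0 by blast
  then have "(u, take i p) \<in> paths Q" "(awlast u (take i p), drop i p) \<in> paths Q"
   using carrierD(1)[OF fg(1)] carrierD(1)[OF fg(2)] by metis+
  then have "(u, take i p @ drop i p) \<in> paths Q" unfolding paths_append by blast
  then show False using that up by simp
 qed
 ultimately show ?thesis unfolding carrier_A by blast
qed

text \<open>Both sides sum over the ways to cut a path into three pieces, indexed by
  \<open>(i, j)\<close> with \<open>i + j \<le> n\<close>; regrouping by \<open>k = i + j\<close>
  exchanges the two nestings.\<close>

lemma mult_assoc: "(f \<otimes>\<^bsub>A\<^esub> g) \<otimes>\<^bsub>A\<^esub> h = f \<otimes>\<^bsub>A\<^esub> (g \<otimes>\<^bsub>A\<^esub> h)"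
proof
 fix x :: "'v \<times> 'e list" obtain u p where up: "x = (u, p)" by (cases x)
 define n where "n = length p"
 define w where "w i = awlast u (take i p)" for i
 define G where "G i j = f (w (i + j), drop (i + j) p) * (g (w i, take j (drop i p)) * h (u, take i p))" for i j
 have wj: "awlast (w i) (take j (drop i p)) = w (i + j)" for i j
  unfolding w_def awlast_append[symmetric] take_add ..
 have "((f \<otimes>\<^bsub>A\<^esub> g) \<otimes>\<^bsub>A\<^esub> h) (u, p) = (\<Sum>i\<le>n. \<Sum>j\<le>n - i. G i j)"
  unfolding A_simps(4)[of "f \<otimes>\<^bsub>A\<^esub> g"] n_def w_def[symmetric]
 proof (intro sum.cong refl)
  fix i assume "i \<in> {..length p}"
  show "(f \<otimes>\<^bsub>A\<^esub> g) (w i, drop i p) * h (u, take i p) = (\<Sum>j\<le>length p - i. G i j)"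
   unfolding A_simps wj sum_distrib_right G_def by (simp add: mult.assoc add.commute)
 qed
 also have "\<dots> = (\<Sum>(i, j)\<in>(SIGMA i:{..n}. {..n - i}). G i j)" by (simp add: sum.Sigma)
 also have "\<dots> = (\<Sum>(i, j)\<in>{(i, j). i + j \<le> n}. G i j)" by (intro sum.cong) auto
 also have "\<dots> = (\<Sum>k\<le>n. \<Sum>i\<le>k. G i (k - i))" by (rule sum.triangle_reindex_eq)
 also have "\<dots> = (f \<otimes>\<^bsub>A\<^esub> (g \<otimes>\<^bsub>A\<^esub> h)) (u, p)"
  unfolding A_simps(4)[of f] n_def w_def[symmetric]
 proof (intro sum.cong refl)
  fix k assume k: "k \<in> {..length p}"
  have gh: "(g \<otimes>\<^bsub>A\<^esub> h) (u, take k p) = (\<Sum>i\<le>k. g (w i, take (k - i) (drop i p)) * h (u, take i p))"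
   unfolding A_simps using k by (intro sum.cong) (auto simp: w_def min_def drop_take)
  show "(\<Sum>i\<le>k. G i (k - i)) = f (w k, drop k p) * (g \<otimes>\<^bsub>A\<^esub> h) (u, take k p)"
   unfolding G_def gh sum_distrib_left by (intro sum.cong) auto
 qed
 finally show "((f \<otimes>\<^bsub>A\<^esub> g) \<otimes>\<^bsub>A\<^esub> h) x = (f \<otimes>\<^bsub>A\<^esub> (g \<otimes>\<^bsub>A\<^esub> h)) x" unfolding up .
qed

lemma mult_path_elem_Nil:
 assumes f: "f \<in> carrier A"
 shows "(f \<otimes>\<^bsub>A\<^esub> path_elem (v, [])) (u, p) = (if u = v then f (u, p) else 0)"
  "(path_elem (v, []) \<otimes>\<^bsub>A\<^esub> f) (u, p) = (if awlast u p = v then f (u, p) else 0)"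
proof -
 have "(f \<otimes>\<^bsub>A\<^esub> path_elem (v, [])) (u, p) =
  (\<Sum>i\<le>length p. if i = 0 then (if u = v then f (u, p) else 0) else 0)"
  unfolding A_simps path_elem_def by (intro sum.cong) auto
 then show "(f \<otimes>\<^bsub>A\<^esub> path_elem (v, [])) (u, p) = (if u = v then f (u, p) else 0)" by simp
 have "(path_elem (v, []) \<otimes>\<^bsub>A\<^esub> f) (u, p) =
  (\<Sum>i\<le>length p. if i = length p then (if awlast u p = v then f (u, p) else 0) else 0)"
  unfolding A_simps path_elem_def by (intro sum.cong) auto
 then show "(path_elem (v, []) \<otimes>\<^bsub>A\<^esub> f) (u, p) = (if awlast u p = v then f (u, p) else 0)" by simp
qed

lemma one_eq: "\<one>\<^bsub>A\<^esub> = (\<Sum>v\<in>verts Q. path_elem (v, []))"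
proof
 fix x :: "'v \<times> 'e list" obtain u p where x: "x = (u, p)" by (cases x)
 have "(\<Sum>v\<in>verts Q. path_elem (v, []) (u, p)) = (\<Sum>v\<in>verts Q. if v = u then (if p = [] then 1 else 0) else (0 :: 'k))"
  unfolding path_elem_def by (intro sum.cong) auto
 then show "\<one>\<^bsub>A\<^esub> x = (\<Sum>v\<in>verts Q. path_elem (v, [])) x"
  unfolding x sum_fun_apply A_simps using fin_verts by simp
qed

lemma mult_one:
 assumes f: "f \<in> carrier A" shows "\<one>\<^bsub>A\<^esub> \<otimes>\<^bsub>A\<^esub> f = f" "f \<otimes>\<^bsub>A\<^esub> \<one>\<^bsub>A\<^esub> = f"
proof -
 have "(\<one>\<^bsub>A\<^esub> \<otimes>\<^bsub>A\<^esub> f) (u, p) = f (u, p)" for u p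
 proof -
  have "(\<one>\<^bsub>A\<^esub> \<otimes>\<^bsub>A\<^esub> f) (u, p) = (\<Sum>i\<le>length p. if i = length p then (if awlast u p \<in> verts Q then f (u, p) else 0) else 0)"
   unfolding A_simps by (intro sum.cong) auto
  also have "\<dots> = f (u, p)" using carrierD(1)[OF f, of "(u, p)"] awlast_verts[of u p] by auto
  finally show ?thesis .
 qed
 then show "\<one>\<^bsub>A\<^esub> \<otimes>\<^bsub>A\<^esub> f = f" by (intro ext) (metis surj_pair)
 have "(f \<otimes>\<^bsub>A\<^esub> \<one>\<^bsub>A\<^esub>) (u, p) = f (u, p)" for u p
 proof -
  have "(f \<otimes>\<^bsub>A\<^esub> \<one>\<^bsub>A\<^esub>) (u, p) = (\<Sum>i\<le>length p. if i = 0 then (if u \<in> verts Q then f (u, p) else 0) else 0)"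
   unfolding A_simps by (intro sum.cong) auto
  also have "\<dots> = f (u, p)"
   using carrierD(1)[OF f, of "(u, p)"] paths_append[of u "[]" p] paths_Nil[of u] by auto
  finally show ?thesis .
 qed
 then show "f \<otimes>\<^bsub>A\<^esub> \<one>\<^bsub>A\<^esub> = f" by (intro ext) (metis surj_pair)
qed

lemma one_closed: "\<one>\<^bsub>A\<^esub> \<in> carrier A"
proof -
 have "{x. \<one>\<^bsub>A\<^esub> x ~= 0} \<subseteq> (%v. (v, [])) ` verts Q" by (auto simp: A_simps split: if_splits)
 then have "finite {x. \<one>\<^bsub>A\<^esub> x ~= 0}" using fin_verts finite_subset by blast
 then show ?thesis unfolding carrier_A by (auto simp: A_simps paths_Nil)
qed

lemma mult_scale: "(fscale c f) \<otimes>\<^bsub>A\<^esub> g = fscale c (f \<otimes>\<^bsub>A\<^esub> g)" "f \<otimes>\<^bsub>A\<^esub> (fscale c g) = fscale c (f \<otimes>\<^bsub>A\<^esub> g)"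
 by (auto simp: fun_eq_iff A_simps sum_distrib_left mult.assoc mult.left_commute)

lemma mult_add: "(%x. f x + g x) \<otimes>\<^bsub>A\<^esub> h = (%x. (f \<otimes>\<^bsub>A\<^esub> h) x + (g \<otimes>\<^bsub>A\<^esub> h) x)"
 "h \<otimes>\<^bsub>A\<^esub> (%x. f x + g x) = (%x. (h \<otimes>\<^bsub>A\<^esub> f) x + (h \<otimes>\<^bsub>A\<^esub> g) x)"
 by (auto simp: fun_eq_iff A_simps sum.distrib distrib_left distrib_right)

lemma zero_closed: "(%x. 0) \<in> carrier A"
 unfolding carrier_A by simp

lemma ring_A: "ring A"
proof (rule ringI)
 show "abelian_group A"
 proof (rule abelian_groupI)
  fix f assume f: "f \<in> carrier A"
  have "fscale (-1) f \<oplus>\<^bsub>A\<^esub> f = \<zero>\<^bsub>A\<^esub>" unfolding A_simps by simp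
  then show "\<exists>g\<in>carrier A. g \<oplus>\<^bsub>A\<^esub> f = \<zero>\<^bsub>A\<^esub>" using scale_closed[OF f, of "-1"] by blast
 qed (auto simp: A_simps add_closed zero_closed add_ac)
 show "Group.monoid A"
  by unfold_locales (auto simp: mult_closed mult_assoc mult_one one_closed)
qed (auto simp: A_simps(1) mult_add)

sublocale A: ring A by (rule ring_A)

lemma minus_A: "f \<in> carrier A ==> \<ominus>\<^bsub>A\<^esub> f = fscale (-1) f"
proof -
 assume f: "f \<in> carrier A"
 have "fscale (-1) f \<oplus>\<^bsub>A\<^esub> f = \<zero>\<^bsub>A\<^esub>" unfolding A_simps by simp
 then show ?thesis by (rule A.minus_equality[OF _ f scale_closed[OF f]])
qed

definition vanishing :: "('v \<times> 'e list => 'k) set" where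
 "vanishing = {f \<in> carrier A. \<forall>u p. avoids \<rho> p --> f (u, p) = 0}"

lemma ideal_vanishing: "ideal vanishing A"
proof (rule idealI[OF ring_A])
 show "subgroup vanishing (add_monoid A)"
 proof (rule A.add.subgroupI)
  show "vanishing ~= {}" using zero_closed unfolding vanishing_def by blast
  show "\<ominus>\<^bsub>A\<^esub> f \<in> vanishing" if f: "f \<in> vanishing" for f
  proof -
   have fc: "f \<in> carrier A" using f unfolding vanishing_def by blast
   show ?thesis
    unfolding minus_A[OF fc] vanishing_def
   proof (intro CollectI conjI allI impI)
    show "fscale (-1) f \<in> carrier A" by (rule scale_closed[OF fc])
    show "-1 * f (u, p) = 0" if "avoids \<rho> p" for u p using f that unfolding vanishing_def by simp
   qed
  qed
  show "f \<oplus>\<^bsub>A\<^esub> g \<in> vanishing" if "f \<in> vanishing" "g \<in> vanishing" for f g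
   using that add_closed[of f g] unfolding vanishing_def A_simps by simp
 qed (auto simp: vanishing_def)
next
 fix f g assume f: "f \<in> vanishing" and g: "g \<in> carrier A"
 show "g \<otimes>\<^bsub>A\<^esub> f \<in> vanishing" "f \<otimes>\<^bsub>A\<^esub> g \<in> vanishing"
  using f g mult_closed[of f g] mult_closed[of g f] unfolding vanishing_def
  by (auto simp: A_simps avoids_take avoids_drop)
qed

lemma mult_path_elem:
 assumes "(u, q) \<in> paths Q" "(awlast u q, r) \<in> paths Q"
 shows "path_elem (awlast u q, r) \<otimes>\<^bsub>A\<^esub> path_elem (u, q) = path_elem (u, q @ r)"
proof
 fix x :: "'v \<times> 'e list" obtain u' p where x: "x = (u', p)" by (cases x)
 have "(path_elem (awlast u q, r) \<otimes>\<^bsub>A\<^esub> path_elem (u, q)) (u', p) =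
  (\<Sum>i\<le>length p. if i = length q then (if u' = u & p = q @ r then 1 else 0) else (0 :: 'k))"
  unfolding A_simps
 proof (intro sum.cong refl)
  fix i assume i: "i \<in> {..length p}"
  show "path_elem (awlast u q, r) (awlast u' (take i p), drop i p) * path_elem (u, q) (u', take i p) =
   (if i = length q then (if u' = u & p = q @ r then 1 else 0) else (0 :: 'k))"
  proof (cases "u' = u & take i p = q")
   case True
   then have "i = length q" using i by auto
   moreover have "p = q @ r \<longleftrightarrow> drop i p = r" using True append_take_drop_id[of i p] by (metis append_eq_conv_conj)
   ultimately show ?thesis using True unfolding path_elem_def by auto
  next
   case False
   then have l: "path_elem (u, q) (u', take i p) = (0 :: 'k)" unfolding path_elem_def by auto
   have "\<not> (i = length q & u' = u & p = q @ r)" using False by auto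
   then show ?thesis unfolding l by auto
  qed
 qed
 also have "\<dots> = path_elem (u, q @ r) (u', p)" unfolding path_elem_def by auto
 finally show "(path_elem (awlast u q, r) \<otimes>\<^bsub>A\<^esub> path_elem (u, q)) x = path_elem (u, q @ r) x" unfolding x .
qed

lemma two_path_path:
 assumes "(\<beta>, \<gamma>) \<in> \<rho>" shows "(tail Q \<beta>, [\<beta>, \<gamma>]) \<in> paths Q"
proof -
 have "composable Q \<beta> \<gamma>" using assms \<rho> by blast
 then show ?thesis unfolding paths_iff composable_def by (auto simp: awalk_simps)
qed

text \<open>\<open>vanishing\<close> is an ideal containing the relations, which gives one
  inclusion. Conversely, a path containing a relation is a product with that relation in the middle,
  hence lies in \<open>I\<close>, and an element of \<open>vanishing\<close> is a finite combination
  of such paths.\<close>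

lemma I_eq: "I = vanishing"
proof
 let ?S = "(%(\<beta>, \<gamma>). two_path Q \<beta> \<gamma>) ` \<rho> :: ('v \<times> 'e list => 'k) set"
 have S: "?S \<subseteq> carrier A"
  using path_elem_closed two_path_path unfolding two_path_def by auto
 have "?S \<subseteq> vanishing"
  using path_elem_closed two_path_path unfolding two_path_def vanishing_def path_elem_def
  by (auto simp: avoids_def)
 then show "I \<subseteq> vanishing" unfolding I by (rule A.genideal_minimal[OF ideal_vanishing])
 interpret I: ideal I A unfolding I by (rule A.genideal_ideal[OF S])
 have gen: "two_path Q \<beta> \<gamma> \<in> I" if "(\<beta>, \<gamma>) \<in> \<rho>" for \<beta> \<gamma>
  unfolding I using A.genideal_self[OF S] that by auto
 have elem: "path_elem (u, p) \<in> I" if up: "(u, p) \<in> paths Q" and na: "\<not> avoids \<rho> p" for u p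
 proof -
  obtain q \<beta> \<gamma> r where p: "p = q @ [\<beta>, \<gamma>] @ r" "(\<beta>, \<gamma>) \<in> \<rho>" using not_avoids[OF na] by blast
  have 1: "(u, q) \<in> paths Q" "(awlast u q, [\<beta>, \<gamma>]) \<in> paths Q" "(awlast (awlast u q) [\<beta>, \<gamma>], r) \<in> paths Q"
   using up unfolding p paths_append by blast+
  have t: "awlast u q = tail Q \<beta>" using 1(2) unfolding paths_iff by (simp add: awalk_Cons_iff)
  have "path_elem (awlast u q, [\<beta>, \<gamma>]) \<in> I" using gen[OF p(2)] unfolding two_path_def t .
  then have "path_elem (awlast u q, [\<beta>, \<gamma>]) \<otimes>\<^bsub>A\<^esub> path_elem (u, q) \<in> I"
   using I.I_r_closed path_elem_closed[OF 1(1)] by blast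
  then have "path_elem (u, q @ [\<beta>, \<gamma>]) \<in> I" unfolding mult_path_elem[OF 1(1,2)] .
  moreover have 2: "(u, q @ [\<beta>, \<gamma>]) \<in> paths Q" "(awlast u (q @ [\<beta>, \<gamma>]), r) \<in> paths Q"
   using 1 unfolding paths_append awlast_append by blast+
  ultimately have "path_elem (awlast u (q @ [\<beta>, \<gamma>]), r) \<otimes>\<^bsub>A\<^esub> path_elem (u, q @ [\<beta>, \<gamma>]) \<in> I"
   using I.I_l_closed path_elem_closed[OF 2(2)] by blast
  then show ?thesis unfolding mult_path_elem[OF 2] p(1) by simp
 qed
 have "finite X ==> f \<in> vanishing ==> {x. f x ~= 0} \<subseteq> X ==> f \<in> I" for X f
 proof (induction X arbitrary: f rule: finite_induct)
  case empty
  then have "f = (%x. 0)" by auto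
  then show ?case using I.zero_closed unfolding A_simps by simp
 next
  case (insert x X)
  define f0 where "f0 = f(x := 0)"
  have fc: "f \<in> carrier A" using insert.prems unfolding vanishing_def by blast
  have "{y. f0 y ~= 0} \<subseteq> {y. f y ~= 0}" unfolding f0_def by auto
  then have "finite {y. f0 y ~= 0}" by (rule finite_subset[OF _ carrierD(2)[OF fc]])
  then have "f0 \<in> carrier A" unfolding carrier_A using carrierD(1)[OF fc] by (simp add: f0_def)
  then have "f0 \<in> vanishing" using insert.prems(1) unfolding vanishing_def f0_def by simp
  moreover have "{y. f0 y ~= 0} \<subseteq> X" using insert.prems(2) unfolding f0_def by auto
  ultimately have f0: "f0 \<in> I" using insert.IH by blast
  have f: "f = f0 \<oplus>\<^bsub>A\<^esub> fscale (f x) (path_elem x)"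
   unfolding A_simps f0_def path_elem_def by auto
  show ?case
  proof (cases "f x = 0")
   case True then show ?thesis using f0 f unfolding A_simps by simp
  next
   case False
   obtain u p where x: "x = (u, p)" by (cases x)
   have up: "(u, p) \<in> paths Q" "\<not> avoids \<rho> p"
    using False carrierD(1)[OF fc] insert.prems(1) unfolding x vanishing_def by blast+
   have "fscale (f x) (path_elem x) = fscale (f x) \<one>\<^bsub>A\<^esub> \<otimes>\<^bsub>A\<^esub> path_elem x"
    unfolding mult_scale mult_one(1)[OF path_elem_closed[OF up(1)[folded x]]] ..
   moreover have "\<dots> \<in> I" using elem[OF up] unfolding x
    by (intro I.I_l_closed scale_closed one_closed)
   ultimately show ?thesis using f f0 I.a_closed by metis
  qed
 qed
 then show "vanishing \<subseteq> I" using carrierD(2) unfolding vanishing_def by blast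
qed

lemma ideal_I: "ideal I A"
 unfolding I_eq by (rule ideal_vanishing)

text \<open>Evaluation at the path itself shows that the ideal contains no paths of length two
  besides the given ones, so conditions on \<open>I\<close> become conditions on
  \<open>\<rho>\<close>.\<close>

lemma two_path_in_I: "two_path Q \<beta> \<gamma> \<in> I \<longleftrightarrow> (\<beta>, \<gamma>) \<in> \<rho>"
proof
 assume t: "two_path Q \<beta> \<gamma> \<in> I"
 show "(\<beta>, \<gamma>) \<in> \<rho>"
 proof (rule ccontr)
  assume "(\<beta>, \<gamma>) \<notin> \<rho>"
  then have "avoids \<rho> [\<beta>, \<gamma>]" by (simp add: avoids_def)
  then have "two_path Q \<beta> \<gamma> (tail Q \<beta>, [\<beta>, \<gamma>]) = (0 :: 'k)" using t unfolding I_eq vanishing_def by blast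
  then show False by (simp add: two_path_def path_elem_def)
 qed
next
 assume "(\<beta>, \<gamma>) \<in> \<rho>"
 then show "two_path Q \<beta> \<gamma> \<in> I"
  unfolding I_eq vanishing_def using path_elem_closed[OF two_path_path]
  by (auto simp: two_path_def path_elem_def avoids_def)
qed

end

section \<open>The quotient algebra and its basis of paths\<close>

context bound_quiver
begin

interpretation I: ideal I A by (rule ideal_I)

definition R :: "('v \<times> 'e list => 'k) set ring" where "R = A Quot I"

definition proj :: "('v \<times> 'e list => 'k) => ('v \<times> 'e list => 'k) set" where "proj f = I +>\<^bsub>A\<^esub> f"

lemma ring_R: "ring R"
 unfolding R_def by (rule I.quotient_is_ring)

sublocale R: ring R by (rule ring_R)

text \<open>Membership in \<open>I\<close> restricts exactly the values on paths avoiding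
  \<open>\<rho>\<close>, so a coset is determined by these values.\<close>

lemma proj_char: "f \<in> carrier A ==> proj f = {h \<in> carrier A. \<forall>u p. avoids \<rho> p --> h (u, p) = f (u, p)}"
proof (intro equalityI subsetI)
 fix h assume f: "f \<in> carrier A" and "h \<in> proj f"
 then obtain i where "i \<in> I" "h = i \<oplus>\<^bsub>A\<^esub> f" unfolding proj_def a_r_coset_def' by blast
 then have "i \<in> vanishing" "h = i \<oplus>\<^bsub>A\<^esub> f" using I_eq by auto
 then show "h \<in> {h \<in> carrier A. \<forall>u p. avoids \<rho> p --> h (u, p) = f (u, p)}"
  using f add_closed[of i f] unfolding vanishing_def A_simps by simp
next
 fix h assume f: "f \<in> carrier A" and h: "h \<in> {h \<in> carrier A. \<forall>u p. avoids \<rho> p --> h (u, p) = f (u, p)}"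
 define i where "i = (%x. h x + (-1) * f x)"
 have "i \<in> carrier A" unfolding i_def using h by (intro add_closed scale_closed f) simp
 then have "i \<in> I" using h unfolding I_eq vanishing_def by (simp add: i_def)
 moreover have "h = i \<oplus>\<^bsub>A\<^esub> f" unfolding A_simps i_def by simp
 ultimately show "h \<in> proj f" unfolding proj_def a_r_coset_def' by blast
qed

lemma proj_eq: "f \<in> carrier A ==> g \<in> carrier A ==>
  proj f = proj g \<longleftrightarrow> (\<forall>u p. avoids \<rho> p --> f (u, p) = g (u, p))"
proof
 assume fg: "f \<in> carrier A" "g \<in> carrier A" and "proj f = proj g"
 then have "f \<in> proj g" using proj_char[OF fg(1)] by auto
 then show "\<forall>u p. avoids \<rho> p --> f (u, p) = g (u, p)" using proj_char[OF fg(2)] by auto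
qed (auto simp: proj_char)

lemma carrier_R: "r \<in> carrier R \<longleftrightarrow> (\<exists>f\<in>carrier A. r = proj f)"
 unfolding R_def FactRing_def A_RCOSETS_def' proj_def by auto

lemma proj_closed [simp]: "f \<in> carrier A ==> proj f \<in> carrier R"
 unfolding carrier_R by blast

lemma proj_hom:
 assumes "f \<in> carrier A" "g \<in> carrier A"
 shows "proj f \<oplus>\<^bsub>R\<^esub> proj g = proj (%x. f x + g x)" "proj f \<otimes>\<^bsub>R\<^esub> proj g = proj (f \<otimes>\<^bsub>A\<^esub> g)"
 using ring_hom_add[OF I.rcos_ring_hom assms] ring_hom_mult[OF I.rcos_ring_hom assms]
 unfolding R_def proj_def A_simps by simp_all

lemma proj_one: "\<one>\<^bsub>R\<^esub> = proj \<one>\<^bsub>A\<^esub>"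
 unfolding R_def FactRing_def proj_def by simp

lemma proj_zero: "\<zero>\<^bsub>R\<^esub> = proj (%x. 0)"
 using ring_hom_zero[OF I.rcos_ring_hom ring_A I.quotient_is_ring] unfolding R_def proj_def A_simps by simp

text \<open>Coordinates in the path basis; any representative will do, because all members of a
  coset agree on paths avoiding \<open>\<rho>\<close>.\<close>

definition co :: "('v \<times> 'e list => 'k) set => 'v \<times> 'e list => 'k" where
 "co r x = (if avoids \<rho> (snd x) then (SOME f. f \<in> r) x else 0)"

lemma co_proj: "f \<in> carrier A ==> co (proj f) (u, p) = (if avoids \<rho> p then f (u, p) else 0)"
proof -
 assume f: "f \<in> carrier A"
 then have "f \<in> proj f" by (simp add: proj_char)
 then have "(SOME g. g \<in> proj f) \<in> proj f" by (rule someI[of "%g. g \<in> proj f"])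
 then show ?thesis using proj_char[OF f] by (simp add: co_def)
qed

lemma co_inject: "r \<in> carrier R ==> s \<in> carrier R ==> co r = co s ==> r = s"
proof -
 assume "r \<in> carrier R" "s \<in> carrier R" and c: "co r = co s"
 then obtain f g where fg: "f \<in> carrier A" "g \<in> carrier A" "r = proj f" "s = proj g" unfolding carrier_R by blast
 have "f (u, p) = g (u, p)" if "avoids \<rho> p" for u p
  using fun_cong[OF c, of "(u, p)"] that unfolding fg co_proj[OF fg(1)] co_proj[OF fg(2)] by simp
 then show "r = s" unfolding fg(3,4) proj_eq[OF fg(1,2)] by blast
qed

definition \<iota> :: "'k => ('v \<times> 'e list => 'k) set" where "\<iota> c = proj (fscale c \<one>\<^bsub>A\<^esub>)"

definition e :: "'v => ('v \<times> 'e list => 'k) set" where "e v = proj (path_elem (v, []))"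

lemma \<iota>_proj: "f \<in> carrier A ==> \<iota> c \<otimes>\<^bsub>R\<^esub> proj f = proj (fscale c f)"
 unfolding \<iota>_def by (simp add: proj_hom scale_closed one_closed mult_scale mult_one)

sublocale k_algebra R \<iota>
proof unfold_locales
 fix c d :: 'k
 show "\<iota> c \<in> carrier R" unfolding \<iota>_def by (intro proj_closed scale_closed one_closed)
 show "\<iota> (c + d) = \<iota> c \<oplus>\<^bsub>R\<^esub> \<iota> d"
  unfolding \<iota>_def proj_hom(1)[OF scale_closed[OF one_closed] scale_closed[OF one_closed]] distrib_right ..
 show "\<iota> (c * d) = \<iota> c \<otimes>\<^bsub>R\<^esub> \<iota> d"
  unfolding \<iota>_def[of d] \<iota>_proj[OF scale_closed[OF one_closed]] unfolding \<iota>_def by (simp only: mult.assoc)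
 show "\<iota> 1 = \<one>\<^bsub>R\<^esub>" unfolding \<iota>_def proj_one by (simp only: mult_1)
 fix r assume "r \<in> carrier R"
 then obtain f where f: "f \<in> carrier A" "r = proj f" unfolding carrier_R by blast
 have "r \<otimes>\<^bsub>R\<^esub> \<iota> c = proj (fscale c f)"
  unfolding f(2) \<iota>_def proj_hom(2)[OF f(1) scale_closed[OF one_closed]] mult_scale mult_one[OF f(1)] ..
 then show "\<iota> c \<otimes>\<^bsub>R\<^esub> r = r \<otimes>\<^bsub>R\<^esub> \<iota> c" unfolding f(2) using \<iota>_proj[OF f(1)] by simp
qed

lemma co_add: "r \<in> carrier R ==> s \<in> carrier R ==> co (r \<oplus>\<^bsub>R\<^esub> s) x = co r x + co s x"
proof -
 assume "r \<in> carrier R" "s \<in> carrier R"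
 then obtain f g where fg: "f \<in> carrier A" "g \<in> carrier A" "r = proj f" "s = proj g" unfolding carrier_R by blast
 obtain u p where x: "x = (u, p)" by (cases x)
 show ?thesis unfolding x fg(3,4) proj_hom[OF fg(1,2)] co_proj[OF fg(1)] co_proj[OF fg(2)]
  using add_closed[OF fg(1,2)] by (simp add: co_proj)
qed

lemma co_smult: "r \<in> carrier R ==> co (\<iota> c \<otimes>\<^bsub>R\<^esub> r) x = c * co r x"
proof -
 assume "r \<in> carrier R"
 then obtain f where f: "f \<in> carrier A" "r = proj f" unfolding carrier_R by blast
 obtain u p where x: "x = (u, p)" by (cases x)
 show ?thesis unfolding x f(2) \<iota>_proj[OF f(1)] using f(1) scale_closed[OF f(1), of c] by (simp add: co_proj)
qed

abbreviation "Av \<equiv> {(u, p). (u, p) \<in> paths Q & avoids \<rho> p}"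

lemma sum_path_elem:
 assumes f: "f \<in> carrier A" and p: "avoids \<rho> p"
 shows "(\<Sum>x\<in>Av. f x * path_elem x (u, p)) = f (u, p)"
proof -
 have "(\<Sum>x\<in>Av. f x * path_elem x (u, p)) = (\<Sum>x\<in>Av. if x = (u, p) then f (u, p) else 0)"
  by (intro sum.cong) (auto simp: path_elem_def)
 also have "\<dots> = (if (u, p) \<in> Av then f (u, p) else 0)" using fin_avoiding by (simp add: sum.delta')
 also have "\<dots> = f (u, p)" using carrierD(1)[OF f, of "(u, p)"] p by auto
 finally show ?thesis .
qed

lemma sum_scale_closed: "(!!i. i \<in> X ==> g i \<in> carrier A) ==> finite X ==> (%y. \<Sum>i\<in>X. c i * g i y) \<in> carrier A"
proof (induction X rule: infinite_finite_induct)
 case (insert i X)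
 have "(%y. c i * g i y + (\<Sum>i\<in>X. c i * g i y)) \<in> carrier A"
  using insert by (intro add_closed scale_closed) auto
 then show ?case using insert.hyps by simp
qed (auto simp: zero_closed)

lemma finite_dimensional:
 "\<exists>B. finite B & B \<subseteq> carrier A & (\<forall>a\<in>carrier (A Quot I). \<exists>c. a = I +>\<^bsub>A\<^esub> (%x. \<Sum>b\<in>B. c b * b x))"
proof (intro exI[of _ "path_elem ` Av"] conjI ballI)
 have inj: "inj_on (path_elem :: _ => _ => 'k) Av"
 proof (rule inj_onI)
  fix x y :: "'v \<times> 'e list" assume "(path_elem x :: _ => 'k) = path_elem y"
  then have "(path_elem x x :: 'k) = path_elem y x" by simp
  then show "x = y" unfolding path_elem_def by (auto split: if_splits)
 qed
 show "finite (path_elem ` Av :: ('v \<times> 'e list => 'k) set)" using fin_avoiding by blast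
 show sub: "(path_elem ` Av :: ('v \<times> 'e list => 'k) set) \<subseteq> carrier A" using path_elem_closed by auto
 fix a assume "a \<in> carrier (A Quot I)"
 then obtain f where f: "f \<in> carrier A" "a = proj f" unfolding R_def[symmetric] carrier_R by blast
 define c where "c b = f (inv_into Av path_elem b)" for b :: "'v \<times> 'e list => 'k"
 have s: "(\<Sum>b\<in>path_elem ` Av. c b * b x) = (\<Sum>y\<in>Av. f y * path_elem y x)" for x
  unfolding sum.reindex[OF inj] c_def by (intro sum.cong refl) (simp add: inv_into_f_f[OF inj])
 have "(%x. \<Sum>b\<in>path_elem ` Av. c b * b x) \<in> carrier A"
  using sum_scale_closed[of "path_elem ` Av" "%b. b" c] sub fin_avoiding by blast
 then have "proj f = proj (%x. \<Sum>b\<in>path_elem ` Av. c b * b x)"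
  using proj_eq[OF f(1)] sum_path_elem[OF f(1)] unfolding s by auto
 then show "\<exists>c. a = I +>\<^bsub>A\<^esub> (%x. \<Sum>b\<in>path_elem ` Av. c b * b x)" unfolding f(2) proj_def by blast
qed

lemma fdim_R: "fdim (rmod R) (carrier R)"
proof -
 obtain h where h: "bij_betw h {0..<card Av} Av" using ex_bij_betw_nat_finite[OF fin_avoiding] by blast
 let ?x = "%i. proj (path_elem (h i))"
 have hp: "h i \<in> paths Q" if "i < card Av" for i
 proof -
  have "h i \<in> Av" using bij_betwE[OF h] that by simp
  then show ?thesis by (cases "h i") simp
 qed
 have l: "klin (rmod R) ?x m c = proj (%y. \<Sum>i\<in>{0..<m}. c i * path_elem (h i) y)" if "m \<le> card Av" for m c
  using that
 proof (induction m)
  case 0 then show ?case by (simp add: klin_def proj_zero)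
 next
  case (Suc m)
  have "(%y. \<Sum>i\<in>{0..<m}. c i * path_elem (h i) y) \<in> carrier A"
   using Suc.prems hp by (intro sum_scale_closed path_elem_closed) auto
  moreover have "path_elem (h m) \<in> carrier A" using hp[of m] Suc.prems by (intro path_elem_closed) simp
  ultimately show ?case using Suc scale_closed[of "path_elem (h m)" "c m"]
   by (simp add: klin_def \<iota>_proj proj_hom)
 qed
 have "carrier R \<subseteq> range (klin (rmod R) ?x (card Av))"
 proof
  fix r assume "r \<in> carrier R"
  then obtain f where f: "f \<in> carrier A" "r = proj f" unfolding carrier_R by blast
  have s: "(\<Sum>i\<in>{0..<card Av}. f (h i) * path_elem (h i) y) = (\<Sum>x\<in>Av. f x * path_elem x y)" for y
   by (rule sum.reindex_bij_betw[OF h])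
  have "(%y. \<Sum>i\<in>{0..<card Av}. f (h i) * path_elem (h i) y) \<in> carrier A"
   using hp by (intro sum_scale_closed path_elem_closed) auto
  then have "r = klin (rmod R) ?x (card Av) (%i. f (h i))"
   unfolding l[OF order_refl] f(2) using proj_eq[OF f(1)] sum_path_elem[OF f(1)] unfolding s by auto
  then show "r \<in> range (klin (rmod R) ?x (card Av))" by blast
 qed
 moreover have "\<forall>i<card Av. ?x i \<in> carrier (rmod R)" using hp path_elem_closed by simp
 ultimately show ?thesis unfolding fdim_def by (intro exI conjI)
qed

lemma e_closed: "v \<in> verts Q ==> e v \<in> carrier R"
 unfolding e_def by (intro proj_closed path_elem_closed) (simp add: paths_Nil)

lemma e_mult:
 assumes f: "f \<in> carrier A" and v: "v \<in> verts Q"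
 shows "e v \<otimes>\<^bsub>R\<^esub> proj f = proj f \<longleftrightarrow> (\<forall>u p. avoids \<rho> p --> awlast u p ~= v --> f (u, p) = 0)"
  "proj f \<otimes>\<^bsub>R\<^esub> e v = proj f \<longleftrightarrow> (\<forall>u p. avoids \<rho> p --> u ~= v --> f (u, p) = 0)"
proof -
 have pv: "path_elem (v, []) \<in> carrier A" using v by (intro path_elem_closed) (simp add: paths_Nil)
 show "e v \<otimes>\<^bsub>R\<^esub> proj f = proj f \<longleftrightarrow> (\<forall>u p. avoids \<rho> p --> awlast u p ~= v --> f (u, p) = 0)"
  unfolding e_def proj_hom(2)[OF pv f] proj_eq[OF mult_closed[OF pv f] f] mult_path_elem_Nil[OF f] by auto
 show "proj f \<otimes>\<^bsub>R\<^esub> e v = proj f \<longleftrightarrow> (\<forall>u p. avoids \<rho> p --> u ~= v --> f (u, p) = 0)"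
  unfolding e_def proj_hom(2)[OF f pv] proj_eq[OF mult_closed[OF f pv] f] mult_path_elem_Nil[OF f] by auto
qed

lemma e_idem: "v \<in> verts Q ==> e v \<otimes>\<^bsub>R\<^esub> e v = e v"
proof -
 assume v: "v \<in> verts Q"
 then have "path_elem (v, []) \<in> carrier A" by (intro path_elem_closed) (simp add: paths_Nil)
 from e_mult(2)[OF this v] show ?thesis unfolding e_def[symmetric] by (simp add: path_elem_def)
qed

lemma e_nonzero: "v \<in> verts Q ==> e v ~= \<zero>\<^bsub>R\<^esub>"
proof
 assume v: "v \<in> verts Q" and "e v = \<zero>\<^bsub>R\<^esub>"
 then have pv: "path_elem (v, []) \<in> carrier A" by (intro path_elem_closed) (simp add: paths_Nil)
 have av: "avoids \<rho> []" by (simp add: avoids_def)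
 have "\<forall>u p. avoids \<rho> p --> path_elem (v, []) (u, p) = (0 :: 'k)"
  using \<open>e v = \<zero>\<^bsub>R\<^esub>\<close> unfolding e_def proj_zero proj_eq[OF pv zero_closed] .
 from this[rule_format, OF av, of v] show False by (simp add: path_elem_def)
qed

text \<open>In a product the right factor is travelled first, so \<open>e w\<close> on the right
  fixes the start and \<open>e v\<close> on the left fixes the end.\<close>

definition Bs :: "'v => 'v => ('v \<times> 'e list) set" where
 "Bs v w = {(u, p). (u, p) \<in> paths Q & avoids \<rho> p & u = w & awlast u p = v}"

lemma co_bij:
 assumes v: "v \<in> verts Q" and w: "w \<in> verts Q"
 shows "bij_betw co {r \<in> carrier R. e v \<otimes>\<^bsub>R\<^esub> r = r & r \<otimes>\<^bsub>R\<^esub> e w = r} (supp_space (Bs v w))" (is "bij_betw _ ?E _")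
 unfolding bij_betw_def
proof (intro conjI equalityI subsetI)
 show "inj_on co ?E" by (intro inj_onI co_inject) auto
 fix g assume "g \<in> co ` ?E"
 then obtain f where f: "f \<in> carrier A" "g = co (proj f)" "e v \<otimes>\<^bsub>R\<^esub> proj f = proj f" "proj f \<otimes>\<^bsub>R\<^esub> e w = proj f"
  unfolding carrier_R by blast
 have "g (u, p) = 0" if "(u, p) \<notin> Bs v w" for u p
 proof (cases "avoids \<rho> p")
  case True
  have "f (u, p) = 0"
  proof (rule ccontr)
   assume nz: "f (u, p) ~= 0"
   then have "(u, p) \<in> paths Q" using carrierD(1)[OF f(1)] by blast
   moreover have "awlast u p = v" using f(3) nz True unfolding e_mult[OF f(1) v] by blast
   moreover have "u = w" using f(4) nz True unfolding e_mult[OF f(1) w] by blast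
   ultimately show False using that True unfolding Bs_def by blast
  qed
  then show ?thesis unfolding f(2) co_proj[OF f(1)] by simp
 next
  case False then show ?thesis unfolding f(2) co_proj[OF f(1)] by simp
 qed
 then show "g \<in> supp_space (Bs v w)" unfolding supp_space_def by auto
next
 fix g :: "'v \<times> 'e list => 'k" assume "g \<in> supp_space (Bs v w)"
 then have g: "g (u, p) = 0" if "(u, p) \<notin> Bs v w" for u p using that unfolding supp_space_def by blast
 have "{x. g x ~= 0} \<subseteq> Av"
 proof
  fix x assume "x \<in> {x. g x ~= 0}"
  then show "x \<in> Av" using g[of "fst x" "snd x"] unfolding Bs_def by (cases x) auto
 qed
 then have gc: "g \<in> carrier A" unfolding carrier_A using finite_subset[OF _ fin_avoiding] by auto
 have "co (proj g) (u, p) = g (u, p)" for u p using g[of u p] unfolding co_proj[OF gc] Bs_def by auto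
 then have cg: "co (proj g) = g" by (intro ext) (metis surj_pair)
 have "e v \<otimes>\<^bsub>R\<^esub> proj g = proj g" "proj g \<otimes>\<^bsub>R\<^esub> e w = proj g"
  unfolding e_mult[OF gc v] e_mult[OF gc w] by (intro allI impI g; simp add: Bs_def)+
 then have "proj g \<in> ?E" using gc by simp
 then have "co (proj g) \<in> co ` ?E" by (rule imageI)
 then show "g \<in> co ` ?E" unfolding cg .
qed

lemma corner:
 assumes "v \<in> verts Q" "w \<in> verts Q" "r \<in> carrier R"
 shows "co (e v \<otimes>\<^bsub>R\<^esub> (r \<otimes>\<^bsub>R\<^esub> e w)) \<in> supp_space (Bs v w)"
proof -
 note c = e_closed[OF assms(1)] e_closed[OF assms(2)] assms(3)
 have "e v \<otimes>\<^bsub>R\<^esub> (e v \<otimes>\<^bsub>R\<^esub> (r \<otimes>\<^bsub>R\<^esub> e w)) = e v \<otimes>\<^bsub>R\<^esub> (r \<otimes>\<^bsub>R\<^esub> e w)"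
  using c e_idem[OF assms(1)] by (simp add: R.m_assoc[symmetric])
 moreover have "e v \<otimes>\<^bsub>R\<^esub> (r \<otimes>\<^bsub>R\<^esub> e w) \<otimes>\<^bsub>R\<^esub> e w = e v \<otimes>\<^bsub>R\<^esub> (r \<otimes>\<^bsub>R\<^esub> e w)"
  using c e_idem[OF assms(2)] by (simp add: R.m_assoc)
 ultimately show ?thesis using co_bij[OF assms(1,2)] c unfolding bij_betw_def by blast
qed

lemma co_zero: "co \<zero>\<^bsub>R\<^esub> = (%x. 0)"
 by (auto simp: fun_eq_iff proj_zero co_proj[OF zero_closed])

lemma corner_zero:
 assumes "v \<in> verts Q" "w \<in> verts Q" "r \<in> carrier R" "Bs v w = {}"
 shows "e v \<otimes>\<^bsub>R\<^esub> (r \<otimes>\<^bsub>R\<^esub> e w) = \<zero>\<^bsub>R\<^esub>"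
 using corner[OF assms(1-3)] e_closed[OF assms(1)] e_closed[OF assms(2)] assms(3) unfolding assms(4)
 by (intro co_inject) (auto simp: co_zero supp_space_def)

lemma corner_local:
 assumes "v \<in> verts Q" "r \<in> carrier R" "Bs v v = {(v, [])}"
 shows "\<exists>c. e v \<otimes>\<^bsub>R\<^esub> (r \<otimes>\<^bsub>R\<^esub> e v) = \<iota> c \<otimes>\<^bsub>R\<^esub> e v"
proof
 let ?s = "e v \<otimes>\<^bsub>R\<^esub> (r \<otimes>\<^bsub>R\<^esub> e v)"
 have ev: "e v \<in> carrier R" by (rule e_closed[OF assms(1)])
 have pv: "path_elem (v, []) \<in> carrier A" using assms(1) by (intro path_elem_closed) (simp add: paths_Nil)
 show "?s = \<iota> (co ?s (v, [])) \<otimes>\<^bsub>R\<^esub> e v"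
 proof (rule co_inject)
  show "co ?s = co (\<iota> (co ?s (v, [])) \<otimes>\<^bsub>R\<^esub> e v)"
  proof
   fix x :: "'v \<times> 'e list" obtain u p where x: "x = (u, p)" by (cases x)
   have "co (\<iota> (co ?s (v, [])) \<otimes>\<^bsub>R\<^esub> e v) (u, p) = co ?s (v, []) * co (e v) (u, p)"
    by (rule co_smult[OF ev])
   moreover have "co (e v) (u, p) = (if (u, p) = (v, []) then 1 else 0)"
    unfolding e_def co_proj[OF pv] by (auto simp: path_elem_def avoids_def)
   ultimately show "co ?s x = co (\<iota> (co ?s (v, [])) \<otimes>\<^bsub>R\<^esub> e v) x"
    using corner[OF assms(1,1,2)] unfolding x assms(3) supp_space_def by auto
  qed
 qed (use ev assms(2) in auto)
qed

text \<open>Triangularity and locality of the algebra are read off from the sets of paths between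
  vertices, in the numbering \<open>v\<close>.\<close>

lemma coordinates:
 assumes n: "bij_betw v {..<n} (verts Q)"
  and tri: "!!i j. i < j ==> j < n ==> Bs (v i) (v j) = {}"
  and loc: "!!i. i < n ==> Bs (v i) (v i) = {(v i, [])}"
 shows "coordinates R \<iota> n (%i. e (v i)) co (%i j. Bs (v i) (v j))"
proof unfold_locales
 have vi: "v i \<in> verts Q" if "i < n" for i using bij_betwE[OF n] that by auto
 show "fdim (rmod R) (carrier R)" by (rule fdim_R)
 show "e (v i) \<in> carrier R" "e (v i) \<otimes>\<^bsub>R\<^esub> e (v i) = e (v i)" if "i < n" for i
  using e_closed e_idem vi that by auto
 show "e (v i) \<otimes>\<^bsub>R\<^esub> (r \<otimes>\<^bsub>R\<^esub> e (v j)) = \<zero>\<^bsub>R\<^esub>" if "i < j" "j < n" "r \<in> carrier R" for i j r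
  using that by (intro corner_zero vi tri) auto
 show "\<exists>c. e (v i) \<otimes>\<^bsub>R\<^esub> (r \<otimes>\<^bsub>R\<^esub> e (v i)) = \<iota> c \<otimes>\<^bsub>R\<^esub> e (v i)" if "i < n" "r \<in> carrier R" for i r
  using that by (intro corner_local vi loc)
 show "finite (Bs (v i) (v j))" for i j
  by (rule finite_subset[OF _ fin_avoiding]) (auto simp: Bs_def)
 show "co (r \<oplus>\<^bsub>R\<^esub> s) x = co r x + co s x" if "r \<in> carrier R" "s \<in> carrier R" for r s x using that by (rule co_add)
 show "co (\<iota> c \<otimes>\<^bsub>R\<^esub> r) x = c * co r x" if "r \<in> carrier R" for c r x using that by (rule co_smult)
 show "bij_betw co {r \<in> carrier R. e (v i) \<otimes>\<^bsub>R\<^esub> r = r & r \<otimes>\<^bsub>R\<^esub> e (v j) = r} (supp_space (Bs (v i) (v j)))"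
  if "i < n" "j < n" for i j using co_bij vi that by auto
 \<comment> \<open>Partial sums are computed inside the path algebra; the factor 1 brings them into
   the shape of \<open>sum_scale_closed\<close>.\<close>
 have *: "(\<Oplus>\<^bsub>R\<^esub>i\<in>{..<m}. e (v i)) = proj (%x. \<Sum>i<m. 1 * path_elem (v i, []) x)" if "m \<le> n" for m
  using that
 proof (induction m)
  case 0 then show ?case by (simp add: proj_zero)
 next
  case (Suc m)
  have "(\<Oplus>\<^bsub>R\<^esub>i\<in>{..<Suc m}. e (v i)) = e (v m) \<oplus>\<^bsub>R\<^esub> (\<Oplus>\<^bsub>R\<^esub>i\<in>{..<m}. e (v i))"
   unfolding lessThan_Suc using Suc.prems e_closed vi by (intro R.finsum_insert) auto
  also have "\<dots> = proj (%x. path_elem (v m, []) x + (\<Sum>i<m. 1 * path_elem (v i, []) x))"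
   using Suc vi by (simp only: Suc_leD e_def)
    (intro proj_hom(1) path_elem_closed sum_scale_closed; auto simp: paths_Nil)
  finally show ?case by (simp add: add.commute)
 qed
 have "\<one>\<^bsub>A\<^esub> = (%x. \<Sum>i<n. 1 * path_elem (v i, []) x)"
 proof
  fix x
  have "\<one>\<^bsub>A\<^esub> x = (\<Sum>w\<in>verts Q. path_elem (w, []) x)" unfolding one_eq by (rule sum_fun_apply)
  also have "\<dots> = (\<Sum>i<n. path_elem (v i, []) x)" by (rule sum.reindex_bij_betw[OF n, symmetric])
  finally show "\<one>\<^bsub>A\<^esub> x = (\<Sum>i<n. 1 * path_elem (v i, []) x)" by simp
 qed
 then show "(\<Oplus>\<^bsub>R\<^esub>i\<in>{..<n}. e (v i)) = \<one>\<^bsub>R\<^esub>" unfolding *[OF order_refl] proj_one by simp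
qed

end

section \<open>Derived inequivalence\<close>

context sf_pt
begin

lemma shift_pow_point: "(shift ^^ m) (sf_obj R (sf_point R e d)) = sf_obj R (sf_point R e (d - int m))"
proof -
 have "sf_shift R (sf_point R e d') = sf_point R e (d' - 1)" for d'
  unfolding sf_shift_def sf_point_def by simp
 then have "(sf_shift R ^^ m) (sf_point R e d) = sf_point R e (d - int m)"
  by (induction m) (simp_all add: algebra_simps)
 then show ?thesis using p.shift_pow_sf_obj by simp
qed

text \<open>Maps from the projective \<open>R e\<close> in degree \<open>d\<close> to
  \<open>R f\<close> in degree \<open>d'\<close> are elements of the corner \<open>e R f\<close> if
  the degrees agree, and zero otherwise.\<close>

lemma thin_point_point:
 assumes f: "f \<in> carrier R" "f \<otimes> f = f"
  and zero: "d = d' ==> (!!r. r \<in> carrier R ==> e \<otimes> (r \<otimes> f) = \<zero>)"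
 shows "thin (derived_cat R) (sf_obj R (sf_point R e d)) (sf_obj R (sf_point R f d'))"
proof -
 interpret f: sf_pt R f d' using f by unfold_locales
 show ?thesis
 proof (rule thin_pt[OF f.p.bounded_complex_sf_obj])
  fix z assume z: "z \<in> carrier (ct (sf_obj R (sf_point R f d')) d)"
   "e \<odot>\<^bsub>ct (sf_obj R (sf_point R f d')) d\<^esub> z = z"
  then obtain r where r: "r \<in> f.p.P d" "z = enc r" unfolding f.p.sf_obj_carrier by blast
  have "enc (%i. e \<otimes> r i) = enc r"
   using z(2) unfolding r(2) f.p.sf_obj_cterm tr_module_simps[OF inj_enc] by simp
  then have er: "(%i. e \<otimes> r i) = r" by (rule injD[OF inj_enc])
  have "r i = \<zero>" for i
  proof -
   have ri: "r i \<in> carrier R" "r i \<otimes> f = r i" "i = 0 & d = d' \<or> r i = \<zero>"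
    using r(1) unfolding f.pt_carrier by auto
   have "e \<otimes> (r i \<otimes> f) = r i" using fun_cong[OF er, of i] ri(2) by simp
   then show ?thesis using ri(1,3) zero by metis
  qed
  then have "r = (%i. \<zero>)" by blast
  then show "z = \<zero>\<^bsub>ct (sf_obj R (sf_point R f d')) d\<^esub>"
   unfolding r(2) f.p.sf_obj_cterm tr_module_simps[OF inj_enc] by simp
 qed
qed

end

theorem (in coordinates) not_derived_equivalent:
 fixes A :: "'c ring"
 assumes Bs: "!!i j. i < n ==> j < n ==> card (Bs i j) + card (Bs j i) = 2"
  and A: "ring A" and x: "x \<in> carrier A" "x \<otimes>\<^bsub>A\<^esub> x = x" "x ~= \<zero>\<^bsub>A\<^esub>"
  and y: "y \<in> carrier A" "y \<otimes>\<^bsub>A\<^esub> y = y" "y ~= \<zero>\<^bsub>A\<^esub>"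
  and xy: "!!r. r \<in> carrier A ==> x \<otimes>\<^bsub>A\<^esub> (r \<otimes>\<^bsub>A\<^esub> y) = \<zero>\<^bsub>A\<^esub>" "!!r. r \<in> carrier A ==> y \<otimes>\<^bsub>A\<^esub> (r \<otimes>\<^bsub>A\<^esub> x) = \<zero>\<^bsub>A\<^esub>"
 shows "\<not> derived_equivalent A R"
proof
 assume de: "derived_equivalent A R"
 show False
 proof (rule derived_equivalent_thin[OF de])
 fix Fo :: "('c, 'c list set) cochain => ('a, 'a list set) cochain"
 assume Fo: "!!X. X \<in> Obj (derived_cat A) ==> Fo X \<in> Obj (derived_cat R)"
  "!!X Y m n. X \<in> Obj (derived_cat A) ==> Y \<in> Obj (derived_cat A) ==>
   thin (derived_cat A) ((shift ^^ m) X) ((shift ^^ n) Y) \<longleftrightarrow>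
   thin (derived_cat R) ((shift ^^ m) (Fo X)) ((shift ^^ n) (Fo Y))"
 interpret A: ring A by (rule A)
 have pt: "sf_pt A z" if "z \<in> carrier A" "z \<otimes>\<^bsub>A\<^esub> z = z" for z using that by unfold_locales
 \<comment> \<open>The projective left module \<open>A z\<close>, placed in degree 0.\<close>
 let ?P = "%z. sf_obj A (sf_point A z 0)"
 have O: "?P z \<in> Obj (derived_cat A)" if "z \<in> carrier A" "z \<otimes>\<^bsub>A\<^esub> z = z" for z
 proof -
  interpret sf_pt A z 0 by (rule pt[OF that])
  show ?thesis using p.bounded_complex_sf_obj by (simp add: Obj_derived_cat)
 qed
 have thin: "thin (derived_cat A) ((shift ^^ m) (?P z)) ((shift ^^ m') (?P w))"
  if "z \<in> carrier A" "z \<otimes>\<^bsub>A\<^esub> z = z" "w \<in> carrier A" "w \<otimes>\<^bsub>A\<^esub> w = w"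
   "m = m' ==> (!!r. r \<in> carrier A ==> z \<otimes>\<^bsub>A\<^esub> (r \<otimes>\<^bsub>A\<^esub> w) = \<zero>\<^bsub>A\<^esub>)" for z w m m'
  unfolding sf_pt.shift_pow_point[OF pt[OF that(1,2)]] sf_pt.shift_pow_point[OF pt[OF that(3,4)]]
  by (rule sf_pt.thin_point_point[OF pt[OF that(1,2)] that(3,4)]) (use that(5) in auto)
 have not_thin: "\<not> thin (derived_cat A) (?P z) (?P z)" if "z \<in> carrier A" "z \<otimes>\<^bsub>A\<^esub> z = z" "z ~= \<zero>\<^bsub>A\<^esub>" for z
  using sf_pt.not_thin_pt[OF pt[OF that(1,2)] that(3)] .
 let ?X = "Fo (?P x)" and ?Y = "Fo (?P y)"
 note tr = Fo(2)[OF O[OF x(1,2)] O[OF y(1,2)]] Fo(2)[OF O[OF y(1,2)] O[OF x(1,2)]]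
  Fo(2)[OF O[OF x(1,2)] O[OF x(1,2)]] Fo(2)[OF O[OF y(1,2)] O[OF y(1,2)]]
 have XY: "thin (derived_cat R) ((shift ^^ m) ?X) ((shift ^^ m') ?Y)" for m m'
  using thin[OF x(1,2) y(1,2)] xy(1) tr(1) by blast
 have YX: "thin (derived_cat R) ((shift ^^ m) ?Y) ((shift ^^ m') ?X)" for m m'
  using thin[OF y(1,2) x(1,2)] xy(2) tr(2) by blast
 have XX: "thin (derived_cat R) ((shift ^^ m) ?X) ((shift ^^ m') ?X)" if "m ~= m'" for m m'
  using thin[OF x(1,2) x(1,2), of m m'] that tr(3) by blast
 have YY: "thin (derived_cat R) ((shift ^^ m) ?Y) ((shift ^^ m') ?Y)" if "m ~= m'" for m m'
  using thin[OF y(1,2) y(1,2), of m m'] that tr(4) by blast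
 have nX: "\<not> thin (derived_cat R) ?X ?X" using not_thin[OF x] tr(3)[of 0 0] by simp
 have nY: "\<not> thin (derived_cat R) ?Y ?Y" using not_thin[OF y] tr(4)[of 0 0] by simp
 have "bounded_complex R ?X" "bounded_complex R ?Y"
  using Fo(1)[OF O[OF x(1,2)]] Fo(1)[OF O[OF y(1,2)]] by (simp_all add: Obj_derived_cat)
 from no_euler_orthogonal_pair[OF Bs this] show False
  using XY[of _ 0] XY[of 0] YX[of _ 0] YX[of 0] XX[of _ 0] XX[of 0] YY[of _ 0] YY[of 0] nX nY
  by (auto simp: odd_pos)
 qed
qed

section \<open>Gentle algebras whose threads form two loops\<close>

lemma (in pre_digraph) awlast_eq: "awlast u p = (if p = [] then u else head G (last p))"
 by (induction p arbitrary: u) auto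

lemma card_le_1: "(!!x y. x \<in> X ==> y \<in> X ==> x = y) ==> card X \<le> 1"
proof (cases "X = {}")
 case False
 assume eq: "!!x y. x \<in> X ==> y \<in> X ==> x = y"
 obtain x where "x \<in> X" using False by blast
 then have "X = {x}" using eq by blast
 then show ?thesis by simp
qed simp

text \<open>The nonempty consecutive pieces of two lists of length three, written out so that
  statements about them reduce to finitely many cases.\<close>

definition chains :: "'e list => 'e list => 'e list set" where
 "chains p q = {[p ! 0], [p ! 1], [p ! 2], [p ! 0, p ! 1], [p ! 1, p ! 2], [p ! 0, p ! 1, p ! 2],
   [q ! 0], [q ! 1], [q ! 2], [q ! 0, q ! 1], [q ! 1, q ! 2], [q ! 0, q ! 1, q ! 2]}"

definition steps :: "'e list => 'e list => ('e \<times> 'e) set" where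
 "steps p q = {(p ! 0, p ! 1), (p ! 1, p ! 2), (q ! 0, q ! 1), (q ! 1, q ! 2)}"

text \<open>With six distinct entries each entry has at most one successor under
  \<open>steps\<close>, so a sequence of steps stays within one of the two lists. The induction
  prepends an entry to a chain.\<close>

lemma chains_iff:
 assumes d: "distinct [a, b, c, x, y, z]"
 shows "l \<in> chains [a, b, c] [x, y, z] \<longleftrightarrow>
  l ~= [] & set l \<subseteq> {a, b, c, x, y, z} & successively (%\<beta> \<gamma>. (\<beta>, \<gamma>) \<in> steps [a, b, c] [x, y, z]) l"
proof
 assume "l \<in> chains [a, b, c] [x, y, z]"
 then show "l ~= [] & set l \<subseteq> {a, b, c, x, y, z} & successively (%\<beta> \<gamma>. (\<beta>, \<gamma>) \<in> steps [a, b, c] [x, y, z]) l"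
  unfolding chains_def steps_def by auto
next
 assume "l ~= [] & set l \<subseteq> {a, b, c, x, y, z} & successively (%\<beta> \<gamma>. (\<beta>, \<gamma>) \<in> steps [a, b, c] [x, y, z]) l"
 then show "l \<in> chains [a, b, c] [x, y, z]"
 proof (induction l)
  case (Cons w l)
  show ?case
  proof (cases l)
   case Nil then show ?thesis using Cons.prems unfolding chains_def by auto
  next
   case (Cons v r)
   then have l: "l \<in> chains [a, b, c] [x, y, z]" and wv: "(w, hd l) \<in> steps [a, b, c] [x, y, z]"
    using Cons.IH Cons.prems by auto
   have "\<forall>l\<in>chains [a, b, c] [x, y, z]. \<forall>(w, v)\<in>steps [a, b, c] [x, y, z]. v = hd l --> w # l \<in> chains [a, b, c] [x, y, z]"
    using d distinct_rev[of "[a, b, c, x, y, z]"] unfolding chains_def steps_def by simp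
   then show ?thesis using l wv by auto
  qed
 qed simp
qed

lemma maximal_path_chains:
 assumes d: "distinct [a, b, c, x, y, z]" and P: "!!l. P l \<longleftrightarrow> l \<in> chains [a, b, c] [x, y, z]"
 shows "maximal_path P l \<longleftrightarrow> l = [a, b, c] \<or> l = [x, y, z]"
proof
 assume l: "maximal_path P l"
 then have lc: "l \<in> chains [a, b, c] [x, y, z]" and
  m: "!!q r. q @ l @ r \<in> chains [a, b, c] [x, y, z] ==> q = [] & r = []"
  unfolding maximal_path_def P by auto
 have "[a, b, c] \<in> chains [a, b, c] [x, y, z]" "[x, y, z] \<in> chains [a, b, c] [x, y, z]"
  unfolding chains_def by auto
 then have "q @ l @ r ~= [a, b, c] & q @ l @ r ~= [x, y, z]" if "q ~= [] \<or> r ~= []" for q r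
  using m[of q r] that by metis
 \<comment> \<open>The five proper pieces of each list, each with an extension to the full
   list.\<close>
 note n = this[of "[]" "[b, c]"] this[of "[a]" "[c]"] this[of "[a, b]" "[]"] this[of "[]" "[c]"] this[of "[a]" "[]"]
  this[of "[]" "[y, z]"] this[of "[x]" "[z]"] this[of "[x, y]" "[]"] this[of "[]" "[z]"] this[of "[x]" "[]"]
 show "l = [a, b, c] \<or> l = [x, y, z]"
  using lc n unfolding chains_def by auto
next
 assume l: "l = [a, b, c] \<or> l = [x, y, z]"
 have "q = [] & r = []" if "q @ l @ r \<in> chains [a, b, c] [x, y, z]" for q r
 proof -
  have "\<forall>k\<in>chains [a, b, c] [x, y, z]. length k \<le> 3" unfolding chains_def by simp
  then have "length (q @ l @ r) \<le> 3" using that by blast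
  then show ?thesis using l by auto
 qed
 moreover have "l \<in> chains [a, b, c] [x, y, z]" using l unfolding chains_def by auto
 ultimately show "maximal_path P l" unfolding maximal_path_def P by blast
qed

lemma The_pair: "Pr a ==> \<not> Pr b ==> (THE x. x \<in> {a, b} & Pr x) = a" "Pr b ==> \<not> Pr a ==> (THE x. x \<in> {a, b} & Pr x) = b"
 by (rule the_equality; blast)+

section \<open>Quivers with four vertices and six arrows\<close>

definition Ve :: "nat set" where "Ve = {0, 1, 2, 3}"
definition Ar :: "nat set" where "Ar = {0, 1, 2, 3, 4, 5}"

definition quiver :: "nat list => nat list => (nat, nat) pre_digraph" where
 "quiver t h = \<lparr>verts = Ve, arcs = Ar, tail = (!) t, head = (!) h\<rparr>"

lemma finite_Ve_Ar [simp]: "finite Ve" "finite Ar"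
 unfolding Ve_def Ar_def by simp_all

lemma quiver_simps [simp]:
 "verts (quiver t h) = Ve" "arcs (quiver t h) = Ar" "tail (quiver t h) \<alpha> = t ! \<alpha>" "head (quiver t h) \<alpha> = h ! \<alpha>"
 unfolding quiver_def by simp_all

lemma composable_quiver: "composable (quiver t h) \<beta> \<gamma> \<longleftrightarrow> \<beta> \<in> Ar & \<gamma> \<in> Ar & h ! \<beta> = t ! \<gamma>"
 unfolding composable_def by simp

abbreviation "perm_steps \<equiv> steps [0, 1, 2] [3, 4, 5 :: nat]"

definition quiver_ideal :: "nat list => nat list => nat list => nat list => (nat \<times> nat list => 'k::field) set" where
 "quiver_ideal t h p q = Idl\<^bsub>path_algebra (quiver t h)\<^esub> ((%(\<beta>, \<gamma>). two_path (quiver t h) \<beta> \<gamma>) ` steps p q)"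

text \<open>
 The permitted threads are \<open>[0, 1, 2]\<close> and \<open>[3, 4, 5]\<close>, the forbidden threads are \<open>[f0, f1, f2]\<close> and
 \<open>[g0, g1, g2]\<close>; the last conditions make the AG-algorithm pass from the first permitted thread to the
 first forbidden thread and back, and likewise for the second ones.
\<close>

locale thread_quiver =
 fixes t h :: "nat list" and f0 f1 f2 g0 g1 g2 :: nat and s ep :: "int list" and I :: "(nat \<times> nat list => 'k::field) set"
 assumes range: "\<forall>\<alpha>\<in>Ar. t ! \<alpha> \<in> Ve & h ! \<alpha> \<in> Ve"
  and perm: "distinct [f0, f1, f2, g0, g1, g2]" "{f0, f1, f2, g0, g1, g2} = Ar"
  and comp: "\<forall>\<beta>\<in>Ar. \<forall>\<gamma>\<in>Ar. h ! \<beta> = t ! \<gamma> \<longleftrightarrow> (\<beta>, \<gamma>) \<in> perm_steps \<union> steps [f0, f1, f2] [g0, g1, g2]"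
  and disj: "perm_steps \<inter> steps [f0, f1, f2] [g0, g1, g2] = {}"
  and conn: "\<forall>i\<in>{0, 1, 2}. \<exists>\<alpha>\<in>Ar. t ! \<alpha> = i & h ! \<alpha> = Suc i"
  and out: "\<forall>v\<in>Ve. \<exists>\<alpha>\<in>Ar. \<exists>\<beta>\<in>Ar. \<forall>\<gamma>\<in>Ar. t ! \<gamma> = v --> \<gamma> = \<alpha> \<or> \<gamma> = \<beta>"
  and inn: "\<forall>v\<in>Ve. \<exists>\<alpha>\<in>Ar. \<exists>\<beta>\<in>Ar. \<forall>\<gamma>\<in>Ar. h ! \<gamma> = v --> \<gamma> = \<alpha> \<or> \<gamma> = \<beta>"
  and thick: "\<forall>v\<in>Ve. \<exists>\<alpha>\<in>Ar. \<exists>\<beta>\<in>Ar. \<alpha> ~= \<beta> & (t ! \<alpha> = v & t ! \<beta> = v \<or> h ! \<alpha> = v & h ! \<beta> = v)"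
  and signs: "\<forall>\<alpha>\<in>Ar. s ! \<alpha> \<in> {1, -1} & ep ! \<alpha> \<in> {1, -1}"
   "\<forall>\<alpha>\<in>Ar. \<forall>\<beta>\<in>Ar. \<alpha> ~= \<beta> & t ! \<alpha> = t ! \<beta> --> s ! \<alpha> = - s ! \<beta>"
   "\<forall>\<alpha>\<in>Ar. \<forall>\<beta>\<in>Ar. \<alpha> ~= \<beta> & h ! \<alpha> = h ! \<beta> --> ep ! \<alpha> = - ep ! \<beta>"
   "\<forall>(\<beta>, \<gamma>)\<in>perm_steps. s ! \<gamma> = - ep ! \<beta>" "\<forall>(\<beta>, \<gamma>)\<in>steps [f0, f1, f2] [g0, g1, g2]. s ! \<gamma> = ep ! \<beta>"
  and ends: "h ! 2 = h ! f2 & f2 ~= 2" "h ! 5 = h ! g2 & g2 ~= 5" "h ! g2 ~= h ! 2 \<or> g2 = 2" "h ! f2 ~= h ! 5 \<or> f2 = 5"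
  and starts: "t ! 0 = t ! f0 & f0 ~= 0" "t ! 3 = t ! g0 & g0 ~= 3" "t ! 3 ~= t ! f0 \<or> f0 = 3" "t ! 0 ~= t ! g0 \<or> g0 = 0"
  and I: "I = quiver_ideal t h [f0, f1, f2] [g0, g1, g2]"
begin

abbreviation "Q \<equiv> quiver t h"
abbreviation "\<rho> \<equiv> steps [f0, f1, f2] [g0, g1, g2]"

lemma steps_Ar: "(\<beta>, \<gamma>) \<in> perm_steps \<union> \<rho> ==> \<beta> \<in> Ar & \<gamma> \<in> Ar"
proof -
 assume "(\<beta>, \<gamma>) \<in> perm_steps \<union> \<rho>"
 then show ?thesis
 proof
  assume "(\<beta>, \<gamma>) \<in> perm_steps"
  then show ?thesis unfolding steps_def Ar_def by auto
 next
  assume "(\<beta>, \<gamma>) \<in> \<rho>"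
  then show ?thesis unfolding steps_def perm(2)[symmetric] by auto
 qed
qed

lemma composable_iff: "composable Q \<beta> \<gamma> \<longleftrightarrow> (\<beta>, \<gamma>) \<in> perm_steps \<union> \<rho>"
 unfolding composable_quiver using comp steps_Ar by blast

lemma fin_digraph_Q: "fin_digraph Q"
 by unfold_locales (use range in simp_all)

sublocale fin_digraph Q by (rule fin_digraph_Q)

lemma perm_distinct: "distinct [0, 1, 2, 3, 4, 5 :: nat]"
 by simp

lemma chains_perm: "l \<in> chains [0, 1, 2] [3, 4, 5] \<longleftrightarrow>
  l ~= [] & set l \<subseteq> Ar & successively (%\<beta> \<gamma>. (\<beta>, \<gamma>) \<in> perm_steps) l"
 unfolding chains_iff[OF perm_distinct] Ar_def ..

lemma chains_forb: "l \<in> chains [f0, f1, f2] [g0, g1, g2] \<longleftrightarrow>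
  l ~= [] & set l \<subseteq> Ar & successively (%\<beta> \<gamma>. (\<beta>, \<gamma>) \<in> \<rho>) l"
 unfolding chains_iff[OF perm(1)] perm(2) ..

lemma awalk_chain: "awalk u p v ==> avoids \<rho> p ==> p ~= [] ==>
  u = t ! hd p & set p \<subseteq> Ar & successively (%\<beta> \<gamma>. (\<beta>, \<gamma>) \<in> perm_steps) p"
proof (induction p arbitrary: u)
 case (Cons a p)
 have a: "a \<in> Ar" "u = t ! a" "awalk (h ! a) p v" using Cons.prems(1) by (auto simp: awalk_Cons_iff)
 show ?case
 proof (cases p)
  case Nil then show ?thesis using a by simp
 next
  case (Cons b r)
  have "avoids \<rho> p" and ab: "(a, b) \<notin> \<rho>" using Cons.prems(2) Cons unfolding avoids_def by auto
  then have IH: "h ! a = t ! hd p" "set p \<subseteq> Ar" "successively (%\<beta> \<gamma>. (\<beta>, \<gamma>) \<in> perm_steps) p"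
   using Cons.IH[OF a(3)] Cons by auto
  then have "(a, b) \<in> perm_steps" using comp a(1) ab Cons by auto
  then show ?thesis using IH a Cons by simp
 qed
qed simp

lemma chain_awalk: "p ~= [] ==> set p \<subseteq> Ar ==> successively (%\<beta> \<gamma>. (\<beta>, \<gamma>) \<in> perm_steps) p ==>
  awalk (t ! hd p) p (h ! last p) & avoids \<rho> p"
proof (induction p)
 case (Cons a p)
 show ?case
 proof (cases p)
  case Nil then show ?thesis using Cons.prems range by (auto simp: awalk_simps avoids_def)
 next
  case (Cons b r)
  then have ab: "(a, b) \<in> perm_steps" and IH: "awalk (t ! hd p) p (h ! last p)" "avoids \<rho> p"
   using Cons.prems Cons.IH by auto
  have "h ! a = t ! b" using comp Cons.prems(2) ab Cons by auto
  moreover have "(a, b) \<notin> \<rho>" using ab disj by blast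
  ultimately show ?thesis using IH Cons Cons.prems(2) by (auto simp: awalk_Cons_iff avoids_def)
 qed
qed simp

text \<open>By \<open>comp\<close>, two composable arrows form either a permitted step or a
  relation, so a path without relations runs along permitted steps.\<close>

lemma path_avoids_iff: "(u, p) \<in> paths Q & avoids \<rho> p \<longleftrightarrow>
  p = [] & u \<in> Ve \<or> p \<in> chains [0, 1, 2] [3, 4, 5] & u = t ! hd p"
proof (cases "p = []")
 case True
 then show ?thesis by (auto simp: paths_def awalk_Nil_iff avoids_def chains_def)
next
 case False
 then show ?thesis unfolding chains_perm paths_def using awalk_chain chain_awalk by blast
qed

sublocale b: bound_quiver Q \<rho> I
proof unfold_locales
 show "\<rho> \<subseteq> {(\<beta>, \<gamma>). composable Q \<beta> \<gamma>}" using composable_iff by blast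
 show "I = Idl\<^bsub>path_algebra Q\<^esub> ((%(\<beta>, \<gamma>). two_path Q \<beta> \<gamma>) ` \<rho>)" unfolding I quiver_ideal_def ..
 have "{(u, p). (u, p) \<in> paths Q & avoids \<rho> p} \<subseteq>
  (%u. (u, [])) ` Ve \<union> (%p. (t ! hd p, p)) ` chains [0, 1, 2] [3, 4, 5]"
  unfolding path_avoids_iff by auto
 moreover have "finite (chains [0, 1, 2] [3, 4, 5 :: nat])" "finite Ve" unfolding chains_def Ve_def by simp_all
 ultimately show "finite {(u, p). (u, p) \<in> paths Q & avoids \<rho> p}" by (meson finite_UnI finite_imageI finite_subset)
qed auto

lemma connected_Q: "connected Q"
proof -
 let ?G = "with_proj (mk_symmetric Q)"
 interpret G: pair_wf_digraph "mk_symmetric Q" by (rule wellformed_mk_symmetric)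
 have adj: "(i, Suc i) \<in> parcs (mk_symmetric Q)" "(Suc i, i) \<in> parcs (mk_symmetric Q)" if "i \<in> {0, 1, 2}" for i
 proof -
  obtain \<alpha> where "\<alpha> \<in> Ar" "t ! \<alpha> = i" "h ! \<alpha> = Suc i" using conn \<open>i \<in> {0, 1, 2}\<close> by blast
  then show "(i, Suc i) \<in> parcs (mk_symmetric Q)" "(Suc i, i) \<in> parcs (mk_symmetric Q)"
   by (auto simp: parcs_mk_symmetric intro!: bexI[of _ \<alpha>])
 qed
 have r: "u \<rightarrow>\<^sup>*\<^bsub>?G\<^esub> v" if "(u, v) \<in> parcs (mk_symmetric Q)" for u v using G.reachable_adjI[OF that] .
 have 1: "0 \<rightarrow>\<^sup>*\<^bsub>?G\<^esub> v & v \<rightarrow>\<^sup>*\<^bsub>?G\<^esub> 0" if "v \<in> Ve" for v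
 proof -
  have z: "0 \<rightarrow>\<^sup>*\<^bsub>?G\<^esub> (0 :: nat)" by (rule G.reachable_refl) (simp add: Ve_def)
  have s1: "0 \<rightarrow>\<^sup>*\<^bsub>?G\<^esub> 1" "1 \<rightarrow>\<^sup>*\<^bsub>?G\<^esub> 0" using r[OF adj(1)[of 0]] r[OF adj(2)[of 0]] by simp_all
  have s2: "1 \<rightarrow>\<^sup>*\<^bsub>?G\<^esub> 2" "2 \<rightarrow>\<^sup>*\<^bsub>?G\<^esub> 1" using r[OF adj(1)[of 1]] r[OF adj(2)[of 1]] by (simp_all add: numeral_2_eq_2)
  have s3: "2 \<rightarrow>\<^sup>*\<^bsub>?G\<^esub> 3" "3 \<rightarrow>\<^sup>*\<^bsub>?G\<^esub> 2" using r[OF adj(1)[of 2]] r[OF adj(2)[of 2]] by (simp_all add: numeral_3_eq_3 numeral_2_eq_2)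
  show ?thesis
   using that z s1 G.reachable_trans[OF s1(1) s2(1)] G.reachable_trans[OF s2(2) s1(2)]
    G.reachable_trans[OF G.reachable_trans[OF s1(1) s2(1)] s3(1)]
    G.reachable_trans[OF s3(2) G.reachable_trans[OF s2(2) s1(2)]] unfolding Ve_def by auto
 qed
 show ?thesis
  unfolding connected_def strongly_connected_def
 proof (intro conjI ballI)
  show "verts ?G ~= {}" by (auto simp: Ve_def)
  fix u v assume "u \<in> verts ?G" "v \<in> verts ?G"
  then show "u \<rightarrow>\<^sup>*\<^bsub>?G\<^esub> v" using 1[of u] 1[of v] G.reachable_trans[of u 0 v] by simp
 qed
qed

lemma two_path_in: "two_path Q \<beta> \<gamma> \<in> I \<longleftrightarrow> (\<beta>, \<gamma>) \<in> \<rho>"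
 by (rule b.two_path_in_I)

lemma not_in: "composable Q \<beta> \<gamma> & two_path Q \<beta> \<gamma> \<notin> I \<longleftrightarrow> (\<beta>, \<gamma>) \<in> perm_steps"
 "composable Q \<beta> \<gamma> & two_path Q \<beta> \<gamma> \<in> I \<longleftrightarrow> (\<beta>, \<gamma>) \<in> \<rho>"
 unfolding composable_iff two_path_in using disj by blast+

text \<open>Permitted and forbidden continuations are unique because both step relations come from
  lists of distinct arrows.\<close>

lemma gentle_Q: "gentle Q I"
 unfolding gentle_def
proof (intro conjI ballI)
 show "fin_digraph Q" by (rule fin_digraph_Q)
 show "connected Q" by (rule connected_Q)
 show "\<exists>\<rho>\<subseteq>{(\<beta>, \<gamma>). composable Q \<beta> \<gamma>}. I = Idl\<^bsub>path_algebra Q\<^esub> ((%(\<beta>, \<gamma>). two_path Q \<beta> \<gamma>) ` \<rho>)"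
  by (rule exI[of _ \<rho>]) (intro conjI b.\<rho> b.I)
 show "\<exists>B. finite B & B \<subseteq> carrier (path_algebra Q) & (\<forall>a\<in>carrier (path_algebra Q Quot I).
   \<exists>c. a = I +>\<^bsub>path_algebra Q\<^esub> (%x. \<Sum>b\<in>B. c b * b x))" by (rule b.finite_dimensional)
 have le2: "card X \<le> 2" if "X \<subseteq> {a, b}" for X :: "nat set" and a b
 proof -
  have "card X \<le> card {a, b}" using that by (intro card_mono) auto
  also have "\<dots> \<le> 2" by (simp add: card_insert_if)
  finally show ?thesis .
 qed
 fix v assume v: "v \<in> verts Q"
 obtain a b where "\<forall>\<gamma>\<in>Ar. t ! \<gamma> = v --> \<gamma> = a \<or> \<gamma> = b" using out v by auto
 then show "card {\<alpha> \<in> arcs Q. tail Q \<alpha> = v} \<le> 2" by (intro le2[of _ a b]) auto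
 obtain a b where "\<forall>\<gamma>\<in>Ar. h ! \<gamma> = v --> \<gamma> = a \<or> \<gamma> = b" using inn v by auto
 then show "card {\<alpha> \<in> arcs Q. head Q \<alpha> = v} \<le> 2" by (intro le2[of _ a b]) auto
next
 fix \<beta>
 have *: "card {\<gamma>. (\<beta>, \<gamma>) \<in> steps [a, b, c] [x, y, z]} \<le> 1 & card {\<gamma>. (\<gamma>, \<beta>) \<in> steps [a, b, c] [x, y, z]} \<le> 1"
  if "distinct [a, b, c, x, y, z]" for a b c x y z :: nat
 proof
  show "card {\<gamma>. (\<beta>, \<gamma>) \<in> steps [a, b, c] [x, y, z]} \<le> 1"
  proof (rule card_le_1)
   fix v w assume "v \<in> {\<gamma>. (\<beta>, \<gamma>) \<in> steps [a, b, c] [x, y, z]}" "w \<in> {\<gamma>. (\<beta>, \<gamma>) \<in> steps [a, b, c] [x, y, z]}"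
   then show "v = w" using that unfolding steps_def by auto
  qed
  show "card {\<gamma>. (\<gamma>, \<beta>) \<in> steps [a, b, c] [x, y, z]} \<le> 1"
  proof (rule card_le_1)
   fix v w assume "v \<in> {\<gamma>. (\<gamma>, \<beta>) \<in> steps [a, b, c] [x, y, z]}" "w \<in> {\<gamma>. (\<gamma>, \<beta>) \<in> steps [a, b, c] [x, y, z]}"
   then show "v = w" using that unfolding steps_def by auto
  qed
 qed
 show "card {\<gamma>. composable Q \<beta> \<gamma> & two_path Q \<beta> \<gamma> \<notin> I} \<le> 1"
  unfolding not_in by (rule conjunct1[OF *[OF perm_distinct]])
 show "card {\<gamma>. composable Q \<beta> \<gamma> & two_path Q \<beta> \<gamma> \<in> I} \<le> 1"
  unfolding not_in by (rule conjunct1[OF *[OF perm(1)]])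
 show "card {\<gamma>. composable Q \<gamma> \<beta> & two_path Q \<gamma> \<beta> \<notin> I} \<le> 1"
  unfolding not_in by (rule conjunct2[OF *[OF perm_distinct]])
 show "card {\<gamma>. composable Q \<gamma> \<beta> & two_path Q \<gamma> \<beta> \<in> I} \<le> 1"
  unfolding not_in by (rule conjunct2[OF *[OF perm(1)]])
qed

lemma arrow_path_iff: "arrow_path Q l & (\<forall>i. Suc i < length l --> X (l ! i) (l ! Suc i)) \<longleftrightarrow>
  l ~= [] & set l \<subseteq> Ar & successively (%\<beta> \<gamma>. composable Q \<beta> \<gamma> & X \<beta> \<gamma>) l"
 unfolding arrow_path_def successively_conv_nth by auto

lemma permitted_path_iff: "permitted_path Q I l \<longleftrightarrow> l \<in> chains [0, 1, 2] [3, 4, 5]"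
 using arrow_path_iff[of l "%\<beta> \<gamma>. two_path Q \<beta> \<gamma> \<notin> I"]
 unfolding permitted_path_def not_in chains_perm by (rule HOL.trans[OF _ refl])

lemma forbidden_path_iff: "forbidden_path Q I l \<longleftrightarrow> l \<in> chains [f0, f1, f2] [g0, g1, g2]"
proof -
 have "distinct l" if "l \<in> chains [f0, f1, f2] [g0, g1, g2]" using that perm(1) unfolding chains_def by auto
 moreover have "arrow_path Q l & (\<forall>i. Suc i < length l --> two_path Q (l ! i) (l ! Suc i) \<in> I) \<longleftrightarrow>
   l \<in> chains [f0, f1, f2] [g0, g1, g2]"
  using arrow_path_iff[of l "%\<beta> \<gamma>. two_path Q \<beta> \<gamma> \<in> I"]
  unfolding not_in chains_forb by (rule HOL.trans[OF _ refl])
 ultimately show ?thesis unfolding forbidden_path_def by blast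
qed

text \<open>\<open>steps\<close> never leads from the last entry of a chain back to its first, so no
  pairs \<open>(0, m)\<close> are recorded for cycles.\<close>

lemma no_forbidden_cycle: "\<not> forbidden_cycle Q I l"
proof -
 have "\<forall>l\<in>chains [f0, f1, f2] [g0, g1, g2]. (last l, hd l) \<notin> \<rho>"
  using perm(1) distinct_rev[of "[f0, f1, f2, g0, g1, g2]"] unfolding chains_def steps_def by simp
 then show ?thesis unfolding forbidden_cycle_def forbidden_path_iff not_in by blast
qed

text \<open>\<open>thick\<close> puts two arrows with a common tail or a common head at each vertex,
  which excludes trivial threads.\<close>

lemma no_thin_vertex: "\<not> thin_vertex Q v"
proof
 assume v: "thin_vertex Q v"
 then have vV: "v \<in> Ve" and c: "card {\<alpha> \<in> Ar. t ! \<alpha> = v} \<le> 1" "card {\<alpha> \<in> Ar. h ! \<alpha> = v} \<le> 1"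
  unfolding thin_vertex_def by auto
 have fin: "finite Ar" by (simp add: Ar_def)
 obtain a b where ab: "a \<in> Ar" "b \<in> Ar" "a ~= b" "t ! a = v & t ! b = v \<or> h ! a = v & h ! b = v"
  using thick vV by blast
 have "a = b"
  using ab(4)
 proof
  assume "t ! a = v & t ! b = v"
  then show ?thesis using c(1) ab(1,2) fin by (auto simp: card_le_Suc0_iff_eq)
 next
  assume "h ! a = v & h ! b = v"
  then show ?thesis using c(2) ab(1,2) fin by (auto simp: card_le_Suc0_iff_eq)
 qed
 then show False using ab(3) by blast
qed

abbreviation "H1 \<equiv> Nontriv [0, 1, 2] :: (nat, nat) thread"
abbreviation "H2 \<equiv> Nontriv [3, 4, 5] :: (nat, nat) thread"
abbreviation "P1 \<equiv> Nontriv [f0, f1, f2] :: (nat, nat) thread"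
abbreviation "P2 \<equiv> Nontriv [g0, g1, g2] :: (nat, nat) thread"

lemma permitted_threads_Q: "permitted_threads Q I = {H1, H2}"
 unfolding permitted_threads_def maximal_path_chains[OF perm_distinct permitted_path_iff] using no_thin_vertex by auto

lemma forbidden_threads_Q: "forbidden_threads Q I = {P1, P2}"
 unfolding forbidden_threads_def maximal_path_chains[OF perm(1) forbidden_path_iff]
 using no_thin_vertex no_forbidden_cycle by auto

lemma Ar_mem: "0 \<in> Ar" "2 \<in> Ar" "3 \<in> Ar" "5 \<in> Ar" "f0 \<in> Ar" "f2 \<in> Ar" "g0 \<in> Ar" "g2 \<in> Ar"
proof -
 show "0 \<in> Ar" "2 \<in> Ar" "3 \<in> Ar" "5 \<in> Ar" by (auto simp: Ar_def)
 show "f0 \<in> Ar" "f2 \<in> Ar" "g0 \<in> Ar" "g2 \<in> Ar" unfolding perm(2)[symmetric] by simp_all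
qed

text \<open>Each permitted thread returns to itself after one passage through a forbidden thread of
  length 3, so both record \<open>(1, 3)\<close>. The signs are arbitrary here because the invariant
  picks them with \<open>SOME\<close>.\<close>

lemma AG_count_Q:
 assumes sg: "sign_functions Q I \<sigma> \<epsilon>"
 shows "AG_count Q \<sigma> \<epsilon> I = (%x. if x = (1, 3) then 2 else 0)"
proof -
 note sg' = sg[unfolded sign_functions_def quiver_simps]
 have pm: "\<sigma> \<alpha> ~= - \<sigma> \<alpha> & \<epsilon> \<alpha> ~= - \<epsilon> \<alpha>" if "\<alpha> \<in> Ar" for \<alpha>
  using bspec[OF sg'[THEN conjunct1] that] by auto
 have \<sigma>: "\<sigma> \<alpha> = - \<sigma> \<beta>" if "\<alpha> \<in> Ar" "\<beta> \<in> Ar" "\<alpha> ~= \<beta>" "t ! \<alpha> = t ! \<beta>" for \<alpha> \<beta>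
  using sg'[THEN conjunct2, THEN conjunct1] that by blast
 have \<epsilon>: "\<epsilon> \<alpha> = - \<epsilon> \<beta>" if "\<alpha> \<in> Ar" "\<beta> \<in> Ar" "\<alpha> ~= \<beta>" "h ! \<alpha> = h ! \<beta>" for \<alpha> \<beta>
  using sg'[THEN conjunct2, THEN conjunct2, THEN conjunct1] that by blast
 \<comment> \<open>When the other forbidden thread ends at the same vertex, \<open>ends\<close>
   makes its last arrow that of the permitted thread; its sign is then the wrong one, and
   \<open>THE\<close> picks the intended thread.\<close>
 have e: "\<epsilon> f2 = - \<epsilon> 2" "\<epsilon> g2 = - \<epsilon> 5" "h ! g2 = h ! 2 ==> \<epsilon> g2 ~= - \<epsilon> 2" "h ! f2 = h ! 5 ==> \<epsilon> f2 ~= - \<epsilon> 5"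
  using ends \<epsilon>[of f2 2] \<epsilon>[of g2 5] pm[of 2] pm[of 5] Ar_mem by metis+
 have s: "\<sigma> 0 = - \<sigma> f0" "\<sigma> 3 = - \<sigma> g0" "t ! 3 = t ! f0 ==> \<sigma> 3 ~= - \<sigma> f0" "t ! 0 = t ! g0 ==> \<sigma> 0 ~= - \<sigma> g0"
  using starts \<sigma>[of 0 f0] \<sigma>[of 3 g0] pm[of f0] pm[of g0] Ar_mem by metis+
 have F1: "AG_forbidden Q \<sigma> \<epsilon> I H1 = P1"
  unfolding AG_forbidden_def forbidden_threads_Q by (rule The_pair(1)) (use e(1,3) ends(1) in auto)
 have F2: "AG_forbidden Q \<sigma> \<epsilon> I H2 = P2"
  unfolding AG_forbidden_def forbidden_threads_Q by (rule The_pair(2)) (use e(2,4) ends(2) in auto)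
 have N1: "AG_next Q \<sigma> \<epsilon> I H1 = H1"
  unfolding AG_next_def permitted_threads_Q F1 by (rule The_pair(1)) (use s(1,3) starts(1) in auto)
 have N2: "AG_next Q \<sigma> \<epsilon> I H2 = H2"
  unfolding AG_next_def permitted_threads_Q F2 by (rule The_pair(2)) (use s(2,4) starts(2) in auto)
 have steps: "AG_steps Q \<sigma> \<epsilon> I H = 1" if "AG_next Q \<sigma> \<epsilon> I H = H" for H
  unfolding AG_steps_def by (rule Least_equality) (use that in auto)
 have pair: "AG_pair Q \<sigma> \<epsilon> I H1 = (1, 3)" "AG_pair Q \<sigma> \<epsilon> I H2 = (1, 3)"
  unfolding AG_pair_def steps[OF N1] steps[OF N2] by (simp_all add: F1[simplified] F2)
 have orbit: "AG_orbit Q \<sigma> \<epsilon> I H1 = {H1}" "AG_orbit Q \<sigma> \<epsilon> I H2 = {H2}"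
  unfolding AG_orbit_def steps[OF N1] steps[OF N2] by auto
 have "{AG_orbit Q \<sigma> \<epsilon> I H | H. H \<in> permitted_threads Q I & AG_pair Q \<sigma> \<epsilon> I H = x} =
  (if x = (1, 3) then {{H1}, {H2}} else {})" for x
  unfolding permitted_threads_Q using pair orbit by auto
 then show ?thesis unfolding AG_count_def using no_forbidden_cycle by (auto simp: fun_eq_iff)
qed

text \<open>Guarantees that the \<open>SOME\<close> in \<open>AG_invariant\<close> yields sign
  functions.\<close>

lemma sign_functions_exist: "sign_functions Q I ((!) s) ((!) ep)"
 unfolding sign_functions_def
proof (intro conjI)
 show "\<forall>\<beta> \<gamma>. composable Q \<beta> \<gamma> -->
   (if two_path Q \<beta> \<gamma> \<notin> I then s ! \<gamma> = - ep ! \<beta> else s ! \<gamma> = ep ! \<beta>)"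
 proof (intro allI impI)
  fix \<beta> \<gamma> assume c: "composable Q \<beta> \<gamma>"
  show "if two_path Q \<beta> \<gamma> \<notin> I then s ! \<gamma> = - ep ! \<beta> else s ! \<gamma> = ep ! \<beta>"
  proof (cases "(\<beta>, \<gamma>) \<in> \<rho>")
   case True
   then have "s ! \<gamma> = ep ! \<beta>" using signs(5) by blast
   then show ?thesis using True by (simp add: two_path_in)
  next
   case False
   then have "(\<beta>, \<gamma>) \<in> perm_steps" using c unfolding composable_iff by blast
   then have "s ! \<gamma> = - ep ! \<beta>" using signs(4) by blast
   then show ?thesis using False by (simp add: two_path_in)
  qed
 qed
 show "\<forall>\<alpha>\<in>arcs Q. s ! \<alpha> \<in> {1, - 1} & ep ! \<alpha> \<in> {1, - 1}" unfolding quiver_simps by (rule signs(1))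
 show "\<forall>\<alpha>\<in>arcs Q. \<forall>\<beta>\<in>arcs Q. \<alpha> ~= \<beta> & tail Q \<alpha> = tail Q \<beta> --> s ! \<alpha> = - s ! \<beta>"
  unfolding quiver_simps by (rule signs(2))
 show "\<forall>\<alpha>\<in>arcs Q. \<forall>\<beta>\<in>arcs Q. \<alpha> ~= \<beta> & head Q \<alpha> = head Q \<beta> --> ep ! \<alpha> = - ep ! \<beta>"
  unfolding quiver_simps by (rule signs(3))
qed

lemma AG_invariant_Q: "AG_invariant Q I = (%x. if x = (1, 3) then 2 else 0)"
proof -
 define p where "p = (SOME (\<sigma>, \<epsilon>). sign_functions Q I \<sigma> \<epsilon>)"
 obtain \<sigma> \<epsilon> where se: "p = (\<sigma>, \<epsilon>)" by (cases p)
 have "case p of (\<sigma>, \<epsilon>) => sign_functions Q I \<sigma> \<epsilon>"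
  unfolding p_def by (rule someI[of _ "((!) s, (!) ep)"]) (simp add: sign_functions_exist)
 then show ?thesis
  unfolding AG_invariant_def p_def[symmetric] se Let_def prod.case using AG_count_Q se by simp
qed

text \<open>The thirteen candidates are the trivial path and the twelve permitted chains; as a list
  they allow paths to be counted by evaluation.\<close>

definition path_list :: "nat => nat => nat list list" where
 "path_list v w = filter (%p. if p = [] then v = w else w = t ! hd p & v = h ! last p)
  [[], [0], [1], [2], [0, 1], [1, 2], [0, 1, 2], [3], [4], [5], [3, 4], [4, 5], [3, 4, 5]]"

lemma Bs_eq:
 assumes w: "w \<in> Ve" shows "b.Bs v w = Pair w ` set (path_list v w)"
proof (rule Set.set_eqI)
 fix x :: "nat \<times> nat list"
 obtain u p where x: "x = (u, p)" by (cases x)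
 have ne: "p ~= []" if "p \<in> chains [0, 1, 2] [3, 4, 5]" using that unfolding chains_perm by blast
 have "(u, p) \<in> b.Bs v w \<longleftrightarrow> ((u, p) \<in> paths Q & avoids \<rho> p) & u = w & awlast u p = v"
  unfolding b.Bs_def by blast
 also have "\<dots> \<longleftrightarrow> u = w & (p = [] & v = w \<or> p \<in> chains [0, 1, 2] [3, 4, 5] & w = t ! hd p & v = h ! last p)"
  unfolding path_avoids_iff awlast_eq quiver_simps by (cases "p = []") (use w ne in auto)
 also have "p = [] & v = w \<or> p \<in> chains [0, 1, 2] [3, 4, 5] & w = t ! hd p & v = h ! last p \<longleftrightarrow> p \<in> set (path_list v w)"
 proof (cases "p = []")
  case True then show ?thesis using ne unfolding path_list_def set_filter by auto
 next
  case False
  have "set [[], [0], [1], [2], [0, 1], [1, 2], [0, 1, 2], [3], [4], [5], [3, 4], [4, 5], [3, 4, 5]] =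
   insert [] (chains [0, 1, 2] [3, 4, 5 :: nat])" unfolding chains_def by simp
  then show ?thesis using False unfolding path_list_def set_filter by auto
 qed
 finally show "x \<in> b.Bs v w \<longleftrightarrow> x \<in> Pair w ` set (path_list v w)" unfolding x by auto
qed

lemma card_Bs: "w \<in> Ve ==> card (b.Bs v w) = length (path_list v w)"
proof -
 assume "w \<in> Ve"
 then have "card (b.Bs v w) = card (set (path_list v w))" by (simp add: Bs_eq card_image inj_on_def)
 also have "\<dots> = length (path_list v w)" unfolding path_list_def by (intro distinct_card distinct_filter) simp
 finally show ?thesis .
qed

end

theorem corollary3p13:
  shows "\<exists>(Q :: (nat, nat) pre_digraph) (I :: (nat \<times> nat list \<Rightarrow> 'k::field) set)
          (Q' :: (nat, nat) pre_digraph) (I' :: (nat \<times> nat list \<Rightarrow> 'k) set).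
    gentle Q I \<and> gentle Q' I' \<and> arcs Q \<noteq> {} \<and> arcs Q' \<noteq> {} \<and>
    AG_invariant Q I = AG_invariant Q' I' \<and>
    \<not> derived_equivalent (path_algebra Q Quot I) (path_algebra Q' Quot I')"
proof -
 \<comment> \<open>First quiver: arrows 0 and 1 form a 2-cycle between vertices 0 and 1, arrows 4
   and 5 one between 2 and 3, and arrow 2 from 0 to 3 and arrow 3 from 1 to 2 connect them. The
   permitted threads visit 0, 1, 0, 3 and 1, 2, 3, 2; the forbidden ones visit 0, 3, 2, 3 and 1, 0,
   1, 2.\<close>
 interpret A: thread_quiver "[0, 1, 0, 1, 2, 3]" "[1, 0, 3, 2, 3, 2]" 2 5 4 1 0 3
  "[1, 1, -1, -1, -1, 1]" "[-1, 1, 1, 1, -1, -1]"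
  "quiver_ideal [0, 1, 0, 1, 2, 3] [1, 0, 3, 2, 3, 2] [2, 5, 4] [1, 0, 3] :: (nat \<times> nat list => 'k) set"
  by unfold_locales (simp_all add: Ve_def Ar_def steps_def insert_commute)
 \<comment> \<open>Second quiver: two arrows from each of the vertices 0, 1, 2 to the next. The
   permitted threads are two parallel strands from 0 to 3, and the relations are the compositions
   that switch strands.\<close>
 interpret B: thread_quiver "[0, 1, 2, 0, 1, 2]" "[1, 2, 3, 1, 2, 3]" 3 1 5 0 4 2
  "[1, 1, 1, -1, -1, -1]" "[-1, -1, 1, 1, 1, -1]"
  "quiver_ideal [0, 1, 2, 0, 1, 2] [1, 2, 3, 1, 2, 3] [3, 1, 5] [0, 4, 2] :: (nat \<times> nat list => 'k) set"
  by unfold_locales (simp_all add: Ve_def Ar_def steps_def insert_commute)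
 have Ve: "i \<in> Ve" if "i < 4" for i using that unfolding Ve_def by auto
 have bij: "bij_betw (%i. i) {..<4} (verts B.Q)"
  unfolding quiver_simps Ve_def by (rule bij_betw_imageI) auto
 \<comment> \<open>In the second algebra a vertex reaches each later vertex by exactly two permitted
   paths, one on each strand, reaches no earlier vertex, and reaches itself by the trivial path
   only. The sum is 2 + 0 off the diagonal and 1 + 1 on it.\<close>
 have "\<forall>i\<in>Ve. \<forall>j\<in>Ve. (i < j --> B.path_list i j = []) & (i = j --> B.path_list i j = [[]]) &
   length (B.path_list i j) + length (B.path_list j i) = 2"
  unfolding Ve_def B.path_list_def by simp
 note list = this[rule_format]
 have tri: "B.b.Bs i j = {}" if "i < j" "j < 4" for i j
  using B.Bs_eq[OF Ve[OF that(2)], of i] list[of i j] Ve that by simp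
 have loc: "B.b.Bs i i = {(i, [])}" if "i < 4" for i
  using B.Bs_eq[OF Ve[OF that], of i] list[of i i] Ve[OF that] by simp
 have card: "card (B.b.Bs i j) + card (B.b.Bs j i) = 2" if "i < 4" "j < 4" for i j
  unfolding B.card_Bs[OF Ve[OF that(1)]] B.card_Bs[OF Ve[OF that(2)]] using list[of i j] Ve that by simp
 \<comment> \<open>Neither permitted thread of the first quiver visits both vertex 0 and vertex 2,
   so the idempotents at these vertices are orthogonal in the required sense.\<close>
 have A: "A.b.Bs 0 2 = {}" "A.b.Bs 2 0 = {}"
  using A.Bs_eq[of 2 0] A.Bs_eq[of 0 2] unfolding A.path_list_def by (simp_all add: Ve_def)
 have v: "0 \<in> verts A.Q" "2 \<in> verts A.Q" unfolding quiver_simps Ve_def by simp_all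
 have "\<not> derived_equivalent A.b.R B.b.R"
  using coordinates.not_derived_equivalent[OF B.b.coordinates[OF bij tri loc] card A.b.ring_R
    A.b.e_closed[OF v(1)] A.b.e_idem[OF v(1)] A.b.e_nonzero[OF v(1)]
    A.b.e_closed[OF v(2)] A.b.e_idem[OF v(2)] A.b.e_nonzero[OF v(2)]
    A.b.corner_zero[OF v(1,2) _ A(1)] A.b.corner_zero[OF v(2,1) _ A(2)]] by blast
 then have "\<not> derived_equivalent (path_algebra A.Q Quot quiver_ideal [0, 1, 0, 1, 2, 3] [1, 0, 3, 2, 3, 2] [2, 5, 4] [1, 0, 3] :: (nat \<times> nat list => 'k) set ring)
   (path_algebra B.Q Quot quiver_ideal [0, 1, 2, 0, 1, 2] [1, 2, 3, 1, 2, 3] [3, 1, 5] [0, 4, 2] :: (nat \<times> nat list => 'k) set ring)"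
  unfolding A.b.R_def B.b.R_def .
 moreover have "arcs A.Q ~= {}" "arcs B.Q ~= {}" by (simp_all add: Ar_def)
 moreover note A.gentle_Q B.gentle_Q
 moreover have "AG_invariant A.Q (quiver_ideal [0, 1, 0, 1, 2, 3] [1, 0, 3, 2, 3, 2] [2, 5, 4] [1, 0, 3] :: (nat \<times> nat list => 'k) set) =
  AG_invariant B.Q (quiver_ideal [0, 1, 2, 0, 1, 2] [1, 2, 3, 1, 2, 3] [3, 1, 5] [0, 4, 2] :: (nat \<times> nat list => 'k) set)"
  unfolding A.AG_invariant_Q B.AG_invariant_Q ..
 ultimately show ?thesis by blast
qed

end
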